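(* Let $A$ be a finite simple algebra over a finite field $k=\mathbb{F}_q$ that is not a field, say $A=M_n(\mathbb{F}_{q^m})$ with $n>1$. Let $f$ be a monic polynomial of degree $n$ over $\mathbb{F}_{q^m}$. Then $P_f(A)\to1$ as $|A|\to\infty$. That is, for every $\delta>0$ there exists $N$ such that $P_f(A)>1-\delta$ for every prime power $q$, all integers $m\ge1$, $n>1$ with $|A|=q^{mn^2}\ge N$, and every monic polynomial $f$ of degree $n$ over $\mathbb{F}_{q^m}$.
   Context: $A=M_n(\mathbb{F}_{q^m})$ is regarded as an algebra over $k=\mathbb{F}_q$; subalgebras contain the identity. For a monic polynomial $f$ of degree $n$ over $\mathbb{F}_{q^m}$, $A_f$ is the set of elements of $A$ whose characteristic polynomial (as an $n\times n$ matrix over $\mathbb{F}_{q^m}$) is $f$. $P_f(A)$ is the probability that two elements of $A_f$, chosen uniformly and independently at random, generate $A$ as a unital $k$-algebra: $P_f(A)=|\{(x,y)\in A_f\times A_f:\langle x,y\rangle=A\}|/|A_f|^2$. *)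

theory Defs
  imports
    Complex_Main
    "HOL-Algebra.Subrings"
    "HOL-Algebra.UnivPoly"
    "HOL-Combinatorics.Permutations"
    "HOL-Number_Theory.Prime_Powers"
    "Jordan_Normal_Form.Matrix"
begin

text \<open>
  Finite fields are records with explicit carriers rather than types of class field: the bound in
  the theorem has to be uniform in the field, so fields must be quantified inside the formula.
  Already carriers inside \<open>nat\<close> realise every finite field up to isomorphism, so the instance
  \<open>'a = nat\<close> of a statement about all \<open>K :: 'a ring\<close> is uniform over all finite fields.
  From Jordan_Normal_Form only the container type \<open>'a mat\<close> is used, because its arithmetic
  refers to the class operations of the entry type. All entries and sums below are taken in
  the given record.
\<close>

definition matrix_algebra :: "('a, 'c) ring_scheme \<Rightarrow> nat \<Rightarrow> ('a, 'a mat) module" where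
  "matrix_algebra K n = \<lparr>
     carrier = {M \<in> carrier_mat n n. \<forall>i<n. \<forall>j<n. M $$ (i, j) \<in> carrier K},
     monoid.mult = (\<lambda>M M'. mat n n (\<lambda>(i, j). \<Oplus>\<^bsub>K\<^esub>l\<in>{..<n}. M $$ (i, l) \<otimes>\<^bsub>K\<^esub> M' $$ (l, j))),
     monoid.one = mat n n (\<lambda>(i, j). if i = j then \<one>\<^bsub>K\<^esub> else \<zero>\<^bsub>K\<^esub>),
     ring.zero = mat n n (\<lambda>_. \<zero>\<^bsub>K\<^esub>),
     ring.add = (\<lambda>M M'. mat n n (\<lambda>(i, j). M $$ (i, j) \<oplus>\<^bsub>K\<^esub> M' $$ (i, j))),
     module.smult = (\<lambda>c M. mat n n (\<lambda>(i, j). c \<otimes>\<^bsub>K\<^esub> M $$ (i, j)))\<rparr>"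

definition matrix_det :: "('b, 'c) ring_scheme \<Rightarrow> nat \<Rightarrow> 'b mat \<Rightarrow> 'b" where
  "matrix_det R n M =
     (\<Oplus>\<^bsub>R\<^esub>p\<in>{p. p permutes {..<n}}. [(sign p :: int)] \<cdot>\<^bsub>R\<^esub> (\<Otimes>\<^bsub>R\<^esub>i\<in>{..<n}. M $$ (i, p i)))"

text \<open>\<open>det (X I - M)\<close>, computed in the ring of \<open>n \<times> n\<close> matrices over \<open>K[X]\<close>.\<close>

definition matrix_char_poly :: "('a, 'c) ring_scheme \<Rightarrow> nat \<Rightarrow> 'a mat \<Rightarrow> nat \<Rightarrow> 'a" where
  "matrix_char_poly K n M =
     matrix_det (UP K) n (mat n n (\<lambda>(i, j).
       (if i = j then up_ring.monom (UP K) \<one>\<^bsub>K\<^esub> 1 else \<zero>\<^bsub>UP K\<^esub>)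
         \<ominus>\<^bsub>UP K\<^esub> up_ring.monom (UP K) (M $$ (i, j)) 0))"

definition monic_of_degree :: "('a, 'c) ring_scheme \<Rightarrow> nat \<Rightarrow> (nat \<Rightarrow> 'a) \<Rightarrow> bool" where
  "monic_of_degree K n f \<longleftrightarrow>
     f \<in> carrier (UP K) \<and> deg K f = n \<and> up_ring.coeff (UP K) f n = \<one>\<^bsub>K\<^esub>"

text \<open>
  The locale \<open>subalgebra\<close> of HOL-Algebra is not suitable here: it describes additive subgroups
  closed under multiplication by a subset of the same ring, and does not require closure under
  products or the presence of the identity.
\<close>

definition unital_subalgebra :: "'a set \<Rightarrow> 'b set \<Rightarrow> ('a, 'b, 'c) module_scheme \<Rightarrow> bool" where
  "unital_subalgebra k B A \<longleftrightarrow>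
     subring B A \<and> (\<forall>c\<in>k. \<forall>b\<in>B. c \<odot>\<^bsub>A\<^esub> b \<in> B)"

definition generated_subalgebra :: "'a set \<Rightarrow> ('a, 'b, 'c) module_scheme \<Rightarrow> 'b set \<Rightarrow> 'b set" where
  "generated_subalgebra k A S = \<Inter>{B. unital_subalgebra k B A \<and> S \<subseteq> B}"

definition matrices_with_char_poly ::
    "('a, 'c) ring_scheme \<Rightarrow> nat \<Rightarrow> (nat \<Rightarrow> 'a) \<Rightarrow> 'a mat set" where
  "matrices_with_char_poly K n f =
     {M \<in> carrier (matrix_algebra K n). matrix_char_poly K n M = f}"

definition generation_probability ::
    "'a set \<Rightarrow> ('a, 'c) ring_scheme \<Rightarrow> nat \<Rightarrow> (nat \<Rightarrow> 'a) \<Rightarrow> real" where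
  "generation_probability k K n f =
     real (card {(x, y). x \<in> matrices_with_char_poly K n f \<and> y \<in> matrices_with_char_poly K n f \<and>
                   generated_subalgebra k (matrix_algebra K n) {x, y}
                     = carrier (matrix_algebra K n)})
       / (real (card (matrices_with_char_poly K n f)))\<^sup>2"

end

theory Submission
  imports
    Defs
    "HOL-Algebra.Multiplicative_Group"
    "HOL-Real_Asymp.Real_Asymp"
    "Jordan_Normal_Form.Char_Poly"
begin

text \<open>
  Let \<open>K\<close> have \<open>Q\<close> elements. The class of \<open>f\<close> has at least \<open>Q\<^bsup>n\<^sup>2 - n\<^esup> / 4\<close> elements, because already the
  conjugates of the companion matrix are that many. If \<open>x\<close> and \<open>y\<close> generate a proper subalgebra \<open>B\<close>,
  then \<open>x\<close> and \<open>y\<close> have a common invariant subspace, or \<open>B\<close> is irreducible and commutes with a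
  nonscalar matrix, or \<open>B\<close> is conjugate into the matrices over a proper subfield. For the last case,
  the full matrix ring is a semisimple \<open>B\<close>-module, so \<open>B\<close> has a complement, and this yields an
  additive map of \<open>K\<^sup>n\<close> that commutes with \<open>B\<close> but is not scalar. A discrete Fourier transform over the
  units of \<open>K\<close> turns it into a \<open>\<sigma>\<close>-semilinear one with \<open>\<sigma> \<noteq> 1\<close>. By Hilbert 90 the norm to the fixed field
  of \<open>\<sigma>\<close> is surjective, so a multiple of this map has the same order as \<open>\<sigma>\<close>, and the vectors that it fixes
  form a \<open>B\<close>-stable form of \<open>K\<^sup>n\<close> over the fixed field.

  In each case the pairs are few. A pair conjugate into a set \<open>X\<close> stable under conjugation by \<open>H\<close> has \<open>|H|\<close> such
  conjugations, so there are at most \<open>Q\<^bsup>n\<^sup>2\<^esup> |X|\<^sup>2 / |H|\<close> of them; \<open>X\<close> consists of block triangular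
  matrices or of matrices over a subfield. In the second case \<open>K[z]\<close> is a field, and \<open>z\<close> and the
  elements of its centraliser are determined by their action on few vectors. All errors are bounded
  by a function of \<open>Q\<^sup>n\<close> that tends to \<open>0\<close>.
\<close>

section \<open>Matrices over a record ring\<close>

text \<open>The limit has to be uniform in the field and in \<open>n\<close> together, so
  \<open>n = 2\<close> with \<open>Q\<close> growing and \<open>Q = 2\<close> with \<open>n\<close>
  growing are both critical. For \<open>n = 2\<close> the square of the class has order
  \<open>Q^4\<close>, and two of the counts fall below this only through an extra device. A
  nonscalar \<open>z\<close> commuting with a pair is counted together with all
  \<open>a z + c\<close>, and a pair conjugate into the matrices over a subfield \<open>F\<close> is
  counted with conjugators from the scalar multiples of GL(n, F) instead of GL(n, F) alone. For
  large \<open>n\<close> the danger is combinatorial: a bound such as \<open>2^n\<close> for the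
  number of factors of \<open>f\<close> would consume the gain at \<open>Q = 2\<close>, hence the
  bound \<open>n^d\<close> for the monic divisors of degree \<open>d\<close>. The final errors are
  powers of \<open>n\<close> and of the number of subfields over a root of \<open>X = Q^n\<close>.
  Since \<open>n\<close> is at most the binary logarithm of \<open>X\<close>, they are bounded by a
  function of \<open>X\<close> alone; and \<open>X\<close> grows with the cardinality
  \<open>X^n\<close> of the algebra, because \<open>n < X\<close>.\<close>

context ring
begin

definition kmat :: "nat \<Rightarrow> nat \<Rightarrow> 'a mat set" where
  "kmat r c = {M \<in> carrier_mat r c. \<forall>i<r. \<forall>j<c. M $$ (i, j) \<in> carrier R}"

definition mmul :: "'a mat \<Rightarrow> 'a mat \<Rightarrow> 'a mat" (infixl "\<odot>\<odot>" 70) where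
  "A \<odot>\<odot> B = mat (dim_row A) (dim_col B) (\<lambda>(i, j). \<Oplus>l\<in>{..<dim_col A}. A $$ (i, l) \<otimes> B $$ (l, j))"

definition madd :: "'a mat \<Rightarrow> 'a mat \<Rightarrow> 'a mat" (infixl "\<oplus>\<oplus>" 65) where
  "A \<oplus>\<oplus> B = mat (dim_row A) (dim_col A) (\<lambda>(i, j). A $$ (i, j) \<oplus> B $$ (i, j))"

definition mscale :: "'a \<Rightarrow> 'a mat \<Rightarrow> 'a mat" where
  "mscale a A = mat (dim_row A) (dim_col A) (\<lambda>(i, j). a \<otimes> A $$ (i, j))"

definition mneg :: "'a mat \<Rightarrow> 'a mat" where
  "mneg A = mat (dim_row A) (dim_col A) (\<lambda>(i, j). \<ominus> A $$ (i, j))"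

definition mzero :: "nat \<Rightarrow> nat \<Rightarrow> 'a mat" where
  "mzero r c = mat r c (\<lambda>_. \<zero>)"

definition mone :: "nat \<Rightarrow> 'a mat" where
  "mone n = mat n n (\<lambda>(i, j). if i = j then \<one> else \<zero>)"

lemma kmat_carrier: "A \<in> kmat r c \<Longrightarrow> A \<in> carrier_mat r c"
  by (simp add: kmat_def)

lemma kmat_dim: "A \<in> kmat r c \<Longrightarrow> dim_row A = r" "A \<in> kmat r c \<Longrightarrow> dim_col A = c"
  by (auto simp: kmat_def)

lemma kmat_entry [intro]: "A \<in> kmat r c \<Longrightarrow> i < r \<Longrightarrow> j < c \<Longrightarrow> A $$ (i, j) \<in> carrier R"
  by (simp add: kmat_def)

lemma kmatI: "dim_row A = r \<Longrightarrow> dim_col A = c \<Longrightarrow>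
    (\<And>i j. i < r \<Longrightarrow> j < c \<Longrightarrow> A $$ (i, j) \<in> carrier R) \<Longrightarrow> A \<in> kmat r c"
  by (auto simp: kmat_def)

lemma kmat_eqI: "A \<in> kmat r c \<Longrightarrow> B \<in> kmat r c \<Longrightarrow>
    (\<And>i j. i < r \<Longrightarrow> j < c \<Longrightarrow> A $$ (i, j) = B $$ (i, j)) \<Longrightarrow> A = B"
  by (rule eq_matI) (auto simp: kmat_dim)

lemma mmul_closed [simp]: "A \<in> kmat r k \<Longrightarrow> B \<in> kmat k c \<Longrightarrow> A \<odot>\<odot> B \<in> kmat r c"
  by (rule kmatI) (auto simp: mmul_def kmat_dim intro!: finsum_closed)

lemma madd_closed [simp]: "A \<in> kmat r c \<Longrightarrow> B \<in> kmat r c \<Longrightarrow> A \<oplus>\<oplus> B \<in> kmat r c"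
  by (rule kmatI) (auto simp: madd_def kmat_dim)

lemma mscale_closed [simp]: "a \<in> carrier R \<Longrightarrow> A \<in> kmat r c \<Longrightarrow> mscale a A \<in> kmat r c"
  by (rule kmatI) (auto simp: mscale_def kmat_dim)

lemma mneg_closed [simp]: "A \<in> kmat r c \<Longrightarrow> mneg A \<in> kmat r c"
  by (rule kmatI) (auto simp: mneg_def kmat_dim)

lemma mzero_closed [simp]: "mzero r c \<in> kmat r c"
  by (rule kmatI) (auto simp: mzero_def)

lemma mone_closed [simp]: "mone n \<in> kmat n n"
  by (rule kmatI) (auto simp: mone_def)

lemma mmul_entry: "A \<in> kmat r k \<Longrightarrow> B \<in> kmat k c \<Longrightarrow> i < r \<Longrightarrow> j < c \<Longrightarrow>
    (A \<odot>\<odot> B) $$ (i, j) = (\<Oplus>l\<in>{..<k}. A $$ (i, l) \<otimes> B $$ (l, j))"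
  by (auto simp: mmul_def kmat_dim)

lemma madd_entry: "A \<in> kmat r c \<Longrightarrow> i < r \<Longrightarrow> j < c \<Longrightarrow> (A \<oplus>\<oplus> B) $$ (i, j) = A $$ (i, j) \<oplus> B $$ (i, j)"
  by (auto simp: madd_def kmat_dim)

lemma mscale_entry: "A \<in> kmat r c \<Longrightarrow> i < r \<Longrightarrow> j < c \<Longrightarrow> (mscale a A) $$ (i, j) = a \<otimes> A $$ (i, j)"
  by (auto simp: mscale_def kmat_dim)

lemma mneg_entry: "A \<in> kmat r c \<Longrightarrow> i < r \<Longrightarrow> j < c \<Longrightarrow> (mneg A) $$ (i, j) = \<ominus> A $$ (i, j)"
  by (auto simp: mneg_def kmat_dim)

lemma mzero_entry: "i < r \<Longrightarrow> j < c \<Longrightarrow> mzero r c $$ (i, j) = \<zero>"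
  by (auto simp: mzero_def)

lemma mone_entry: "i < n \<Longrightarrow> j < n \<Longrightarrow> mone n $$ (i, j) = (if i = j then \<one> else \<zero>)"
  by (auto simp: mone_def)

end

text \<open>
  The matrix identities needed over a record ring \<open>R\<close> are pulled back along a surjective ring
  homomorphism onto \<open>R\<close> from a type of class \<open>idom\<close>, where Jordan_Normal_Form proves them.
\<close>

locale class_hom = cring R for R :: "('a, 'b) ring_scheme" (structure) +
  fixes h :: "'p :: idom \<Rightarrow> 'a"
  assumes h_closed [simp]: "h x \<in> carrier R"
    and h_add: "h (x + y) = h x \<oplus> h y"
    and h_mult: "h (x * y) = h x \<otimes> h y"
    and h_one [simp]: "h 1 = \<one>"
begin

lemma h_zero [simp]: "h 0 = \<zero>"
  using h_add[of 0 0] h_closed[of 0] by (metis add.r_cancel_one' add_0)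

lemma h_uminus: "h (- x) = \<ominus> h x"
  by (rule minus_equality[symmetric]) (simp_all flip: h_add)

lemma h_minus: "h (x - y) = h x \<ominus> h y"
  using h_add[of x "- y"] by (simp add: h_uminus a_minus_def)

lemma h_sum: "finite A \<Longrightarrow> h (sum f A) = (\<Oplus>i\<in>A. h (f i))"
  by (induction A rule: finite_induct) (auto simp: h_add)

lemma h_prod: "finite A \<Longrightarrow> h (prod f A) = (\<Otimes>i\<in>A. h (f i))"
  by (induction A rule: finite_induct) (auto simp: h_mult)

lemma h_int: "h (of_int k * x) = [k] \<cdot> h x"
proof -
  have nat: "h (of_nat m * x) = [(int m)] \<cdot> h x" for m
  proof (induction m)
    case 0
    show ?case by (simp add: add_pow_def)
  next
    case (Suc m)
    have "[(int (Suc m))] \<cdot> h x = [(int m)] \<cdot> h x \<oplus> h x"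
      using add.int_pow_mult[of "h x" "int m" 1] by (simp add: add.int_pow_1 add.commute)
    then show ?case using Suc by (simp add: algebra_simps h_add a_comm)
  qed
  show ?thesis
  proof (cases k)
    case (nonneg m)
    then show ?thesis using nat[of m] by simp
  next
    case (neg m)
    have "h (of_int k * x) = \<ominus> h (of_nat (Suc m) * x)"
      unfolding neg by (simp add: h_uminus[symmetric] algebra_simps)
    also have "\<dots> = \<ominus> ([(int (Suc m))] \<cdot> h x)" by (simp only: nat)
    also have "\<dots> = [k] \<cdot> h x" unfolding neg by (metis add.int_pow_neg h_closed)
    finally show ?thesis .
  qed
qed

text \<open>The Leibniz formula uses only sums, products and signs, all of which \<open>h\<close>
  respects. This is the bridge from the library determinant to the \<open>matrix_det\<close> of the
  statement.\<close>

lemma h_det: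
  assumes "M \<in> carrier_mat n n"
  shows "h (det M) = matrix_det R n (map_mat h M)"
proof -
  have fin: "finite {p. p permutes {..<n}}" by (simp add: finite_permutations)
  have "h (det M) = (\<Oplus>p\<in>{p. p permutes {..<n}}. h (signof p * (\<Prod>i<n. M $$ (i, p i))))"
    using assms fin by (simp add: det_def' lessThan_atLeast0 h_sum)
  also have "\<dots> = (\<Oplus>p\<in>{p. p permutes {..<n}}. [(sign p :: int)] \<cdot> (\<Otimes>i\<in>{..<n}. map_mat h M $$ (i, p i)))"
  proof -
    have eq: "[(sign p :: int)] \<cdot> (\<Otimes>i\<in>{..<n}. map_mat h M $$ (i, p i))
        = h (signof p * (\<Prod>i<n. M $$ (i, p i)))" if p: "p permutes {..<n}" for p
    proof -
      have e: "map_mat h M $$ (i, p i) = h (M $$ (i, p i))" if "i \<in> {..<n}" for i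
        using that p assms permutes_in_image[of p "{..<n}" i] by auto
      have "(\<Otimes>i\<in>{..<n}. map_mat h M $$ (i, p i)) = (\<Otimes>i\<in>{..<n}. h (M $$ (i, p i)))"
        by (rule finprod_cong') (auto simp: e)
      then show ?thesis by (simp add: h_int h_prod)
    qed
    show ?thesis by (rule finsum_cong') (simp_all add: eq Pi_def)
  qed
  finally show ?thesis unfolding matrix_det_def .
qed

lemma kmat_map [simp]: "M \<in> carrier_mat r c \<Longrightarrow> map_mat h M \<in> kmat r c"
  by (auto intro!: kmatI)

lemma map_mat_hom [simp]:
  "dim_col A = dim_row B \<Longrightarrow> map_mat h A \<odot>\<odot> map_mat h B = map_mat h (A * B)"
  "dim_row A = dim_row B \<Longrightarrow> dim_col A = dim_col B \<Longrightarrow> map_mat h A \<oplus>\<oplus> map_mat h B = map_mat h (A + B)"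
  "mscale (h a) (map_mat h A) = map_mat h (a \<cdot>\<^sub>m A)"
  "mneg (map_mat h A) = map_mat h (- A)"
  by (auto simp: mmul_def madd_def mscale_def mneg_def h_add h_mult h_uminus h_sum scalar_prod_def
      lessThan_atLeast0 intro!: eq_matI finsum_cong')

lemma map_mat_zero_one [simp]: "map_mat h (0\<^sub>m r c) = mzero r c" "map_mat h (1\<^sub>m n) = mone n"
  by (auto simp: mzero_def mone_def)

end

locale class_epi = class_hom R h
  for R :: "('a, 'b) ring_scheme" (structure) and h :: "'p :: idom \<Rightarrow> 'a" +
  assumes h_surj: "x \<in> carrier R \<Longrightarrow> \<exists>p. h p = x"
begin

definition lift :: "'a mat \<Rightarrow> 'p mat" where
  "lift M = map_mat (\<lambda>x. if x = \<zero> then 0 else SOME p. h p = x) M"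

lemma lift_carrier [simp]: "M \<in> carrier_mat r c \<Longrightarrow> lift M \<in> carrier_mat r c"
  by (auto simp: lift_def)

lemma map_lift [simp]: "M \<in> kmat r c \<Longrightarrow> map_mat h (lift M) = M"
proof (rule eq_matI)
  fix i j assume M: "M \<in> kmat r c" and ij: "i < dim_row M" "j < dim_col M"
  have "M $$ (i, j) \<in> carrier R" using M ij by (auto simp: kmat_dim)
  then have "h (SOME p. h p = M $$ (i, j)) = M $$ (i, j)"
    using h_surj by (rule_tac someI_ex) auto
  then show "map_mat h (lift M) $$ (i, j) = M $$ (i, j)"
    using ij by (auto simp: lift_def)
qed (auto simp: lift_def)

lemma kmat_cases:
  assumes "M \<in> kmat r c"
  obtains M' where "M' \<in> carrier_mat r c" "M = map_mat h M'"
  using map_lift[OF assms] lift_carrier[of M r c] kmat_carrier[OF assms] that[of "lift M"] by simp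

lemma mmul_assoc:
  assumes "A \<in> kmat r k" "B \<in> kmat k l" "C \<in> kmat l c"
  shows "A \<odot>\<odot> B \<odot>\<odot> C = A \<odot>\<odot> (B \<odot>\<odot> C)"
proof -
  obtain A' where A: "A' \<in> carrier_mat r k" "A = map_mat h A'" by (rule kmat_cases[OF assms(1)])
  obtain B' where B: "B' \<in> carrier_mat k l" "B = map_mat h B'" by (rule kmat_cases[OF assms(2)])
  obtain C' where C: "C' \<in> carrier_mat l c" "C = map_mat h C'" by (rule kmat_cases[OF assms(3)])
  show ?thesis using A B C by (simp add: assoc_mult_mat[of _ r k])
qed

lemma mmul_distrib_left:
  assumes "A \<in> kmat r k" "B \<in> kmat k c" "C \<in> kmat k c"
  shows "A \<odot>\<odot> (B \<oplus>\<oplus> C) = A \<odot>\<odot> B \<oplus>\<oplus> A \<odot>\<odot> C"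
proof -
  obtain A' where A: "A' \<in> carrier_mat r k" "A = map_mat h A'" by (rule kmat_cases[OF assms(1)])
  obtain B' where B: "B' \<in> carrier_mat k c" "B = map_mat h B'" by (rule kmat_cases[OF assms(2)])
  obtain C' where C: "C' \<in> carrier_mat k c" "C = map_mat h C'" by (rule kmat_cases[OF assms(3)])
  show ?thesis
    using A B C by (simp add: mult_add_distrib_mat[of _ r k])
qed

lemma mmul_distrib_right:
  assumes "A \<in> kmat r k" "B \<in> kmat r k" "C \<in> kmat k c"
  shows "(A \<oplus>\<oplus> B) \<odot>\<odot> C = A \<odot>\<odot> C \<oplus>\<oplus> B \<odot>\<odot> C"
proof -
  obtain A' where A: "A' \<in> carrier_mat r k" "A = map_mat h A'" by (rule kmat_cases[OF assms(1)])
  obtain B' where B: "B' \<in> carrier_mat r k" "B = map_mat h B'" by (rule kmat_cases[OF assms(2)])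
  obtain C' where C: "C' \<in> carrier_mat k c" "C = map_mat h C'" by (rule kmat_cases[OF assms(3)])
  show ?thesis
    using A B C by (simp add: add_mult_distrib_mat[of _ r k])
qed

lemma mmul_scale:
  assumes "a \<in> carrier R" "A \<in> kmat r k" "B \<in> kmat k c"
  shows "A \<odot>\<odot> mscale a B = mscale a (A \<odot>\<odot> B)" "mscale a A \<odot>\<odot> B = mscale a (A \<odot>\<odot> B)"
proof -
  obtain a' where a': "a = h a'" using assms(1) h_surj by blast
  obtain A' where A: "A' \<in> carrier_mat r k" "A = map_mat h A'" by (rule kmat_cases[OF assms(2)])
  obtain B' where B: "B' \<in> carrier_mat k c" "B = map_mat h B'" by (rule kmat_cases[OF assms(3)])
  show "A \<odot>\<odot> mscale a B = mscale a (A \<odot>\<odot> B)" "mscale a A \<odot>\<odot> B = mscale a (A \<odot>\<odot> B)"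
    using a' A B by (simp_all add: mult_smult_distrib[of _ r k] mult_smult_assoc_mat[of _ r k])
qed

lemma mmul_neg:
  assumes "A \<in> kmat r k" "B \<in> kmat k c"
  shows "A \<odot>\<odot> mneg B = mneg (A \<odot>\<odot> B)" "mneg A \<odot>\<odot> B = mneg (A \<odot>\<odot> B)"
proof -
  obtain A' where A: "A' \<in> carrier_mat r k" "A = map_mat h A'" by (rule kmat_cases[OF assms(1)])
  obtain B' where B: "B' \<in> carrier_mat k c" "B = map_mat h B'" by (rule kmat_cases[OF assms(2)])
  show "A \<odot>\<odot> mneg B = mneg (A \<odot>\<odot> B)" "mneg A \<odot>\<odot> B = mneg (A \<odot>\<odot> B)"
    using A B by (simp_all add: uminus_mult_left_mat uminus_mult_right_mat)
qed

lemma mmul_one [simp]: "A \<in> kmat r c \<Longrightarrow> mone r \<odot>\<odot> A = A" "A \<in> kmat r c \<Longrightarrow> A \<odot>\<odot> mone c = A"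
proof -
  assume A: "A \<in> kmat r c"
  then obtain A' where A': "A' \<in> carrier_mat r c" "A = map_mat h A'" by (rule kmat_cases)
  then show "mone r \<odot>\<odot> A = A" "A \<odot>\<odot> mone c = A"
    using map_mat_hom(1)[of "1\<^sub>m r" A'] map_mat_hom(1)[of A' "1\<^sub>m c"] by auto
qed

lemma mmul_zero [simp]:
  assumes "A \<in> kmat r k"
  shows "A \<odot>\<odot> mzero k c = mzero r c" "mzero l r \<odot>\<odot> A = mzero l k"
proof -
  obtain A' where A': "A' \<in> carrier_mat r k" "A = map_mat h A'" by (rule kmat_cases[OF assms])
  show "A \<odot>\<odot> mzero k c = mzero r c"
    using map_mat_hom(1)[of A' "0\<^sub>m k c"] A' right_mult_zero_mat[OF A'(1), of c] by simp
  show "mzero l r \<odot>\<odot> A = mzero l k"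
    using map_mat_hom(1)[of "0\<^sub>m l r" A'] A' left_mult_zero_mat[OF A'(1), of l] by simp
qed

end

context ring
begin

lemma madd_comm:
  assumes "A \<in> kmat r c" "B \<in> kmat r c"
  shows "A \<oplus>\<oplus> B = B \<oplus>\<oplus> A"
  by (rule kmat_eqI[of _ r c])
    (use assms in \<open>simp_all add: madd_entry[of _ r c] a_comm kmat_entry[of _ r c]\<close>)

lemma madd_assoc:
  assumes "A \<in> kmat r c" "B \<in> kmat r c" "C \<in> kmat r c"
  shows "A \<oplus>\<oplus> B \<oplus>\<oplus> C = A \<oplus>\<oplus> (B \<oplus>\<oplus> C)"
  by (rule kmat_eqI[of _ r c])
    (use assms in \<open>simp_all add: madd_entry[of _ r c] a_assoc kmat_entry[of _ r c]\<close>)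

lemma madd_zero [simp]:
  assumes "A \<in> kmat r c"
  shows "mzero r c \<oplus>\<oplus> A = A" "A \<oplus>\<oplus> mzero r c = A"
  by (rule kmat_eqI[of _ r c]; use assms in
      \<open>simp add: madd_entry[of _ r c] mzero_entry[of _ r _ c] kmat_entry[of _ r c]\<close>)+

lemma madd_neg [simp]:
  assumes "A \<in> kmat r c"
  shows "A \<oplus>\<oplus> mneg A = mzero r c" "mneg A \<oplus>\<oplus> A = mzero r c"
  by (rule kmat_eqI[of _ r c]; use assms in
      \<open>simp add: madd_entry[of _ r c] mneg_entry[of _ r c] mzero_entry[of _ r _ c] kmat_entry[of _ r c] r_neg l_neg\<close>)+

end

section \<open>Characteristic polynomials\<close>

definition companion :: "nat \<Rightarrow> 'a \<Rightarrow> 'a \<Rightarrow> (nat \<Rightarrow> 'a) \<Rightarrow> 'a mat" where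
  "companion n z u a = mat n n (\<lambda>(i, j). if j = n - 1 then a i else if i = Suc j then u else z)"

lemma companion_carrier [simp]: "companion n z u a \<in> carrier_mat n n"
  by (simp add: companion_def)

lemma mat_mult_entry:
  "A \<in> carrier_mat r k \<Longrightarrow> B \<in> carrier_mat k c \<Longrightarrow> i < r \<Longrightarrow> j < c \<Longrightarrow>
    (A * B) $$ (i, j) = (\<Sum>l<k. A $$ (i, l) * B $$ (l, j))"
  by (simp add: scalar_prod_def lessThan_atLeast0)

text \<open>
  Multiplying \<open>X I - C\<close> from the left by the unipotent matrix with first row \<open>1, X, X\<^sup>2, \<dots>\<close>
  makes the first row vanish except for its last entry, which is the characteristic polynomial.
\<close>

lemma char_poly_companion:
  fixes a :: "nat \<Rightarrow> 'a :: idom"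
  assumes n: "n > 0"
  shows "char_poly (companion n 0 1 a) = monom 1 n - (\<Sum>i<n. monom (a i) i)"
proof -
  let ?X = "[:0, 1:] :: 'a poly"
  define C where "C = char_poly_matrix (companion n 0 1 a)"
  define U where "U = mat n n (\<lambda>(i, j). if i = 0 then ?X ^ j else if i = j then 1 else 0)"
  define W where "W = U * C"
  define g where "g = monom 1 n - (\<Sum>i<n. monom (a i) i)"
  have C: "C \<in> carrier_mat n n" and U: "U \<in> carrier_mat n n" by (auto simp: C_def U_def)
  then have W: "W \<in> carrier_mat n n" by (auto simp: W_def)
  have Cij: "C $$ (i, j) = (if i = j then ?X else 0) - (if j = n - 1 then [:a i:] else if i = Suc j then 1 else 0)"
    if "i < n" "j < n" for i j
    using that unfolding C_def char_poly_matrix_def by (auto simp: companion_def one_pCons)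
  have "det U = prod_list (diag_mat U)"
    by (rule det_upper_triangular[OF _ U]) (auto simp: U_def upper_triangular_def)
  also have "diag_mat U = map (\<lambda>_. 1) [0..<n]"
    by (auto simp: diag_mat_def U_def)
  also have "prod_list \<dots> = 1" by (induction n) auto
  finally have "det U = 1" .
  then have det_W: "char_poly (companion n 0 1 a) = det W"
    using det_mult[OF U C] by (simp add: W_def char_poly_def C_def)
  have W0: "W $$ (0, j) = (if j = n - 1 then g else 0)" if j: "j < n" for j
  proof -
    have "W $$ (0, j) = (\<Sum>l<n. ?X ^ l * C $$ (l, j))"
      using j n C U by (simp add: W_def scalar_prod_def lessThan_atLeast0) (auto simp: U_def intro!: sum.cong)
    also have "\<dots> = (\<Sum>l<n. (if l = j then ?X ^ Suc j else 0)
        - (if j = n - 1 then ?X ^ l * [:a l:] else if l = Suc j then ?X ^ Suc j else 0))"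
      using j by (intro sum.cong) (auto simp: Cij algebra_simps)
    also have "\<dots> = (if j = n - 1 then g else 0)"
    proof (cases "j = n - 1")
      case True
      have "(\<Sum>l<n. ?X ^ l * [:a l:]) = (\<Sum>l<n. monom (a l) l)"
        by (intro sum.cong) (auto simp: monom_altdef)
      then show ?thesis using True j n
        by (simp add: sum_subtractf g_def sum.delta' monom_altdef del: power_Suc)
    next
      case False
      then have "Suc j < n" using j by auto
      then show ?thesis using False j by (simp add: sum_subtractf sum.delta' del: power_Suc)
    qed
    finally show ?thesis .
  qed
  have Wi: "W $$ (i, j) = C $$ (i, j)" if "0 < i" "i < n" "j < n" for i j
  proof -
    have "W $$ (i, j) = (\<Sum>l<n. (if i = l then 1 else 0) * C $$ (l, j))"
      using that C U by (simp add: W_def scalar_prod_def lessThan_atLeast0) (auto simp: U_def intro!: sum.cong)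
    also have "\<dots> = (\<Sum>l<n. if i = l then C $$ (l, j) else 0)" by (intro sum.cong) auto
    also have "\<dots> = C $$ (i, j)" using that by (simp add: sum.delta')
    finally show ?thesis .
  qed
  define D where "D = mat_delete W 0 (n - 1)"
  have D: "D \<in> carrier_mat (n - 1) (n - 1)" using W by (auto simp: D_def mat_delete_def)
  have Dij: "D $$ (i, j) = C $$ (Suc i, j)" if "i < n - 1" "j < n - 1" for i j
    using that W by (auto simp: D_def mat_delete_def Wi)
  have "det D = prod_list (diag_mat D)"
    by (rule det_upper_triangular[OF _ D]) (use D in \<open>auto simp: upper_triangular_def Dij Cij\<close>)
  also have "diag_mat D = map (\<lambda>_. -1) [0..<n - 1]"
    using D by (auto simp: diag_mat_def Dij Cij)
  also have "prod_list \<dots> = (-1) ^ (n - 1)" by (simp add: map_replicate_const)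
  finally have "cofactor W 0 (n - 1) = 1"
    by (simp add: cofactor_def D_def power_add[symmetric] flip: mult_2)
  have "det W = (\<Sum>j<n. W $$ (0, j) * cofactor W 0 j)"
    by (rule laplace_expansion_row[OF W n])
  also have "\<dots> = (\<Sum>j<n. if j = n - 1 then g * cofactor W 0 j else 0)"
    by (intro sum.cong) (auto simp: W0)
  also have "\<dots> = g" using n \<open>cofactor W 0 (n - 1) = 1\<close> by simp
  finally show ?thesis using det_W by (simp add: g_def)
qed

text \<open>
  The coefficient matrices \<open>B\<^sub>k\<close> of the adjugate of \<open>X I - A\<close> satisfy \<open>c\<^sub>k I = B\<^bsub>k-1\<^esub> - B\<^sub>k A\<close>,
  so that \<open>\<Sum> c\<^sub>k A\<^sup>k\<close> telescopes.
\<close>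

lemma cayley_hamilton_entry:
  fixes A :: "'a :: comm_ring_1 mat"
  assumes A: "A \<in> carrier_mat n n" and ij: "i < n" "j < n"
  shows "(\<Sum>k\<le>n. coeff (char_poly A) k * (A ^\<^sub>m k) $$ (i, j)) = 0"
proof -
  let ?cm = "char_poly_matrix A"
  define B where "B k = map_mat (\<lambda>p. coeff p k) (adj_mat ?cm)" for k
  have cm: "?cm \<in> carrier_mat n n" using A by simp
  note adj = adj_mat[OF cm]
  have B: "B k \<in> carrier_mat n n" for k using adj(1) by (auto simp: B_def)
  have cmij: "?cm $$ (i, j) = (if i = j then [:0, 1:] else 0) + [:- A $$ (i, j):]" if "i < n" "j < n" for i j
    using that A by (auto simp: char_poly_matrix_def)
  have step: "(case k of 0 \<Rightarrow> 0 | Suc k' \<Rightarrow> B k' $$ (i, j)) - (B k * A) $$ (i, j)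
      = (if i = j then coeff (char_poly A) k else 0)" if ij: "i < n" "j < n" for i j k
  proof -
    have "(adj_mat ?cm * ?cm) $$ (i, j) = (\<Sum>l<n. adj_mat ?cm $$ (i, l) * ?cm $$ (l, j))"
      using ij adj(1) cm by (rule_tac mat_mult_entry) auto
    also have "\<dots> = (\<Sum>l<n. (if l = j then [:0, 1:] * adj_mat ?cm $$ (i, l) else 0)
        + [:- A $$ (l, j):] * adj_mat ?cm $$ (i, l))"
      using ij by (intro sum.cong) (auto simp: cmij algebra_simps)
    also have "\<dots> = [:0, 1:] * adj_mat ?cm $$ (i, j) + (\<Sum>l<n. [:- A $$ (l, j):] * adj_mat ?cm $$ (i, l))"
      by (subst sum.distrib) (use ij in \<open>simp add: sum.delta'\<close>)
    finally have e: "(if i = j then char_poly A else 0) = \<dots>"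
      using adj(3) ij by (cases "i = j") (simp_all add: char_poly_def)
    have "(\<Sum>l<n. coeff ([:- A $$ (l, j):] * adj_mat ?cm $$ (i, l)) k) = - (B k * A) $$ (i, j)"
      using ij A adj(1) B[of k] by (simp add: scalar_prod_def lessThan_atLeast0 B_def sum_negf mult.commute)
    moreover have "coeff ([:0, 1:] * adj_mat ?cm $$ (i, j)) k = (case k of 0 \<Rightarrow> 0 | Suc k' \<Rightarrow> B k' $$ (i, j))"
      using ij adj(1) by (cases k) (auto simp: B_def)
    ultimately show ?thesis
      using arg_cong[OF e, of "\<lambda>p. coeff p k"] by (auto simp: coeff_sum split: if_splits)
  qed
  have pow: "A ^\<^sub>m k \<in> carrier_mat n n" for k using A by simp
  have part: "(\<Sum>k\<le>m. coeff (char_poly A) k * (A ^\<^sub>m k) $$ (i, j)) = - (B m * A ^\<^sub>m Suc m) $$ (i, j)"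
    if ij: "i < n" "j < n" for m i j
  proof -
    have c: "coeff (char_poly A) k * (A ^\<^sub>m k) $$ (i, j) =
        (case k of 0 \<Rightarrow> 0 | Suc k' \<Rightarrow> (B k' * A ^\<^sub>m k) $$ (i, j)) - (B k * A ^\<^sub>m Suc k) $$ (i, j)" for k
    proof -
      have "coeff (char_poly A) k * (A ^\<^sub>m k) $$ (i, j)
          = (\<Sum>l<n. (if i = l then coeff (char_poly A) k * (A ^\<^sub>m k) $$ (l, j) else 0))"
        using ij by simp
      also have "\<dots> = (\<Sum>l<n. ((case k of 0 \<Rightarrow> 0 | Suc k' \<Rightarrow> B k' $$ (i, l)) - (B k * A) $$ (i, l)) * (A ^\<^sub>m k) $$ (l, j))"
        using ij by (intro sum.cong) (auto simp: step)
      also have "\<dots> = (\<Sum>l<n. (case k of 0 \<Rightarrow> 0 | Suc k' \<Rightarrow> B k' $$ (i, l)) * (A ^\<^sub>m k) $$ (l, j))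
          - (B k * A * A ^\<^sub>m k) $$ (i, j)"
        using ij B[of k] A pow[of k] by (simp add: scalar_prod_def lessThan_atLeast0 algebra_simps sum_subtractf)
      also have "B k * A * A ^\<^sub>m k = B k * (A * A ^\<^sub>m k)"
        by (rule assoc_mult_mat[OF B A pow])
      also have "A * A ^\<^sub>m k = A ^\<^sub>m Suc k"
        using A by (induction k) (simp_all add: assoc_mult_mat[of A n n _ n A n, symmetric])
      also have "(\<Sum>l<n. (case k of 0 \<Rightarrow> 0 | Suc k' \<Rightarrow> B k' $$ (i, l)) * (A ^\<^sub>m k) $$ (l, j))
          = (case k of 0 \<Rightarrow> 0 | Suc k' \<Rightarrow> (B k' * A ^\<^sub>m k) $$ (i, j))"
      proof (cases k)
        case (Suc k')
        show ?thesis unfolding Suc nat.case by (rule mat_mult_entry[OF B pow ij, symmetric])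
      qed simp
      finally show ?thesis .
    qed
    show ?thesis
      by (induction m) (simp_all add: c del: pow_mat.simps)
  qed
  \<comment> \<open>Beyond all degrees that occur in the adjugate the coefficient matrix is zero, so
    the remainder of the telescoping sum vanishes. The summand \<open>n\<close> ensures that the sum
    covers the whole characteristic polynomial.\<close>
  define N where "N = n + (\<Sum>i<n. \<Sum>l<n. degree (adj_mat ?cm $$ (i, l)))"
  have "degree (adj_mat ?cm $$ (i, l)) < Suc N" if "i < n" "l < n" for i l
  proof -
    have "degree (adj_mat ?cm $$ (i, l)) \<le> (\<Sum>l<n. degree (adj_mat ?cm $$ (i, l)))"
      using that by (intro member_le_sum) auto
    also have "\<dots> \<le> (\<Sum>i<n. \<Sum>l<n. degree (adj_mat ?cm $$ (i, l)))"
      using that by (intro member_le_sum[of _ _ "\<lambda>i. \<Sum>l<n. degree (adj_mat ?cm $$ (i, l))"]) auto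
    finally show ?thesis by (simp add: N_def)
  qed
  then have "B (Suc N) = 0\<^sub>m n n" using adj(1) by (auto simp: B_def coeff_eq_0 intro!: eq_matI)
  then have "(\<Sum>k\<le>Suc N. coeff (char_poly A) k * (A ^\<^sub>m k) $$ (i, j)) = 0"
    using part[OF ij, of "Suc N"] ij pow[of "Suc (Suc N)"] by (simp del: pow_mat.simps add: left_mult_zero_mat)
  also have "(\<Sum>k\<le>Suc N. coeff (char_poly A) k * (A ^\<^sub>m k) $$ (i, j)) =
      (\<Sum>k\<le>n. coeff (char_poly A) k * (A ^\<^sub>m k) $$ (i, j))"
    by (rule sum.mono_neutral_right) (use degree_monic_char_poly[OF A] in \<open>auto simp: N_def coeff_eq_0\<close>)
  finally show ?thesis .
qed

context class_epi
begin

definition hp :: "'p poly \<Rightarrow> nat \<Rightarrow> 'a" where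
  "hp p = (\<lambda>i. h (coeff p i))"

lemma hp_up [simp]: "hp p \<in> up R"
  by (auto simp: hp_def up_def bound_def coeff_eq_0 intro!: exI[of _ "degree p"])

text \<open>The transfer principle applied to polynomials: since polynomials over an integral domain
  form an integral domain, determinants over \<open>K[X]\<close> are images of library determinants
  as well.\<close>

lemma class_epi_UP: "class_epi (UP R) hp"
proof -
  interpret UP: UP_cring R "UP R" by unfold_locales
  show ?thesis
  proof (unfold_locales, goal_cases)
    case (1 x)
    show ?case by (simp add: UP_def)
  next
    case (2 x y)
    show ?case by (simp add: UP_def) (simp add: hp_def h_add)
  next
    case (3 x y)
    show ?case by (simp add: UP_def) (simp add: hp_def h_mult coeff_mult h_sum fun_eq_iff)
  next
    case 4
    show ?case by (auto simp: UP_def hp_def)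
  next
    case (5 f)
    then have f: "f i \<in> carrier R" for i by (auto simp: UP_def up_def)
    from 5 obtain n where n: "\<And>i. i > n \<Longrightarrow> f i = \<zero>" by (auto simp: UP_def up_def bound_def)
    \<comment> \<open>Preimages are chosen only up to the degree bound and are 0 above it; otherwise
      the sequence would not be a polynomial.\<close>
    define g where "g i = (if i > n then 0 else SOME p. h p = f i)" for i
    have g: "h (g i) = f i" for i
      using f[of i] h_surj[of "f i"] n[of i] by (auto simp: g_def intro: someI_ex)
    have "coeff (Abs_poly g) = g" by (rule coeff_Abs_poly[of n]) (auto simp: g_def)
    then show ?case by (intro exI[of _ "Abs_poly g"]) (simp add: hp_def g)
  qed
qed

definition cp :: "nat \<Rightarrow> 'a mat \<Rightarrow> nat \<Rightarrow> 'a" where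
  "cp n M = matrix_char_poly R n M"

lemma hp_monom: "hp (Polynomial.monom a n) = up_ring.monom (UP R) (h a) n"
  by (auto simp: UP_def hp_def fun_eq_iff)

lemma cp_map:
  assumes M: "M \<in> carrier_mat n n"
  shows "cp n (map_mat h M) = hp (char_poly M)"
proof -
  interpret UP: class_epi "UP R" hp by (rule class_epi_UP)
  have "hp (char_poly M) = matrix_det (UP R) n (map_mat hp (char_poly_matrix M))"
    unfolding char_poly_def by (rule UP.h_det) (use M in simp)
  also have "map_mat hp (char_poly_matrix M) = mat n n (\<lambda>(i, j).
       (if i = j then up_ring.monom (UP R) \<one> 1 else \<zero>\<^bsub>UP R\<^esub>)
         \<ominus>\<^bsub>UP R\<^esub> up_ring.monom (UP R) (map_mat h M $$ (i, j)) 0)" (is "_ = ?M")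
  proof (rule eq_matI)
    fix i j assume "i < dim_row ?M" "j < dim_col ?M"
    then have ij: "i < n" "j < n" by auto
    have "char_poly_matrix M $$ (i, j) = (if i = j then Polynomial.monom 1 1 else 0) - Polynomial.monom (M $$ (i, j)) 0"
      using ij M by (auto simp: char_poly_matrix_def monom_altdef)
    then show "map_mat hp (char_poly_matrix M) $$ (i, j) = ?M $$ (i, j)"
      using ij carrier_matD[OF char_poly_matrix_closed[OF M]] carrier_matD[OF M]
      by (simp add: UP.h_minus hp_monom del: One_nat_def)
  qed (use carrier_matD[OF char_poly_matrix_closed[OF M]] in auto)
  finally show ?thesis by (simp add: cp_def matrix_char_poly_def)
qed

lemma cp_closed:
  assumes "M \<in> kmat n n"
  shows "cp n M \<in> carrier (UP R)"
  by (rule kmat_cases[OF assms]) (simp add: cp_map, simp add: UP_def)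

lemma cp_monic:
  assumes "M \<in> kmat n n"
  shows "cp n M n = \<one>" "i > n \<Longrightarrow> cp n M i = \<zero>"
proof -
  obtain M' where M': "M' \<in> carrier_mat n n" "M = map_mat h M'" by (rule kmat_cases[OF assms])
  show "cp n M n = \<one>" "i > n \<Longrightarrow> cp n M i = \<zero>"
    using M' degree_monic_char_poly[OF M'(1)] by (auto simp: cp_map hp_def coeff_eq_0)
qed

lemma cp_block:
  assumes "A \<in> kmat r r" "B \<in> kmat r s" "D \<in> kmat s s"
  shows "cp (r + s) (four_block_mat A B (mzero s r) D) = cp r A \<otimes>\<^bsub>UP R\<^esub> cp s D"
proof -
  interpret UP: class_epi "UP R" hp by (rule class_epi_UP)
  obtain A' where A: "A' \<in> carrier_mat r r" "A = map_mat h A'" by (rule kmat_cases[OF assms(1)])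
  obtain B' where B: "B' \<in> carrier_mat r s" "B = map_mat h B'" by (rule kmat_cases[OF assms(2)])
  obtain D' where D: "D' \<in> carrier_mat s s" "D = map_mat h D'" by (rule kmat_cases[OF assms(3)])
  let ?M = "four_block_mat A' B' (0\<^sub>m s r) D'"
  have M: "?M \<in> carrier_mat (r + s) (r + s)" using A B D by simp
  have "four_block_mat A B (mzero s r) D = map_mat h ?M"
    using map_four_block_mat[OF A(1) B(1) _ D(1), of "0\<^sub>m s r" h] A B D by simp
  then have "cp (r + s) (four_block_mat A B (mzero s r) D) = hp (char_poly ?M)"
    using cp_map[OF M] by simp
  also have "char_poly_matrix ?M = four_block_mat (char_poly_matrix A') (map_mat (\<lambda>a. [:- a:]) B')
      (0\<^sub>m s r) (char_poly_matrix D')"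
    using A B D by (intro eq_matI) (auto simp: char_poly_matrix_def)
  then have "char_poly ?M = char_poly A' * char_poly D'"
    unfolding char_poly_def using A B D by (simp add: det_four_block_mat_lower_left_zero[of _ r _ s])
  finally show ?thesis using A D by (simp add: UP.h_mult cp_map)
qed

text \<open>A lift of \<open>S\<close> need not be invertible, and the lifted equation
  \<open>x S = S y\<close> holds only modulo the kernel of \<open>h\<close>. So the determinant
  identities are first pushed to \<open>UP R\<close>, where the image of the determinant of
  \<open>S\<close> is a unit and can be cancelled.\<close>

lemma cp_similar:
  assumes S: "S \<in> kmat n n" and T: "T \<in> kmat n n" and x: "x \<in> kmat n n" and y: "y \<in> kmat n n"
    and inv: "S \<odot>\<odot> T = mone n" and eq: "x \<odot>\<odot> S = S \<odot>\<odot> y"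
  shows "cp n x = cp n y"
proof -
  interpret UP: class_epi "UP R" hp by (rule class_epi_UP)
  obtain S' where S': "S' \<in> carrier_mat n n" "S = map_mat h S'" by (rule kmat_cases[OF S])
  obtain T' where T': "T' \<in> carrier_mat n n" "T = map_mat h T'" by (rule kmat_cases[OF T])
  obtain x' where x': "x' \<in> carrier_mat n n" "x = map_mat h x'" by (rule kmat_cases[OF x])
  obtain y' where y': "y' \<in> carrier_mat n n" "y = map_mat h y'" by (rule kmat_cases[OF y])
  define c :: "'p mat \<Rightarrow> 'p poly mat" where "c = map_mat (\<lambda>a. [:a:])"
  interpret c: comm_ring_hom "\<lambda>a::'p. [:a:]" by unfold_locales (auto simp: one_pCons)
  have cc [simp]: "M \<in> carrier_mat r s \<Longrightarrow> c M \<in> carrier_mat r s" for M r s by (auto simp: c_def)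
  have hc: "map_mat hp (c M) = map_mat (\<lambda>a. hp [:a:]) M" for M by (auto simp: c_def)
  have hpc: "hp [:a:] = hp [:b:]" if "h a = h b" for a b
    using that by (auto simp: hp_def fun_eq_iff coeff_pCons split: nat.split)
  have cong: "map_mat hp (c M) = map_mat hp (c N)" if "map_mat h M = map_mat h N" for M N
  proof -
    have d: "dim_row M = dim_row N" "dim_col M = dim_col N"
      using that by (metis index_map_mat(2,3))+
    have "h (M $$ (i, j)) = h (N $$ (i, j))" if "i < dim_row N" "j < dim_col N" for i j
      using arg_cong[OF \<open>map_mat h M = _\<close>, of "\<lambda>M. M $$ (i, j)"] that d by simp
    then show ?thesis unfolding hc using d by (intro eq_matI) (auto intro!: hpc)
  qed
  have cm: "char_poly_matrix M = [:0, 1:] \<cdot>\<^sub>m 1\<^sub>m n - c M" if "M \<in> carrier_mat n n" for M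
    using that by (auto simp: char_poly_matrix_def c_def)
  have c1: "char_poly_matrix x' * c S' = [:0, 1:] \<cdot>\<^sub>m c S' - c (x' * S')"
    using x' S' by (simp add: cm minus_mult_distrib_mat[of _ n n] c_def c.mat_hom_mult[of _ n n _ n] mult_smult_assoc_mat[of _ n n])
  have c2: "c S' * char_poly_matrix y' = [:0, 1:] \<cdot>\<^sub>m c S' - c (S' * y')"
    using y' S' by (simp add: cm mult_minus_distrib_mat[of _ n n _ n] c_def c.mat_hom_mult[of _ n n _ n] mult_smult_distrib[of _ n n _ n])
  have "map_mat h (x' * S') = map_mat h (S' * y')"
    using eq S' x' y' by simp
  then have ce: "map_mat hp (c (x' * S')) = map_mat hp (c (S' * y'))" by (rule cong)
  have minus: "map_mat hp (M - N) = map_mat hp (M - N')" if "map_mat hp N = map_mat hp N'" for M N N'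
  proof -
    have d: "dim_row N = dim_row N'" "dim_col N = dim_col N'"
      using that by (metis index_map_mat(2,3))+
    have "hp (N $$ (i, j)) = hp (N' $$ (i, j))" if "i < dim_row N'" "j < dim_col N'" for i j
      using arg_cong[OF \<open>map_mat hp N = _\<close>, of "\<lambda>M. M $$ (i, j)"] that d by simp
    then show ?thesis using d by (intro eq_matI) (auto simp: UP.h_minus)
  qed
  have "map_mat hp (char_poly_matrix x' * c S') = map_mat hp (c S' * char_poly_matrix y')"
    unfolding c1 c2 by (rule minus[OF ce])
  then have "hp (det (char_poly_matrix x' * c S')) = hp (det (c S' * char_poly_matrix y'))"
    using UP.h_det[of "char_poly_matrix x' * c S'" n] UP.h_det[of "c S' * char_poly_matrix y'" n] S' x' y'
    by (metis cc char_poly_matrix_closed mult_carrier_mat)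
  then have m: "hp (char_poly x') \<otimes>\<^bsub>UP R\<^esub> hp (det (c S')) = hp (det (c S')) \<otimes>\<^bsub>UP R\<^esub> hp (char_poly y')"
    using S' x' y' by (simp add: det_mult[of _ n] UP.h_mult char_poly_def)
  have "map_mat h (S' * T') = map_mat h (1\<^sub>m n)" using inv S' T' by simp
  then have "map_mat hp (c (S' * T')) = map_mat hp (c (1\<^sub>m n))" by (rule cong)
  then have "hp (det (c (S' * T'))) = hp (det (c (1\<^sub>m n)))"
    using UP.h_det[of "c (S' * T')" n] UP.h_det[of "c (1\<^sub>m n)" n] S' T'
    by (metis cc mult_carrier_mat one_carrier_mat)
  then have u: "hp (det (c S')) \<otimes>\<^bsub>UP R\<^esub> hp (det (c T')) = \<one>\<^bsub>UP R\<^esub>"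
  proof -
    have "det (c (S' * T')) = det (c S') * det (c T')"
      using S' T' by (metis c_def c.mat_hom_mult cc det_mult)
    moreover have "det (c (1\<^sub>m n)) = 1" by (simp add: c_def)
    ultimately show ?thesis using \<open>hp (det (c (S' * T'))) = _\<close> by (simp only: UP.h_mult UP.h_one)
  qed
  have "hp (char_poly x') = hp (char_poly x') \<otimes>\<^bsub>UP R\<^esub> (hp (det (c S')) \<otimes>\<^bsub>UP R\<^esub> hp (det (c T')))"
    by (simp add: u)
  also have "\<dots> = (hp (det (c S')) \<otimes>\<^bsub>UP R\<^esub> hp (char_poly y')) \<otimes>\<^bsub>UP R\<^esub> hp (det (c T'))"
    by (simp add: UP.m_assoc[symmetric] m)
  also have "\<dots> = hp (char_poly y') \<otimes>\<^bsub>UP R\<^esub> (hp (det (c S')) \<otimes>\<^bsub>UP R\<^esub> hp (det (c T')))"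
    by (simp add: UP.m_ac)
  also have "\<dots> = hp (char_poly y')" by (simp add: u)
  finally show ?thesis using x' y' by (simp add: cp_map)
qed

text \<open>The last column of a companion matrix can be read off from its characteristic
  polynomial; this is what later recovers an unknown companion block.\<close>

lemma cp_companion:
  assumes n: "n > 0" and a: "\<And>i. i < n \<Longrightarrow> a i \<in> carrier R"
  shows "cp n (companion n \<zero> \<one> a) = (\<lambda>i. if i < n then \<ominus> a i else if i = n then \<one> else \<zero>)"
proof -
  define b where "b i = (SOME p. h p = a i)" for i
  have b: "h (b i) = a i" if "i < n" for i
    using h_surj[OF a[OF that]] by (auto simp: b_def intro: someI_ex)
  have "companion n \<zero> \<one> a = map_mat h (companion n 0 1 b)"
    by (rule eq_matI) (auto simp: companion_def b)
  then have "cp n (companion n \<zero> \<one> a) = hp (char_poly (companion n 0 1 b))"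
    by (simp add: cp_map)
  also have "char_poly (companion n 0 1 b) = Polynomial.monom 1 n - (\<Sum>i<n. Polynomial.monom (b i) i)"
    by (rule char_poly_companion[OF n])
  finally show ?thesis
    by (auto simp: hp_def fun_eq_iff coeff_sum sum.delta' h_minus h_uminus b sum.neutral
        a_minus_def a)
qed

primrec mpow :: "nat \<Rightarrow> 'a mat \<Rightarrow> nat \<Rightarrow> 'a mat" where
  "mpow n x 0 = mone n"
| "mpow n x (Suc k) = mpow n x k \<odot>\<odot> x"

lemma mpow_closed [simp]: "x \<in> kmat n n \<Longrightarrow> mpow n x k \<in> kmat n n"
  by (induction k) auto

lemma cayley_hamilton_kmat:
  assumes x: "x \<in> kmat n n" and ij: "i < n" "j < n"
  shows "(\<Oplus>k\<in>{..n}. cp n x k \<otimes> mpow n x k $$ (i, j)) = \<zero>"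
proof -
  obtain x' where x': "x' \<in> carrier_mat n n" "x = map_mat h x'" by (rule kmat_cases[OF x])
  have p: "mpow n x k = map_mat h (x' ^\<^sub>m k)" for k
    using x' by (induction k) auto
  have "(\<Oplus>k\<in>{..n}. cp n x k \<otimes> mpow n x k $$ (i, j)) = (\<Oplus>k\<in>{..n}. h (coeff (char_poly x') k * (x' ^\<^sub>m k) $$ (i, j)))"
    using x' ij pow_carrier_mat[OF x'(1)] by (intro finsum_cong') (auto simp: p[unfolded x'(2)] cp_map hp_def h_mult)
  also have "\<dots> = h (\<Sum>k\<le>n. coeff (char_poly x') k * (x' ^\<^sub>m k) $$ (i, j))"
    by (rule h_sum[symmetric]) simp
  finally show ?thesis by (simp only: cayley_hamilton_entry[OF x'(1) ij] h_zero)
qed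

end

section \<open>Matrices with entries in a given set, and their concatenation\<close>

definition mats :: "'a set \<Rightarrow> nat \<Rightarrow> nat \<Rightarrow> 'a mat set" where
  "mats F r c = {M \<in> carrier_mat r c. \<forall>i<r. \<forall>j<c. M $$ (i, j) \<in> F}"

lemma bij_betw_mats:
  "bij_betw (\<lambda>M. \<lambda>p\<in>{..<r} \<times> {..<c}. M $$ p) (mats F r c) (({..<r} \<times> {..<c}) \<rightarrow>\<^sub>E F)"
proof (rule bij_betwI[where g = "\<lambda>f. mat r c f"])
  show "(\<lambda>M. \<lambda>p\<in>{..<r} \<times> {..<c}. M $$ p) \<in> mats F r c \<rightarrow> (({..<r} \<times> {..<c}) \<rightarrow>\<^sub>E F)"
    by (rule Pi_I, rule PiE_I) (auto simp: mats_def)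
qed (auto simp: mats_def fun_eq_iff PiE_iff extensional_def intro!: eq_matI)

lemma card_mats: "card (mats F r c) = card F ^ (r * c)"
  using bij_betw_same_card[OF bij_betw_mats[of r c F]] by (simp add: card_PiE)

lemma finite_mats: "finite F \<Longrightarrow> finite (mats F r c)"
  using bij_betw_finite[OF bij_betw_mats[of r c F]] by (simp add: finite_PiE)

lemma mats_mono: "F \<subseteq> G \<Longrightarrow> mats F r c \<subseteq> mats G r c"
  by (auto simp: mats_def)

definition hcat :: "'a mat \<Rightarrow> 'a mat \<Rightarrow> 'a mat" where
  "hcat A B = mat (dim_row A) (dim_col A + dim_col B)
     (\<lambda>(i, j). if j < dim_col A then A $$ (i, j) else B $$ (i, j - dim_col A))"

definition vcat :: "'a mat \<Rightarrow> 'a mat \<Rightarrow> 'a mat" where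
  "vcat A B = mat (dim_row A + dim_row B) (dim_col A)
     (\<lambda>(i, j). if i < dim_row A then A $$ (i, j) else B $$ (i - dim_row A, j))"

definition mcol :: "'a mat \<Rightarrow> nat \<Rightarrow> 'a mat" where
  "mcol A j = mat (dim_row A) 1 (\<lambda>(i, _). A $$ (i, j))"

definition mjoin :: "nat \<Rightarrow> nat \<Rightarrow> (nat \<Rightarrow> 'a mat) \<Rightarrow> 'a mat" where
  "mjoin r c f = mat r c (\<lambda>(i, j). f j $$ (i, 0))"

lemma hcat_mats [simp]: "A \<in> mats F r c \<Longrightarrow> B \<in> mats F r d \<Longrightarrow> hcat A B \<in> mats F r (c + d)"
  by (auto simp: mats_def hcat_def)

lemma vcat_mats [simp]: "A \<in> mats F r c \<Longrightarrow> B \<in> mats F s c \<Longrightarrow> vcat A B \<in> mats F (r + s) c"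
  by (auto simp: mats_def vcat_def)

lemma mcol_mats [simp]: "A \<in> mats F r c \<Longrightarrow> j < c \<Longrightarrow> mcol A j \<in> mats F r 1"
  by (auto simp: mats_def mcol_def)

lemma mjoin_mats [simp]: "(\<And>j. j < c \<Longrightarrow> f j \<in> mats F r 1) \<Longrightarrow> mjoin r c f \<in> mats F r c"
  by (auto simp: mats_def mjoin_def)

lemma mcol_mjoin: "j < c \<Longrightarrow> f j \<in> mats F r 1 \<Longrightarrow> mcol (mjoin r c f) j = f j"
  by (auto simp: mcol_def mjoin_def mats_def intro!: eq_matI)

lemma mats_eqI_mcol:
  "A \<in> mats F r c \<Longrightarrow> B \<in> mats F r c \<Longrightarrow> (\<And>j. j < c \<Longrightarrow> mcol A j = mcol B j) \<Longrightarrow> A = B"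
proof (rule eq_matI, goal_cases)
  case (1 i j)
  then have "mcol A j $$ (i, 0) = mcol B j $$ (i, 0)" by (auto simp: mats_def)
  then show ?case using 1 by (auto simp: mats_def mcol_def)
qed (auto simp: mats_def)

lemma vcat_cases:
  assumes "A \<in> mats F (r + s) c"
  obtains B C where "B \<in> mats F r c" "C \<in> mats F s c" "A = vcat B C"
proof
  show "mat r c (\<lambda>(i, j). A $$ (i, j)) \<in> mats F r c" using assms by (auto simp: mats_def)
  show "mat s c (\<lambda>(i, j). A $$ (r + i, j)) \<in> mats F s c" using assms by (auto simp: mats_def)
  show "A = vcat (mat r c (\<lambda>(i, j). A $$ (i, j))) (mat s c (\<lambda>(i, j). A $$ (r + i, j)))"
    using assms by (auto simp: mats_def vcat_def intro!: eq_matI)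
qed

lemma vcat_inj:
  assumes "A \<in> mats F r c" "A' \<in> mats F r c" "B \<in> mats F s c" "B' \<in> mats F s c" "vcat A B = vcat A' B'"
  shows "A = A' \<and> B = B'"
proof (intro conjI eq_matI)
  fix i j assume "i < dim_row A'" "j < dim_col A'"
  moreover have "vcat A B $$ (i, j) = vcat A' B' $$ (i, j)" using assms(5) by simp
  ultimately show "A $$ (i, j) = A' $$ (i, j)"
    using assms(1-4) by (auto simp: mats_def vcat_def)
next
  fix i j assume "i < dim_row B'" "j < dim_col B'"
  moreover have "vcat A B $$ (r + i, j) = vcat A' B' $$ (r + i, j)" using assms(5) by simp
  ultimately show "B $$ (i, j) = B' $$ (i, j)"
    using assms(1-4) by (auto simp: mats_def vcat_def)
qed (use assms in \<open>auto simp: mats_def\<close>)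

lemma hcat_cases:
  assumes "A \<in> mats F r (c + d)"
  obtains B C where "B \<in> mats F r c" "C \<in> mats F r d" "A = hcat B C"
proof
  show "mat r c (\<lambda>(i, j). A $$ (i, j)) \<in> mats F r c" using assms by (auto simp: mats_def)
  show "mat r d (\<lambda>(i, j). A $$ (i, c + j)) \<in> mats F r d" using assms by (auto simp: mats_def)
  show "A = hcat (mat r c (\<lambda>(i, j). A $$ (i, j))) (mat r d (\<lambda>(i, j). A $$ (i, c + j)))"
    using assms by (auto simp: mats_def hcat_def intro!: eq_matI)
qed

lemma hcat_inj:
  assumes "A \<in> mats F r c" "A' \<in> mats F r c" "B \<in> mats F r d" "B' \<in> mats F r d" "hcat A B = hcat A' B'"
  shows "A = A' \<and> B = B'"
proof (intro conjI eq_matI)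
  fix i j assume "i < dim_row A'" "j < dim_col A'"
  moreover have "hcat A B $$ (i, j) = hcat A' B' $$ (i, j)" using assms(5) by simp
  ultimately show "A $$ (i, j) = A' $$ (i, j)"
    using assms(1-4) by (auto simp: mats_def hcat_def)
next
  fix i j assume "i < dim_row B'" "j < dim_col B'"
  moreover have "hcat A B $$ (i, c + j) = hcat A' B' $$ (i, c + j)" using assms(5) by simp
  ultimately show "B $$ (i, j) = B' $$ (i, j)"
    using assms(1-4) by (auto simp: mats_def hcat_def)
qed (use assms in \<open>auto simp: mats_def\<close>)

lemma hcat_assoc: "dim_row B = dim_row A \<Longrightarrow> hcat (hcat A B) C = hcat A (hcat B C)"
  by (rule eq_matI) (auto simp: hcat_def)

lemma hcat_empty: "A \<in> mats F r c \<Longrightarrow> B \<in> mats F r 0 \<Longrightarrow> hcat A B = A"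
  by (rule eq_matI) (auto simp: hcat_def mats_def)

lemma four_block_hcat:
  assumes "A \<in> mats F r c" "B \<in> mats F r d" "C \<in> mats F s c" "D \<in> mats F s d"
  shows "four_block_mat A B C D = hcat (vcat A C) (vcat B D)"
  using assms by (intro eq_matI) (auto simp: hcat_def vcat_def mats_def)

lemma map_hcat: "dim_row B = dim_row A \<Longrightarrow> map_mat f (hcat A B) = hcat (map_mat f A) (map_mat f B)"
  by (rule eq_matI) (auto simp: hcat_def)

lemma map_vcat: "dim_col B = dim_col A \<Longrightarrow> map_mat f (vcat A B) = vcat (map_mat f A) (map_mat f B)"
  by (rule eq_matI) (auto simp: vcat_def)

lemma sum_lessThan_add:
  fixes f :: "nat \<Rightarrow> 'a :: comm_monoid_add"
  shows "(\<Sum>l<d + e. f l) = (\<Sum>l<d. f l) + (\<Sum>l<e. f (d + l))"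
  by (induction e) (simp_all add: ac_simps)

lemma hcat_mult_vcat:
  fixes A :: "'a :: comm_ring_1 mat"
  assumes "A \<in> carrier_mat r k" "B \<in> carrier_mat r l" "C \<in> carrier_mat k c" "D \<in> carrier_mat l c"
  shows "hcat A B * vcat C D = A * C + B * D"
proof (rule eq_matI)
  fix i j assume "i < dim_row (A * C + B * D)" "j < dim_col (A * C + B * D)"
  then have ij: "i < r" "j < c" using assms by auto
  have "(hcat A B * vcat C D) $$ (i, j) = (\<Sum>m<k + l. hcat A B $$ (i, m) * vcat C D $$ (m, j))"
    by (rule mat_mult_entry[of _ r _ _ c]) (use assms ij in \<open>auto simp: hcat_def vcat_def\<close>)
  also have "\<dots> = (\<Sum>m<k. A $$ (i, m) * C $$ (m, j)) + (\<Sum>m<l. B $$ (i, m) * D $$ (m, j))"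
    unfolding sum_lessThan_add using assms ij
    by (intro arg_cong2[of _ _ _ _ "(+)"] sum.cong) (auto simp: hcat_def vcat_def)
  also have "\<dots> = (A * C + B * D) $$ (i, j)"
    using assms ij by (simp add: mat_mult_entry[OF assms(1,3)] mat_mult_entry[OF assms(2,4)] del: index_mult_mat(1))
  finally show "(hcat A B * vcat C D) $$ (i, j) = (A * C + B * D) $$ (i, j)" .
qed (use assms in \<open>auto simp: hcat_def vcat_def\<close>)

lemma (in ring) kmat_mats: "kmat = mats (carrier R)"
  by (auto simp: kmat_def mats_def fun_eq_iff)

lemma (in class_epi) mmul_hcat_vcat:
  assumes "A \<in> kmat r k" "B \<in> kmat r l" "C \<in> kmat k c" "D \<in> kmat l c"
  shows "hcat A B \<odot>\<odot> vcat C D = A \<odot>\<odot> C \<oplus>\<oplus> B \<odot>\<odot> D"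
proof -
  obtain A' where A: "A' \<in> carrier_mat r k" "A = map_mat h A'" by (rule kmat_cases[OF assms(1)])
  obtain B' where B: "B' \<in> carrier_mat r l" "B = map_mat h B'" by (rule kmat_cases[OF assms(2)])
  obtain C' where C: "C' \<in> carrier_mat k c" "C = map_mat h C'" by (rule kmat_cases[OF assms(3)])
  obtain D' where D: "D' \<in> carrier_mat l c" "D = map_mat h D'" by (rule kmat_cases[OF assms(4)])
  have "hcat A B \<odot>\<odot> vcat C D = map_mat h (hcat A' B' * vcat C' D')"
    using A B C D by (simp add: map_hcat[symmetric] map_vcat[symmetric]) (simp add: hcat_def vcat_def)
  also have "hcat A' B' * vcat C' D' = A' * C' + B' * D'" by (rule hcat_mult_vcat[OF A(1) B(1) C(1) D(1)])
  finally show ?thesis using A B C D by simp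
qed

lemma (in ring) mmul_hcat:
  assumes "A \<in> kmat r k" "B \<in> kmat k c" "C \<in> kmat k d"
  shows "A \<odot>\<odot> hcat B C = hcat (A \<odot>\<odot> B) (A \<odot>\<odot> C)"
proof -
  have "j - c < d" if "j < c + d" "\<not> j < c" for j using that by auto
  then show ?thesis using assms by (intro eq_matI) (auto simp: mmul_def hcat_def kmat_dim
      kmat_entry[of A r k] kmat_entry[of B k c] kmat_entry[of C k d] intro!: finsum_cong')
qed

lemma (in ring) mcol_mmul:
  assumes "A \<in> kmat r k" "B \<in> kmat k c" "j < c"
  shows "mcol (A \<odot>\<odot> B) j = A \<odot>\<odot> mcol B j"
proof (rule eq_matI, goal_cases)
  case (1 i j')
  then show ?case using assms
    by (auto simp: mmul_def mcol_def kmat_dim kmat_entry[of A r k] kmat_entry[of B k c] intro!: finsum_cong')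
qed (use assms in \<open>auto simp: mmul_def mcol_def kmat_dim\<close>)

section \<open>Finite fields as images of the integer polynomials\<close>

locale finite_field = field R for R :: "('a, 'b) ring_scheme" (structure) +
  assumes finite_carrier: "finite (carrier R)"
begin

definition gen :: 'a where
  "gen = (SOME a. a \<in> carrier R \<and> carrier R - {\<zero>} = {a [^] i | i::nat. i \<in> UNIV})"

lemma gen: "gen \<in> carrier R" "carrier R - {\<zero>} = {gen [^] i | i::nat. i \<in> UNIV}"
proof -
  have "\<exists>a. a \<in> carrier R \<and> carrier R - {\<zero>} = {a [^] i | i::nat. i \<in> UNIV}"
    using finite_field_mult_group_has_gen[OF finite_carrier]
    by (auto simp: carrier_mult_of nat_pow_mult_of)
  then have "gen \<in> carrier R \<and> carrier R - {\<zero>} = {gen [^] i | i::nat. i \<in> UNIV}"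
    unfolding gen_def by (rule someI_ex)
  then show "gen \<in> carrier R" "carrier R - {\<zero>} = {gen [^] i | i::nat. i \<in> UNIV}" by auto
qed

text \<open>Evaluation of an integer polynomial at the generator of the unit group, written as a
  Horner scheme so that it obeys a recursion along \<open>pCons\<close>.\<close>

definition gen_eval :: "int poly \<Rightarrow> 'a" where
  "gen_eval p = foldr (\<lambda>a r. [a] \<cdot> \<one> \<oplus> gen \<otimes> r) (coeffs p) \<zero>"

lemma gen_eval_pCons: "gen_eval (pCons a p) = [a] \<cdot> \<one> \<oplus> gen \<otimes> gen_eval p"
  using gen(1) by (cases "p = 0 \<and> a = 0") (auto simp: gen_eval_def add_pow_def)

lemma gen_eval_0: "gen_eval 0 = \<zero>"
  by (simp add: gen_eval_def)

lemma gen_eval_closed: "gen_eval p \<in> carrier R"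
  by (induction p) (auto simp: gen_eval_pCons gen_eval_0 gen)

lemma gen_eval_add: "gen_eval (p + q) = gen_eval p \<oplus> gen_eval q"
proof (induction p q rule: poly_induct2)
  case (pCons a p b q)
  have "[(a + b)] \<cdot> \<one> = [a] \<cdot> \<one> \<oplus> [b] \<cdot> \<one>" by (simp add: add.int_pow_mult)
  then show ?case using pCons gen(1) gen_eval_closed
    by (simp add: gen_eval_pCons r_distr a_ac)
qed (simp add: gen_eval_0)

lemma gen_eval_smult: "gen_eval (Polynomial.smult a p) = [a] \<cdot> gen_eval p"
proof (induction p)
  case 0
  show ?case by (simp add: gen_eval_0 add.int_pow_one)
next
  case (pCons b p)
  have "[(a * b)] \<cdot> \<one> = [a] \<cdot> ([b] \<cdot> \<one>)" by (simp add: add.int_pow_pow mult.commute)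
  moreover have "gen \<otimes> [a] \<cdot> gen_eval p = [a] \<cdot> (gen \<otimes> gen_eval p)"
    by (rule add_pow_rdistr_int) (simp_all add: gen gen_eval_closed)
  ultimately show ?case using pCons gen(1) gen_eval_closed
    by (simp add: gen_eval_pCons add.int_pow_distrib)
qed

lemma gen_eval_mult: "gen_eval (p * q) = gen_eval p \<otimes> gen_eval q"
proof (induction p)
  case 0
  show ?case by (simp add: gen_eval_0 gen_eval_closed)
next
  case (pCons a p)
  have "[a] \<cdot> gen_eval q = [a] \<cdot> \<one> \<otimes> gen_eval q"
    using add_pow_ldistr_int[of \<one> "gen_eval q" a] by (simp add: gen_eval_closed)
  moreover have "[(0::int)] \<cdot> \<one> = \<zero>" by (simp add: add_pow_def)
  ultimately show ?case using pCons gen(1) gen_eval_closed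
    by (simp add: mult_pCons_left gen_eval_add gen_eval_pCons gen_eval_smult l_distr m_assoc)
qed

lemma gen_eval_1: "gen_eval 1 = \<one>"
proof -
  have "gen_eval 1 = [(1::int)] \<cdot> \<one> \<oplus> gen \<otimes> \<zero>"
    by (simp only: one_pCons gen_eval_pCons gen_eval_0)
  also have "[(1::int)] \<cdot> \<one> = \<one>" by (rule add.int_pow_1) simp
  finally show ?thesis by (simp add: gen)
qed

text \<open>Surjective because every nonzero element is a power of \<open>gen\<close>, hence the
  image of a monomial. From here on all matrix identities are available over every finite
  field.\<close>

sublocale class_epi R gen_eval
proof unfold_locales
  fix x assume x: "x \<in> carrier R"
  show "\<exists>p. gen_eval p = x"
  proof (cases "x = \<zero>")
    case True
    then show ?thesis using gen_eval_0 by blast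
  next
    case False
    then obtain i :: nat where i: "x = gen [^] i" using x gen(2) by blast
    have "gen_eval ([:0, 1:] ^ i) = gen [^] i"
    proof (induction i)
      case (Suc i)
      then show ?case by (simp add: gen_eval_pCons gen m_comm) (simp add: add_pow_def gen)
    qed (simp add: gen_eval_1)
    then show ?thesis using i by blast
  qed
qed (simp_all add: gen_eval_closed gen_eval_add gen_eval_mult gen_eval_1)

end

section \<open>Linear independence over subfields\<close>

declare One_nat_def [simp del]

text \<open>The infinite product at \<open>x = 1/2\<close> is about 0.289, so \<open>1/4\<close> is
  a lower bound for all \<open>n\<close>; a smaller \<open>x\<close> only increases each
  factor.\<close>

lemma prod_one_minus_powers:
  fixes x :: real
  assumes "0 \<le> x" "x \<le> 1 / 2"
  shows "(\<Prod>j<n. 1 - x ^ Suc j) \<ge> 1 / 4"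
proof -
  \<comment> \<open>The bare bound \<open>1/4\<close> is not inductive, because the next factor is
    below 1. The surplus \<open>(1/2)^(n+1)\<close> pays for it, and at \<open>n = 1\<close> there
    is equality.\<close>
  have half: "(\<Prod>j<n. 1 - (1 / 2 :: real) ^ Suc j) \<ge> 1 / 4 + (1 / 2) ^ Suc n" if "n \<ge> 1"
    using that
  proof (induction n rule: dec_induct)
    case (step n)
    define e :: real where "e = (1 / 2) ^ Suc n"
    have e: "0 < e" "e \<le> 1 / 4"
      using step(1) power_decreasing[of 2 "Suc n" "1 / 2 :: real"] by (auto simp: e_def power2_eq_square)
    have "(1 / 4 + e) * (1 - e) \<le> (\<Prod>j<n. 1 - (1 / 2 :: real) ^ Suc j) * (1 - e)"
      using step e by (intro mult_right_mono) (auto simp: e_def)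
    moreover have "(1 / 4 + e) * (1 - e) = 1 / 4 + e * (3 / 4 - e)" by (simp add: field_simps)
    moreover have "e * (3 / 4 - e) \<ge> e * (1 / 2)" using e by (intro mult_left_mono) auto
    moreover have "(1 / 2 :: real) ^ Suc (Suc n) = e * (1 / 2)" by (simp add: e_def)
    moreover have "(\<Prod>j<Suc n. 1 - (1 / 2 :: real) ^ Suc j) = (\<Prod>j<n. 1 - (1 / 2) ^ Suc j) * (1 - e)"
      by (simp add: e_def)
    ultimately show ?case by linarith
  qed (simp add: power2_eq_square)
  have "(\<Prod>j<n. 1 - x ^ Suc j) \<ge> (\<Prod>j<n. 1 - (1 / 2) ^ Suc j)"
  proof (rule prod_mono)
    fix j
    have "x ^ Suc j \<le> (1 / 2) ^ Suc j" using assms by (intro power_mono) auto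
    moreover have "(1 / 2 :: real) ^ Suc j \<le> 1" by (rule power_le_one) auto
    ultimately show "0 \<le> 1 - (1 / 2 :: real) ^ Suc j \<and> 1 - (1 / 2) ^ Suc j \<le> 1 - x ^ Suc j" by auto
  qed
  moreover have "(\<Prod>j<n. 1 - (1 / 2 :: real) ^ Suc j) \<ge> 1 / 4"
  proof (cases "n \<ge> 1")
    case True
    moreover have "(1 / 2 :: real) ^ Suc n \<ge> 0" by simp
    ultimately show ?thesis using half by linarith
  qed (simp add: not_le)
  ultimately show ?thesis by linarith
qed

lemma prod_card_GL_bound:
  fixes q :: nat
  assumes q: "q \<ge> 2"
  shows "4 * (\<Prod>i<n. q ^ n - q ^ i) \<ge> q ^ n\<^sup>2"
proof -
  have "real (q ^ n - q ^ i) = real q ^ n * (1 - (1 / real q) ^ (n - i))" if "i < n" for i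
  proof -
    have "q ^ i \<le> q ^ n" using that q by (intro power_increasing) auto
    moreover have "real q ^ n = real q ^ i * real q ^ (n - i)" using that by (simp flip: power_add)
    ultimately show ?thesis using q by (simp add: of_nat_diff algebra_simps power_one_over)
  qed
  then have "real (\<Prod>i<n. q ^ n - q ^ i) = (\<Prod>i<n. real q ^ n * (1 - (1 / real q) ^ (n - i)))"
    unfolding of_nat_prod by (intro prod.cong) auto
  also have "\<dots> = real q ^ n\<^sup>2 * (\<Prod>i<n. 1 - (1 / real q) ^ (n - i))"
    by (simp add: prod.distrib power_mult[symmetric] power2_eq_square)
  also have "(\<Prod>i<n. 1 - (1 / real q) ^ (n - i)) = (\<Prod>j<n. 1 - (1 / real q) ^ Suc j)"
    by (rule prod.reindex_bij_witness[of _ "\<lambda>j. n - Suc j" "\<lambda>i. n - Suc i"])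
      (auto simp: Suc_diff_Suc simp del: power_Suc)
  finally have e: "real (\<Prod>i<n. q ^ n - q ^ i) = real q ^ n\<^sup>2 * (\<Prod>j<n. 1 - (1 / real q) ^ Suc j)" .
  have "(\<Prod>j<n. 1 - (1 / real q) ^ Suc j) \<ge> 1 / 4"
    by (rule prod_one_minus_powers) (use q in \<open>auto simp: field_simps\<close>)
  then have "real q ^ n\<^sup>2 * (1 / 4) \<le> real (\<Prod>i<n. q ^ n - q ^ i)"
    unfolding e by (intro mult_left_mono) auto
  then have "real (q ^ n\<^sup>2) \<le> real (4 * (\<Prod>i<n. q ^ n - q ^ i))" by simp
  then show ?thesis by (simp only: of_nat_le_iff)
qed

context finite_field
begin

lemma finite_kmat: "finite (kmat r c)"
  by (simp add: kmat_mats finite_mats finite_carrier)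

lemma card_kmat: "card (kmat r c) = card (carrier R) ^ (r * c)"
  by (simp add: kmat_mats card_mats)

lemma subfield_finite: "subfield F R \<Longrightarrow> finite F"
  using subfieldE(3) finite_carrier finite_subset by blast

lemma subfield_card_ge_2: "subfield F R \<Longrightarrow> card F \<ge> 2"
proof -
  assume F: "subfield F R"
  have "{\<zero>, \<one>} \<subseteq> F" using subringE[OF subfieldE(1)[OF F]] by auto
  from card_mono[OF subfield_finite[OF F] this] show ?thesis by (simp add: one_not_zero[symmetric])
qed

lemma subfield_finsum_closed:
  assumes F: "subfield F R" and f: "f \<in> A \<rightarrow> F"
  shows "finsum R f A \<in> F"
proof (cases "finite A")
  case True
  have "B \<subseteq> A \<Longrightarrow> finsum R f B \<in> F" if "finite B" for B
    using that
  proof (induction B rule: finite_induct)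
    case (insert b B)
    then have "f \<in> B \<rightarrow> carrier R" "f b \<in> carrier R" using f subfieldE(3)[OF F] by auto
    then show ?case using insert f subringE(7)[OF subfieldE(1)[OF F]] by auto
  qed (use subringE(2)[OF subfieldE(1)[OF F]] in auto)
  then show ?thesis using True by blast
qed (use subringE(2)[OF subfieldE(1)[OF F]] in \<open>simp add: finsum_infinite\<close>)

lemma mats_kmat: "subfield F R \<Longrightarrow> M \<in> mats F r c \<Longrightarrow> M \<in> kmat r c"
  using mats_mono[OF subfieldE(3), of F R r c] by (auto simp: kmat_mats)

lemma mats_closed [simp]:
  assumes F: "subfield F R"
  shows "A \<in> mats F r k \<Longrightarrow> B \<in> mats F k c \<Longrightarrow> A \<odot>\<odot> B \<in> mats F r c"
    and "A \<in> mats F r c \<Longrightarrow> B \<in> mats F r c \<Longrightarrow> A \<oplus>\<oplus> B \<in> mats F r c"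
    and "A \<in> mats F r c \<Longrightarrow> mneg A \<in> mats F r c"
    and "a \<in> F \<Longrightarrow> A \<in> mats F r c \<Longrightarrow> mscale a A \<in> mats F r c"
    and "mzero r c \<in> mats F r c" and "mone r \<in> mats F r r"
proof -
  note E = subringE[OF subfieldE(1)[OF F]]
  show "A \<in> mats F r k \<Longrightarrow> B \<in> mats F k c \<Longrightarrow> A \<odot>\<odot> B \<in> mats F r c"
    using E(6) by (auto simp: mats_def mmul_def intro!: subfield_finsum_closed[OF F])
qed (use subringE[OF subfieldE(1)[OF F]] in \<open>auto simp: mats_def madd_def mneg_def mscale_def mzero_def mone_def\<close>)

text \<open>Linear independence of the columns as triviality of the kernel. The field of
  coefficients is a parameter because both subfields and all of \<open>K\<close> are needed.\<close>

definition indep :: "'a set \<Rightarrow> nat \<Rightarrow> nat \<Rightarrow> 'a mat \<Rightarrow> bool" where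
  "indep F n d b \<longleftrightarrow> b \<in> mats F n d \<and>
     (\<forall>u\<in>mats F d 1. b \<odot>\<odot> u = mzero n 1 \<longrightarrow> u = mzero d 1)"

definition col_span :: "'a set \<Rightarrow> nat \<Rightarrow> 'a mat \<Rightarrow> 'a mat set" where
  "col_span F d b = (\<lambda>u. b \<odot>\<odot> u) ` mats F d 1"

lemma indepD: "indep F n d b \<Longrightarrow> b \<in> mats F n d"
  by (simp add: indep_def)

lemma madd_neg_zeroD:
  assumes "A \<in> kmat r c" "B \<in> kmat r c" "A \<oplus>\<oplus> mneg B = mzero r c"
  shows "A = B"
proof -
  have "A = A \<oplus>\<oplus> (mneg B \<oplus>\<oplus> B)" using assms(1,2) by simp
  also have "\<dots> = A \<oplus>\<oplus> mneg B \<oplus>\<oplus> B" using assms(1,2) by (simp add: madd_assoc[of _ r c])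
  finally show ?thesis using assms by simp
qed

context
  fixes F assumes F: "subfield F R"
begin

lemma indep_cancel:
  assumes b: "indep F n d b" and u: "u \<in> mats F d k" "w \<in> mats F d k" and eq: "b \<odot>\<odot> u = b \<odot>\<odot> w"
  shows "u = w"
proof (rule mats_eqI_mcol[OF u])
  fix j assume j: "j < k"
  have b': "b \<in> kmat n d" using mats_kmat[OF F indepD[OF b]] .
  have u': "mcol u j \<in> mats F d 1" "mcol w j \<in> mats F d 1" using u j by auto
  then have u'': "mcol u j \<in> kmat d 1" "mcol w j \<in> kmat d 1" using mats_kmat[OF F] by blast+
  have "b \<odot>\<odot> mcol u j = b \<odot>\<odot> mcol w j"
    using mcol_mmul[OF b' mats_kmat[OF F u(1)] j] mcol_mmul[OF b' mats_kmat[OF F u(2)] j] eq by simp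
  then have "b \<odot>\<odot> (mcol u j \<oplus>\<oplus> mneg (mcol w j)) = mzero n 1"
    using b' u'' by (simp add: mmul_distrib_left[of _ n d _ 1] mmul_neg[of _ n d _ 1])
  then have "mcol u j \<oplus>\<oplus> mneg (mcol w j) = mzero d 1"
    using b u' F by (auto simp: indep_def)
  then show "mcol u j = mcol w j" by (rule madd_neg_zeroD[OF u''])
qed

lemma finite_col_span: "finite (col_span F d b)"
  by (simp add: col_span_def finite_mats subfield_finite[OF F])

lemma col_span_subset: "b \<in> mats F n d \<Longrightarrow> col_span F d b \<subseteq> mats F n 1"
  using F by (auto simp: col_span_def)

lemma card_col_span: "indep F n d b \<Longrightarrow> card (col_span F d b) = card F ^ d"
proof -
  assume b: "indep F n d b"
  have "inj_on (\<lambda>u. b \<odot>\<odot> u) (mats F d 1)"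
    by (rule inj_onI) (rule indep_cancel[OF b])
  then show ?thesis by (simp add: col_span_def card_image card_mats)
qed

text \<open>Dimensions are compared by cardinality: \<open>card F ^ d\<close> combinations lie among
  \<open>card F ^ n\<close> vectors.\<close>

lemma indep_le: "indep F n d b \<Longrightarrow> d \<le> n"
proof -
  assume b: "indep F n d b"
  have "card F ^ d \<le> card F ^ n"
    using card_mono[OF finite_mats[OF subfield_finite[OF F]] col_span_subset[OF indepD[OF b]]]
    by (simp add: card_col_span[OF b] card_mats)
  then show ?thesis using subfield_card_ge_2[OF F] by (simp add: power_le_imp_le_exp)
qed

lemma col_span_full: "indep F n n b \<Longrightarrow> col_span F n b = mats F n 1"
  by (rule card_subset_eq)
    (simp_all add: finite_mats subfield_finite[OF F] col_span_subset indepD card_col_span card_mats)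

lemma indep_solve:
  assumes b: "indep F n n b" and M: "M \<in> mats F n k"
  obtains X where "X \<in> mats F n k" "b \<odot>\<odot> X = M"
proof -
  have "\<exists>u\<in>mats F n 1. b \<odot>\<odot> u = mcol M j" if "j < k" for j
  proof -
    have "mcol M j \<in> col_span F n b" using col_span_full[OF b] M that by auto
    then show ?thesis by (auto simp: col_span_def)
  qed
  then obtain u where u: "\<And>j. j < k \<Longrightarrow> u j \<in> mats F n 1" "\<And>j. j < k \<Longrightarrow> b \<odot>\<odot> u j = mcol M j"
    by metis
  show ?thesis
  proof (rule that)
    show X: "mjoin n k u \<in> mats F n k" using u(1) by simp
    have b': "b \<in> kmat n n" using mats_kmat[OF F indepD[OF b]] .
    show "b \<odot>\<odot> mjoin n k u = M"
    proof (rule mats_eqI_mcol[of _ F n k])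
      fix j assume j: "j < k"
      show "mcol (b \<odot>\<odot> mjoin n k u) j = mcol M j"
        using mcol_mmul[OF b' mats_kmat[OF F X] j] u j mcol_mjoin[of j k u F n] by simp
    qed (use F X M indepD[OF b] in auto)
  qed
qed

lemma indep_inverse:
  assumes b: "indep F n n b"
  obtains T where "T \<in> mats F n n" "b \<odot>\<odot> T = mone n" "T \<odot>\<odot> b = mone n"
proof -
  obtain T where T: "T \<in> mats F n n" "b \<odot>\<odot> T = mone n"
    using indep_solve[OF b, of "mone n" n] F by auto
  have k: "b \<in> kmat n n" "T \<in> kmat n n" using mats_kmat[OF F] indepD[OF b] T by auto
  have "b \<odot>\<odot> (T \<odot>\<odot> b) = b \<odot>\<odot> mone n"
    using k T by (simp add: mmul_assoc[of _ n n _ n _ n, symmetric])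
  then have "T \<odot>\<odot> b = mone n"
    by (rule indep_cancel[OF b, of _ n, rotated -1]) (use F T indepD[OF b] in auto)
  then show ?thesis using T that by blast
qed

text \<open>\<open>T\<close> may have entries outside \<open>F\<close>: a left inverse over the
  large field already forces the kernel over \<open>F\<close> to be zero.\<close>

lemma indepI_inverse:
  assumes b: "b \<in> mats F n d" and T: "T \<in> kmat d n" "T \<odot>\<odot> b = mone d"
  shows "indep F n d b"
  unfolding indep_def
proof (intro conjI ballI impI b)
  fix u assume u: "u \<in> mats F d 1" "b \<odot>\<odot> u = mzero n 1"
  have k: "b \<in> kmat n d" "u \<in> kmat d 1" using mats_kmat[OF F] b u by auto
  have "T \<odot>\<odot> (b \<odot>\<odot> u) = T \<odot>\<odot> b \<odot>\<odot> u" by (rule mmul_assoc[OF T(1) k, symmetric])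
  then have "u = T \<odot>\<odot> (b \<odot>\<odot> u)" using T k by simp
  also have "\<dots> = mzero d 1" using T u(2) by simp
  finally show "u = mzero d 1" .
qed

lemma indep_extend:
  assumes b: "indep F n d b" and v: "v \<in> mats F n 1" "v \<notin> col_span F d b"
  shows "indep F n (Suc d) (hcat b v)"
  unfolding indep_def
proof (intro conjI ballI impI)
  note b' = indepD[OF b]
  show "hcat b v \<in> mats F n (Suc d)" using hcat_mats[OF b' v(1)] by (simp only: Suc_eq_plus1)
  fix u assume u: "u \<in> mats F (Suc d) 1" "hcat b v \<odot>\<odot> u = mzero n 1"
  obtain w c where w: "w \<in> mats F d 1" and c: "c \<in> mats F 1 1" and uw: "u = vcat w c"
    using vcat_cases[of u F d 1 1] u(1) by (auto simp only: Suc_eq_plus1)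
  note k = mats_kmat[OF F b'] mats_kmat[OF F v(1)] mats_kmat[OF F w] mats_kmat[OF F c]
  define a where "a = c $$ (0, 0)"
  have a: "a \<in> F" using c by (auto simp: mats_def a_def)
  then have aR: "a \<in> carrier R" using subfieldE(3)[OF F] by auto
  have c': "c = mscale a (mone 1)"
    by (rule eq_matI) (use c aR in \<open>auto simp: mats_def a_def mscale_def mone_def\<close>)
  have vc: "v \<odot>\<odot> c = mscale a v" using k(2) aR by (simp add: c' mmul_scale[of _ _ n 1 _ 1])
  have sum: "b \<odot>\<odot> w \<oplus>\<oplus> mscale a v = mzero n 1"
    using u(2) mmul_hcat_vcat[OF k] by (simp add: uw vc)
  have "a = \<zero>"
  proof (rule ccontr)
    assume "a \<noteq> \<zero>"
    then have i: "inv a \<in> F" "inv a \<otimes> a = \<one>" using subfield_m_inv[OF F, of a] a by auto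
    then have iR: "inv a \<in> carrier R" using subfieldE(3)[OF F] by auto
    have "mscale a v = mneg (b \<odot>\<odot> w)"
    proof (rule madd_neg_zeroD[of _ n 1])
      have "mneg (mneg (b \<odot>\<odot> w)) = b \<odot>\<odot> w"
        using mmul_closed[OF k(1,3)] by (intro eq_matI) (auto simp: mneg_def kmat_dim kmat_entry)
      then show "mscale a v \<oplus>\<oplus> mneg (mneg (b \<odot>\<odot> w)) = mzero n 1"
        using sum k aR by (simp add: madd_comm[of "b \<odot>\<odot> w" n 1])
    qed (use k aR in auto)
    then have "mscale (inv a) (mscale a v) = mscale (inv a) (b \<odot>\<odot> mneg w)"
      using k by (simp add: mmul_neg[of _ n d _ 1])
    moreover have "mscale (inv a) (mscale a v) = v"
      using k(2) iR aR i(2) by (intro eq_matI) (auto simp: mscale_def kmat_dim m_assoc[symmetric] kmat_entry)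
    moreover have "mscale (inv a) (b \<odot>\<odot> mneg w) = b \<odot>\<odot> mscale (inv a) (mneg w)"
      using k iR by (simp add: mmul_scale[of _ _ n d _ 1])
    ultimately have "v = b \<odot>\<odot> mscale (inv a) (mneg w)" by simp
    moreover have "mscale (inv a) (mneg w) \<in> mats F d 1" using F w i by auto
    ultimately show False using v(2) by (auto simp: col_span_def)
  qed
  then have "mscale a v = mzero n 1"
    using k(2) by (intro eq_matI) (auto simp: mscale_def mzero_def kmat_dim kmat_entry)
  then have "b \<odot>\<odot> w = mzero n 1" using sum mmul_closed[OF k(1,3)] by simp
  then have "w = mzero d 1" using b w by (auto simp: indep_def)
  moreover have "c = mzero 1 1"
    by (rule eq_matI) (use c \<open>a = \<zero>\<close> in \<open>auto simp: mats_def a_def mzero_def\<close>)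
  ultimately show "u = mzero (Suc d) 1"
    unfolding uw by (intro eq_matI) (auto simp: vcat_def mzero_def)
qed

lemma indep_empty: "b \<in> mats F n 0 \<Longrightarrow> indep F n 0 b"
  by (auto simp: indep_def mats_def mzero_def intro!: eq_matI)

text \<open>If all unit vectors were combinations of the \<open>d\<close> columns, the coefficients
  would form a right inverse of \<open>b\<close>. This right inverse would then have
  \<open>n\<close> independent columns of length \<open>d < n\<close>.\<close>

lemma unit_vec_not_in_span:
  assumes b: "indep F n d b" and d: "d < n"
  shows "\<exists>j<n. mcol (mone n) j \<notin> col_span F d b"
proof (rule ccontr)
  assume "\<not> ?thesis"
  then have "\<exists>u\<in>mats F d 1. b \<odot>\<odot> u = mcol (mone n) j" if "j < n" for j
    using that by (force simp: col_span_def)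
  then obtain u where u: "\<And>j. j < n \<Longrightarrow> u j \<in> mats F d 1" "\<And>j. j < n \<Longrightarrow> b \<odot>\<odot> u j = mcol (mone n) j"
    by metis
  have b': "b \<in> kmat n d" using mats_kmat[OF F indepD[OF b]] .
  have X: "mjoin d n u \<in> mats F d n" using u(1) by simp
  then have Xk: "mjoin d n u \<in> kmat d n" using mats_kmat[OF F] by blast
  have "b \<odot>\<odot> mjoin d n u = mone n"
  proof (rule mats_eqI_mcol[of _ F n n])
    fix j assume j: "j < n"
    show "mcol (b \<odot>\<odot> mjoin d n u) j = mcol (mone n) j"
      using mcol_mmul[OF b' Xk j] u j mcol_mjoin[of j n u F d] by simp
  qed (use F X indepD[OF b] in auto)
  then have "indep F d n (mjoin d n u)" by (rule indepI_inverse[OF X b'])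
  then show False using indep_le d by fastforce
qed

text \<open>The complement is assembled from unit vectors, so its entries are 0 and 1 and it lies
  over every subfield. This allows a matrix over a subfield to be evaluated on the complement
  without leaving the subfield, even when independence is tested over \<open>K\<close>.\<close>

lemma indep_complete:
  assumes "indep F n d b"
  obtains c where "c \<in> mats {\<zero>, \<one>} n (n - d)" "indep F n n (hcat b c)"
proof -
  have "\<exists>c. c \<in> mats {\<zero>, \<one>} n (n - d) \<and> indep F n n (hcat b c)" if "indep F n d b" for b d
    using that
  proof (induction "n - d" arbitrary: d b)
    case 0
    then have "d = n" using indep_le[OF 0(2)] by simp
    have "mzero n 0 \<in> mats {\<zero>, \<one>} n 0" by (auto simp: mats_def mzero_def)
    then show ?case using 0 \<open>d = n\<close> hcat_empty[OF indepD[OF 0(2)], of "mzero n 0"]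
      by (intro exI[of _ "mzero n 0"]) (use F in auto)
  next
    case (Suc m)
    then have d: "d < n" by simp
    obtain j where j: "j < n" "mcol (mone n) j \<notin> col_span F d b"
      using unit_vec_not_in_span[OF Suc(3) d] by blast
    define e where "e = mcol (mone n) j"
    have e: "e \<in> mats {\<zero>, \<one>} n 1" by (auto simp: e_def mcol_def mone_def mats_def j)
    have "{\<zero>, \<one>} \<subseteq> F" using subringE[OF subfieldE(1)[OF F]] by auto
    then have eF: "e \<in> mats F n 1" using mats_mono e by blast
    have "indep F n (Suc d) (hcat b e)"
      using indep_extend[OF Suc(3) eF] j by (simp add: e_def)
    then obtain c where c: "c \<in> mats {\<zero>, \<one>} n (n - Suc d)" "indep F n n (hcat (hcat b e) c)"
      using Suc(1)[of "Suc d" "hcat b e"] Suc(2) Suc_diff_Suc[OF d] by force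
    have "hcat (hcat b e) c = hcat b (hcat e c)"
      by (rule hcat_assoc) (use e indepD[OF Suc(3)] in \<open>auto simp: mats_def\<close>)
    moreover have "hcat e c \<in> mats {\<zero>, \<one>} n (n - d)"
      using hcat_mats[OF e c(1)] d by simp
    ultimately show ?case using c by metis
  qed
  then show ?thesis using assms that by blast
qed

lemma card_indep_ge:
  "card {b. indep F n d b} \<ge> (\<Prod>i<d. card F ^ n - card F ^ i)"
proof (induction d)
  case 0
  have "mzero n 0 \<in> {b. indep F n 0 b}" using indep_empty F by auto
  moreover have fin: "finite {b. indep F n 0 b}"
    by (rule finite_subset[OF _ finite_mats[OF subfield_finite[OF F], of n 0]]) (auto simp: indep_def)
  ultimately have "card {b. indep F n 0 b} > 0" by (auto simp: card_gt_0_iff)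
  then show ?case by simp
next
  case (Suc d)
  have fin: "finite {b. indep F n d b}" for d
    by (rule finite_subset[OF _ finite_mats[OF subfield_finite[OF F], of n d]]) (auto simp: indep_def)
  define S where "S = (SIGMA b:{b. indep F n d b}. mats F n 1 - col_span F d b)"
  have "card S = (\<Sum>b | indep F n d b. card (mats F n 1 - col_span F d b))"
    unfolding S_def by (rule card_SigmaI) (use fin finite_mats[OF subfield_finite[OF F]] in auto)
  also have "\<dots> = (\<Sum>b | indep F n d b. card F ^ n - card F ^ d)"
    by (intro sum.cong refl)
      (simp add: card_Diff_subset[OF finite_col_span col_span_subset] indepD card_col_span card_mats)
  finally have "card S = card {b. indep F n d b} * (card F ^ n - card F ^ d)" by simp
  moreover have "card S \<le> card {b. indep F n (Suc d) b}"
  proof (rule card_inj_on_le[where f = "\<lambda>(b, v). hcat b v"])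
    show "inj_on (\<lambda>(b, v). hcat b v) S"
      by (rule inj_onI) (auto simp: S_def dest!: indepD dest: hcat_inj)
    show "(\<lambda>(b, v). hcat b v) ` S \<subseteq> {b. indep F n (Suc d) b}"
      using indep_extend by (auto simp: S_def)
  qed (rule fin)
  ultimately show ?case using Suc by (simp add: order_trans[OF mult_right_mono])
qed

lemma card_GL_ge: "4 * card {b. indep F n n b} \<ge> card F ^ n\<^sup>2"
proof -
  have "card F ^ n\<^sup>2 \<le> 4 * (\<Prod>i<n. card F ^ n - card F ^ i)"
    by (rule prod_card_GL_bound[OF subfield_card_ge_2[OF F]])
  then show ?thesis using card_indep_ge[of n n] by linarith
qed

end

end

section \<open>Matrices with a given characteristic polynomial\<close>

context finite_field
begin

abbreviation K where "K \<equiv> carrier R"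

lemmas KF = carrier_is_subfield

lemma kmat_matsK: "kmat r c = mats K r c"
  by (simp add: kmat_mats)

definition char_class :: "nat \<Rightarrow> (nat \<Rightarrow> 'a) \<Rightarrow> 'a mat set" where
  "char_class n f = {x \<in> kmat n n. cp n x = f}"

lemma finite_char_class: "finite (char_class n f)"
  by (rule finite_subset[OF _ finite_kmat[of n n]]) (auto simp: char_class_def)

lemma char_class_kmat: "x \<in> char_class n f \<Longrightarrow> x \<in> kmat n n"
  by (simp add: char_class_def)

lemma mmul_mcol_mone:
  assumes "b \<in> kmat n d" "j < d"
  shows "b \<odot>\<odot> mcol (mone d) j = mcol b j"
  using mcol_mmul[OF assms(1) mone_closed assms(2)] assms by simp

lemma mpow_comm:
  assumes x: "x \<in> kmat n n"
  shows "x \<odot>\<odot> mpow n x k = mpow n x k \<odot>\<odot> x"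
proof (induction k)
  case (Suc k)
  have "x \<odot>\<odot> mpow n x (Suc k) = x \<odot>\<odot> mpow n x k \<odot>\<odot> x"
    using x by (simp add: mmul_assoc[OF x mpow_closed[OF x] x])
  then show ?case using Suc by simp
qed (use x in simp)

text \<open>The Krylov matrix of \<open>x\<close> and \<open>v\<close>. Multiplied by a column
  \<open>c\<close> it gives \<open>p(x) v\<close> for the polynomial \<open>p\<close> with
  coefficients \<open>c\<close>; elements of \<open>K[x]\<close> are represented in this way
  later.\<close>

definition kry :: "nat \<Rightarrow> 'a mat \<Rightarrow> 'a mat \<Rightarrow> nat \<Rightarrow> 'a mat" where
  "kry n x v d = mjoin n d (\<lambda>j. mpow n x j \<odot>\<odot> v)"

context
  fixes n x v
  assumes x: "x \<in> kmat n n" and v: "v \<in> kmat n 1"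
begin

lemma mpow_vec: "mpow n x j \<odot>\<odot> v \<in> kmat n 1"
  using mmul_closed[OF mpow_closed[OF x] v] .

lemma kry_closed: "kry n x v d \<in> kmat n d"
  using mpow_vec by (auto simp: kry_def kmat_matsK)

lemma mcol_kry: "j < d \<Longrightarrow> mcol (kry n x v d) j = mpow n x j \<odot>\<odot> v"
  unfolding kry_def by (rule mcol_mjoin[of _ _ _ K]) (use mpow_vec in \<open>auto simp: kmat_matsK\<close>)

lemma kry_Suc: "kry n x v (Suc d) = hcat (kry n x v d) (mpow n x d \<odot>\<odot> v)"
proof (rule eq_matI, goal_cases)
  case (1 i j)
  then have "i < n" "j < Suc d" by (auto simp: hcat_def kry_def mjoin_def kmat_dim[OF mpow_vec])
  then show ?case
    by (cases "j = d") (auto simp: kry_def mjoin_def hcat_def kmat_dim[OF mpow_vec])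
qed (auto simp: kry_def mjoin_def hcat_def kmat_dim[OF mpow_vec])

lemma mpow_Suc_vec: "x \<odot>\<odot> (mpow n x j \<odot>\<odot> v) = mpow n x (Suc j) \<odot>\<odot> v"
  by (simp add: mmul_assoc[OF x mpow_closed[OF x] v, symmetric] mpow_comm[OF x])

text \<open>On Krylov columns \<open>x\<close> is a shift. Only the last column needs the relation
  for \<open>x^d v\<close>, which becomes the last column of the companion matrix.\<close>

lemma mmul_kry:
  assumes a: "a \<in> kmat d 1" and eq: "mpow n x d \<odot>\<odot> v = kry n x v d \<odot>\<odot> a"
  shows "x \<odot>\<odot> kry n x v d = kry n x v d \<odot>\<odot> companion d \<zero> \<one> (\<lambda>i. a $$ (i, 0))"
proof (rule mats_eqI_mcol[of _ K n d])
  let ?C = "companion d \<zero> \<one> (\<lambda>i. a $$ (i, 0))"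
  have C: "?C \<in> kmat d d" using a by (auto simp: kmat_def companion_def)
  show "x \<odot>\<odot> kry n x v d \<in> mats K n d" "kry n x v d \<odot>\<odot> ?C \<in> mats K n d"
    using mmul_closed[OF x kry_closed] mmul_closed[OF kry_closed C] by (simp_all add: kmat_matsK)
  fix j assume j: "j < d"
  have "mcol (x \<odot>\<odot> kry n x v d) j = mpow n x (Suc j) \<odot>\<odot> v"
    using mcol_mmul[OF x kry_closed j] mcol_kry[OF j] mpow_Suc_vec by simp
  moreover have "mcol (kry n x v d \<odot>\<odot> ?C) j = kry n x v d \<odot>\<odot> mcol ?C j"
    by (rule mcol_mmul[OF kry_closed C j])
  moreover have "kry n x v d \<odot>\<odot> mcol ?C j = mpow n x (Suc j) \<odot>\<odot> v"
  proof (cases "Suc j = d")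
    case True
    have "mcol ?C j = a"
      by (rule eq_matI) (use a True in \<open>auto simp: mcol_def companion_def kmat_dim\<close>)
    then show ?thesis using eq True by simp
  next
    case False
    then have j': "Suc j < d" using j by simp
    have "mcol ?C j = mcol (mone d) (Suc j)"
      by (rule eq_matI) (use j' in \<open>auto simp: mcol_def companion_def mone_def\<close>)
    then show ?thesis using mmul_mcol_mone[OF kry_closed j'] mcol_kry[OF j'] by simp
  qed
  ultimately show "mcol (x \<odot>\<odot> kry n x v d) j = mcol (kry n x v d \<odot>\<odot> ?C) j" by simp
qed

text \<open>Independence holds at length 0 and fails at length \<open>n + 1\<close>, so it breaks at
  some step; that \<open>v\<close> is nonzero excludes a break at the very first one.\<close>

lemma kry_stabilises:
  assumes nz: "v \<noteq> mzero n 1"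
  obtains d a where "d \<ge> 1" "indep K n d (kry n x v d)" "a \<in> kmat d 1"
    "mpow n x d \<odot>\<odot> v = kry n x v d \<odot>\<odot> a"
proof -
  let ?P = "\<lambda>d. indep K n d (kry n x v d)"
  have "?P 0" using indep_empty[OF KF] kry_closed[of 0] by (simp add: kmat_matsK)
  have "\<not> ?P (Suc n)" using indep_le[OF KF] by fastforce
  have "\<exists>d. ?P d \<and> \<not> ?P (Suc d)"
  proof (rule ccontr)
    assume "\<not> ?thesis"
    then have "?P d" for d by (induction d) (use \<open>?P 0\<close> in auto)
    then show False using \<open>\<not> ?P (Suc n)\<close> by blast
  qed
  then obtain d where d: "?P d" "\<not> ?P (Suc d)" by blast
  have "mpow n x d \<odot>\<odot> v \<in> col_span K d (kry n x v d)"
    using indep_extend[OF KF d(1), of "mpow n x d \<odot>\<odot> v"] d(2) mpow_vec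
    by (auto simp: kry_Suc kmat_matsK)
  then obtain a where a: "a \<in> kmat d 1" "mpow n x d \<odot>\<odot> v = kry n x v d \<odot>\<odot> a"
    by (auto simp: col_span_def kmat_matsK)
  have "d \<noteq> 0"
  proof
    assume "d = 0"
    then have "v = kry n x v 0 \<odot>\<odot> a" using a v by simp
    also have "\<dots> = mzero n 1"
      using a \<open>d = 0\<close> by (intro eq_matI) (auto simp: mmul_def kry_def mjoin_def mzero_def kmat_dim)
    finally show False using nz by simp
  qed
  then show ?thesis using that[of d a] d(1) a by simp
qed

end

text \<open>Change of basis adapted to an invariant subspace spanned by the columns of
  \<open>b\<close>. It serves the upper bound for a class as well as the passage from common
  invariant subspaces to block triangular pairs.\<close>

lemma block_form:
  assumes d: "d \<le> n" and b: "b \<in> kmat n d" and c: "c \<in> kmat n (n - d)"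
    and S: "indep K n n (hcat b c)" and x: "x \<in> kmat n n"
    and P: "P \<in> kmat d d" and N: "N \<in> kmat d (n - d)" and D: "D \<in> kmat (n - d) (n - d)"
    and xb: "x \<odot>\<odot> b = b \<odot>\<odot> P" and xc: "x \<odot>\<odot> c = hcat b c \<odot>\<odot> vcat N D"
  shows "x \<odot>\<odot> hcat b c = hcat b c \<odot>\<odot> four_block_mat P N (mzero (n - d) d) D"
    and "cp n x = cp d P \<otimes>\<^bsub>UP R\<^esub> cp (n - d) D"
proof -
  let ?M = "four_block_mat P N (mzero (n - d) d) D"
  have Sk: "hcat b c \<in> kmat n n" using indepD[OF S] by (simp add: kmat_matsK)
  have M: "?M = hcat (vcat P (mzero (n - d) d)) (vcat N D)"
    using P N D by (intro four_block_hcat[of _ K]) (auto simp: kmat_matsK[symmetric])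
  have Mk: "?M \<in> kmat n n"
    using P N D d by (intro kmatI) (auto simp: kmat_dim mzero_def kmat_entry)
  have z: "mzero (n - d) d \<in> kmat (n - d) d" by simp
  have v1: "vcat P (mzero (n - d) d) \<in> kmat n d" "vcat N D \<in> kmat n (n - d)"
    using vcat_mats[of P K d d "mzero (n - d) d" "n - d"] vcat_mats[of N K d "n - d" D "n - d"] P N D z d
    by (simp_all add: kmat_matsK)
  have "hcat b c \<odot>\<odot> vcat P (mzero (n - d) d) = b \<odot>\<odot> P \<oplus>\<oplus> c \<odot>\<odot> mzero (n - d) d"
    by (rule mmul_hcat_vcat[OF b c P z])
  also have "\<dots> = b \<odot>\<odot> P" using c mmul_closed[OF b P] by simp
  finally show eq: "x \<odot>\<odot> hcat b c = hcat b c \<odot>\<odot> ?M"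
    unfolding M using mmul_hcat[OF Sk v1] mmul_hcat[OF x b c] xb xc by simp
  obtain T where T: "T \<in> kmat n n" "hcat b c \<odot>\<odot> T = mone n"
    using indep_inverse[OF KF S] by (auto simp: kmat_matsK)
  have "cp n x = cp n ?M" by (rule cp_similar[OF Sk T(1) x Mk T(2) eq])
  also have "\<dots> = cp d P \<otimes>\<^bsub>UP R\<^esub> cp (n - d) D" using cp_block[OF P N D] d by simp
  finally show "cp n x = cp d P \<otimes>\<^bsub>UP R\<^esub> cp (n - d) D" .
qed

lemma cp_nonzero: "x \<in> kmat n n \<Longrightarrow> cp n x \<noteq> \<zero>\<^bsub>UP R\<^esub>"
  using cp_monic(1)[of x n] by (auto simp: UP_def)

lemma cp_cancel:
  assumes "P \<in> kmat d d" "P' \<in> kmat d d" "D \<in> kmat e e"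
    "cp d P \<otimes>\<^bsub>UP R\<^esub> cp e D = cp d P' \<otimes>\<^bsub>UP R\<^esub> cp e D"
  shows "cp d P = cp d P'"
proof -
  interpret UP: UP_domain R "UP R" by unfold_locales
  show ?thesis
    using UP.m_rcancel[OF cp_nonzero[OF assms(3)] cp_closed[OF assms(3)] cp_closed[OF assms(1)] cp_closed[OF assms(2)]]
      assms(4) by simp
qed

definition complete :: "nat \<Rightarrow> nat \<Rightarrow> 'a mat \<Rightarrow> 'a mat" where
  "complete n d b = (SOME c. c \<in> mats {\<zero>, \<one>} n (n - d) \<and> indep K n n (hcat b c))"

lemma complete:
  assumes "indep K n d b"
  shows "complete n d b \<in> mats {\<zero>, \<one>} n (n - d)" "indep K n n (hcat b (complete n d b))"
    "complete n d b \<in> kmat n (n - d)"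
proof -
  have "\<exists>c. c \<in> mats {\<zero>, \<one>} n (n - d) \<and> indep K n n (hcat b c)"
    using indep_complete[OF KF assms] by blast
  then have *: "complete n d b \<in> mats {\<zero>, \<one>} n (n - d) \<and> indep K n n (hcat b (complete n d b))"
    unfolding complete_def by (rule someI_ex)
  then show "complete n d b \<in> mats {\<zero>, \<one>} n (n - d)" "indep K n n (hcat b (complete n d b))" by auto
  show "complete n d b \<in> kmat n (n - d)"
    using * mats_mono[of "{\<zero>, \<one>}" K] by (auto simp: kmat_matsK)
qed

lemma four_block_kmat:
  "P \<in> kmat d d \<Longrightarrow> N \<in> kmat d e \<Longrightarrow> D \<in> kmat e e \<Longrightarrow> four_block_mat P N (mzero e d) D \<in> kmat (d + e) (d + e)"
  by (intro kmatI) (auto simp: kmat_dim mzero_def kmat_entry)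

text \<open>
  A matrix \<open>x\<close> with given characteristic polynomial is determined by \<open>d\<close>, the vectors \<open>x\<^sup>i e\<close> for
  \<open>i < d\<close>, where \<open>x\<^sup>d e\<close> is the first one dependent on its predecessors, and its values on a
  complement: in a basis adapted to these data only one companion block is still unknown, and
  the characteristic polynomial determines it by cancellation.
\<close>

lemma card_char_class_mats_le:
  assumes F: "subfield F R" and n: "n > 0"
  shows "card (char_class n f \<inter> mats F n n) \<le> n * card F ^ (n\<^sup>2 - n)"
proof -
  define e where "e = mcol (mone n) 0"
  have eF: "e \<in> mats F n 1" unfolding e_def by (rule mcol_mats) (use F n in auto)
  have e: "e \<in> kmat n 1" using mats_kmat[OF F eF] .
  have "e $$ (0, 0) \<noteq> mzero n 1 $$ (0, 0)" using n by (simp add: e_def mcol_def mone_def mzero_def)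
  then have e0: "e \<noteq> mzero n 1" by metis
  have fF: "finite F" by (rule subfield_finite[OF F])
  let ?X = "char_class n f \<inter> mats F n n"
  have xk: "x \<in> kmat n n" if "x \<in> ?X" for x using that by (auto simp: char_class_def)
  have "\<exists>d a. d \<ge> 1 \<and> indep K n d (kry n x e d) \<and> a \<in> kmat d 1 \<and>
    mpow n x d \<odot>\<odot> e = kry n x e d \<odot>\<odot> a" if "x \<in> ?X" for x
    using kry_stabilises[OF xk[OF that] e e0] by metis
  then obtain d a where da: "\<And>x. x \<in> ?X \<Longrightarrow> d x \<ge> 1 \<and> indep K n (d x) (kry n x e (d x)) \<and> a x \<in> kmat (d x) 1 \<and>
    mpow n x (d x) \<odot>\<odot> e = kry n x e (d x) \<odot>\<odot> a x"
    by metis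
  define c where "c x = complete n (d x) (kry n x e (d x))" for x
  \<comment> \<open>The first Krylov column is the fixed vector \<open>e\<close>, so only
    \<open>d - 1\<close> columns are recorded. Together with the \<open>n - d\<close> columns for
    the complement these are \<open>n - 1\<close> columns of length \<open>n\<close>, whence the
    exponent \<open>n^2 - n\<close>.\<close>
  define \<Phi> where "\<Phi> x = (d x, mjoin n (d x - 1) (\<lambda>j. mpow n x (Suc j) \<odot>\<odot> e), x \<odot>\<odot> c x)" for x
  define Z where "Z = (SIGMA d:{1..n}. mats F n (d - 1) \<times> mats F n (n - d))"
  have kryF: "mpow n x j \<odot>\<odot> e \<in> mats F n 1" if "x \<in> ?X" for x j
  proof -
    have "mpow n x j \<in> mats F n n" by (induction j) (use that F in auto)
    then show ?thesis using F eF by simp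
  qed
  have "{\<zero>, \<one>} \<subseteq> F" using subringE[OF subfieldE(1)[OF F]] by auto
  then have cF: "c x \<in> mats F n (n - d x)" if "x \<in> ?X" for x
    using complete(1)[of n "d x" "kry n x e (d x)"] da[OF that] mats_mono[of "{\<zero>, \<one>}" F n "n - d x"]
    unfolding c_def by auto
  have dn: "d x \<le> n" if "x \<in> ?X" for x using da[OF that] indep_le[OF KF] by blast
  have "\<Phi> ` ?X \<subseteq> Z"
  proof
    fix z assume "z \<in> \<Phi> ` ?X"
    then obtain x where x: "x \<in> ?X" "z = \<Phi> x" by blast
    show "z \<in> Z" using da[OF x(1)] dn[OF x(1)] kryF[OF x(1)] cF[OF x(1)] x F
      by (auto simp: Z_def \<Phi>_def simp del: mpow.simps)
  qed
  moreover have "inj_on \<Phi> ?X"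
  proof (rule inj_onI)
    fix x y assume x: "x \<in> ?X" and y: "y \<in> ?X" and eq: "\<Phi> x = \<Phi> y"
    define D where "D = d x"
    have dy: "d y = D" using eq by (simp add: \<Phi>_def D_def)
    have D1: "D \<ge> 1" using da[OF x] by (simp add: D_def)
    have col: "mpow n x j \<odot>\<odot> e = mpow n y j \<odot>\<odot> e" if j: "j < D" for j
    proof (cases j)
      case 0
      then show ?thesis by simp
    next
      case (Suc i)
      have "mcol (mjoin n (D - 1) (\<lambda>j. mpow n x (Suc j) \<odot>\<odot> e)) i = mcol (mjoin n (D - 1) (\<lambda>j. mpow n y (Suc j) \<odot>\<odot> e)) i"
        using eq dy by (simp add: \<Phi>_def D_def)
      moreover have "mcol (mjoin n (D - 1) (\<lambda>j. mpow n z (Suc j) \<odot>\<odot> e)) i = mpow n z (Suc i) \<odot>\<odot> e" if "z \<in> ?X" for z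
        by (rule mcol_mjoin[of _ _ _ F]) (use kryF[OF that] j Suc in \<open>auto simp del: mpow.simps\<close>)
      ultimately show ?thesis using x y Suc by (simp del: mpow.simps)
    qed
    define b where "b = kry n x e D"
    have kyb: "kry n y e D = b"
      unfolding b_def kry_def mjoin_def using col by (intro cong_mat) auto
    \<comment> \<open>The complement is a function of the Krylov matrix alone, so equal data give
      the same basis for \<open>x\<close> and \<open>y\<close>.\<close>
    have cy: "c y = c x" by (simp add: c_def dy kyb b_def D_def[symmetric])
    have b: "indep K n D b" using da[OF x] by (simp add: b_def D_def)
    have bk: "b \<in> kmat n D" using indepD[OF b] by (simp add: kmat_matsK)
    have Dn: "D \<le> n" using dn[OF x] by (simp add: D_def)
    define C where "C = c x"
    have C: "C \<in> kmat n (n - D)" and S: "indep K n n (hcat b C)"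
      using complete[OF b] by (simp_all add: C_def c_def b_def D_def)
    have Sk: "hcat b C \<in> kmat n n" using indepD[OF S] by (simp add: kmat_matsK)
    have xC: "x \<odot>\<odot> C = y \<odot>\<odot> C" using eq cy by (simp add: \<Phi>_def C_def)
    have "x \<odot>\<odot> C \<in> mats K n (n - D)" using mmul_closed[OF xk[OF x] C] by (simp add: kmat_matsK)
    from indep_solve[OF KF S this] obtain W where W: "W \<in> kmat n (n - D)" "hcat b C \<odot>\<odot> W = x \<odot>\<odot> C"
      by (auto simp: kmat_matsK)
    obtain N G where N: "N \<in> kmat D (n - D)" and G: "G \<in> kmat (n - D) (n - D)" and WN: "W = vcat N G"
      using vcat_cases[of W K D "n - D" "n - D"] W Dn by (auto simp: kmat_matsK)
    let ?P = "\<lambda>z. companion D \<zero> \<one> (\<lambda>i. a z $$ (i, 0))"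
    have Pk: "?P z \<in> kmat D D" if "z \<in> ?X" "d z = D" for z
      using da[OF that(1)] that(2) by (auto simp: kmat_def companion_def)
    have zb: "z \<odot>\<odot> b = b \<odot>\<odot> ?P z" if "z \<in> ?X" "d z = D" "kry n z e D = b" for z
      using mmul_kry[OF xk[OF that(1)] e, of "a z" D] da[OF that(1)] that by simp
    have bx: "kry n x e D = b" and dx: "d x = D" by (simp_all add: b_def D_def)
    have "cp n x = cp D (?P x) \<otimes>\<^bsub>UP R\<^esub> cp (n - D) G"
      by (rule block_form(2)[OF Dn bk C S xk[OF x] Pk[OF x dx] N G zb[OF x dx bx]]) (use W WN in simp)
    moreover have "cp n y = cp D (?P y) \<otimes>\<^bsub>UP R\<^esub> cp (n - D) G"
      by (rule block_form(2)[OF Dn bk C S xk[OF y] Pk[OF y dy] N G zb[OF y dy kyb]]) (use W WN xC in simp)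
    moreover have "cp n x = cp n y" using x y by (simp add: char_class_def)
    ultimately have cpeq: "cp D (?P x) = cp D (?P y)"
      using cp_cancel[OF Pk[OF x dx] Pk[OF y dy] G] by simp
    have "a x $$ (i, 0) = a y $$ (i, 0)" if i: "i < D" for i
    proof -
      have aR: "a z $$ (i, 0) \<in> K" if "z \<in> ?X" "d z = D" "i < D" for z i
        using da[OF that(1)] that by (auto intro: kmat_entry[of _ D 1])
      have "cp D (?P z) i = \<ominus> a z $$ (i, 0)" if "z \<in> ?X" "d z = D" for z
        using cp_companion[of D "\<lambda>i. a z $$ (i, 0)"] aR[OF that] D1 i by simp
      then have "\<ominus> a x $$ (i, 0) = \<ominus> a y $$ (i, 0)" using cpeq x y dx dy by metis
      then show ?thesis using aR[OF x dx i] aR[OF y dy i] by (metis minus_minus)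
    qed
    then have "?P x = ?P y" by (intro eq_matI) (auto simp: companion_def)
    then have "x \<odot>\<odot> b = y \<odot>\<odot> b" using zb[OF x dx bx] zb[OF y dy kyb] by simp
    then have xS: "x \<odot>\<odot> hcat b C = y \<odot>\<odot> hcat b C"
      using mmul_hcat[OF xk[OF x] bk C] mmul_hcat[OF xk[OF y] bk C] xC by simp
    obtain T where T: "T \<in> kmat n n" "hcat b C \<odot>\<odot> T = mone n"
      using indep_inverse[OF KF S] by (auto simp: kmat_matsK)
    have "x = x \<odot>\<odot> hcat b C \<odot>\<odot> T" using xk[OF x] T by (simp add: mmul_assoc[OF xk[OF x] Sk T(1)])
    also have "\<dots> = y" unfolding xS using xk[OF y] T by (simp add: mmul_assoc[OF xk[OF y] Sk T(1)])
    finally show "x = y" .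
  qed
  moreover have "finite Z" unfolding Z_def by (intro finite_SigmaI finite_cartesian_product) (auto simp: finite_mats fF)
  ultimately have "card ?X \<le> card Z" by (metis card_inj_on_le)
  also have "card Z = (\<Sum>d\<in>{1..n}. card F ^ (n * (d - 1)) * card F ^ (n * (n - d)))"
    unfolding Z_def by (subst card_SigmaI) (auto simp: card_cartesian_product card_mats finite_mats fF)
  also have "\<dots> = (\<Sum>d\<in>{1..n}. card F ^ (n\<^sup>2 - n))"
  proof (intro sum.cong refl)
    fix d assume "d \<in> {1..n}"
    then have "n * (d - 1) + n * (n - d) = n\<^sup>2 - n"
      by (simp add: algebra_simps power2_eq_square flip: distrib_left)
    then show "card F ^ (n * (d - 1)) * card F ^ (n * (n - d)) = card F ^ (n\<^sup>2 - n)"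
      by (simp flip: power_add)
  qed
  finally show ?thesis by simp
qed

lemma card_char_class_le: "n > 0 \<Longrightarrow> card (char_class n f) \<le> n * card K ^ (n\<^sup>2 - n)"
  using card_char_class_mats_le[OF KF, of n f] Int_absorb2[of "char_class n f" "mats K n n"]
  by (auto simp: char_class_def kmat_matsK)

text \<open>The first unit vector is cyclic for the companion matrix \<open>C\<close>, so the
  columns of \<open>S\<close> are \<open>x^j (S e)\<close> with \<open>x = S C S^-1\<close>. Thus
  \<open>S\<close> is determined by a conjugate of \<open>C\<close> and one vector, and the order of
  GL, at least \<open>Q^(n^2) / 4\<close>, is at most the size of the class times
  \<open>Q^n\<close>.\<close>

lemma card_char_class_ge:
  assumes n: "n > 0" and f: "\<And>i. f i \<in> K" "f n = \<one>" "\<And>i. i > n \<Longrightarrow> f i = \<zero>"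
  shows "card K ^ n\<^sup>2 \<le> 4 * card (char_class n f) * card K ^ n"
proof -
  define C where "C = companion n \<zero> \<one> (\<lambda>i. \<ominus> f i)"
  have C: "C \<in> kmat n n" using f by (auto simp: kmat_def companion_def C_def)
  have cpC: "cp n C = f"
    unfolding C_def using f by (subst cp_companion[OF n]) (auto simp: fun_eq_iff not_less)
  define e where "e = mcol (mone n) 0"
  have e: "e \<in> kmat n 1" unfolding e_def kmat_matsK
    by (rule mcol_mats) (use mone_closed[of n] n in \<open>auto simp: kmat_matsK\<close>)
  have "\<exists>T. T \<in> kmat n n \<and> S \<odot>\<odot> T = mone n \<and> T \<odot>\<odot> S = mone n" if "indep K n n S" for S
    using indep_inverse[OF KF that] by (auto simp: kmat_matsK)
  then obtain T where T: "\<And>S. indep K n n S \<Longrightarrow> T S \<in> kmat n n \<and> S \<odot>\<odot> T S = mone n \<and> T S \<odot>\<odot> S = mone n"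
    by metis
  let ?G = "{S. indep K n n S}"
  have Sk: "S \<in> kmat n n" if "S \<in> ?G" for S using that indepD by (auto simp: kmat_matsK)
  define \<Phi> where "\<Phi> S = (S \<odot>\<odot> C \<odot>\<odot> T S, S \<odot>\<odot> e)" for S
  have xS: "S \<odot>\<odot> C \<odot>\<odot> T S \<odot>\<odot> S = S \<odot>\<odot> C" if S: "S \<in> ?G" for S
    using mmul_assoc[OF mmul_closed[OF Sk[OF S] C] _ Sk[OF S], of "T S"] T[of S] S mmul_closed[OF Sk[OF S] C]
    by simp
  have xk: "S \<odot>\<odot> C \<odot>\<odot> T S \<in> kmat n n" if S: "S \<in> ?G" for S
    using mmul_closed[OF mmul_closed[OF Sk[OF S] C], of "T S" n] T[of S] S by simp
  have cols: "mcol S j = mpow n (S \<odot>\<odot> C \<odot>\<odot> T S) j \<odot>\<odot> (S \<odot>\<odot> e)" if S: "S \<in> ?G" and j: "j < n" for S j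
    using j
  proof (induction j)
    case 0
    have "S \<odot>\<odot> e \<in> kmat n 1" using Sk[OF S] e by simp
    then show ?case using mmul_mcol_mone[OF Sk[OF S] n] by (simp add: e_def)
  next
    case (Suc j)
    let ?x = "S \<odot>\<odot> C \<odot>\<odot> T S"
    have j: "j < n" using Suc by simp
    have "mcol C j = mcol (mone n) (Suc j)"
      by (rule eq_matI) (use Suc in \<open>auto simp: mcol_def companion_def mone_def C_def\<close>)
    then have "mcol S (Suc j) = S \<odot>\<odot> mcol C j"
      using mmul_mcol_mone[OF Sk[OF S] Suc.prems] by simp
    also have "\<dots> = mcol (?x \<odot>\<odot> S) j" using mcol_mmul[OF Sk[OF S] C j] xS[OF S] by simp
    also have "\<dots> = ?x \<odot>\<odot> mcol S j" by (rule mcol_mmul[OF xk[OF S] Sk[OF S] j])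
    also have "\<dots> = mpow n ?x (Suc j) \<odot>\<odot> (S \<odot>\<odot> e)"
      using Suc.IH[OF j] mpow_Suc_vec[OF xk[OF S] mmul_closed[OF Sk[OF S] e]] by simp
    finally show ?case .
  qed
  have "card ?G \<le> card (char_class n f \<times> kmat n 1)"
  proof (rule card_inj_on_le[where f = \<Phi>])
    show "inj_on \<Phi> ?G"
    proof (rule inj_onI)
      fix S S' assume S: "S \<in> ?G" "S' \<in> ?G" and eq: "\<Phi> S = \<Phi> S'"
      show "S = S'"
      proof (rule mats_eqI_mcol[of _ K n n])
        fix j assume "j < n"
        then show "mcol S j = mcol S' j" using cols[OF S(1)] cols[OF S(2)] eq by (simp add: \<Phi>_def)
      qed (use S indepD in auto)
    qed
    show "\<Phi> ` ?G \<subseteq> char_class n f \<times> kmat n 1"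
    proof
      fix z assume "z \<in> \<Phi> ` ?G"
      then obtain S where S: "S \<in> ?G" "z = \<Phi> S" by blast
      have "cp n (S \<odot>\<odot> C \<odot>\<odot> T S) = cp n C"
        by (rule cp_similar[OF Sk[OF S(1)] _ xk[OF S(1)] C _ xS[OF S(1)], of "T S"]) (use T[of S] S in auto)
      then show "z \<in> char_class n f \<times> kmat n 1"
        using xk[OF S(1)] Sk[OF S(1)] e S by (simp add: \<Phi>_def char_class_def cpC)
    qed
    show "finite (char_class n f \<times> kmat n 1)" by (simp add: finite_char_class finite_kmat)
  qed
  then have "card ?G \<le> card (char_class n f) * card K ^ n"
    by (simp add: card_cartesian_product card_kmat)
  moreover have "card K ^ n\<^sup>2 \<le> 4 * card ?G" by (rule card_GL_ge[OF KF])
  ultimately show ?thesis by linarith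
qed

end

section \<open>Monic divisors of a polynomial\<close>

text \<open>The induction step of the divisor count. Splitting off an irreducible factor of degree
  \<open>r\<close> sorts the divisors of degree \<open>d\<close> into those that contain it and
  those that divide the cofactor of degree \<open>n - r\<close>.\<close>

lemma divisor_count_arith:
  fixes n r d :: nat
  assumes "1 \<le> r" "r \<le> d" "r \<le> n"
  shows "(n - r) ^ (d - r) + (n - r) ^ d \<le> n ^ d"
proof (cases "n - r = 0")
  case True
  then have "n = r" using assms by simp
  \<comment> \<open>The cofactor is constant here, and \<open>0 ^ (d - r)\<close> is 1 exactly when
    \<open>d = r\<close>, so this case has to be separated.\<close>
  show ?thesis
  proof (cases "d = r")
    case True
    then show ?thesis using assms \<open>n = r\<close> self_le_power[of r r] by (simp add: zero_power)
  next
    case False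
    then have "(0::nat) ^ (d - r) = 0" "(0::nat) ^ d = 0" using assms by (simp_all add: zero_power)
    then show ?thesis using \<open>n = r\<close> by (simp only: diff_self_eq_0 add_0 le0)
  qed
next
  case False
  define m where "m = n - r"
  have m: "m \<ge> 1" "m + 1 \<le> n" using False assms by (auto simp: m_def)
  obtain d' where d': "d = Suc d'" using assms by (cases d) auto
  have "m ^ (d - r) \<le> m ^ d'" using m assms d' by (intro power_increasing) auto
  then have "m ^ (d - r) + m ^ d \<le> m ^ d' + m * m ^ d'" by (simp add: d')
  also have "\<dots> = (m + 1) * m ^ d'" by (simp add: algebra_simps)
  also have "\<dots> \<le> (m + 1) * (m + 1) ^ d'" by (intro mult_left_mono power_mono) auto
  also have "\<dots> = (m + 1) ^ d" unfolding d' by simp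
  also have "\<dots> \<le> n ^ d" using m by (intro power_mono) auto
  finally show ?thesis by (simp add: m_def)
qed

context field
begin

definition monic :: "nat \<Rightarrow> (nat \<Rightarrow> 'a) \<Rightarrow> bool" where
  "monic d g \<longleftrightarrow> g \<in> carrier (UP R) \<and> deg R g = d \<and> up_ring.coeff (UP R) g d = \<one>"

definition monic_divisors :: "nat \<Rightarrow> (nat \<Rightarrow> 'a) \<Rightarrow> (nat \<Rightarrow> 'a) set" where
  "monic_divisors d f = {g. monic d g \<and> (\<exists>h\<in>carrier (UP R). f = g \<otimes>\<^bsub>UP R\<^esub> h)}"

text \<open>Pseudo-division multiplies the dividend by a power of the leading coefficient of the
  divisor; over a field this power can be inverted.\<close>

lemma UP_divide:
  assumes f: "f \<in> carrier (UP R)" and g: "g \<in> carrier (UP R)" "g \<noteq> \<zero>\<^bsub>UP R\<^esub>"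
  obtains q r where "q \<in> carrier (UP R)" "r \<in> carrier (UP R)" "f = g \<otimes>\<^bsub>UP R\<^esub> q \<oplus>\<^bsub>UP R\<^esub> r"
    "r = \<zero>\<^bsub>UP R\<^esub> \<or> deg R r < deg R g"
proof -
  interpret UP: UP_domain R "UP R" by unfold_locales
  obtain q r and k :: nat where qr: "q \<in> carrier (UP R)" "r \<in> carrier (UP R)"
    "UP.lcoeff g [^] k \<odot>\<^bsub>UP R\<^esub> f = g \<otimes>\<^bsub>UP R\<^esub> q \<oplus>\<^bsub>UP R\<^esub> r"
    "r = \<zero>\<^bsub>UP R\<^esub> \<or> deg R r < deg R g"
    using UP.long_div_theorem[OF g(1) f g(2)] by blast
  define c where "c = UP.lcoeff g [^] k"
  have lc: "UP.lcoeff g \<in> carrier R" "UP.lcoeff g \<noteq> \<zero>" using g UP.lcoeff_nonzero by auto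
  then have "UP.lcoeff g [^] k \<noteq> \<zero>" by (induction k) (auto simp: integral_iff)
  then have c: "c \<in> carrier R" "c \<noteq> \<zero>" using lc by (auto simp: c_def)
  then have i: "inv c \<in> carrier R" "inv c \<otimes> c = \<one>" using field_Units by auto
  have "f = inv c \<odot>\<^bsub>UP R\<^esub> (c \<odot>\<^bsub>UP R\<^esub> f)"
    using f c i UP.smult_assoc1[of "inv c" c f] by simp
  also have "c \<odot>\<^bsub>UP R\<^esub> f = g \<otimes>\<^bsub>UP R\<^esub> q \<oplus>\<^bsub>UP R\<^esub> r" using qr by (simp add: c_def)
  also have "inv c \<odot>\<^bsub>UP R\<^esub> \<dots> = g \<otimes>\<^bsub>UP R\<^esub> (inv c \<odot>\<^bsub>UP R\<^esub> q) \<oplus>\<^bsub>UP R\<^esub> inv c \<odot>\<^bsub>UP R\<^esub> r"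
    using qr g i UP.m_comm[of g "inv c \<odot>\<^bsub>UP R\<^esub> q"] UP.smult_assoc2[of "inv c" q g] UP.m_comm[of q g]
    by (simp add: UP.smult_r_distr)
  finally show ?thesis
    using qr i c by (intro that[of "inv c \<odot>\<^bsub>UP R\<^esub> q" "inv c \<odot>\<^bsub>UP R\<^esub> r"]) auto
qed

lemma UP_const_inverse:
  assumes s: "s \<in> carrier (UP R)" "s \<noteq> \<zero>\<^bsub>UP R\<^esub>" "deg R s = 0"
  obtains t where "t \<in> carrier (UP R)" "s \<otimes>\<^bsub>UP R\<^esub> t = \<one>\<^bsub>UP R\<^esub>" "t \<otimes>\<^bsub>UP R\<^esub> s = \<one>\<^bsub>UP R\<^esub>"
proof -
  interpret UP: UP_domain R "UP R" by unfold_locales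
  obtain q r where q: "q \<in> carrier (UP R)" "r \<in> carrier (UP R)" "\<one>\<^bsub>UP R\<^esub> = s \<otimes>\<^bsub>UP R\<^esub> q \<oplus>\<^bsub>UP R\<^esub> r"
    "r = \<zero>\<^bsub>UP R\<^esub> \<or> deg R r < deg R s"
    using UP_divide[of "\<one>\<^bsub>UP R\<^esub>" s] s by auto
  then have "s \<otimes>\<^bsub>UP R\<^esub> q = \<one>\<^bsub>UP R\<^esub>" using s by simp
  then show ?thesis using that[OF q(1)] UP.m_comm[OF s(1) q(1)] by simp
qed

text \<open>Euclid's lemma for a divisor \<open>p\<close> of \<open>f\<close> of least positive degree, which is irreducible.\<close>

lemma UP_prime_divisor:
  assumes p: "p \<in> carrier (UP R)" "p \<noteq> \<zero>\<^bsub>UP R\<^esub>" and f': "f' \<in> carrier (UP R)"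
    and f: "f = p \<otimes>\<^bsub>UP R\<^esub> f'"
    and min: "\<And>s t. s \<in> carrier (UP R) \<Longrightarrow> t \<in> carrier (UP R) \<Longrightarrow> f = s \<otimes>\<^bsub>UP R\<^esub> t \<Longrightarrow> deg R s \<noteq> 0 \<Longrightarrow>
      deg R p \<le> deg R s"
    and g: "g \<in> carrier (UP R)" and h: "h \<in> carrier (UP R)" and gh: "f = g \<otimes>\<^bsub>UP R\<^esub> h"
  shows "(\<exists>t\<in>carrier (UP R). g = p \<otimes>\<^bsub>UP R\<^esub> t) \<or> (\<exists>t\<in>carrier (UP R). f' = g \<otimes>\<^bsub>UP R\<^esub> t)"
proof -
  interpret UP: UP_domain R "UP R" by unfold_locales
  \<comment> \<open>The ideal generated by \<open>p\<close> and \<open>g\<close>. A nonzero element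
    \<open>s\<close> of least degree divides both. If \<open>s\<close> is constant, there is a
    Bezout identity and \<open>g\<close> divides \<open>f'\<close>; otherwise minimality of
    \<open>p\<close> makes \<open>p\<close> a unit multiple of \<open>s\<close>, so \<open>p\<close>
    divides \<open>g\<close>.\<close>
  define I where "I = {a \<otimes>\<^bsub>UP R\<^esub> p \<oplus>\<^bsub>UP R\<^esub> b \<otimes>\<^bsub>UP R\<^esub> g | a b. a \<in> carrier (UP R) \<and> b \<in> carrier (UP R)}"
  have Ic: "I \<subseteq> carrier (UP R)" using p g by (auto simp: I_def)
  have pI: "p \<in> I" unfolding I_def
    using p g by (intro CollectI exI[of _ "\<one>\<^bsub>UP R\<^esub>"] exI[of _ "\<zero>\<^bsub>UP R\<^esub>"]) auto
  have gI: "g \<in> I" unfolding I_def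
    using p g by (intro CollectI exI[of _ "\<zero>\<^bsub>UP R\<^esub>"] exI[of _ "\<one>\<^bsub>UP R\<^esub>"]) auto
  have sub: "u \<ominus>\<^bsub>UP R\<^esub> v \<otimes>\<^bsub>UP R\<^esub> q \<in> I" if uv: "u \<in> I" "v \<in> I" and q: "q \<in> carrier (UP R)" for u v q
  proof -
    obtain a b c d where ab: "a \<in> carrier (UP R)" "b \<in> carrier (UP R)" "c \<in> carrier (UP R)" "d \<in> carrier (UP R)"
      "u = a \<otimes>\<^bsub>UP R\<^esub> p \<oplus>\<^bsub>UP R\<^esub> b \<otimes>\<^bsub>UP R\<^esub> g" "v = c \<otimes>\<^bsub>UP R\<^esub> p \<oplus>\<^bsub>UP R\<^esub> d \<otimes>\<^bsub>UP R\<^esub> g"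
      using uv by (auto simp: I_def)
    have "u \<ominus>\<^bsub>UP R\<^esub> v \<otimes>\<^bsub>UP R\<^esub> q = (a \<ominus>\<^bsub>UP R\<^esub> c \<otimes>\<^bsub>UP R\<^esub> q) \<otimes>\<^bsub>UP R\<^esub> p \<oplus>\<^bsub>UP R\<^esub> (b \<ominus>\<^bsub>UP R\<^esub> d \<otimes>\<^bsub>UP R\<^esub> q) \<otimes>\<^bsub>UP R\<^esub> g"
      unfolding ab(5,6) using ab(1-4) p g q by algebra
    then show ?thesis unfolding I_def using ab(1-4) q by blast
  qed
  obtain s where s: "s \<in> I" "s \<noteq> \<zero>\<^bsub>UP R\<^esub>" and smin: "\<And>t. t \<in> I \<Longrightarrow> t \<noteq> \<zero>\<^bsub>UP R\<^esub> \<Longrightarrow> deg R s \<le> deg R t"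
    using ex_has_least_nat[of "\<lambda>s. s \<in> I \<and> s \<noteq> \<zero>\<^bsub>UP R\<^esub>" p "deg R"] pI p by blast
  have sc: "s \<in> carrier (UP R)" using s Ic by auto
  have sdvd: "\<exists>q\<in>carrier (UP R). u = s \<otimes>\<^bsub>UP R\<^esub> q" if u: "u \<in> I" for u
  proof -
    have uc: "u \<in> carrier (UP R)" using u Ic by auto
    obtain q r where q: "q \<in> carrier (UP R)" "r \<in> carrier (UP R)" "u = s \<otimes>\<^bsub>UP R\<^esub> q \<oplus>\<^bsub>UP R\<^esub> r"
      "r = \<zero>\<^bsub>UP R\<^esub> \<or> deg R r < deg R s"
      using UP_divide[OF uc sc s(2)] by blast
    have "r = u \<ominus>\<^bsub>UP R\<^esub> s \<otimes>\<^bsub>UP R\<^esub> q" unfolding q(3) using q(1,2) sc by algebra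
    then have "r \<in> I" using sub[OF u s(1) q(1)] by simp
    then have "r = \<zero>\<^bsub>UP R\<^esub>" using smin[of r] q(4) leD by blast
    then show ?thesis using q sc by auto
  qed
  obtain t where t: "t \<in> carrier (UP R)" "p = s \<otimes>\<^bsub>UP R\<^esub> t" using sdvd[OF pI] by blast
  obtain u where u: "u \<in> carrier (UP R)" "g = s \<otimes>\<^bsub>UP R\<^esub> u" using sdvd[OF gI] by blast
  have tnz: "t \<noteq> \<zero>\<^bsub>UP R\<^esub>" using p t sc by auto
  have degp: "deg R p = deg R s + deg R t" using t sc s tnz by simp
  show ?thesis
  proof (cases "deg R s = 0")
    case True
    obtain w where w: "w \<in> carrier (UP R)" "s \<otimes>\<^bsub>UP R\<^esub> w = \<one>\<^bsub>UP R\<^esub>"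
      using UP_const_inverse[OF sc s(2) True] by blast
    obtain a b where ab: "a \<in> carrier (UP R)" "b \<in> carrier (UP R)"
      "s = a \<otimes>\<^bsub>UP R\<^esub> p \<oplus>\<^bsub>UP R\<^esub> b \<otimes>\<^bsub>UP R\<^esub> g" using s(1) by (auto simp: I_def)
    have "f' = s \<otimes>\<^bsub>UP R\<^esub> w \<otimes>\<^bsub>UP R\<^esub> f'" using w f' by simp
    also have "\<dots> = w \<otimes>\<^bsub>UP R\<^esub> a \<otimes>\<^bsub>UP R\<^esub> (p \<otimes>\<^bsub>UP R\<^esub> f') \<oplus>\<^bsub>UP R\<^esub> g \<otimes>\<^bsub>UP R\<^esub> (w \<otimes>\<^bsub>UP R\<^esub> b \<otimes>\<^bsub>UP R\<^esub> f')"
      unfolding ab(3) using ab(1,2) w(1) f' p g by algebra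
    also have "p \<otimes>\<^bsub>UP R\<^esub> f' = g \<otimes>\<^bsub>UP R\<^esub> h" using f gh by simp
    also have "w \<otimes>\<^bsub>UP R\<^esub> a \<otimes>\<^bsub>UP R\<^esub> (g \<otimes>\<^bsub>UP R\<^esub> h) \<oplus>\<^bsub>UP R\<^esub> g \<otimes>\<^bsub>UP R\<^esub> (w \<otimes>\<^bsub>UP R\<^esub> b \<otimes>\<^bsub>UP R\<^esub> f')
        = g \<otimes>\<^bsub>UP R\<^esub> (w \<otimes>\<^bsub>UP R\<^esub> a \<otimes>\<^bsub>UP R\<^esub> h \<oplus>\<^bsub>UP R\<^esub> w \<otimes>\<^bsub>UP R\<^esub> b \<otimes>\<^bsub>UP R\<^esub> f')"
      using ab(1,2) w(1) f' g h by algebra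
    finally show ?thesis using ab(1,2) w(1) f' h by blast
  next
    case False
    have "f = s \<otimes>\<^bsub>UP R\<^esub> (t \<otimes>\<^bsub>UP R\<^esub> f')" unfolding f t(2) using sc t f' by (simp add: UP.m_assoc)
    then have "deg R p \<le> deg R s" using min[OF sc _ _ False, of "t \<otimes>\<^bsub>UP R\<^esub> f'"] t f' by simp
    then have "deg R t = 0" using degp by simp
    then obtain w where w: "w \<in> carrier (UP R)" "t \<otimes>\<^bsub>UP R\<^esub> w = \<one>\<^bsub>UP R\<^esub>"
      using UP_const_inverse[OF t(1) tnz] by blast
    have "g = s \<otimes>\<^bsub>UP R\<^esub> (t \<otimes>\<^bsub>UP R\<^esub> w) \<otimes>\<^bsub>UP R\<^esub> u" using u w sc by simp
    also have "\<dots> = p \<otimes>\<^bsub>UP R\<^esub> (w \<otimes>\<^bsub>UP R\<^esub> u)" unfolding t(2) using t(1) sc w(1) u(1) by algebra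
    finally show ?thesis using w u by blast
  qed
qed

lemma monic_nonzero: "monic d g \<Longrightarrow> g \<noteq> \<zero>\<^bsub>UP R\<^esub>"
proof
  interpret UP: UP_domain R "UP R" by unfold_locales
  assume "monic d g" "g = \<zero>\<^bsub>UP R\<^esub>"
  then show False by (auto simp: monic_def)
qed

lemma UP_lcoeff_mult:
  assumes "p \<in> carrier (UP R)" "q \<in> carrier (UP R)"
  shows "up_ring.coeff (UP R) (p \<otimes>\<^bsub>UP R\<^esub> q) (deg R p + deg R q)
    = up_ring.coeff (UP R) p (deg R p) \<otimes> up_ring.coeff (UP R) q (deg R q)"
proof -
  interpret UP: UP_domain R "UP R" by unfold_locales
  let ?d = "deg R p" and ?e = "deg R q"
  have "up_ring.coeff (UP R) (p \<otimes>\<^bsub>UP R\<^esub> q) (?d + ?e) = (\<Oplus>i\<in>{..?d + ?e}. up_ring.coeff (UP R) p i \<otimes> up_ring.coeff (UP R) q (?d + ?e - i))"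
    using assms by simp
  also have "\<dots> = (\<Oplus>i\<in>{..?d + ?e}. if ?d = i then up_ring.coeff (UP R) p i \<otimes> up_ring.coeff (UP R) q (?d + ?e - i) else \<zero>)"
  proof (rule finsum_cong')
    fix i assume i: "i \<in> {..?d + ?e}"
    show "up_ring.coeff (UP R) p i \<otimes> up_ring.coeff (UP R) q (?d + ?e - i) =
      (if ?d = i then up_ring.coeff (UP R) p i \<otimes> up_ring.coeff (UP R) q (?d + ?e - i) else \<zero>)"
    proof (cases i "?d" rule: linorder_cases)
      case less
      then have "up_ring.coeff (UP R) q (?d + ?e - i) = \<zero>" using assms by (intro UP.deg_aboveD) auto
      then show ?thesis using less assms by simp
    next
      case greater
      then have "up_ring.coeff (UP R) p i = \<zero>" using assms by (intro UP.deg_aboveD) auto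
      then show ?thesis using greater assms by simp
    qed simp
  qed (use assms in auto)
  also have "\<dots> = up_ring.coeff (UP R) p ?d \<otimes> up_ring.coeff (UP R) q (?d + ?e - ?d)"
    by (rule finsum_singleton) (use assms in auto)
  finally show ?thesis by simp
qed

lemma monic_mult:
  assumes "monic d g" "h \<in> carrier (UP R)" "monic n (g \<otimes>\<^bsub>UP R\<^esub> h)"
  shows "monic (n - d) h" "d \<le> n"
proof -
  interpret UP: UP_domain R "UP R" by unfold_locales
  have g: "g \<in> carrier (UP R)" "deg R g = d" "up_ring.coeff (UP R) g d = \<one>" using assms by (auto simp: monic_def)
  have "h \<noteq> \<zero>\<^bsub>UP R\<^esub>" using monic_nonzero[OF assms(3)] g by auto
  then have n: "n = d + deg R h"
    using assms(2,3) g monic_nonzero[OF assms(1)] by (auto simp: monic_def)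
  then have "up_ring.coeff (UP R) h (deg R h) = \<one>"
    using UP_lcoeff_mult[OF g(1) assms(2)] assms(2,3) g by (simp add: monic_def)
  then show "monic (n - d) h" "d \<le> n" using n assms(2) by (auto simp: monic_def)
qed

lemma monic_normalise:
  assumes p: "p \<in> carrier (UP R)" "p \<noteq> \<zero>\<^bsub>UP R\<^esub>"
  obtains c where "c \<in> carrier (UP R)" "monic (deg R p) (c \<otimes>\<^bsub>UP R\<^esub> p)"
    "\<exists>c'\<in>carrier (UP R). c \<otimes>\<^bsub>UP R\<^esub> c' = \<one>\<^bsub>UP R\<^esub>"
proof -
  interpret UP: UP_domain R "UP R" by unfold_locales
  define l where "l = up_ring.coeff (UP R) p (deg R p)"
  have l: "l \<in> carrier R" "l \<noteq> \<zero>" using UP.lcoeff_nonzero[OF p(2,1)] p by (auto simp: l_def)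
  then have i: "inv l \<in> carrier R" "inv l \<otimes> l = \<one>" "inv l \<noteq> \<zero>" using field_Units by auto
  let ?c = "up_ring.monom (UP R) (inv l) 0"
  have c: "?c \<in> carrier (UP R)" "deg R ?c = 0" using i by auto
  have cnz: "?c \<noteq> \<zero>\<^bsub>UP R\<^esub>" using i by (metis UP.coeff_monom UP.coeff_zero)
  have "monic (deg R p) (?c \<otimes>\<^bsub>UP R\<^esub> p)"
    unfolding monic_def using p i l
    by (auto simp: UP.monom_mult_is_smult l_def[symmetric])
  moreover obtain c' where "c' \<in> carrier (UP R)" "?c \<otimes>\<^bsub>UP R\<^esub> c' = \<one>\<^bsub>UP R\<^esub>"
    using UP_const_inverse[OF c(1) cnz c(2)] by blast
  ultimately show ?thesis using that c by blast
qed

text \<open>A divisor of least positive degree behaves like a prime, and each divisor of degree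
  \<open>d\<close> either contains it or divides the cofactor. The form \<open>n^d\<close> matters:
  one factor \<open>n\<close> per unit of degree is something that the later gain
  \<open>Q^(d (n - d))\<close> can absorb even over the field with two elements.\<close>

lemma card_monic_divisors:
  "monic n f \<Longrightarrow> finite (monic_divisors d f) \<and> card (monic_divisors d f) \<le> n ^ d"
proof (induction n arbitrary: f d rule: less_induct)
  case (less n)
  interpret UP: UP_domain R "UP R" by unfold_locales
  have f: "f \<in> carrier (UP R)" using less.prems by (simp add: monic_def)
  show ?case
  proof (cases "d = 0")
    case True
    have "g = \<one>\<^bsub>UP R\<^esub>" if "monic 0 g" for g
    proof (rule UP.up_eqI)
      fix i show "up_ring.coeff (UP R) g i = up_ring.coeff (UP R) \<one>\<^bsub>UP R\<^esub> i"
        using that by (cases "i = 0") (auto simp: monic_def UP.deg_aboveD)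
    qed (use that in \<open>auto simp: monic_def\<close>)
    then have "monic_divisors d f \<subseteq> {\<one>\<^bsub>UP R\<^esub>}" using True by (auto simp: monic_divisors_def)
    then show ?thesis
      using True finite_subset[of "monic_divisors d f" "{\<one>\<^bsub>UP R\<^esub>}"] card_mono[of "{\<one>\<^bsub>UP R\<^esub>}" "monic_divisors d f"]
      by simp
  next
    case False
    show ?thesis
    proof (cases "monic_divisors d f = {}")
      case True
      then show ?thesis by simp
    next
      case nonempty: False
      then obtain g0 h0 where g0: "monic d g0" "h0 \<in> carrier (UP R)" "f = g0 \<otimes>\<^bsub>UP R\<^esub> h0"
        by (auto simp: monic_divisors_def)
      let ?D = "\<lambda>p. p \<in> carrier (UP R) \<and> deg R p \<noteq> 0 \<and> (\<exists>t\<in>carrier (UP R). f = p \<otimes>\<^bsub>UP R\<^esub> t)"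
      have "?D g0" using g0 False by (auto simp: monic_def)
      then obtain p0 where p0: "?D p0" and p0min: "\<And>s. ?D s \<Longrightarrow> deg R p0 \<le> deg R s"
        using ex_has_least_nat[of ?D g0 "deg R"] by blast
      define r where "r = deg R p0"
      have p0nz: "p0 \<noteq> \<zero>\<^bsub>UP R\<^esub>" using p0 by auto
      obtain t0 where t0: "t0 \<in> carrier (UP R)" "f = p0 \<otimes>\<^bsub>UP R\<^esub> t0" using p0 by blast
      obtain c c' where c: "c \<in> carrier (UP R)" "monic r (c \<otimes>\<^bsub>UP R\<^esub> p0)" "c' \<in> carrier (UP R)" "c \<otimes>\<^bsub>UP R\<^esub> c' = \<one>\<^bsub>UP R\<^esub>"
        using monic_normalise[of p0] p0 p0nz unfolding r_def by metis
      define p where "p = c \<otimes>\<^bsub>UP R\<^esub> p0"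
      define f' where "f' = c' \<otimes>\<^bsub>UP R\<^esub> t0"
      have p: "p \<in> carrier (UP R)" "monic r p" "deg R p = r" using c p0 by (auto simp: p_def monic_def)
      have f': "f' \<in> carrier (UP R)" using c t0 by (simp add: f'_def)
      have "p \<otimes>\<^bsub>UP R\<^esub> f' = (c \<otimes>\<^bsub>UP R\<^esub> c') \<otimes>\<^bsub>UP R\<^esub> (p0 \<otimes>\<^bsub>UP R\<^esub> t0)"
        unfolding p_def f'_def using c(1,3) p0 t0(1) UP.m_ac by auto
      then have ff: "f = p \<otimes>\<^bsub>UP R\<^esub> f'" using c t0 f by simp
      have r: "r \<ge> 1" using p0 by (auto simp: r_def)
      have mf': "monic (n - r) f'" "r \<le> n" using monic_mult[OF p(2) f'] less.prems ff by auto
      have rd: "r \<le> d" using p0min[of g0] \<open>?D g0\<close> g0 by (simp add: r_def monic_def)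
      have IH: "finite (monic_divisors e f') \<and> card (monic_divisors e f') \<le> (n - r) ^ e" for e
        using less.IH[of "n - r" f' e] mf' r by simp
      have "monic_divisors d f \<subseteq> (\<lambda>t. p \<otimes>\<^bsub>UP R\<^esub> t) ` monic_divisors (d - r) f' \<union> monic_divisors d f'"
      proof
        fix g assume "g \<in> monic_divisors d f"
        then obtain h where g: "monic d g" "h \<in> carrier (UP R)" "f = g \<otimes>\<^bsub>UP R\<^esub> h"
          by (auto simp: monic_divisors_def)
        have gc: "g \<in> carrier (UP R)" using g by (simp add: monic_def)
        have "(\<exists>t\<in>carrier (UP R). g = p \<otimes>\<^bsub>UP R\<^esub> t) \<or> (\<exists>t\<in>carrier (UP R). f' = g \<otimes>\<^bsub>UP R\<^esub> t)"
        proof (rule UP_prime_divisor[OF p(1) monic_nonzero[OF p(2)] f' ff _ gc g(2,3)])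
          fix s t assume "s \<in> carrier (UP R)" "t \<in> carrier (UP R)" "f = s \<otimes>\<^bsub>UP R\<^esub> t" "deg R s \<noteq> 0"
          then show "deg R p \<le> deg R s" using p0min[of s] p(3) r_def by auto
        qed
        then show "g \<in> (\<lambda>t. p \<otimes>\<^bsub>UP R\<^esub> t) ` monic_divisors (d - r) f' \<union> monic_divisors d f'"
        proof (elim disjE bexE)
          fix t assume t: "t \<in> carrier (UP R)" "g = p \<otimes>\<^bsub>UP R\<^esub> t"
          have "monic (d - r) t" using monic_mult(1)[OF p(2) t(1)] g t by simp
          moreover have "p \<otimes>\<^bsub>UP R\<^esub> f' = p \<otimes>\<^bsub>UP R\<^esub> (t \<otimes>\<^bsub>UP R\<^esub> h)"
            using g(3) ff t p(1) g(2) by (simp add: UP.m_assoc)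
          then have "f' = t \<otimes>\<^bsub>UP R\<^esub> h"
            using UP.m_lcancel[OF monic_nonzero[OF p(2)] p(1) f'] t g by simp
          ultimately have "t \<in> monic_divisors (d - r) f'" using g by (auto simp: monic_divisors_def)
          then show ?thesis using t by blast
        qed (use g in \<open>auto simp: monic_divisors_def\<close>)
      qed
      then have "finite (monic_divisors d f)" "card (monic_divisors d f)
          \<le> card ((\<lambda>t. p \<otimes>\<^bsub>UP R\<^esub> t) ` monic_divisors (d - r) f' \<union> monic_divisors d f')"
        using IH by (auto intro: finite_subset card_mono)
      moreover have "card ((\<lambda>t. p \<otimes>\<^bsub>UP R\<^esub> t) ` monic_divisors (d - r) f' \<union> monic_divisors d f')
          \<le> (n - r) ^ (d - r) + (n - r) ^ d"
        using card_Un_le[of "(\<lambda>t. p \<otimes>\<^bsub>UP R\<^esub> t) ` monic_divisors (d - r) f'" "monic_divisors d f'"]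
          card_image_le[of "monic_divisors (d - r) f'" "\<lambda>t. p \<otimes>\<^bsub>UP R\<^esub> t"] IH[of "d - r"] IH[of d] by linarith
      moreover have "(n - r) ^ (d - r) + (n - r) ^ d \<le> n ^ d"
        by (rule divisor_count_arith[OF r rd mf'(2)])
      ultimately show ?thesis by linarith
    qed
  qed
qed

end

context finite_field
begin

section \<open>Pairs with a common invariant subspace\<close>

definition GLs :: "nat \<Rightarrow> 'a mat set" where
  "GLs n = {S. indep K n n S}"

definition minv :: "nat \<Rightarrow> 'a mat \<Rightarrow> 'a mat" where
  "minv n S = (SOME T. T \<in> kmat n n \<and> S \<odot>\<odot> T = mone n \<and> T \<odot>\<odot> S = mone n)"

definition mconj :: "nat \<Rightarrow> 'a mat \<Rightarrow> 'a mat \<Rightarrow> 'a mat" where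
  "mconj n S x = minv n S \<odot>\<odot> x \<odot>\<odot> S"

lemma GLs_kmat: "S \<in> GLs n \<Longrightarrow> S \<in> kmat n n"
  using indepD by (auto simp: GLs_def kmat_matsK)

lemma finite_GLs: "finite (GLs n)"
  by (rule finite_subset[OF _ finite_kmat[of n n]]) (auto intro: GLs_kmat)

lemma card_GLs_le: "card (GLs n) \<le> card K ^ n\<^sup>2"
  using card_mono[OF finite_kmat[of n n], of "GLs n"] by (simp add: card_kmat power2_eq_square subsetI GLs_kmat)

lemma card_GLs_ge: "card K ^ n\<^sup>2 \<le> 4 * card (GLs n)"
  using card_GL_ge[OF KF, of n] by (simp add: GLs_def)

lemma minv:
  assumes "S \<in> GLs n"
  shows "minv n S \<in> kmat n n" "S \<odot>\<odot> minv n S = mone n" "minv n S \<odot>\<odot> S = mone n"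
proof -
  have "\<exists>T. T \<in> kmat n n \<and> S \<odot>\<odot> T = mone n \<and> T \<odot>\<odot> S = mone n"
    using assms indep_inverse[OF KF, of n S] by (auto simp: GLs_def kmat_matsK)
  then have "minv n S \<in> kmat n n \<and> S \<odot>\<odot> minv n S = mone n \<and> minv n S \<odot>\<odot> S = mone n"
    unfolding minv_def by (rule someI_ex)
  then show "minv n S \<in> kmat n n" "S \<odot>\<odot> minv n S = mone n" "minv n S \<odot>\<odot> S = mone n" by auto
qed

lemma GLsI:
  assumes "S \<in> kmat n n" "T \<in> kmat n n" "T \<odot>\<odot> S = mone n"
  shows "S \<in> GLs n"
  using indepI_inverse[OF KF, of S n n T] assms by (auto simp: GLs_def kmat_matsK)

lemma minv_unique:
  assumes "S \<in> kmat n n" "T \<in> kmat n n" "T \<odot>\<odot> S = mone n"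
  shows "minv n S = T"
proof -
  have S: "S \<in> GLs n" by (rule GLsI[OF assms])
  have "T = T \<odot>\<odot> (S \<odot>\<odot> minv n S)" using assms(2) minv[OF S] by simp
  also have "\<dots> = T \<odot>\<odot> S \<odot>\<odot> minv n S" by (rule mmul_assoc[OF assms(2,1) minv(1)[OF S], symmetric])
  finally show ?thesis using assms minv[OF S] by simp
qed

lemma GLs_mult:
  assumes "S \<in> GLs n" "P \<in> GLs n"
  shows "S \<odot>\<odot> P \<in> GLs n" "minv n (S \<odot>\<odot> P) = minv n P \<odot>\<odot> minv n S"
proof -
  note k = GLs_kmat[OF assms(1)] GLs_kmat[OF assms(2)] minv[OF assms(1)] minv[OF assms(2)]
  have "minv n P \<odot>\<odot> minv n S \<odot>\<odot> (S \<odot>\<odot> P) = minv n P \<odot>\<odot> (minv n S \<odot>\<odot> (S \<odot>\<odot> P))"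
    by (rule mmul_assoc[OF k(6,3) mmul_closed[OF k(1,2)]])
  also have "minv n S \<odot>\<odot> (S \<odot>\<odot> P) = minv n S \<odot>\<odot> S \<odot>\<odot> P"
    by (rule mmul_assoc[OF k(3,1,2), symmetric])
  finally have e: "minv n P \<odot>\<odot> minv n S \<odot>\<odot> (S \<odot>\<odot> P) = mone n" using k by simp
  show "S \<odot>\<odot> P \<in> GLs n"
    by (rule GLsI[OF mmul_closed[OF k(1,2)] mmul_closed[OF k(6,3)] e])
  show "minv n (S \<odot>\<odot> P) = minv n P \<odot>\<odot> minv n S"
    by (rule minv_unique[OF mmul_closed[OF k(1,2)] mmul_closed[OF k(6,3)] e])
qed

context
  fixes n S x
  assumes S: "S \<in> GLs n" and x: "x \<in> kmat n n"
begin

lemma mconj_closed: "mconj n S x \<in> kmat n n"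
  unfolding mconj_def using mmul_closed[OF mmul_closed[OF minv(1)[OF S] x] GLs_kmat[OF S]] .

lemma mmul_mconj: "S \<odot>\<odot> mconj n S x = x \<odot>\<odot> S"
proof -
  have "S \<odot>\<odot> mconj n S x = S \<odot>\<odot> (minv n S \<odot>\<odot> (x \<odot>\<odot> S))"
    unfolding mconj_def using mmul_assoc[OF minv(1)[OF S] x GLs_kmat[OF S]] by simp
  also have "\<dots> = S \<odot>\<odot> minv n S \<odot>\<odot> (x \<odot>\<odot> S)"
    by (rule mmul_assoc[OF GLs_kmat[OF S] minv(1)[OF S] mmul_closed[OF x GLs_kmat[OF S]], symmetric])
  finally show ?thesis using minv[OF S] mmul_closed[OF x GLs_kmat[OF S]] by simp
qed

lemma mconj_unique:
  assumes y: "y \<in> kmat n n" and eq: "x \<odot>\<odot> S = S \<odot>\<odot> y"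
  shows "mconj n S x = y"
  by (rule indep_cancel[OF KF, of n n S _ n])
    (use S y mconj_closed mmul_mconj eq in \<open>auto simp: GLs_def kmat_matsK\<close>)

lemma mconj_back: "x = S \<odot>\<odot> mconj n S x \<odot>\<odot> minv n S"
  using mmul_mconj mmul_assoc[OF x GLs_kmat[OF S] minv(1)[OF S]] minv[OF S] x by simp

lemma cp_mconj: "cp n (mconj n S x) = cp n x"
  by (rule cp_similar[OF GLs_kmat[OF S] minv(1)[OF S] x mconj_closed minv(2)[OF S], symmetric])
    (simp add: mmul_mconj)

lemma mconj_mconj:
  assumes P: "P \<in> GLs n"
  shows "mconj n (S \<odot>\<odot> P) x = mconj n P (mconj n S x)"
proof -
  note k = GLs_kmat[OF S] GLs_kmat[OF P] minv(1)[OF S] minv(1)[OF P]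
  note c = mmul_closed[OF k(4,3)] mmul_closed[OF k(1,2)] mmul_closed[OF k(3) x] mmul_closed[OF mmul_closed[OF k(3) x] k(1)]
  have "mconj n (S \<odot>\<odot> P) x = minv n P \<odot>\<odot> minv n S \<odot>\<odot> x \<odot>\<odot> (S \<odot>\<odot> P)"
    by (simp add: mconj_def GLs_mult[OF S P])
  also have "\<dots> = minv n P \<odot>\<odot> (minv n S \<odot>\<odot> x) \<odot>\<odot> (S \<odot>\<odot> P)"
    by (simp add: mmul_assoc[OF k(4,3) x])
  also have "\<dots> = minv n P \<odot>\<odot> (minv n S \<odot>\<odot> x) \<odot>\<odot> S \<odot>\<odot> P"
    by (rule mmul_assoc[OF mmul_closed[OF k(4) c(3)] k(1,2), symmetric])
  also have "\<dots> = minv n P \<odot>\<odot> (minv n S \<odot>\<odot> x \<odot>\<odot> S) \<odot>\<odot> P"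
    by (simp add: mmul_assoc[OF k(4) c(3) k(1)])
  finally show ?thesis by (simp add: mconj_def)
qed

end

text \<open>
  Each pair that is simultaneously conjugate into \<open>X\<close> via \<open>S\<close> is so via all \<open>S p\<close> with \<open>p \<in> H\<close>,
  and \<open>S p\<close> together with the two conjugates determines the pair and \<open>p\<close>.
\<close>

lemma simultaneous_conjugation_count:
  assumes X: "X \<subseteq> kmat n n" and H: "H \<subseteq> GLs n"
    and inv: "\<And>p x. p \<in> H \<Longrightarrow> x \<in> X \<Longrightarrow> mconj n p x \<in> X"
    and B: "\<And>x y. (x, y) \<in> B \<Longrightarrow> x \<in> kmat n n \<and> y \<in> kmat n n \<and>
      (\<exists>S\<in>GLs n. mconj n S x \<in> X \<and> mconj n S y \<in> X)"
  shows "card B * card H \<le> card K ^ n\<^sup>2 * (card X)\<^sup>2"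
proof -
  obtain S where S: "\<And>x y. (x, y) \<in> B \<Longrightarrow> S x y \<in> GLs n \<and> mconj n (S x y) x \<in> X \<and> mconj n (S x y) y \<in> X"
    using B by metis
  define \<Phi> where "\<Phi> = (\<lambda>((x, y), p). (S x y \<odot>\<odot> p, mconj n (S x y \<odot>\<odot> p) x, mconj n (S x y \<odot>\<odot> p) y))"
  have "inj_on \<Phi> (B \<times> H)"
  proof (rule inj_onI)
    fix u v assume uv: "u \<in> B \<times> H" "v \<in> B \<times> H" "\<Phi> u = \<Phi> v"
    obtain x y p where u: "u = ((x, y), p)" by (metis surj_pair)
    obtain x' y' p' where v: "v = ((x', y'), p')" by (metis surj_pair)
    have xy: "(x, y) \<in> B" "(x', y') \<in> B" and p: "p \<in> H" "p' \<in> H"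
      and eq: "\<Phi> ((x, y), p) = \<Phi> ((x', y'), p')" using uv by (auto simp: u v)
    define G where "G = S x y \<odot>\<odot> p"
    have G': "G = S x' y' \<odot>\<odot> p'" using eq by (simp add: \<Phi>_def G_def)
    have G: "G \<in> GLs n" unfolding G_def using GLs_mult(1) S[OF xy(1)] p H by blast
    have xk: "x \<in> kmat n n" "y \<in> kmat n n" "x' \<in> kmat n n" "y' \<in> kmat n n" using B xy by auto
    have e: "mconj n G x = mconj n G x'" "mconj n G y = mconj n G y'"
      using eq by (auto simp: \<Phi>_def G_def)
    have x: "x = x'" using mconj_back[OF G xk(1)] mconj_back[OF G xk(3)] e(1) by metis
    have y: "y = y'" using mconj_back[OF G xk(2)] mconj_back[OF G xk(4)] e(2) by metis
    have "S x y \<odot>\<odot> p = S x y \<odot>\<odot> p'" using G' x y by (simp add: G_def)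
    then have "p = p'"
      using indep_cancel[OF KF, of n n "S x y" p n p'] S[OF xy(1)] p H GLs_kmat
      by (auto simp: GLs_def kmat_matsK)
    then show "u = v" using x y by (simp add: u v)
  qed
  moreover have "\<Phi> ` (B \<times> H) \<subseteq> GLs n \<times> (X \<times> X)"
  proof (rule image_subsetI)
    fix u assume u': "u \<in> B \<times> H"
    obtain x y p where u: "u = ((x, y), p)" by (metis surj_pair)
    have xy: "(x, y) \<in> B" and p: "p \<in> H" using u' by (auto simp: u)
    have pG: "p \<in> GLs n" using p H by blast
    note Sxy = S[OF xy]
    have k: "x \<in> kmat n n" "y \<in> kmat n n" using B[OF xy] by auto
    show "\<Phi> u \<in> GLs n \<times> (X \<times> X)"
      using Sxy GLs_mult(1)[OF _ pG, of "S x y"] mconj_mconj[OF _ k(1) pG, of "S x y"]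
        mconj_mconj[OF _ k(2) pG, of "S x y"] inv[OF p] by (simp add: \<Phi>_def u)
  qed
  moreover have fX: "finite X" using finite_subset[OF X finite_kmat] .
  moreover have "finite (GLs n \<times> (X \<times> X))" using finite_GLs fX by simp
  ultimately have "card (B \<times> H) \<le> card (GLs n \<times> (X \<times> X))"
    by (metis card_inj_on_le)
  then have "card B * card H \<le> card (GLs n) * (card X)\<^sup>2"
    by (simp add: card_cartesian_product power2_eq_square)
  also have "\<dots> \<le> card K ^ n\<^sup>2 * (card X)\<^sup>2" by (intro mult_right_mono card_GLs_le) auto
  finally show ?thesis .
qed

section \<open>Block triangular matrices\<close>

definition parabolic :: "nat \<Rightarrow> nat \<Rightarrow> 'a mat \<Rightarrow> 'a mat \<Rightarrow> 'a mat \<Rightarrow> 'a mat" where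
  "parabolic d e A N D = four_block_mat A N (mzero e d) D"

lemma parabolic_closed:
  "A \<in> kmat d d \<Longrightarrow> N \<in> kmat d e \<Longrightarrow> D \<in> kmat e e \<Longrightarrow> parabolic d e A N D \<in> kmat (d + e) (d + e)"
  unfolding parabolic_def by (rule four_block_kmat)

lemma parabolic_mult:
  assumes k: "A \<in> kmat d d" "N \<in> kmat d e" "D \<in> kmat e e" "A' \<in> kmat d d" "N' \<in> kmat d e" "D' \<in> kmat e e"
  shows "parabolic d e A N D \<odot>\<odot> parabolic d e A' N' D'
    = parabolic d e (A \<odot>\<odot> A') (A \<odot>\<odot> N' \<oplus>\<oplus> N \<odot>\<odot> D') (D \<odot>\<odot> D')"
proof -
  obtain a where a: "a \<in> carrier_mat d d" "A = map_mat gen_eval a" by (rule kmat_cases[OF k(1)])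
  obtain b where b: "b \<in> carrier_mat d e" "N = map_mat gen_eval b" by (rule kmat_cases[OF k(2)])
  obtain c where c: "c \<in> carrier_mat e e" "D = map_mat gen_eval c" by (rule kmat_cases[OF k(3)])
  obtain a' where a': "a' \<in> carrier_mat d d" "A' = map_mat gen_eval a'" by (rule kmat_cases[OF k(4)])
  obtain b' where b': "b' \<in> carrier_mat d e" "N' = map_mat gen_eval b'" by (rule kmat_cases[OF k(5)])
  obtain c' where c': "c' \<in> carrier_mat e e" "D' = map_mat gen_eval c'" by (rule kmat_cases[OF k(6)])
  have par: "parabolic d e (map_mat gen_eval u) (map_mat gen_eval v) (map_mat gen_eval w)
      = map_mat gen_eval (four_block_mat u v (0\<^sub>m e d) w)"
    if "u \<in> carrier_mat d d" "v \<in> carrier_mat d e" "w \<in> carrier_mat e e" for u v w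
    using map_four_block_mat[OF that(1,2) _ that(3), of "0\<^sub>m e d" gen_eval] by (simp add: parabolic_def)
  have "four_block_mat a b (0\<^sub>m e d) c * four_block_mat a' b' (0\<^sub>m e d) c'
      = four_block_mat (a * a') (a * b' + b * c') (0\<^sub>m e d) (c * c')"
    using mult_four_block_mat[OF a(1) b(1) _ c(1) a'(1) b'(1) _ c'(1), of "0\<^sub>m e d" "0\<^sub>m e d"] a(1) b(1) c(1) a'(1) b'(1) c'(1)
    by (simp add: left_add_zero_mat[of _ e e] right_add_zero_mat[of _ d d])
  then show ?thesis
    using a b c a' b' c' par[of a b c] par[of a' b' c'] par[of "a * a'" "a * b' + b * c'" "c * c'"] by simp
qed

lemma parabolic_one: "parabolic d e (mone d) (mzero d e) (mone e) = mone (d + e)"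
  unfolding parabolic_def by (rule eq_matI) (auto simp: mone_def mzero_def)

text \<open>The inverse is again block triangular, with corner \<open>- A^-1 N D^-1\<close>. This is
  what makes the block triangular matrices stable under conjugation by the invertible ones among
  them.\<close>

lemma parabolic_GLs:
  assumes A: "A \<in> GLs d" and N: "N \<in> kmat d e" and D: "D \<in> GLs e"
  shows "parabolic d e A N D \<in> GLs (d + e)"
    and "\<exists>N'\<in>kmat d e. minv (d + e) (parabolic d e A N D) = parabolic d e (minv d A) N' (minv e D)"
proof -
  note k = GLs_kmat[OF A] GLs_kmat[OF D] minv[OF A] minv[OF D]
  define N' where "N' = mneg (minv d A \<odot>\<odot> N \<odot>\<odot> minv e D)"
  have AN: "minv d A \<odot>\<odot> N \<in> kmat d e" using mmul_closed[OF k(3) N] .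
  have N': "N' \<in> kmat d e" unfolding N'_def using mmul_closed[OF AN k(6)] by simp
  have "N' \<odot>\<odot> D = mneg (minv d A \<odot>\<odot> N \<odot>\<odot> minv e D \<odot>\<odot> D)"
    unfolding N'_def by (rule mmul_neg(2)[OF mmul_closed[OF AN k(6)] k(2)])
  also have "minv d A \<odot>\<odot> N \<odot>\<odot> minv e D \<odot>\<odot> D = minv d A \<odot>\<odot> N"
    using mmul_assoc[OF AN k(6,2)] k(8) AN by simp
  finally have z: "minv d A \<odot>\<odot> N \<oplus>\<oplus> N' \<odot>\<odot> D = mzero d e" using AN by simp
  have M: "parabolic d e A N D \<in> kmat (d + e) (d + e)" by (rule parabolic_closed[OF k(1) N k(2)])
  have T: "parabolic d e (minv d A) N' (minv e D) \<in> kmat (d + e) (d + e)"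
    by (rule parabolic_closed[OF k(3) N' k(6)])
  have TM: "parabolic d e (minv d A) N' (minv e D) \<odot>\<odot> parabolic d e A N D = mone (d + e)"
    using parabolic_mult[OF k(3) N' k(6,1) N k(2)] z k by (simp add: parabolic_one)
  show "parabolic d e A N D \<in> GLs (d + e)" by (rule GLsI[OF M T TM])
  show "\<exists>N'\<in>kmat d e. minv (d + e) (parabolic d e A N D) = parabolic d e (minv d A) N' (minv e D)"
    using minv_unique[OF M T TM] N' by blast
qed

definition parabolics :: "nat \<Rightarrow> nat \<Rightarrow> 'a mat set" where
  "parabolics n d = (\<lambda>(A, N, D). parabolic d (n - d) A N D) ` (kmat d d \<times> kmat d (n - d) \<times> kmat (n - d) (n - d))"

lemma parabolicsI:
  "A \<in> kmat d d \<Longrightarrow> N \<in> kmat d (n - d) \<Longrightarrow> D \<in> kmat (n - d) (n - d) \<Longrightarrow>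
    parabolic d (n - d) A N D \<in> parabolics n d"
  unfolding parabolics_def by (rule image_eqI[of _ _ "(A, N, D)"]) auto

lemma parabolic_inj:
  assumes "A \<in> kmat d d" "N \<in> kmat d e" "D \<in> kmat e e" "A' \<in> kmat d d" "N' \<in> kmat d e" "D' \<in> kmat e e"
    "parabolic d e A N D = parabolic d e A' N' D'"
  shows "A = A' \<and> N = N' \<and> D = D'"
proof -
  let ?z = "mzero e d"
  have z: "?z \<in> mats K e d" using mzero_closed by (simp add: kmat_matsK)
  have k: "A \<in> mats K d d" "N \<in> mats K d e" "D \<in> mats K e e" "A' \<in> mats K d d" "N' \<in> mats K d e" "D' \<in> mats K e e"
    using assms by (simp_all add: kmat_matsK)
  have "hcat (vcat A ?z) (vcat N D) = hcat (vcat A' ?z) (vcat N' D')"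
    using assms(7) four_block_hcat[OF k(1,2) z k(3)] four_block_hcat[OF k(4,5) z k(6)]
    by (simp add: parabolic_def)
  then have "vcat A ?z = vcat A' ?z \<and> vcat N D = vcat N' D'"
    by (intro hcat_inj[of _ K "d + e" d _ _ e]) (use k z in auto)
  then show ?thesis
    using vcat_inj[OF k(1,4) z z] vcat_inj[OF k(2,5,3,6)] by blast
qed

lemma cp_monic_poly: "x \<in> kmat n n \<Longrightarrow> monic n (cp n x)"
proof -
  assume x: "x \<in> kmat n n"
  interpret UP: UP_domain R "UP R" by unfold_locales
  have c: "cp n x \<in> carrier (UP R)" by (rule cp_closed[OF x])
  then have co: "up_ring.coeff (UP R) (cp n x) i = cp n x i" for i by (simp add: UP_def)
  have "deg R (cp n x) = n"
    by (rule le_antisym[OF UP.deg_aboveI UP.deg_belowI]) (use cp_monic[OF x] c co in auto)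
  then show ?thesis using c co cp_monic[OF x] by (simp add: monic_def)
qed

text \<open>The diagonal blocks have characteristic polynomials \<open>g\<close> and
  \<open>h\<close> with \<open>g h = f\<close>. Each of them determines the other, so the divisors
  of the smaller of the two degrees bound the number of such pairs; hence the minimum. The class
  bounds of the two blocks contribute \<open>d (n - d)\<close>, which is at most \<open>n^2\<close>
  and explains the \<open>+ 2\<close>.\<close>

lemma card_parabolics_char_class:
  assumes d: "0 < d" "d < n" and f: "monic n f"
  shows "card (parabolics n d \<inter> char_class n f)
    \<le> n ^ (min d (n - d) + 2) * card K ^ (n\<^sup>2 - n - d * (n - d))"
proof -
  interpret UP: UP_domain R "UP R" by unfold_locales
  let ?e = "n - d" and ?Q = "card K"
  define P where "P = {(g, h). monic d g \<and> monic ?e h \<and> f = g \<otimes>\<^bsub>UP R\<^esub> h}"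
  have mc: "monic m g \<Longrightarrow> g \<in> carrier (UP R)" for m g by (simp add: monic_def)
  have i1: "inj_on fst P" and i2: "inj_on snd P"
  proof -
    have "g = g' \<longleftrightarrow> h = h'" if "(g, h) \<in> P" "(g', h') \<in> P" for g h g' h'
    proof -
      have *: "monic d g" "monic ?e h" "monic d g'" "monic ?e h'" "g \<otimes>\<^bsub>UP R\<^esub> h = g' \<otimes>\<^bsub>UP R\<^esub> h'"
        using that by (auto simp: P_def)
      show ?thesis
        using *(5) UP.m_lcancel[OF monic_nonzero[OF *(1)] mc[OF *(1)] mc[OF *(2)] mc[OF *(4)]]
          UP.m_rcancel[OF monic_nonzero[OF *(2)] mc[OF *(2)] mc[OF *(1)] mc[OF *(3)]] by auto
    qed
    then show "inj_on fst P" "inj_on snd P" by (auto simp: inj_on_def)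
  qed
  have s1: "fst ` P \<subseteq> monic_divisors d f" by (auto simp: P_def monic_divisors_def mc)
  have s2: "snd ` P \<subseteq> monic_divisors ?e f"
  proof
    fix h assume "h \<in> snd ` P"
    then obtain g where "monic d g" and h: "monic ?e h" and "f = g \<otimes>\<^bsub>UP R\<^esub> h" by (auto simp: P_def)
    then have "g \<in> carrier (UP R)" "f = h \<otimes>\<^bsub>UP R\<^esub> g" using mc UP.m_comm by auto
    then show "h \<in> monic_divisors ?e f" using h by (auto simp: monic_divisors_def)
  qed
  note D = card_monic_divisors[OF f]
  have finP: "finite P" using finite_imageD[OF finite_subset[OF s1] i1] D by blast
  have "card P \<le> n ^ d" using card_inj_on_le[OF i1 s1] D[of d] by linarith
  moreover have "card P \<le> n ^ ?e" using card_inj_on_le[OF i2 s2] D[of ?e] by linarith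
  ultimately have cP: "card P \<le> n ^ min d ?e" by (simp add: min_def)
  define Z where "Z = (SIGMA (g, h):P. char_class d g \<times> kmat d ?e \<times> char_class ?e h)"
  have "parabolics n d \<inter> char_class n f \<subseteq> (\<lambda>(_, A, N, D). parabolic d ?e A N D) ` Z"
  proof
    fix x assume x: "x \<in> parabolics n d \<inter> char_class n f"
    then obtain A N D where k: "A \<in> kmat d d" "N \<in> kmat d ?e" "D \<in> kmat ?e ?e"
      and xe: "x = parabolic d ?e A N D" by (auto simp: parabolics_def)
    have "f = cp d A \<otimes>\<^bsub>UP R\<^esub> cp ?e D"
      using cp_block[OF k] x xe d by (simp add: char_class_def parabolic_def)
    then have "(cp d A, cp ?e D) \<in> P" using cp_monic_poly k by (auto simp: P_def)
    then have "((cp d A, cp ?e D), A, N, D) \<in> Z" using k by (auto simp: Z_def char_class_def)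
    then show "x \<in> (\<lambda>(_, A, N, D). parabolic d ?e A N D) ` Z" using xe by force
  qed
  moreover have "finite Z" unfolding Z_def
    by (intro finite_SigmaI finP) (auto simp: finite_char_class finite_kmat)
  ultimately have "card (parabolics n d \<inter> char_class n f) \<le> card Z"
    by (rule surj_card_le[rotated])
  also have "card Z = (\<Sum>(g, h)\<in>P. card (char_class d g) * (?Q ^ (d * ?e) * card (char_class ?e h)))"
    unfolding Z_def by (subst card_SigmaI[OF finP])
      (auto simp: finite_char_class finite_kmat card_cartesian_product card_kmat intro!: sum.cong)
  also have "\<dots> \<le> (\<Sum>(g, h)\<in>P. (d * ?Q ^ (d\<^sup>2 - d)) * (?Q ^ (d * ?e) * (?e * ?Q ^ (?e\<^sup>2 - ?e))))"
  proof (rule sum_mono, clarify)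
    fix g h
    have "card (char_class d g) \<le> d * ?Q ^ (d\<^sup>2 - d)" "card (char_class ?e h) \<le> ?e * ?Q ^ (?e\<^sup>2 - ?e)"
      by (rule card_char_class_le; use d in simp)+
    then show "card (char_class d g) * (?Q ^ (d * ?e) * card (char_class ?e h))
        \<le> d * ?Q ^ (d\<^sup>2 - d) * (?Q ^ (d * ?e) * (?e * ?Q ^ (?e\<^sup>2 - ?e)))"
      by (intro mult_mono) auto
  qed
  also have "\<dots> = card P * ((d * ?e) * ?Q ^ (d\<^sup>2 - d + d * ?e + (?e\<^sup>2 - ?e)))"
    by (simp add: power_add algebra_simps)
  also have "\<dots> \<le> n ^ min d ?e * (n\<^sup>2 * ?Q ^ (d\<^sup>2 - d + d * ?e + (?e\<^sup>2 - ?e)))"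
    unfolding power2_eq_square[of n] by (intro mult_mono cP) (use d in auto)
  also have "d\<^sup>2 - d + d * ?e + (?e\<^sup>2 - ?e) = n\<^sup>2 - n - d * ?e"
  proof -
    obtain e where e: "n = d + e" using d by (auto dest: less_imp_add_positive)
    have "d \<le> d\<^sup>2" "e \<le> e\<^sup>2" by (simp_all add: power2_nat_le_imp_le power2_eq_square)
    moreover have "(d + e)\<^sup>2 = d\<^sup>2 + e\<^sup>2 + 2 * (d * e)" by (simp add: power2_sum)
    ultimately show ?thesis unfolding e by simp
  qed
  finally show ?thesis by (simp only: power_add mult.assoc)
qed

text \<open>With \<open>e = n - d\<close>, restricting to block triangular form loses a factor
  \<open>Q^(d e)\<close> for each of \<open>x\<close> and \<open>y\<close>, while the conjugating
  group is smaller than GL by only one such factor. The net gain is \<open>Q^(d e)\<close>; the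
  constant 16 stems from the lower bounds for the orders of GL(d) and GL(e).\<close>

lemma card_parabolic_pairs:
  assumes d: "0 < d" "d < n" and f: "monic n f"
    and B: "\<And>x y. (x, y) \<in> B \<Longrightarrow> x \<in> char_class n f \<and> y \<in> char_class n f \<and>
      (\<exists>S\<in>GLs n. mconj n S x \<in> parabolics n d \<and> mconj n S y \<in> parabolics n d)"
  shows "card B * card K ^ (d * (n - d))
    \<le> 16 * n ^ (2 * min d (n - d) + 4) * card K ^ (2 * (n\<^sup>2 - n))"
proof -
  let ?e = "n - d" and ?Q = "card K"
  have de: "d + ?e = n" using d by simp
  define X where "X = parabolics n d \<inter> char_class n f"
  define H where "H = (\<lambda>(A, N, D). parabolic d ?e A N D) ` (GLs d \<times> kmat d ?e \<times> GLs ?e)"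
  have "card B * card H \<le> ?Q ^ n\<^sup>2 * (card X)\<^sup>2"
  proof (rule simultaneous_conjugation_count[where X = X and H = H and B = B])
    show "X \<subseteq> kmat n n" by (auto simp: X_def char_class_def)
    show "H \<subseteq> GLs n" using parabolic_GLs(1)[of _ d _ ?e] de by (auto simp: H_def)
    show "mconj n p x \<in> X" if p: "p \<in> H" and x: "x \<in> X" for p x
    proof -
      obtain A N D where pe: "p = parabolic d ?e A N D" and A: "A \<in> GLs d" and N: "N \<in> kmat d ?e" and D: "D \<in> GLs ?e"
        using p by (auto simp: H_def)
      obtain A' M D' where xe: "x = parabolic d ?e A' M D'" and A': "A' \<in> kmat d d" and M: "M \<in> kmat d ?e" and D': "D' \<in> kmat ?e ?e"
        using x by (auto simp: X_def parabolics_def)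
      obtain N' where N': "N' \<in> kmat d ?e" "minv n p = parabolic d ?e (minv d A) N' (minv ?e D)"
        using parabolic_GLs(2)[OF A N D] de pe by auto
      note k = minv(1)[OF A] minv(1)[OF D] GLs_kmat[OF A] GLs_kmat[OF D]
      have e1: "minv n p \<odot>\<odot> x = parabolic d ?e (minv d A \<odot>\<odot> A') (minv d A \<odot>\<odot> M \<oplus>\<oplus> N' \<odot>\<odot> D') (minv ?e D \<odot>\<odot> D')"
        unfolding N'(2) xe by (rule parabolic_mult[OF k(1) N'(1) k(2) A' M D'])
      note k' = mmul_closed[OF k(1) A'] madd_closed[OF mmul_closed[OF k(1) M] mmul_closed[OF N'(1) D']] mmul_closed[OF k(2) D']
      have "mconj n p x = parabolic d ?e (minv d A \<odot>\<odot> A' \<odot>\<odot> A)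
          (minv d A \<odot>\<odot> A' \<odot>\<odot> N \<oplus>\<oplus> (minv d A \<odot>\<odot> M \<oplus>\<oplus> N' \<odot>\<odot> D') \<odot>\<odot> D) (minv ?e D \<odot>\<odot> D' \<odot>\<odot> D)"
        unfolding mconj_def e1 unfolding pe by (rule parabolic_mult[OF k' k(3) N k(4)])
      moreover have "minv d A \<odot>\<odot> A' \<odot>\<odot> A \<in> kmat d d"
        "minv d A \<odot>\<odot> A' \<odot>\<odot> N \<oplus>\<oplus> (minv d A \<odot>\<odot> M \<oplus>\<oplus> N' \<odot>\<odot> D') \<odot>\<odot> D \<in> kmat d ?e"
        "minv ?e D \<odot>\<odot> D' \<odot>\<odot> D \<in> kmat ?e ?e"
        using mmul_closed[OF k'(1) k(3)] madd_closed[OF mmul_closed[OF k'(1) N] mmul_closed[OF k'(2) k(4)]]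
          mmul_closed[OF k'(3) k(4)] by auto
      ultimately have "mconj n p x \<in> parabolics n d" by (simp add: parabolicsI)
      moreover have pG: "p \<in> GLs n" using parabolic_GLs(1)[OF A N D] de pe by simp
      have xk: "x \<in> kmat n n" using x by (simp add: X_def char_class_def)
      have "mconj n p x \<in> char_class n f"
        using cp_mconj[OF pG xk] mconj_closed[OF pG xk] x by (simp add: X_def char_class_def)
      ultimately show ?thesis by (simp add: X_def)
    qed
    show "x \<in> kmat n n \<and> y \<in> kmat n n \<and> (\<exists>S\<in>GLs n. mconj n S x \<in> X \<and> mconj n S y \<in> X)"
      if xy: "(x, y) \<in> B" for x y
    proof -
      have k: "x \<in> kmat n n" "y \<in> kmat n n" using B[OF xy] by (auto simp: char_class_def)
      obtain S where S: "S \<in> GLs n" "mconj n S x \<in> parabolics n d" "mconj n S y \<in> parabolics n d"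
        using B[OF xy] by blast
      have "mconj n S x \<in> char_class n f" "mconj n S y \<in> char_class n f"
        using cp_mconj[OF S(1) k(1)] cp_mconj[OF S(1) k(2)] mconj_closed[OF S(1) k(1)] mconj_closed[OF S(1) k(2)] B[OF xy]
        by (auto simp: char_class_def)
      then show ?thesis using k S by (auto simp: X_def)
    qed
  qed
  also have "\<dots> \<le> ?Q ^ n\<^sup>2 * (n ^ (min d ?e + 2) * ?Q ^ (n\<^sup>2 - n - d * ?e))\<^sup>2"
    unfolding X_def by (intro mult_left_mono power_mono card_parabolics_char_class[OF d f]) auto
  finally have 1: "card B * card H \<le> ?Q ^ n\<^sup>2 * (n ^ (min d ?e + 2) * ?Q ^ (n\<^sup>2 - n - d * ?e))\<^sup>2" .
  have cH: "card H = card (GLs d) * (?Q ^ (d * ?e) * card (GLs ?e))"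
  proof -
    have "inj_on (\<lambda>(A, N, D). parabolic d ?e A N D) (GLs d \<times> kmat d ?e \<times> GLs ?e)"
      by (rule inj_onI) (auto dest!: parabolic_inj[rotated 6] simp: GLs_kmat)
    then show ?thesis by (simp add: H_def card_image card_cartesian_product card_kmat)
  qed
  obtain e where e: "n = d + e" using d by (auto dest: less_imp_add_positive)
  have dd: "d \<le> d\<^sup>2" "e \<le> e\<^sup>2" by (simp_all add: power2_eq_square)
  have sq: "(d + e)\<^sup>2 = d\<^sup>2 + e\<^sup>2 + 2 * (d * e)" by (simp add: power2_sum)
  have "?Q ^ (d\<^sup>2) * (?Q ^ (d * e) * ?Q ^ e\<^sup>2) \<le> (4 * card (GLs d)) * (?Q ^ (d * e) * (4 * card (GLs e)))"
    by (intro mult_mono card_GLs_ge) auto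
  then have 2: "?Q ^ (d\<^sup>2 + d * e + e\<^sup>2) \<le> 16 * card H"
    unfolding cH by (simp add: e power_add algebra_simps)
  have "card B * ?Q ^ (d * e) * ?Q ^ (d\<^sup>2 + d * e + e\<^sup>2) \<le> ?Q ^ (d * e) * (16 * (card B * card H))"
    using mult_left_mono[OF 2, of "card B * ?Q ^ (d * e)"] by (simp add: algebra_simps)
  also have "\<dots> \<le> ?Q ^ (d * e) * (16 * (?Q ^ n\<^sup>2 * (n ^ (min d ?e + 2) * ?Q ^ (n\<^sup>2 - n - d * ?e))\<^sup>2))"
    using 1 by (intro mult_left_mono) auto
  also have "\<dots> = 16 * n ^ (2 * min d ?e + 4) * ?Q ^ (d * e + n\<^sup>2 + 2 * (n\<^sup>2 - n - d * e))"
  proof -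
    have "(n ^ (min d ?e + 2))\<^sup>2 = n ^ (2 * min d ?e + 4)"
      unfolding power_mult[symmetric] by (rule arg_cong[where f = "power n"]) simp
    moreover have "(?Q ^ (n\<^sup>2 - n - d * ?e))\<^sup>2 = ?Q ^ (2 * (n\<^sup>2 - n - d * e))"
      unfolding power_mult[symmetric] by (rule arg_cong[where f = "power ?Q"]) (simp add: e)
    ultimately have "(n ^ (min d ?e + 2) * ?Q ^ (n\<^sup>2 - n - d * ?e))\<^sup>2
        = n ^ (2 * min d ?e + 4) * ?Q ^ (2 * (n\<^sup>2 - n - d * e))"
      by (simp only: power_mult_distrib[of "n ^ (min d ?e + 2)"])
    then show ?thesis by (simp only: power_add ac_simps)
  qed
  also have "d * e + n\<^sup>2 + 2 * (n\<^sup>2 - n - d * e) = 2 * (n\<^sup>2 - n) + (d\<^sup>2 + d * e + e\<^sup>2)"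
    using dd sq unfolding e by simp
  finally have "card B * ?Q ^ (d * e) * ?Q ^ (d\<^sup>2 + d * e + e\<^sup>2)
      \<le> 16 * n ^ (2 * min d ?e + 4) * ?Q ^ (2 * (n\<^sup>2 - n)) * ?Q ^ (d\<^sup>2 + d * e + e\<^sup>2)"
    by (simp add: power_add mult.assoc)
  moreover have "?Q > 0" using subfield_card_ge_2[OF KF] by simp
  ultimately show ?thesis using e by (simp add: mult_le_cancel2)
qed

section \<open>Subspaces, bases and invariant subspaces\<close>

definition subspace :: "nat \<Rightarrow> 'a mat set \<Rightarrow> bool" where
  "subspace n U \<longleftrightarrow> U \<subseteq> kmat n 1 \<and> mzero n 1 \<in> U \<and> (\<forall>u\<in>U. \<forall>v\<in>U. u \<oplus>\<oplus> v \<in> U)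
     \<and> (\<forall>c\<in>K. \<forall>u\<in>U. mscale c u \<in> U)"

lemma subspaceD:
  assumes "subspace n U"
  shows "U \<subseteq> kmat n 1" "mzero n 1 \<in> U" "u \<in> U \<Longrightarrow> v \<in> U \<Longrightarrow> u \<oplus>\<oplus> v \<in> U" "c \<in> K \<Longrightarrow> u \<in> U \<Longrightarrow> mscale c u \<in> U"
  using assms by (auto simp: subspace_def)

lemma kmat_1_1:
  assumes "c \<in> kmat 1 1"
  shows "c = mscale (c $$ (0, 0)) (mone 1)"
  by (rule eq_matI) (use assms in \<open>auto simp: mscale_def mone_def kmat_dim kmat_entry\<close>)

lemma mmul_1_1:
  assumes "v \<in> kmat n 1" "c \<in> kmat 1 1"
  shows "v \<odot>\<odot> c = mscale (c $$ (0, 0)) v"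
proof -
  have "c $$ (0, 0) \<in> K" using assms(2) by (rule kmat_entry) auto
  then show ?thesis
    using assms(1) mmul_scale(1)[of "c $$ (0, 0)" v n 1 "mone 1" 1] by (subst kmat_1_1[OF assms(2)]) simp
qed

lemma kmat_split_last:
  assumes "b \<in> kmat n (Suc d)"
  obtains b' v where "b' \<in> kmat n d" "v \<in> kmat n 1" "b = hcat b' v"
  by (rule hcat_cases[OF assms[unfolded Suc_eq_plus1 kmat_matsK]]) (rule that, simp_all add: kmat_matsK)

lemma subspace_mmul:
  assumes U: "subspace n U"
  shows "b \<in> kmat n d \<Longrightarrow> (\<And>j. j < d \<Longrightarrow> mcol b j \<in> U) \<Longrightarrow> u \<in> kmat d 1 \<Longrightarrow> b \<odot>\<odot> u \<in> U"
proof (induction d arbitrary: b u)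
  case 0
  then have "b \<odot>\<odot> u = mzero n 1" by (intro eq_matI) (auto simp: mmul_def mzero_def kmat_dim)
  then show ?case using subspaceD[OF U] by simp
next
  case (Suc d)
  obtain b' v where b: "b' \<in> kmat n d" "v \<in> kmat n 1" "b = hcat b' v" using kmat_split_last[OF Suc(2)] .
  obtain w c where u: "w \<in> kmat d 1" "c \<in> kmat 1 1" "u = vcat w c"
    by (rule vcat_cases[OF Suc(4)[unfolded Suc_eq_plus1 kmat_matsK]]) (rule that, simp_all add: kmat_matsK)
  have "mcol b' j = mcol b j" if "j < d" for j
    using b that by (intro eq_matI) (auto simp: mcol_def hcat_def kmat_dim)
  then have "b' \<odot>\<odot> w \<in> U" using Suc.IH[OF b(1) _ u(1)] Suc(3) by simp
  moreover have "mcol b d = v"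
    using b by (intro eq_matI) (auto simp: mcol_def hcat_def kmat_dim)
  then have "v \<in> U" using Suc(3)[of d] by simp
  then have "v \<odot>\<odot> c \<in> U"
    using mmul_1_1[OF b(2) u(2)] subspaceD(4)[OF U] kmat_entry[OF u(2), of 0 0] by simp
  ultimately show ?case unfolding b(3) u(3) mmul_hcat_vcat[OF b(1,2) u(1,2)] by (rule subspaceD(3)[OF U])
qed

text \<open>\<open>W\<close> is an arbitrary set of vectors. The descent to a subfield applies this
  to the vectors fixed by a semilinear map, which need not form a \<open>K\<close>-subspace.\<close>

lemma maximal_indep:
  assumes W: "W \<subseteq> kmat n 1"
  obtains d b where "indep K n d b" "\<And>j. j < d \<Longrightarrow> mcol b j \<in> W" "W \<subseteq> col_span K d b"
proof -
  define P where "P d \<longleftrightarrow> (\<exists>b. indep K n d b \<and> (\<forall>j<d. mcol b j \<in> W))" for d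
  have P0: "P 0"
    using indep_empty[OF KF, of "mzero n 0" n] mzero_closed[of n 0] by (auto simp: P_def kmat_matsK)
  have "\<not> P (Suc n)" using indep_le[OF KF, of n "Suc n"] by (auto simp: P_def)
  moreover have "P d" if "\<forall>d. P d \<longrightarrow> P (Suc d)" for d
    by (induction d) (use P0 that in auto)
  ultimately obtain d where "P d" and max: "\<not> P (Suc d)" by blast
  then obtain b where b: "indep K n d b" "\<And>j. j < d \<Longrightarrow> mcol b j \<in> W" by (auto simp: P_def)
  have bk: "b \<in> kmat n d" using indepD[OF b(1)] by (simp add: kmat_matsK)
  have "W \<subseteq> col_span K d b"
  proof (rule ccontr)
    assume "\<not> W \<subseteq> col_span K d b"
    then obtain v where v: "v \<in> W" "v \<notin> col_span K d b" by blast
    have vk: "v \<in> kmat n 1" using v W by auto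
    have "indep K n (Suc d) (hcat b v)" using indep_extend[OF KF b(1)] v vk by (simp add: kmat_matsK)
    moreover have "mcol (hcat b v) j \<in> W" if "j < Suc d" for j
    proof (cases "j = d")
      case True
      have "mcol (hcat b v) j = v"
        using bk vk True by (intro eq_matI) (auto simp: mcol_def hcat_def kmat_dim)
      then show ?thesis using v by simp
    next
      case False
      have "mcol (hcat b v) j = mcol b j"
        using bk vk False that by (intro eq_matI) (auto simp: mcol_def hcat_def kmat_dim)
      then show ?thesis using b(2)[of j] that False by simp
    qed
    ultimately show False using max unfolding P_def by blast
  qed
  then show ?thesis using that[OF b] by blast
qed

lemma subspace_basis:
  assumes U: "subspace n U"
  obtains d b where "indep K n d b" "col_span K d b = U"
proof -
  obtain d b where b: "indep K n d b" "\<And>j. j < d \<Longrightarrow> mcol b j \<in> U" "U \<subseteq> col_span K d b"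
    using maximal_indep[OF subspaceD(1)[OF U]] by metis
  have bk: "b \<in> kmat n d" using indepD[OF b(1)] by (simp add: kmat_matsK)
  have "col_span K d b \<subseteq> U"
    using subspace_mmul[OF U bk b(2)] by (auto simp: col_span_def kmat_matsK)
  then show ?thesis using that[OF b(1)] b(3) by blast
qed

lemma subspace_col_span:
  assumes b: "b \<in> kmat n d"
  shows "subspace n (col_span K d b)"
  unfolding subspace_def
proof (intro conjI ballI)
  show "col_span K d b \<subseteq> kmat n 1" using mmul_closed[OF b] by (auto simp: col_span_def kmat_matsK)
  show "mzero n 1 \<in> col_span K d b"
    unfolding col_span_def using mmul_zero(1)[OF b, of 1] mzero_closed[of d 1]
    by (intro image_eqI[of _ _ "mzero d 1"]) (auto simp: kmat_matsK)
  fix u assume "u \<in> col_span K d b"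
  then obtain a where a: "a \<in> kmat d 1" "u = b \<odot>\<odot> a" by (auto simp: col_span_def kmat_matsK)
  show "mscale c u \<in> col_span K d b" if c: "c \<in> K" for c
    unfolding col_span_def using mmul_scale(1)[OF c b a(1)] mscale_closed[OF c a(1)] a(2)
    by (intro image_eqI[of _ _ "mscale c a"]) (auto simp: kmat_matsK)
  fix v assume "v \<in> col_span K d b"
  then obtain a' where a': "a' \<in> kmat d 1" "v = b \<odot>\<odot> a'" by (auto simp: col_span_def kmat_matsK)
  show "u \<oplus>\<oplus> v \<in> col_span K d b"
    unfolding col_span_def using mmul_distrib_left[OF b a(1) a'(1)] madd_closed[OF a(1) a'(1)] a(2) a'(2)
    by (intro image_eqI[of _ _ "a \<oplus>\<oplus> a'"]) (auto simp: kmat_matsK)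
qed

text \<open>The basis depends on \<open>U\<close> alone, so a single \<open>S\<close> serves all
  matrices that preserve \<open>U\<close>, in particular both members of a pair.\<close>

lemma subspace_parabolic:
  assumes U: "subspace n U" and ne: "U \<noteq> {mzero n 1}" "U \<noteq> kmat n 1"
  obtains d S where "0 < d" "d < n" "S \<in> GLs n"
    "\<And>x. x \<in> kmat n n \<Longrightarrow> (\<And>u. u \<in> U \<Longrightarrow> x \<odot>\<odot> u \<in> U) \<Longrightarrow> mconj n S x \<in> parabolics n d"
proof -
  obtain d b where b: "indep K n d b" "col_span K d b = U" using subspace_basis[OF U] .
  have bk: "b \<in> kmat n d" using indepD[OF b(1)] by (simp add: kmat_matsK)
  have d0: "0 < d"
  proof (rule ccontr)
    assume "\<not> 0 < d"
    then have "card U = 1" using card_col_span[OF KF b(1)] b(2) by simp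
    then obtain u where "U = {u}" by (rule card_1_singletonE)
    then show False using ne(1) subspaceD(2)[OF U] by auto
  qed
  have dn: "d < n"
  proof (rule ccontr)
    assume "\<not> d < n"
    then have "d = n" using indep_le[OF KF b(1)] by simp
    then show False using col_span_full[OF KF, of n b] b ne(2) by (simp add: kmat_matsK)
  qed
  define c where "c = complete n d b"
  note c = complete(2,3)[OF b(1), folded c_def]
  have S: "hcat b c \<in> GLs n" using c by (simp add: GLs_def)
  have "mconj n (hcat b c) x \<in> parabolics n d" if x: "x \<in> kmat n n" and st: "\<And>u. u \<in> U \<Longrightarrow> x \<odot>\<odot> u \<in> U" for x
  proof -
    have "\<exists>a. a \<in> kmat d 1 \<and> b \<odot>\<odot> a = mcol (x \<odot>\<odot> b) j" if j: "j < d" for j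
    proof -
      have "mcol b j = b \<odot>\<odot> mcol (mone d) j" using mmul_mcol_mone[OF bk j] by simp
      moreover have "mcol (mone d) j \<in> mats K d 1"
        by (rule mcol_mats[OF _ j]) (use mone_closed[of d] in \<open>simp add: kmat_matsK\<close>)
      ultimately have "mcol b j \<in> U" unfolding b(2)[symmetric] col_span_def by blast
      then have "mcol (x \<odot>\<odot> b) j \<in> U" using st mcol_mmul[OF x bk j] by simp
      then show ?thesis unfolding b(2)[symmetric] col_span_def by (auto simp: kmat_matsK)
    qed
    then obtain a where a: "\<And>j. j < d \<Longrightarrow> a j \<in> kmat d 1 \<and> b \<odot>\<odot> a j = mcol (x \<odot>\<odot> b) j" by metis
    define P where "P = mjoin d d a"
    have P: "P \<in> kmat d d" unfolding P_def using a by (auto simp: kmat_matsK)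
    have xb: "x \<odot>\<odot> b = b \<odot>\<odot> P"
    proof (rule mats_eqI_mcol[of _ K n d])
      fix j assume j: "j < d"
      show "mcol (x \<odot>\<odot> b) j = mcol (b \<odot>\<odot> P) j"
        using mcol_mmul[OF bk P j] mcol_mjoin[OF j, of a K d] a[OF j] by (simp add: P_def kmat_matsK)
    qed (use mmul_closed[OF x bk] mmul_closed[OF bk P] in \<open>simp_all add: kmat_matsK\<close>)
    have "x \<odot>\<odot> c \<in> mats K n (n - d)" using mmul_closed[OF x c(2)] by (simp add: kmat_matsK)
    from indep_solve[OF KF c(1) this] obtain W where W: "W \<in> kmat n (n - d)" "hcat b c \<odot>\<odot> W = x \<odot>\<odot> c"
      by (auto simp: kmat_matsK)
    obtain N D where N: "N \<in> kmat d (n - d)" and D: "D \<in> kmat (n - d) (n - d)" and WN: "W = vcat N D"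
      using vcat_cases[of W K d "n - d" "n - d"] W dn by (auto simp: kmat_matsK)
    have "x \<odot>\<odot> hcat b c = hcat b c \<odot>\<odot> parabolic d (n - d) P N D"
      unfolding parabolic_def by (rule block_form(1)[OF _ bk c(2,1) x P N D xb]) (use dn W WN in auto)
    then have "mconj n (hcat b c) x = parabolic d (n - d) P N D"
      using mconj_unique[OF S x] parabolic_closed[OF P N D] dn by simp
    then show ?thesis using parabolicsI[OF P N D] by simp
  qed
  then show ?thesis using that[OF d0 dn S] by blast
qed

text \<open>A nonzero polynomial of degree below \<open>m\<close> has fewer than \<open>m\<close>
  roots. It yields the inversion of the Fourier transform over the units and the uniqueness of a
  subfield of given order.\<close>

lemma poly_fun_zero:
  assumes c: "\<And>i. c i \<in> K" and S: "S \<subseteq> K" "card S \<ge> m"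
    and z: "\<And>a. a \<in> S \<Longrightarrow> (\<Oplus>i\<in>{..<m}. c i \<otimes> a [^] i) = \<zero>"
    and j: "j < m"
  shows "c j = \<zero>"
proof (rule ccontr)
  assume nz: "c j \<noteq> \<zero>"
  interpret UP: UP_domain R "UP R" by unfold_locales
  define f where "f i = (if i < m then c i else \<zero>)" for i
  have f: "f \<in> carrier (UP R)" using c by (auto simp: f_def UP_def up_def bound_def intro!: exI[of _ m])
  then have co: "up_ring.coeff (UP R) f i = f i" for i by (simp add: UP_def)
  have fnz: "f \<noteq> \<zero>\<^bsub>UP R\<^esub>" using nz j by (auto simp: f_def UP_def fun_eq_iff)
  have deg: "deg R f \<le> m - 1" by (rule UP.deg_aboveI[OF _ f]) (auto simp: co f_def)
  have "eval R R id a f = \<zero>" if a: "a \<in> S" for a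
  proof -
    have aK: "a \<in> K" using a S by auto
    have "eval R R id a f = (\<Oplus>i\<in>{..deg R f}. f i \<otimes> a [^] i)"
      using f by (simp add: eval_def co)
    also have "\<dots> = (\<Oplus>i\<in>{..<m}. f i \<otimes> a [^] i)"
    proof (rule add.finprod_mono_neutral_cong_left)
      show "{..deg R f} \<subseteq> {..<m}" using deg j by auto
      fix i assume "i \<in> {..<m} - {..deg R f}"
      then have "f i = \<zero>" using UP.deg_aboveD[OF _ f] co by auto
      then show "f i \<otimes> a [^] i = \<zero>" using aK by simp
    qed (use c aK in \<open>auto simp: f_def\<close>)
    also have "\<dots> = (\<Oplus>i\<in>{..<m}. c i \<otimes> a [^] i)"
      by (rule finsum_cong') (use c aK in \<open>auto simp: f_def\<close>)
    finally show ?thesis using z[OF a] by simp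
  qed
  then have "S \<subseteq> {a \<in> K. eval R R id a f = \<zero>}" using S by auto
  then have "card S \<le> card {a \<in> K. eval R R id a f = \<zero>}" by (rule card_mono[rotated]) (simp add: finite_carrier)
  also have "\<dots> \<le> deg R f" using UP.roots_bound[OF f fnz finite_carrier] by simp
  finally show False using S(2) deg j by simp
qed

section \<open>Irreducible proper subrings\<close>

text \<open>Closure under the scalars of \<open>K\<close> is not asked for, since the matrix rings
  over proper subfields have to be covered.\<close>

definition mat_subring :: "nat \<Rightarrow> 'a mat set \<Rightarrow> bool" where
  "mat_subring n B \<longleftrightarrow> B \<subseteq> kmat n n \<and> mone n \<in> B \<and> (\<forall>x\<in>B. mneg x \<in> B)
     \<and> (\<forall>x\<in>B. \<forall>y\<in>B. x \<oplus>\<oplus> y \<in> B) \<and> (\<forall>x\<in>B. \<forall>y\<in>B. x \<odot>\<odot> y \<in> B)"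

text \<open>The invariant subspaces tested are \<open>K\<close>-subspaces although \<open>B\<close>
  need not contain the scalars. So it is the \<open>K\<close>-span of \<open>B\<close> that acts
  irreducibly; as a module over \<open>B\<close> alone the space may be reducible.\<close>

definition irreducible_on :: "nat \<Rightarrow> 'a mat set \<Rightarrow> bool" where
  "irreducible_on n B \<longleftrightarrow> (\<forall>U. subspace n U \<longrightarrow> (\<forall>x\<in>B. \<forall>u\<in>U. x \<odot>\<odot> u \<in> U) \<longrightarrow>
     U = {mzero n 1} \<or> U = kmat n 1)"

text \<open>Additive and not linear on purpose: the linear maps commuting with the matrices over a
  subfield are all scalar, and it is the nonlinear ones that detect the subfield.\<close>

definition additive_commuting :: "nat \<Rightarrow> 'a mat set \<Rightarrow> ('a mat \<Rightarrow> 'a mat) \<Rightarrow> bool" where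
  "additive_commuting n B \<phi> \<longleftrightarrow> (\<forall>v\<in>kmat n 1. \<phi> v \<in> kmat n 1)
     \<and> (\<forall>u\<in>kmat n 1. \<forall>v\<in>kmat n 1. \<phi> (u \<oplus>\<oplus> v) = \<phi> u \<oplus>\<oplus> \<phi> v)
     \<and> (\<forall>x\<in>B. \<forall>v\<in>kmat n 1. \<phi> (x \<odot>\<odot> v) = x \<odot>\<odot> \<phi> v)"

lemma mat_subringD:
  assumes "mat_subring n B"
  shows "x \<in> B \<Longrightarrow> x \<in> kmat n n" "mone n \<in> B" "x \<in> B \<Longrightarrow> mneg x \<in> B"
    "x \<in> B \<Longrightarrow> y \<in> B \<Longrightarrow> x \<oplus>\<oplus> y \<in> B" "x \<in> B \<Longrightarrow> y \<in> B \<Longrightarrow> x \<odot>\<odot> y \<in> B"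
  using assms by (auto simp: mat_subring_def)

section \<open>Left modules over a matrix subring\<close>

definition left_submodule :: "nat \<Rightarrow> 'a mat set \<Rightarrow> 'a mat set \<Rightarrow> bool" where
  "left_submodule n B M \<longleftrightarrow> M \<subseteq> kmat n n \<and> mzero n n \<in> M \<and> (\<forall>x\<in>M. mneg x \<in> M)
     \<and> (\<forall>x\<in>M. \<forall>y\<in>M. x \<oplus>\<oplus> y \<in> M) \<and> (\<forall>b\<in>B. \<forall>x\<in>M. b \<odot>\<odot> x \<in> M)"

lemma left_submoduleD:
  assumes "left_submodule n B M"
  shows "x \<in> M \<Longrightarrow> x \<in> kmat n n" "mzero n n \<in> M" "x \<in> M \<Longrightarrow> mneg x \<in> M"
    "x \<in> M \<Longrightarrow> y \<in> M \<Longrightarrow> x \<oplus>\<oplus> y \<in> M" "b \<in> B \<Longrightarrow> x \<in> M \<Longrightarrow> b \<odot>\<odot> x \<in> M"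
  using assms by (auto simp: left_submodule_def)

lemma left_submodule_self:
  assumes B: "mat_subring n B"
  shows "left_submodule n B B"
proof -
  have "mzero n n \<in> B"
    using mat_subringD(4)[OF B mat_subringD(2)[OF B] mat_subringD(3)[OF B mat_subringD(2)[OF B]]]
      madd_neg(1)[OF mone_closed[of n]] by simp
  then show ?thesis using mat_subringD[OF B] by (auto simp: left_submodule_def)
qed

lemma mneg_madd: "x \<in> kmat r c \<Longrightarrow> y \<in> kmat r c \<Longrightarrow> mneg (x \<oplus>\<oplus> y) = mneg x \<oplus>\<oplus> mneg y"
  by (rule eq_matI) (auto simp: mneg_def madd_def kmat_dim kmat_entry minus_add)

lemma mneg_mzero: "mneg (mzero r c) = mzero r c"
  by (rule eq_matI) (auto simp: mneg_def mzero_def)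

lemma madd_madd:
  assumes "a \<in> kmat r c" "b \<in> kmat r c" "x \<in> kmat r c" "y \<in> kmat r c"
  shows "(a \<oplus>\<oplus> b) \<oplus>\<oplus> (x \<oplus>\<oplus> y) = (a \<oplus>\<oplus> x) \<oplus>\<oplus> (b \<oplus>\<oplus> y)"
  using assms by (intro eq_matI) (auto simp: madd_def kmat_dim kmat_entry a_ac)

lemma left_submodule_sum:
  assumes B: "mat_subring n B" and M: "left_submodule n B M" and N: "left_submodule n B N"
  shows "left_submodule n B {x \<oplus>\<oplus> y | x y. x \<in> M \<and> y \<in> N}" (is "left_submodule n B ?S")
  unfolding left_submodule_def
proof (intro conjI ballI)
  note kM = left_submoduleD(1)[OF M] and kN = left_submoduleD(1)[OF N]
  show "?S \<subseteq> kmat n n" using kM kN by auto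
  show "mzero n n \<in> ?S"
    by (intro CollectI exI[of _ "mzero n n"]) (use left_submoduleD(2)[OF M] left_submoduleD(2)[OF N] in simp)
  fix s assume "s \<in> ?S"
  then obtain x y where s: "s = x \<oplus>\<oplus> y" "x \<in> M" "y \<in> N" by auto
  show "mneg s \<in> ?S"
    using mneg_madd[OF kM[OF s(2)] kN[OF s(3)]] left_submoduleD(3)[OF M s(2)] left_submoduleD(3)[OF N s(3)] s(1) by blast
  show "b \<odot>\<odot> s \<in> ?S" if "b \<in> B" for b
    using mmul_distrib_left[OF mat_subringD(1)[OF B that] kM[OF s(2)] kN[OF s(3)]]
      left_submoduleD(5)[OF M that s(2)] left_submoduleD(5)[OF N that s(3)] s(1) by blast
  fix t assume "t \<in> ?S"
  then obtain x' y' where t: "t = x' \<oplus>\<oplus> y'" "x' \<in> M" "y' \<in> N" by auto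
  show "s \<oplus>\<oplus> t \<in> ?S"
    using madd_madd[OF kM[OF s(2)] kN[OF s(3)] kM[OF t(2)] kN[OF t(3)]]
      left_submoduleD(4)[OF M s(2) t(2)] left_submoduleD(4)[OF N s(3) t(3)] s(1) t(1) by blast
qed

lemma left_submodule_image:
  assumes B: "mat_subring n B" and W: "left_submodule n B W" and r: "r \<in> kmat n n"
  shows "left_submodule n B ((\<lambda>w. w \<odot>\<odot> r) ` W)"
  unfolding left_submodule_def
proof (intro conjI ballI)
  note kW = left_submoduleD(1)[OF W]
  show "(\<lambda>w. w \<odot>\<odot> r) ` W \<subseteq> kmat n n" using mmul_closed[OF kW r] by auto
  show "mzero n n \<in> (\<lambda>w. w \<odot>\<odot> r) ` W"
    using left_submoduleD(2)[OF W] r by (intro image_eqI[of _ _ "mzero n n"]) auto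
  fix s assume "s \<in> (\<lambda>w. w \<odot>\<odot> r) ` W"
  then obtain x where s: "s = x \<odot>\<odot> r" "x \<in> W" by auto
  show "mneg s \<in> (\<lambda>w. w \<odot>\<odot> r) ` W"
    using mmul_neg(2)[OF kW[OF s(2)] r] left_submoduleD(3)[OF W s(2)] s(1) by force
  show "b \<odot>\<odot> s \<in> (\<lambda>w. w \<odot>\<odot> r) ` W" if "b \<in> B" for b
    using mmul_assoc[OF mat_subringD(1)[OF B that] kW[OF s(2)] r] left_submoduleD(5)[OF W that s(2)] s(1) by force
  fix t assume "t \<in> (\<lambda>w. w \<odot>\<odot> r) ` W"
  then obtain y where t: "t = y \<odot>\<odot> r" "y \<in> W" by auto
  show "s \<oplus>\<oplus> t \<in> (\<lambda>w. w \<odot>\<odot> r) ` W"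
    using mmul_distrib_right[OF kW[OF s(2)] kW[OF t(2)] r] left_submoduleD(4)[OF W s(2) t(2)] s(1) t(1) by force
qed

lemma left_submodule_preimage:
  assumes B: "mat_subring n B" and W: "left_submodule n B W" and r: "r \<in> kmat n n" and M: "left_submodule n B M"
  shows "left_submodule n B {w \<in> W. w \<odot>\<odot> r \<in> M}"
  unfolding left_submodule_def
proof (intro conjI ballI)
  note kW = left_submoduleD(1)[OF W]
  show "{w \<in> W. w \<odot>\<odot> r \<in> M} \<subseteq> kmat n n" using kW by auto
  show "mzero n n \<in> {w \<in> W. w \<odot>\<odot> r \<in> M}"
    using left_submoduleD(2)[OF W] left_submoduleD(2)[OF M] r by simp
  fix s assume s: "s \<in> {w \<in> W. w \<odot>\<odot> r \<in> M}"
  then have sk: "s \<in> kmat n n" using kW by simp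
  show "mneg s \<in> {w \<in> W. w \<odot>\<odot> r \<in> M}"
    using mmul_neg(2)[OF sk r] left_submoduleD(3)[OF W] left_submoduleD(3)[OF M] s by simp
  show "b \<odot>\<odot> s \<in> {w \<in> W. w \<odot>\<odot> r \<in> M}" if "b \<in> B" for b
    using mmul_assoc[OF mat_subringD(1)[OF B that] sk r] left_submoduleD(5)[OF W that] left_submoduleD(5)[OF M that] s by simp
  fix t assume t: "t \<in> {w \<in> W. w \<odot>\<odot> r \<in> M}"
  then have tk: "t \<in> kmat n n" using kW by simp
  show "s \<oplus>\<oplus> t \<in> {w \<in> W. w \<odot>\<odot> r \<in> M}"
    using mmul_distrib_right[OF sk tk r] left_submoduleD(4)[OF W] left_submoduleD(4)[OF M] s t by simp
qed

section \<open>Rank one matrices and the splitting of the full matrix ring\<close>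

definition erow :: "nat \<Rightarrow> nat \<Rightarrow> 'a mat" where
  "erow n i = mat 1 n (\<lambda>(_, j). if j = i then \<one> else \<zero>)"

definition ecol :: "nat \<Rightarrow> nat \<Rightarrow> 'a mat" where
  "ecol n j = mcol (mone n) j"

definition ediag :: "nat \<Rightarrow> nat \<Rightarrow> 'a mat" where
  "ediag n k = mat n n (\<lambda>(i, j). if i = j \<and> i < k then \<one> else \<zero>)"

lemma e_closed [simp]: "erow n i \<in> kmat 1 n" "j < n \<Longrightarrow> ecol n j \<in> kmat n 1" "ediag n k \<in> kmat n n"
  by (auto intro!: kmatI simp: erow_def ecol_def ediag_def mcol_def mone_def)

lemma mmul_ecol: "b \<in> kmat n d \<Longrightarrow> j < d \<Longrightarrow> b \<odot>\<odot> ecol d j = mcol b j"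
  by (simp add: ecol_def mmul_mcol_mone)

lemma outer_entry:
  assumes "v \<in> kmat n 1" "u \<in> kmat 1 m" "i < n" "j < m"
  shows "(v \<odot>\<odot> u) $$ (i, j) = v $$ (i, 0) \<otimes> u $$ (0, j)"
proof -
  have "(v \<odot>\<odot> u) $$ (i, j) = (\<Oplus>l\<in>{..<1}. v $$ (i, l) \<otimes> u $$ (l, j))" by (rule mmul_entry[OF assms])
  also have "{..<1::nat} = {0}" by auto
  finally show ?thesis using assms by (simp add: kmat_entry)
qed

lemma ediag_Suc:
  assumes "k < n"
  shows "ediag n (Suc k) = ediag n k \<oplus>\<oplus> ecol n k \<odot>\<odot> erow n k"
proof (rule kmat_eqI[of _ n n])
  have "ecol n k \<odot>\<odot> erow n k \<in> kmat n n" by (rule mmul_closed[OF e_closed(2)[OF assms] e_closed(1)])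
  then show "ediag n k \<oplus>\<oplus> ecol n k \<odot>\<odot> erow n k \<in> kmat n n" by simp
  fix i j assume ij: "i < n" "j < n"
  have "(ecol n k \<odot>\<odot> erow n k) $$ (i, j) = (if i = k then \<one> else \<zero>) \<otimes> (if j = k then \<one> else \<zero>)"
    using outer_entry[OF e_closed(2)[OF assms] e_closed(1) ij, of k] ij assms
    by (simp add: ecol_def erow_def mcol_def mone_def)
  then show "ediag n (Suc k) $$ (i, j) = (ediag n k \<oplus>\<oplus> ecol n k \<odot>\<odot> erow n k) $$ (i, j)"
    using madd_entry[OF e_closed(3) ij, of k] ij by (auto simp: ediag_def)
qed simp

lemma ediag_0: "ediag n 0 = mzero n n" and ediag_full: "ediag n n = mone n"
  by (auto simp: ediag_def mzero_def mone_def intro!: eq_matI)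

lemma mmul_ediag_Suc:
  assumes m: "m \<in> kmat n n" and k: "k < n"
  shows "m \<odot>\<odot> ediag n (Suc k) = m \<odot>\<odot> ediag n k \<oplus>\<oplus> mcol m k \<odot>\<odot> erow n k"
proof -
  have "m \<odot>\<odot> ediag n (Suc k) = m \<odot>\<odot> ediag n k \<oplus>\<oplus> m \<odot>\<odot> (ecol n k \<odot>\<odot> erow n k)"
    unfolding ediag_Suc[OF k] by (rule mmul_distrib_left[OF m e_closed(3) mmul_closed[OF e_closed(2)[OF k] e_closed(1)]])
  also have "m \<odot>\<odot> (ecol n k \<odot>\<odot> erow n k) = mcol m k \<odot>\<odot> erow n k"
    using mmul_assoc[OF m e_closed(2)[OF k] e_closed(1)] mmul_ecol[OF m k] by metis
  finally show ?thesis .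
qed

lemma mcol_kmat: "m \<in> kmat r c \<Longrightarrow> j < c \<Longrightarrow> mcol m j \<in> kmat r 1"
  using mcol_mats[of m K r c j] by (simp add: kmat_matsK)

lemma madd_cancel:
  assumes "a \<in> kmat r c" "b \<in> kmat r c" "x \<in> kmat r c" "y \<in> kmat r c" "a \<oplus>\<oplus> b = x \<oplus>\<oplus> y"
  shows "a \<oplus>\<oplus> mneg x = y \<oplus>\<oplus> mneg b"
proof (rule kmat_eqI[of _ r c])
  fix i j assume ij: "i < r" "j < c"
  have "(a \<oplus>\<oplus> b) $$ (i, j) = (x \<oplus>\<oplus> y) $$ (i, j)" using assms(5) by simp
  then have e: "a $$ (i, j) \<oplus> b $$ (i, j) = x $$ (i, j) \<oplus> y $$ (i, j)"
    using madd_entry[OF assms(1) ij] madd_entry[OF assms(3) ij] by simp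
  have k: "a $$ (i, j) \<in> K" "b $$ (i, j) \<in> K" "x $$ (i, j) \<in> K" "y $$ (i, j) \<in> K"
    using assms ij by (auto intro: kmat_entry)
  have "a $$ (i, j) \<ominus> x $$ (i, j) = a $$ (i, j) \<oplus> b $$ (i, j) \<ominus> b $$ (i, j) \<ominus> x $$ (i, j)"
    using k by algebra
  also have "\<dots> = y $$ (i, j) \<ominus> b $$ (i, j)" unfolding e using k by algebra
  finally show "(a \<oplus>\<oplus> mneg x) $$ (i, j) = (y \<oplus>\<oplus> mneg b) $$ (i, j)"
    using assms ij by (simp add: madd_entry[of _ r c] mneg_entry[of _ r c] a_minus_def)
qed (use assms in auto)

text \<open>
  If \<open>B\<close> acts irreducibly together with the scalars, then the full matrix ring is a semisimple
  left \<open>B\<close>-module, since it is the sum of the translates \<open>W r\<close> of a minimal submodule \<open>W\<close>.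
  Hence \<open>B\<close> itself has a complement. If \<open>B\<close> is proper, then the projection onto \<open>B\<close>, which
  fixes \<open>1\<close>, is not a right multiplication, and one of its blocks is not scalar.
\<close>

lemma complement_exists:
  assumes n: "n > 0" and B: "mat_subring n B" and irr: "irreducible_on n B"
  obtains T where "left_submodule n B T" "T \<inter> B = {mzero n n}"
    "\<And>m. m \<in> kmat n n \<Longrightarrow> \<exists>b\<in>B. \<exists>t\<in>T. m = b \<oplus>\<oplus> t"
proof -
  have BB: "left_submodule n B B" by (rule left_submodule_self[OF B])
  have AA: "left_submodule n B (kmat n n)"
    using mmul_closed[OF mat_subringD(1)[OF B]] by (auto simp: left_submodule_def)
  have fin: "left_submodule n B M \<Longrightarrow> finite M" for M
    using finite_subset[OF _ finite_kmat[of n n]] left_submoduleD(1) by blast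
  let ?N = "\<lambda>M. left_submodule n B M \<and> M \<noteq> {mzero n n}"
  have "mone n \<noteq> mzero n n"
  proof
    assume "mone n = mzero n n"
    then have "mone n $$ (0, 0) = mzero n n $$ (0, 0)" by simp
    then show False using n by (simp add: mone_entry mzero_entry)
  qed
  then have "?N (kmat n n)" using AA mone_closed[of n] by blast
  then obtain W where W: "?N W" and Wmin: "\<And>M. ?N M \<Longrightarrow> card W \<le> card M"
    using ex_has_least_nat[of ?N "kmat n n" card] by blast
  have W': "left_submodule n B W" using W by blast
  have min: "M = {mzero n n} \<or> M = W" if "left_submodule n B M" "M \<subseteq> W" for M
    using Wmin[of M] that fin[OF W'] card_seteq[of W M] by blast
  let ?C = "\<lambda>T. left_submodule n B T \<and> T \<inter> B = {mzero n n}"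
  have "left_submodule n B {mzero n n}"
    unfolding left_submodule_def using mmul_zero(1)[OF mat_subringD(1)[OF B]] mneg_mzero by simp
  then have C0: "?C {mzero n n}" using left_submoduleD(2)[OF BB] by blast
  have "card T < Suc (card (kmat n n))" if "?C T" for T
    using card_mono[OF finite_kmat[of n n], of T] that left_submoduleD(1)[of n B T] by (auto simp: less_Suc_eq_le)
  then obtain T where T: "?C T" and Tmax: "\<And>M. ?C M \<Longrightarrow> card M \<le> card T"
    using ex_has_greatest_nat[of ?C "{mzero n n}" card "Suc (card (kmat n n))"] C0 by blast
  have T': "left_submodule n B T" using T by blast
  define S where "S = {b \<oplus>\<oplus> t | b t. b \<in> B \<and> t \<in> T}"
  have S: "left_submodule n B S" unfolding S_def by (rule left_submodule_sum[OF B BB T'])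
  have Tk: "t \<in> kmat n n" if "t \<in> T" for t using left_submoduleD(1)[OF T'] that by blast
  have Bk: "b \<in> kmat n n" if "b \<in> B" for b using mat_subringD(1)[OF B] that by blast
  have TS: "T \<subseteq> S"
  proof
    fix t assume t: "t \<in> T"
    then have "t = mzero n n \<oplus>\<oplus> t" using Tk by simp
    then show "t \<in> S" unfolding S_def using left_submoduleD(2)[OF BB] t by blast
  qed
  \<comment> \<open>A translate \<open>W r\<close> not contained in \<open>S\<close> meets
    \<open>S\<close> only in zero, since the part of \<open>W\<close> sent into \<open>S\<close> is
    a proper submodule of the simple \<open>W\<close>. Then \<open>W r\<close> could be added to
    \<open>T\<close> without meeting \<open>B\<close>, against the maximality of
    \<open>T\<close>.\<close>
  have Wr: "w \<odot>\<odot> r \<in> S" if w: "w \<in> W" and r: "r \<in> kmat n n" for w r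
  proof (rule ccontr)
    assume nS: "w \<odot>\<odot> r \<notin> S"
    define U where "U = (\<lambda>w. w \<odot>\<odot> r) ` W"
    have U: "left_submodule n B U" unfolding U_def by (rule left_submodule_image[OF B W' r])
    have "{w \<in> W. w \<odot>\<odot> r \<in> S} \<noteq> W" using nS w by blast
    then have pre: "{w \<in> W. w \<odot>\<odot> r \<in> S} = {mzero n n}"
      using min[OF left_submodule_preimage[OF B W' r S]] by blast
    have US: "u = mzero n n" if "u \<in> U" "u \<in> S" for u
    proof -
      obtain w' where w': "w' \<in> W" "u = w' \<odot>\<odot> r" using \<open>u \<in> U\<close> by (auto simp: U_def)
      then have "w' = mzero n n" using pre that by blast
      then show ?thesis using w' r by simp
    qed
    define T2 where "T2 = {t \<oplus>\<oplus> u | t u. t \<in> T \<and> u \<in> U}"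
    have T2: "left_submodule n B T2" unfolding T2_def by (rule left_submodule_sum[OF B T' U])
    have "b = mzero n n" if b: "b \<in> T2" "b \<in> B" for b
    proof -
      obtain t u where tu: "b = t \<oplus>\<oplus> u" "t \<in> T" "u \<in> U" using b by (auto simp: T2_def)
      note k = Bk[OF b(2)] Tk[OF tu(2)] left_submoduleD(1)[OF U tu(3)]
      have "mzero n n \<oplus>\<oplus> b = t \<oplus>\<oplus> u" using k tu by simp
      then have "b \<oplus>\<oplus> mzero n n = t \<oplus>\<oplus> u" using k by simp
      from madd_cancel[OF k(1) mzero_closed k(2,3) this]
      have "b \<oplus>\<oplus> mneg t = u \<oplus>\<oplus> mneg (mzero n n)" .
      moreover note mneg_mzero[of n n]
      ultimately have "u = b \<oplus>\<oplus> mneg t" using k by simp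
      then have "u \<in> S" unfolding S_def using b left_submoduleD(3)[OF T' tu(2)] by blast
      then have "u = mzero n n" using US tu by blast
      then have "b \<in> T" using tu k by simp
      then show ?thesis using T b by blast
    qed
    then have "?C T2" using T2 left_submoduleD(2)[OF T2] left_submoduleD(2)[OF BB] by blast
    moreover have "T \<subseteq> T2"
    proof
      fix t assume t: "t \<in> T"
      then have "t = t \<oplus>\<oplus> mzero n n" using Tk by simp
      then show "t \<in> T2" unfolding T2_def using left_submoduleD(2)[OF U] t by blast
    qed
    ultimately have "T2 = T" using Tmax[of T2] card_seteq[of T2 T] fin[OF T2] by blast
    moreover have wU: "w \<odot>\<odot> r \<in> U" using w by (auto simp: U_def)
    then have "w \<odot>\<odot> r = mzero n n \<oplus>\<oplus> w \<odot>\<odot> r" using left_submoduleD(1)[OF U wU] by simp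
    then have "w \<odot>\<odot> r \<in> T2"
      unfolding T2_def using left_submoduleD(2)[OF T'] wU by blast
    ultimately show False using nS TS by blast
  qed
  \<comment> \<open>The vectors all of whose rank one products lie in \<open>S\<close>. This set is
    a \<open>K\<close>-subspace, because a scalar can be moved into the row factor, and it is stable
    under \<open>B\<close>. It contains the columns of \<open>W\<close>, so irreducibility makes it
    everything, and \<open>S\<close> is the whole ring.\<close>
  define U where "U = {v \<in> kmat n 1. \<forall>u\<in>kmat 1 n. v \<odot>\<odot> u \<in> S}"
  have "subspace n U" unfolding subspace_def
  proof (intro conjI ballI)
    show "U \<subseteq> kmat n 1" by (auto simp: U_def)
    show "mzero n 1 \<in> U" using left_submoduleD(2)[OF S] by (auto simp: U_def)
    fix v assume v: "v \<in> U"
    then have vk: "v \<in> kmat n 1" by (simp add: U_def)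
    show "v \<oplus>\<oplus> v' \<in> U" if v': "v' \<in> U" for v'
    proof -
      have v'k: "v' \<in> kmat n 1" using v' by (simp add: U_def)
      have "(v \<oplus>\<oplus> v') \<odot>\<odot> u \<in> S" if u: "u \<in> kmat 1 n" for u
        using mmul_distrib_right[OF vk v'k u] left_submoduleD(4)[OF S] v v' u by (simp add: U_def)
      then show ?thesis using vk v'k by (simp add: U_def)
    qed
    show "mscale c v \<in> U" if c: "c \<in> K" for c
    proof -
      have "mscale c v \<odot>\<odot> u \<in> S" if u: "u \<in> kmat 1 n" for u
        using mmul_scale[OF c vk u] v c u by (simp add: U_def) (metis mscale_closed)
      then show ?thesis using vk c by (simp add: U_def)
    qed
  qed
  moreover have "\<forall>x\<in>B. \<forall>v\<in>U. x \<odot>\<odot> v \<in> U"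
  proof (intro ballI)
    fix x v assume x: "x \<in> B" and v: "v \<in> U"
    then have k: "x \<in> kmat n n" "v \<in> kmat n 1" using Bk by (auto simp: U_def)
    have "x \<odot>\<odot> v \<odot>\<odot> u \<in> S" if u: "u \<in> kmat 1 n" for u
      using mmul_assoc[OF k u] left_submoduleD(5)[OF S x] v u by (simp add: U_def)
    then show "x \<odot>\<odot> v \<in> U" using mmul_closed[OF k] by (simp add: U_def)
  qed
  ultimately have "U = {mzero n 1} \<or> U = kmat n 1" using irr unfolding irreducible_on_def by blast
  moreover have "U \<noteq> {mzero n 1}"
  proof
    assume U0: "U = {mzero n 1}"
    have "w = mzero n n" if w: "w \<in> W" for w
    proof (rule mats_eqI_mcol[of _ K n n])
      have wk: "w \<in> kmat n n" using left_submoduleD(1)[OF W' w] .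
      then show "w \<in> mats K n n" by (simp add: kmat_matsK)
      show "mzero n n \<in> mats K n n" using mzero_closed by (simp add: kmat_matsK)
      fix j assume j: "j < n"
      have "mcol w j \<odot>\<odot> u \<in> S" if u: "u \<in> kmat 1 n" for u
      proof -
        have "mcol w j \<odot>\<odot> u = w \<odot>\<odot> (ecol n j \<odot>\<odot> u)"
          using mmul_assoc[OF wk e_closed(2)[OF j] u] mmul_ecol[OF wk j] by simp
        then show ?thesis using Wr[OF w] mmul_closed[OF e_closed(2)[OF j] u] by simp
      qed
      then have "mcol w j \<in> U" using mcol_kmat[OF wk j] by (simp add: U_def)
      moreover have "mcol (mzero n n) j = mzero n 1" using j by (auto simp: mcol_def mzero_def intro!: eq_matI)
      ultimately show "mcol w j = mcol (mzero n n) j" using U0 by simp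
    qed
    then show False using W left_submoduleD(2)[OF W'] by blast
  qed
  ultimately have U: "U = kmat n 1" by blast
  have "m \<in> S" if m: "m \<in> kmat n n" for m
  proof -
    have "k \<le> n \<Longrightarrow> m \<odot>\<odot> ediag n k \<in> S" for k
    proof (induction k)
      case 0
      then show ?case using m left_submoduleD(2)[OF S] by (simp add: ediag_0)
    next
      case (Suc k)
      then have k: "k < n" by simp
      have "mcol m k \<in> U" using mcol_kmat[OF m k] U by simp
      then have "mcol m k \<odot>\<odot> erow n k \<in> S" by (simp add: U_def)
      then show ?case unfolding mmul_ediag_Suc[OF m k] using Suc k by (intro left_submoduleD(4)[OF S]) auto
    qed
    from this[of n] show ?thesis using m by (simp add: ediag_full)
  qed
  then have "\<exists>b\<in>B. \<exists>t\<in>T. m = b \<oplus>\<oplus> t" if "m \<in> kmat n n" for m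
    using that unfolding S_def by blast
  then show ?thesis using that[of T] T by blast
qed

lemma nonscalar_commuting_map:
  assumes n: "n > 0" and B: "mat_subring n B" and irr: "irreducible_on n B" and proper: "B \<noteq> kmat n n"
  obtains \<phi> where "additive_commuting n B \<phi>" "\<not> (\<exists>c\<in>K. \<forall>v\<in>kmat n 1. \<phi> v = mscale c v)"
proof -
  obtain T where T: "left_submodule n B T" "T \<inter> B = {mzero n n}"
    and dec: "\<And>m. m \<in> kmat n n \<Longrightarrow> \<exists>b\<in>B. \<exists>t\<in>T. m = b \<oplus>\<oplus> t"
    using complement_exists[OF n B irr] by metis
  have Tk: "t \<in> kmat n n" if "t \<in> T" for t using left_submoduleD(1)[OF T(1)] that by blast
  have Bk: "b \<in> kmat n n" if "b \<in> B" for b using mat_subringD(1)[OF B] that by blast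
  have BB: "left_submodule n B B" by (rule left_submodule_self[OF B])
  define \<pi> where "\<pi> m = (SOME b. b \<in> B \<and> (\<exists>t\<in>T. m = b \<oplus>\<oplus> t))" for m
  have \<pi>: "\<pi> m \<in> B \<and> (\<exists>t\<in>T. m = \<pi> m \<oplus>\<oplus> t)" if "m \<in> kmat n n" for m
    unfolding \<pi>_def by (rule someI_ex) (use dec[OF that] in blast)
  have uniq: "b = b'" if "b \<in> B" "b' \<in> B" "t \<in> T" "t' \<in> T" "b \<oplus>\<oplus> t = b' \<oplus>\<oplus> t'" for b b' t t'
  proof -
    have e: "b \<oplus>\<oplus> mneg b' = t' \<oplus>\<oplus> mneg t"
      by (rule madd_cancel[of _ n n]) (use that Bk Tk in auto)
    have "b \<oplus>\<oplus> mneg b' \<in> B" using mat_subringD(3,4)[OF B] that by blast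
    moreover have "t' \<oplus>\<oplus> mneg t \<in> T" using left_submoduleD(3,4)[OF T(1)] that by blast
    ultimately have "b \<oplus>\<oplus> mneg b' = mzero n n" using e T(2) by auto
    then show ?thesis by (rule madd_neg_zeroD[rotated 2]) (use that Bk in auto)
  qed
  have \<pi>I: "\<pi> m = b" if "b \<in> B" "t \<in> T" "m = b \<oplus>\<oplus> t" for m b t
  proof -
    have "m \<in> kmat n n" using that Bk Tk by auto
    then show ?thesis using \<pi>[of m] uniq[of "\<pi> m" b _ t] that by metis
  qed
  have \<pi>k: "\<pi> m \<in> kmat n n" if "m \<in> kmat n n" for m using \<pi>[OF that] Bk by blast
  have \<pi>_add: "\<pi> (x \<oplus>\<oplus> y) = \<pi> x \<oplus>\<oplus> \<pi> y" if xy: "x \<in> kmat n n" "y \<in> kmat n n" for x y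
  proof -
    obtain t s where ts: "t \<in> T" "x = \<pi> x \<oplus>\<oplus> t" "s \<in> T" "y = \<pi> y \<oplus>\<oplus> s" using \<pi> xy by blast
    have "x \<oplus>\<oplus> y = (\<pi> x \<oplus>\<oplus> \<pi> y) \<oplus>\<oplus> (t \<oplus>\<oplus> s)"
      using madd_madd[OF \<pi>k[OF xy(1)] Tk[OF ts(1)] \<pi>k[OF xy(2)] Tk[OF ts(3)]] ts(2,4) by simp
    then show ?thesis
      using \<pi>I[of "\<pi> x \<oplus>\<oplus> \<pi> y" "t \<oplus>\<oplus> s"] mat_subringD(4)[OF B] left_submoduleD(4)[OF T(1)] \<pi> xy ts by blast
  qed
  have \<pi>_mul: "\<pi> (b \<odot>\<odot> x) = b \<odot>\<odot> \<pi> x" if b: "b \<in> B" and x: "x \<in> kmat n n" for b x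
  proof -
    obtain t where t: "t \<in> T" "x = \<pi> x \<oplus>\<oplus> t" using \<pi> x by blast
    have "b \<odot>\<odot> x = b \<odot>\<odot> \<pi> x \<oplus>\<oplus> b \<odot>\<odot> t"
      using mmul_distrib_left[OF Bk[OF b] \<pi>k[OF x] Tk[OF t(1)]] t(2) by simp
    then show ?thesis
      using \<pi>I[of "b \<odot>\<odot> \<pi> x" "b \<odot>\<odot> t"] mat_subringD(5)[OF B b] left_submoduleD(5)[OF T(1) b] \<pi> x t by blast
  qed
  have \<pi>_one: "\<pi> (mone n) = mone n"
    using \<pi>I[OF mat_subringD(2)[OF B] left_submoduleD(2)[OF T(1)]] by simp
  have "T \<noteq> {mzero n n}"
  proof
    assume T0: "T = {mzero n n}"
    have "m \<in> B" if "m \<in> kmat n n" for m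
      using dec[OF that] T0 Bk by auto
    then show False using proper Bk by blast
  qed
  then obtain t0 where t0: "t0 \<in> T" "t0 \<noteq> mzero n n" using left_submoduleD(2)[OF T(1)] by blast
  have \<pi>t0: "\<pi> t0 = mzero n n"
    using \<pi>I[OF left_submoduleD(2)[OF BB] t0(1), of t0] Tk[OF t0(1)] by simp
  \<comment> \<open>The block \<open>(i, j)\<close> of the projection: \<open>v\<close> is placed in
    column \<open>i\<close>, projected onto \<open>B\<close>, and column \<open>j\<close> is read
    off.\<close>
  define \<phi> where "\<phi> i j v = \<pi> (v \<odot>\<odot> erow n i) \<odot>\<odot> ecol n j" for i j v
  have vk: "v \<odot>\<odot> erow n i \<in> kmat n n" if "v \<in> kmat n 1" for v i
    by (rule mmul_closed[OF that e_closed(1)])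
  have comm: "additive_commuting n B (\<phi> i j)" if j: "j < n" for i j
    unfolding additive_commuting_def
  proof (intro conjI ballI)
    fix v assume v: "v \<in> kmat n 1"
    show "\<phi> i j v \<in> kmat n 1" unfolding \<phi>_def by (rule mmul_closed[OF \<pi>k[OF vk[OF v]] e_closed(2)[OF j]])
    show "\<phi> i j (x \<odot>\<odot> v) = x \<odot>\<odot> \<phi> i j v" if x: "x \<in> B" for x
      unfolding \<phi>_def using mmul_assoc[OF Bk[OF x] v e_closed(1)] \<pi>_mul[OF x vk[OF v]]
        mmul_assoc[OF Bk[OF x] \<pi>k[OF vk[OF v]] e_closed(2)[OF j]] by simp
    fix u assume u: "u \<in> kmat n 1"
    show "\<phi> i j (u \<oplus>\<oplus> v) = \<phi> i j u \<oplus>\<oplus> \<phi> i j v"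
      unfolding \<phi>_def using mmul_distrib_right[OF u v e_closed(1)] \<pi>_add[OF vk[OF u] vk[OF v]]
        mmul_distrib_right[OF \<pi>k[OF vk[OF u]] \<pi>k[OF vk[OF v]] e_closed(2)[OF j]] by simp
  qed
  have "\<exists>i<n. \<exists>j<n. \<not> (\<exists>c\<in>K. \<forall>v\<in>kmat n 1. \<phi> i j v = mscale c v)"
  proof (rule ccontr)
    assume "\<not> ?thesis"
    then obtain s where s: "\<And>i j. i < n \<Longrightarrow> j < n \<Longrightarrow> s i j \<in> K \<and> (\<forall>v\<in>kmat n 1. \<phi> i j v = mscale (s i j) v)"
      by metis
    \<comment> \<open>If all blocks are scalar, the projection is right multiplication by the matrix
      of these scalars. As it fixes the identity, \<open>P\<close> is the identity, and then only
      zero projects to zero; but \<open>T\<close> contains a nonzero matrix.\<close>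
    define P where "P = mat n n (\<lambda>(i, j). s i j)"
    have P: "P \<in> kmat n n" using s by (auto intro!: kmatI simp: P_def)
    have P_entry: "erow n i \<odot>\<odot> mcol P j = mscale (s i j) (mone 1)" if ij: "i < n" "j < n" for i j
    proof -
      have c: "erow n i \<odot>\<odot> mcol P j \<in> kmat 1 1" by (rule mmul_closed[OF e_closed(1) mcol_kmat[OF P ij(2)]])
      have "(erow n i \<odot>\<odot> mcol P j) $$ (0, 0) = (\<Oplus>l\<in>{..<n}. erow n i $$ (0, l) \<otimes> mcol P j $$ (l, 0))"
        by (rule mmul_entry[OF e_closed(1) mcol_kmat[OF P ij(2)]]) auto
      also have "\<dots> = (\<Oplus>l\<in>{..<n}. if i = l then s l j else \<zero>)"
        by (rule finsum_cong') (use s ij in \<open>auto simp: erow_def mcol_def P_def\<close>)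
      also have "\<dots> = s i j" by (rule finsum_singleton) (use s ij in auto)
      finally show ?thesis using kmat_1_1[OF c] by simp
    qed
    have step: "\<pi> (m \<odot>\<odot> ediag n k) \<odot>\<odot> ecol n j = m \<odot>\<odot> ediag n k \<odot>\<odot> mcol P j"
      if m: "m \<in> kmat n n" and j: "j < n" and "k \<le> n" for m j k
      using that(3)
    proof (induction k)
      case 0
      have "\<pi> (mzero n n) = mzero n n"
        using \<pi>I[OF left_submoduleD(2)[OF BB] left_submoduleD(2)[OF T(1)]] by simp
      then show ?case using m j mcol_kmat[OF P j] by (simp add: ediag_0)
    next
      case (Suc k)
      then have k: "k < n" by simp
      let ?v = "mcol m k"
      have v: "?v \<in> kmat n 1" by (rule mcol_kmat[OF m k])
      have md: "m \<odot>\<odot> ediag n k \<in> kmat n n" by (rule mmul_closed[OF m e_closed(3)])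
      have "\<pi> (m \<odot>\<odot> ediag n (Suc k)) \<odot>\<odot> ecol n j = \<pi> (m \<odot>\<odot> ediag n k) \<odot>\<odot> ecol n j \<oplus>\<oplus> \<phi> k j ?v"
        unfolding mmul_ediag_Suc[OF m k] \<pi>_add[OF md vk[OF v]] \<phi>_def
        by (rule mmul_distrib_right[OF \<pi>k[OF md] \<pi>k[OF vk[OF v]] e_closed(2)[OF j]])
      also have "\<phi> k j ?v = mscale (s k j) ?v" using s[OF k j] v by blast
      also have "\<dots> = ?v \<odot>\<odot> (erow n k \<odot>\<odot> mcol P j)"
        unfolding P_entry[OF k j] using mmul_scale(1)[OF _ v mone_closed] s[OF k j] v by simp
      also have "\<dots> = ?v \<odot>\<odot> erow n k \<odot>\<odot> mcol P j"
        by (rule mmul_assoc[OF v e_closed(1) mcol_kmat[OF P j], symmetric])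
      also have "\<pi> (m \<odot>\<odot> ediag n k) \<odot>\<odot> ecol n j = m \<odot>\<odot> ediag n k \<odot>\<odot> mcol P j" using Suc k by simp
      also have "m \<odot>\<odot> ediag n k \<odot>\<odot> mcol P j \<oplus>\<oplus> ?v \<odot>\<odot> erow n k \<odot>\<odot> mcol P j
          = (m \<odot>\<odot> ediag n k \<oplus>\<oplus> ?v \<odot>\<odot> erow n k) \<odot>\<odot> mcol P j"
        by (rule mmul_distrib_right[OF md vk[OF v] mcol_kmat[OF P j], symmetric])
      also have "m \<odot>\<odot> ediag n k \<oplus>\<oplus> ?v \<odot>\<odot> erow n k = m \<odot>\<odot> ediag n (Suc k)"
        by (rule mmul_ediag_Suc[OF m k, symmetric])
      finally show ?case .
    qed
    have piP: "\<pi> m = m \<odot>\<odot> P" if m: "m \<in> kmat n n" for m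
    proof (rule mats_eqI_mcol[of _ K n n])
      fix j assume j: "j < n"
      have "mcol (\<pi> m) j = \<pi> m \<odot>\<odot> ecol n j" using mmul_ecol[OF \<pi>k[OF m] j] by simp
      also have "\<dots> = m \<odot>\<odot> mcol P j" using step[OF m j, of n] m by (simp add: ediag_full)
      also have "\<dots> = mcol (m \<odot>\<odot> P) j" by (rule mcol_mmul[OF m P j, symmetric])
      finally show "mcol (\<pi> m) j = mcol (m \<odot>\<odot> P) j" .
    qed (use \<pi>k[OF m] mmul_closed[OF m P] in \<open>simp_all add: kmat_matsK\<close>)
    have "P = mone n" using piP[OF mone_closed] \<pi>_one P by simp
    then have "t0 = mzero n n" using piP[OF Tk[OF t0(1)]] \<pi>t0 Tk[OF t0(1)] by simp
    then show False using t0 by blast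
  qed
  then show ?thesis using comm that by blast
qed

section \<open>Semilinear maps commuting with a subring\<close>

lemma gen_nonzero: "gen \<noteq> \<zero>"
proof -
  have "gen [^] (1::nat) \<in> carrier R - {\<zero>}" using gen(2) by blast
  then show ?thesis using gen(1) by (simp add: One_nat_def)
qed

lemma gen_cases:
  assumes "c \<in> K" "c \<noteq> \<zero>"
  obtains i :: nat where "c = gen [^] i"
  using assms gen(2) by blast

lemma unit_power_card:
  assumes "a \<in> K" "a \<noteq> \<zero>"
  shows "a [^] (card K - 1) = \<one>"
proof -
  interpret G: group "mult_of R" by (rule field_mult_group)
  have "Coset.order (mult_of R) = card K - 1"
    using finite_carrier by (simp add: Coset.order_def carrier_mult_of card_Diff_singleton)
  then show ?thesis
    using G.pow_order_eq_1[of a] assms by (simp add: carrier_mult_of nat_pow_mult_of)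
qed

definition field_endo :: "('a \<Rightarrow> 'a) \<Rightarrow> bool" where
  "field_endo \<sigma> \<longleftrightarrow> \<sigma> \<in> K \<rightarrow> K \<and> (\<forall>a\<in>K. \<forall>b\<in>K. \<sigma> (a \<oplus> b) = \<sigma> a \<oplus> \<sigma> b)
     \<and> (\<forall>a\<in>K. \<forall>b\<in>K. \<sigma> (a \<otimes> b) = \<sigma> a \<otimes> \<sigma> b) \<and> \<sigma> \<one> = \<one>"

definition semilinear :: "nat \<Rightarrow> ('a \<Rightarrow> 'a) \<Rightarrow> ('a mat \<Rightarrow> 'a mat) \<Rightarrow> bool" where
  "semilinear n \<sigma> \<phi> \<longleftrightarrow> (\<forall>c\<in>K. \<forall>v\<in>kmat n 1. \<phi> (mscale c v) = mscale (\<sigma> c) (\<phi> v))"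

lemma additive_commutingD:
  assumes "additive_commuting n B \<phi>"
  shows "v \<in> kmat n 1 \<Longrightarrow> \<phi> v \<in> kmat n 1"
    "u \<in> kmat n 1 \<Longrightarrow> v \<in> kmat n 1 \<Longrightarrow> \<phi> (u \<oplus>\<oplus> v) = \<phi> u \<oplus>\<oplus> \<phi> v"
    "x \<in> B \<Longrightarrow> v \<in> kmat n 1 \<Longrightarrow> \<phi> (x \<odot>\<odot> v) = x \<odot>\<odot> \<phi> v"
  using assms by (auto simp: additive_commuting_def)

lemma madd_self_zero: "a \<in> kmat r c \<Longrightarrow> a \<oplus>\<oplus> a = a \<Longrightarrow> a = mzero r c"
proof -
  assume a: "a \<in> kmat r c" "a \<oplus>\<oplus> a = a"
  have "a = a \<oplus>\<oplus> (a \<oplus>\<oplus> mneg a)" using a by simp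
  also have "\<dots> = a \<oplus>\<oplus> a \<oplus>\<oplus> mneg a" by (rule madd_assoc[OF a(1) a(1) mneg_closed[OF a(1)], symmetric])
  also have "\<dots> = a \<oplus>\<oplus> mneg a" unfolding a(2) ..
  finally show ?thesis using a(1) by simp
qed

lemma madd_swap: "a \<in> kmat r c \<Longrightarrow> b \<in> kmat r c \<Longrightarrow> x \<in> kmat r c \<Longrightarrow> a \<oplus>\<oplus> b \<oplus>\<oplus> x = a \<oplus>\<oplus> x \<oplus>\<oplus> b"
  by (rule eq_matI) (auto simp: madd_def kmat_dim kmat_entry a_ac)

lemma additive_zero:
  assumes "additive_commuting n B \<phi>"
  shows "\<phi> (mzero n 1) = mzero n 1"
  using additive_commutingD(2)[OF assms mzero_closed mzero_closed] additive_commutingD(1)[OF assms mzero_closed]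
  by (intro madd_self_zero) auto

lemma mscale_mscale: "a \<in> K \<Longrightarrow> b \<in> K \<Longrightarrow> v \<in> kmat r c \<Longrightarrow> mscale a (mscale b v) = mscale (a \<otimes> b) v"
  by (rule eq_matI) (auto simp: mscale_def kmat_dim kmat_entry m_assoc)

lemma mscale_one [simp]: "v \<in> kmat r c \<Longrightarrow> mscale \<one> v = v"
  by (rule eq_matI) (auto simp: mscale_def kmat_dim kmat_entry)

lemma mscale_zero: "v \<in> kmat r c \<Longrightarrow> mscale \<zero> v = mzero r c"
  by (rule eq_matI) (auto simp: mscale_def mzero_def kmat_dim kmat_entry)

lemma mscale_mzero [simp]: "a \<in> K \<Longrightarrow> mscale a (mzero r c) = mzero r c"
  by (rule eq_matI) (auto simp: mscale_def mzero_def)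

lemma mscale_madd:
  "a \<in> K \<Longrightarrow> u \<in> kmat r c \<Longrightarrow> v \<in> kmat r c \<Longrightarrow> mscale a (u \<oplus>\<oplus> v) = mscale a u \<oplus>\<oplus> mscale a v"
  by (rule eq_matI) (auto simp: mscale_def madd_def kmat_dim kmat_entry r_distr)

lemma mscale_mneg: "a \<in> K \<Longrightarrow> u \<in> kmat r c \<Longrightarrow> mscale a (mneg u) = mneg (mscale a u)"
  by (rule eq_matI) (auto simp: mscale_def mneg_def kmat_dim kmat_entry r_minus)

lemma mscale_add:
  "a \<in> K \<Longrightarrow> b \<in> K \<Longrightarrow> v \<in> kmat r c \<Longrightarrow> mscale (a \<oplus> b) v = mscale a v \<oplus>\<oplus> mscale b v"
  by (rule eq_matI) (auto simp: mscale_def madd_def kmat_dim kmat_entry l_distr)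

lemma kmat_nonzero_entry:
  assumes "v \<in> kmat n 1" "v \<noteq> mzero n 1"
  obtains r where "r < n" "v $$ (r, 0) \<noteq> \<zero>"
proof -
  have "\<exists>r<n. v $$ (r, 0) \<noteq> \<zero>"
  proof (rule ccontr)
    assume *: "\<not> ?thesis"
    have "v = mzero n 1"
      by (rule kmat_eqI[OF assms(1) mzero_closed]) (use * in \<open>auto simp: mzero_def\<close>)
    then show False using assms by simp
  qed
  then show ?thesis using that by blast
qed

lemma mscale_cancel:
  assumes v: "v \<in> kmat n 1" "v \<noteq> mzero n 1" and ab: "a \<in> K" "b \<in> K" "mscale a v = mscale b v"
  shows "a = b"
proof -
  obtain r where r: "r < n" "v $$ (r, 0) \<noteq> \<zero>" using kmat_nonzero_entry[OF v] .
  have "mscale a v $$ (r, 0) = mscale b v $$ (r, 0)" using ab by simp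
  then have "a \<otimes> v $$ (r, 0) = b \<otimes> v $$ (r, 0)"
    using r v by (simp add: mscale_entry[of _ n 1])
  then show ?thesis using r ab kmat_entry[OF v(1) r(1), of 0] m_rcancel by auto
qed

lemma linear_matrix:
  assumes \<phi>: "additive_commuting n B \<phi>" and lin: "semilinear n (\<lambda>c. c) \<phi>" and B: "B \<subseteq> kmat n n"
  obtains z where "z \<in> kmat n n" "\<And>v. v \<in> kmat n 1 \<Longrightarrow> \<phi> v = z \<odot>\<odot> v" "\<And>x. x \<in> B \<Longrightarrow> z \<odot>\<odot> x = x \<odot>\<odot> z"
proof -
  define z where "z = mjoin n n (\<lambda>j. \<phi> (ecol n j))"
  have \<phi>e: "\<phi> (ecol n j) \<in> kmat n 1" if "j < n" for j using additive_commutingD(1)[OF \<phi>] that by simp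
  have z: "z \<in> kmat n n" unfolding z_def kmat_matsK by (rule mjoin_mats) (use \<phi>e in \<open>simp add: kmat_matsK\<close>)
  have ze: "z \<odot>\<odot> ecol n j = \<phi> (ecol n j)" if j: "j < n" for j
    using mmul_ecol[OF z j] mcol_mjoin[OF j, of "\<lambda>j. \<phi> (ecol n j)" K n] \<phi>e[OF j] by (simp add: z_def kmat_matsK)
  define U where "U = {v \<in> kmat n 1. \<phi> v = z \<odot>\<odot> v}"
  have U: "subspace n U"
    unfolding subspace_def
  proof (intro conjI ballI)
    show "U \<subseteq> kmat n 1" by (auto simp: U_def)
    show "mzero n 1 \<in> U" using additive_zero[OF \<phi>] mmul_zero(1)[OF z] by (simp add: U_def)
    fix u assume u: "u \<in> U"
    show "mscale c u \<in> U" if c: "c \<in> K" for c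
      using u c lin mmul_scale(1)[OF c z, of u 1] by (simp add: U_def semilinear_def)
    fix v assume v: "v \<in> U"
    show "u \<oplus>\<oplus> v \<in> U"
      using u v additive_commutingD(2)[OF \<phi>, of u v] mmul_distrib_left[OF z, of u 1 v] by (simp add: U_def)
  qed
  have "mcol (mone n) j \<in> U" if "j < n" for j
    using ze[OF that] that e_closed(2)[OF that] by (simp add: U_def ecol_def)
  then have "v \<in> U" if "v \<in> kmat n 1" for v
    using subspace_mmul[OF U mone_closed _ that] that by simp
  then have zv: "\<phi> v = z \<odot>\<odot> v" if "v \<in> kmat n 1" for v using that by (simp add: U_def)
  have "z \<odot>\<odot> x = x \<odot>\<odot> z" if x: "x \<in> B" for x
  proof (rule mats_eqI_mcol[of _ K n n])
    have xk: "x \<in> kmat n n" using B x by blast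
    show "z \<odot>\<odot> x \<in> mats K n n" "x \<odot>\<odot> z \<in> mats K n n"
      using mmul_closed[OF z xk] mmul_closed[OF xk z] by (simp_all add: kmat_matsK)
    fix j assume j: "j < n"
    have "mcol (z \<odot>\<odot> x) j = z \<odot>\<odot> (x \<odot>\<odot> ecol n j)" using mcol_mmul[OF z xk j] mmul_ecol[OF xk j] by simp
    also have "\<dots> = x \<odot>\<odot> \<phi> (ecol n j)"
      using zv[OF mmul_closed[OF xk e_closed(2)[OF j]]] additive_commutingD(3)[OF \<phi> x e_closed(2)[OF j]] by simp
    also have "\<dots> = mcol (x \<odot>\<odot> z) j" using mcol_mmul[OF xk z j] ze[OF j] mmul_ecol[OF z j] by simp
    finally show "mcol (z \<odot>\<odot> x) j = mcol (x \<odot>\<odot> z) j" .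
  qed
  then show ?thesis using that z zv by blast
qed

text \<open>With \<open>card K - 1\<close> terms this extracts, up to a constant factor, the
  component of \<open>\<psi>\<close> on which replacing \<open>v\<close> by \<open>gen v\<close>
  multiplies the value by the inverse of \<open>\<alpha>\<close>. Partial sums are kept as the
  object of induction.\<close>

primrec fourier :: "nat \<Rightarrow> ('a mat \<Rightarrow> 'a mat) \<Rightarrow> 'a \<Rightarrow> nat \<Rightarrow> 'a mat \<Rightarrow> 'a mat" where
  "fourier n \<psi> \<alpha> 0 v = mzero n 1"
| "fourier n \<psi> \<alpha> (Suc k) v = fourier n \<psi> \<alpha> k v \<oplus>\<oplus> mscale (\<alpha> [^] k) (\<psi> (mscale (gen [^] k) v))"

context
  fixes n B \<psi> \<alpha>
  assumes \<psi>: "additive_commuting n B \<psi>" and \<alpha>: "\<alpha> \<in> K" and B: "B \<subseteq> kmat n n"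
begin

lemma fourier_term: "v \<in> kmat n 1 \<Longrightarrow> mscale (\<alpha> [^] (k::nat)) (\<psi> (mscale (gen [^] k) v)) \<in> kmat n 1"
  using additive_commutingD(1)[OF \<psi>] \<alpha> gen(1) by simp

lemma fourier_closed: "v \<in> kmat n 1 \<Longrightarrow> fourier n \<psi> \<alpha> k v \<in> kmat n 1"
  by (induction k) (simp_all add: fourier_term)

lemma fourier_additive_commuting: "additive_commuting n B (fourier n \<psi> \<alpha> k)"
  unfolding additive_commuting_def
proof (intro conjI ballI)
  fix v assume v: "v \<in> kmat n 1"
  show "fourier n \<psi> \<alpha> k v \<in> kmat n 1" by (rule fourier_closed[OF v])
  have g: "gen [^] i \<in> K" "\<alpha> [^] i \<in> K" for i :: nat using gen(1) \<alpha> by simp_all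
  show "fourier n \<psi> \<alpha> k (x \<odot>\<odot> v) = x \<odot>\<odot> fourier n \<psi> \<alpha> k v" if x: "x \<in> B" for x
  proof (induction k)
    case 0
    have "x \<in> kmat n n" using B x by blast
    then show ?case by simp
  next
    case (Suc k)
    have xk: "x \<in> kmat n n" using B x by blast
    have gv: "mscale (gen [^] k) v \<in> kmat n 1" using g(1) v by simp
    have "mscale (\<alpha> [^] k) (\<psi> (mscale (gen [^] k) (x \<odot>\<odot> v))) = x \<odot>\<odot> mscale (\<alpha> [^] k) (\<psi> (mscale (gen [^] k) v))"
      using mmul_scale(1)[OF g(1) xk v] additive_commutingD(3)[OF \<psi> x gv]
        mmul_scale(1)[OF g(2) xk additive_commutingD(1)[OF \<psi> gv]] by simp
    then show ?case using Suc mmul_distrib_left[OF xk fourier_closed[OF v] fourier_term[OF v]] by simp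
  qed
  fix u assume u: "u \<in> kmat n 1"
  show "fourier n \<psi> \<alpha> k (u \<oplus>\<oplus> v) = fourier n \<psi> \<alpha> k u \<oplus>\<oplus> fourier n \<psi> \<alpha> k v"
  proof (induction k)
    case (Suc k)
    have gu: "mscale (gen [^] k) u \<in> kmat n 1" "mscale (gen [^] k) v \<in> kmat n 1" using g(1) u v by simp_all
    have "mscale (\<alpha> [^] k) (\<psi> (mscale (gen [^] k) (u \<oplus>\<oplus> v)))
        = mscale (\<alpha> [^] k) (\<psi> (mscale (gen [^] k) u)) \<oplus>\<oplus> mscale (\<alpha> [^] k) (\<psi> (mscale (gen [^] k) v))"
      using mscale_madd[OF g(1) u v] additive_commutingD(2)[OF \<psi> gu]
        mscale_madd[OF g(2) additive_commutingD(1)[OF \<psi> gu(1)] additive_commutingD(1)[OF \<psi> gu(2)]] by simp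
    then show ?case
      using Suc madd_madd[OF fourier_closed[OF u] fourier_closed[OF v] fourier_term[OF u] fourier_term[OF v]] by simp
  qed simp
qed

lemma fourier_entry:
  assumes v: "v \<in> kmat n 1" and r: "r < n"
  shows "fourier n \<psi> \<alpha> k v $$ (r, 0) = (\<Oplus>i\<in>{..<k}. \<psi> (mscale (gen [^] i) v) $$ (r, 0) \<otimes> \<alpha> [^] i)"
proof (induction k)
  case 0
  show ?case using r by (simp add: mzero_entry)
next
  case (Suc k)
  have \<psi>k: "\<psi> (mscale (gen [^] (i::nat)) v) \<in> kmat n 1" for i
    using additive_commutingD(1)[OF \<psi>] gen(1) v by simp
  have K: "\<psi> (mscale (gen [^] (i::nat)) v) $$ (r, 0) \<in> K" for i using kmat_entry[OF \<psi>k r] by simp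
  have "fourier n \<psi> \<alpha> (Suc k) v $$ (r, 0)
      = fourier n \<psi> \<alpha> k v $$ (r, 0) \<oplus> mscale (\<alpha> [^] k) (\<psi> (mscale (gen [^] k) v)) $$ (r, 0)"
    using madd_entry[OF fourier_closed[OF v] r] by simp
  also have "mscale (\<alpha> [^] k) (\<psi> (mscale (gen [^] k) v)) $$ (r, 0) = \<psi> (mscale (gen [^] k) v) $$ (r, 0) \<otimes> \<alpha> [^] k"
    using mscale_entry[OF \<psi>k r] K \<alpha> by (simp add: m_comm)
  finally show ?case using Suc K \<alpha> by (simp add: lessThan_Suc a_comm)
qed

lemma fourier_shift:
  assumes v: "v \<in> kmat n 1"
  shows "mscale \<alpha> (fourier n \<psi> \<alpha> k (mscale gen v)) \<oplus>\<oplus> \<psi> v = fourier n \<psi> \<alpha> (Suc k) v"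
proof (induction k)
  case 0
  show ?case using v \<alpha> gen(1) additive_commutingD(1)[OF \<psi> v] by simp
next
  case (Suc k)
  let ?t = "\<psi> (mscale (gen [^] k) (mscale gen v))"
  have gv: "mscale gen v \<in> kmat n 1" using v gen(1) by simp
  note c = fourier_closed[OF gv] fourier_term[OF gv]
  have tk: "?t \<in> kmat n 1" using additive_commutingD(1)[OF \<psi>] gv gen(1) by simp
  have sc: "mscale \<alpha> (mscale (\<alpha> [^] k) ?t) = mscale (\<alpha> [^] Suc k) (\<psi> (mscale (gen [^] Suc k) v))"
    using mscale_mscale[of \<alpha> "\<alpha> [^] k" ?t n 1] mscale_mscale[of "gen [^] k" gen v n 1] tk \<alpha> gen(1) v
    by (simp add: m_comm)
  have "mscale \<alpha> (fourier n \<psi> \<alpha> (Suc k) (mscale gen v)) \<oplus>\<oplus> \<psi> v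
      = mscale \<alpha> (fourier n \<psi> \<alpha> k (mscale gen v)) \<oplus>\<oplus> mscale (\<alpha> [^] Suc k) (\<psi> (mscale (gen [^] Suc k) v)) \<oplus>\<oplus> \<psi> v"
    using mscale_madd[OF \<alpha> c] sc by simp
  also have "\<dots> = (mscale \<alpha> (fourier n \<psi> \<alpha> k (mscale gen v)) \<oplus>\<oplus> \<psi> v) \<oplus>\<oplus> mscale (\<alpha> [^] Suc k) (\<psi> (mscale (gen [^] Suc k) v))"
    by (rule madd_swap[OF mscale_closed[OF \<alpha> c(1)] fourier_term[OF v] additive_commutingD(1)[OF \<psi> v]])
  also have "\<dots> = fourier n \<psi> \<alpha> (Suc (Suc k)) v" using Suc by simp
  finally show ?case .
qed

text \<open>The sum runs over a full period, because \<open>\<alpha>\<close> and \<open>gen\<close>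
  have trivial power of exponent \<open>card K - 1\<close>. Shifting the summation index therefore
  only costs the factor \<open>inv \<alpha>\<close>.\<close>

lemma fourier_eigen:
  assumes v: "v \<in> kmat n 1" and nz: "\<alpha> \<noteq> \<zero>"
  shows "fourier n \<psi> \<alpha> (card K - 1) (mscale gen v) = mscale (inv \<alpha>) (fourier n \<psi> \<alpha> (card K - 1) v)"
proof -
  let ?N = "card K - 1"
  have gv: "mscale gen v \<in> kmat n 1" using v gen(1) by simp
  have i: "inv \<alpha> \<in> K" "inv \<alpha> \<otimes> \<alpha> = \<one>" using \<alpha> nz field_Units by auto
  have "\<alpha> [^] ?N = \<one>" "gen [^] ?N = \<one>"
    using unit_power_card \<alpha> nz gen(1) gen_nonzero by auto
  then have e: "mscale \<alpha> (fourier n \<psi> \<alpha> ?N (mscale gen v)) \<oplus>\<oplus> \<psi> v = fourier n \<psi> \<alpha> ?N v \<oplus>\<oplus> \<psi> v"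
    using fourier_shift[OF v, of ?N] v additive_commutingD(1)[OF \<psi> v] by simp
  let ?a = "mscale \<alpha> (fourier n \<psi> \<alpha> ?N (mscale gen v))" and ?b = "fourier n \<psi> \<alpha> ?N v"
  have k: "?a \<in> kmat n 1" "?b \<in> kmat n 1" "\<psi> v \<in> kmat n 1"
    using mscale_closed[OF \<alpha> fourier_closed[OF gv]] fourier_closed[OF v] additive_commutingD(1)[OF \<psi> v] by auto
  have "?a \<oplus>\<oplus> mneg ?b = \<psi> v \<oplus>\<oplus> mneg (\<psi> v)"
    by (rule madd_cancel[OF k(1,3,2,3) e])
  then have "?a = ?b" using madd_neg_zeroD[OF k(1,2)] k(3) by simp
  then have "mscale (inv \<alpha>) ?b = mscale (inv \<alpha>) ?a" by simp
  also have "\<dots> = fourier n \<psi> \<alpha> ?N (mscale gen v)"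
    using mscale_mscale[OF i(1) \<alpha> fourier_closed[OF gv]] i(2) mscale_one[OF fourier_closed[OF gv]] by simp
  finally show ?thesis by simp
qed

end

text \<open>Transform of the commutator of \<open>\<phi>\<close> with \<open>gen\<close>. At
  \<open>\<alpha> = inv gen\<close> the right-hand side cancels by \<open>fourier_eigen\<close>, so
  the commutator has no linear component.\<close>

lemma fourier_twist:
  assumes \<phi>: "additive_commuting n B \<phi>" and \<alpha>: "\<alpha> \<in> K" and B: "B \<subseteq> kmat n n" and v: "v \<in> kmat n 1"
  shows "fourier n (\<lambda>v. \<phi> (mscale gen v) \<oplus>\<oplus> mneg (mscale gen (\<phi> v))) \<alpha> k v
    = fourier n \<phi> \<alpha> k (mscale gen v) \<oplus>\<oplus> mneg (mscale gen (fourier n \<phi> \<alpha> k v))"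
proof (induction k)
  case 0
  show ?case using gen(1) by (simp add: mneg_mzero)
next
  case (Suc k)
  let ?a = "\<alpha> [^] k" and ?g = "gen [^] k"
  have K: "?a \<in> K" "?g \<in> K" using \<alpha> gen(1) by auto
  have gv: "mscale gen v \<in> kmat n 1" "mscale ?g v \<in> kmat n 1" using v gen(1) by auto
  have c: "mscale gen (mscale ?g v) = mscale ?g (mscale gen v)"
    using mscale_mscale[of gen ?g v n 1] mscale_mscale[of ?g gen v n 1] K gen(1) v by (simp add: m_comm)
  let ?x = "\<phi> (mscale ?g (mscale gen v))" and ?y = "\<phi> (mscale ?g v)"
  have xy: "?x \<in> kmat n 1" "?y \<in> kmat n 1" using additive_commutingD(1)[OF \<phi>] gv K by auto
  have "mscale ?a (?x \<oplus>\<oplus> mneg (mscale gen ?y)) = mscale ?a ?x \<oplus>\<oplus> mneg (mscale gen (mscale ?a ?y))"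
    using mscale_madd[OF K(1) xy(1)] mscale_mneg[OF K(1), of "mscale gen ?y" n 1] xy gen(1) K
      mscale_mscale[OF K(1) gen(1) xy(2)] mscale_mscale[OF gen(1) K(1) xy(2)] by (simp add: m_comm)
  moreover have "mneg (mscale gen (fourier n \<phi> \<alpha> k v \<oplus>\<oplus> mscale ?a ?y))
      = mneg (mscale gen (fourier n \<phi> \<alpha> k v)) \<oplus>\<oplus> mneg (mscale gen (mscale ?a ?y))"
    using mscale_madd[OF gen(1) fourier_closed[OF \<phi> \<alpha> B v] mscale_closed[OF K(1) xy(2)]]
      mneg_madd[of "mscale gen (fourier n \<phi> \<alpha> k v)" n 1 "mscale gen (mscale ?a ?y)"]
      fourier_closed[OF \<phi> \<alpha> B v] xy K gen(1) by simp
  ultimately show ?case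
    using Suc c madd_madd[of "fourier n \<phi> \<alpha> k (mscale gen v)" n 1 "mneg (mscale gen (fourier n \<phi> \<alpha> k v))"
        "mscale ?a ?x" "mneg (mscale gen (mscale ?a ?y))"]
      fourier_closed[OF \<phi> \<alpha> B gv(1)] fourier_closed[OF \<phi> \<alpha> B v] xy K gen(1) by simp
qed

text \<open>The relation at \<open>gen\<close> propagates to its powers, that is, to all nonzero
  scalars. Comparing multiples of the single nonzero vector \<open>\<phi> v0\<close> shows that the
  scalar function obtained respects sums and products.\<close>

lemma semilinear_of_eigen:
  assumes \<phi>: "additive_commuting n B \<phi>" and a: "a \<in> K"
    and eig: "\<And>v. v \<in> kmat n 1 \<Longrightarrow> \<phi> (mscale gen v) = mscale a (\<phi> v)"
    and v0: "v0 \<in> kmat n 1" "\<phi> v0 \<noteq> mzero n 1"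
  obtains \<sigma> where "field_endo \<sigma>" "semilinear n \<sigma> \<phi>" "\<sigma> gen = a"
proof -
  have "\<exists>c'. c' \<in> K \<and> (\<forall>v\<in>kmat n 1. \<phi> (mscale c v) = mscale c' (\<phi> v))" if c: "c \<in> K" for c
  proof (cases "c = \<zero>")
    case True
    have "\<phi> (mscale c v) = mscale \<zero> (\<phi> v)" if "v \<in> kmat n 1" for v
      using mscale_zero[OF that] mscale_zero[OF additive_commutingD(1)[OF \<phi> that]] additive_zero[OF \<phi>] True by simp
    then show ?thesis using True by blast
  next
    case False
    then obtain i :: nat where i: "c = gen [^] i" using gen_cases c by blast
    have "\<phi> (mscale (gen [^] i) v) = mscale (a [^] i) (\<phi> v)" if v: "v \<in> kmat n 1" for v
      using v
    proof (induction i arbitrary: v)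
      case 0
      then show ?case using mscale_one[OF additive_commutingD(1)[OF \<phi> 0]] mscale_one[OF 0] by simp
    next
      case (Suc i)
      have gv: "mscale gen v \<in> kmat n 1" using Suc gen(1) by simp
      have "mscale (gen [^] Suc i) v = mscale (gen [^] i) (mscale gen v)"
        using mscale_mscale[of "gen [^] i" gen v n 1] gen(1) Suc.prems by simp
      then have "\<phi> (mscale (gen [^] Suc i) v) = mscale (a [^] i) (mscale a (\<phi> v))"
        using Suc.IH[OF gv] eig[OF Suc.prems] by simp
      then show ?case
        using mscale_mscale[of "a [^] i" a "\<phi> v" n 1] a additive_commutingD(1)[OF \<phi> Suc.prems] by simp
    qed
    moreover have "a [^] i \<in> K" using a by simp
    ultimately show ?thesis unfolding i by blast
  qed
  then obtain \<sigma> where \<sigma>: "\<And>c. c \<in> K \<Longrightarrow> \<sigma> c \<in> K \<and> (\<forall>v\<in>kmat n 1. \<phi> (mscale c v) = mscale (\<sigma> c) (\<phi> v))"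
    by metis
  let ?w = "\<phi> v0"
  have w: "?w \<in> kmat n 1" using additive_commutingD(1)[OF \<phi> v0(1)] .
  have uniq: "\<sigma> c = c'" if "c \<in> K" "c' \<in> K" "\<phi> (mscale c v0) = mscale c' ?w" for c c'
    using mscale_cancel[OF w v0(2)] \<sigma>[OF that(1)] that v0(1) by metis
  have "field_endo \<sigma>"
    unfolding field_endo_def
  proof (intro conjI ballI)
    show "\<sigma> \<in> K \<rightarrow> K" using \<sigma> by blast
    show "\<sigma> \<one> = \<one>" by (rule uniq) (use v0 w in auto)
    fix c d assume cd: "c \<in> K" "d \<in> K"
    show "\<sigma> (c \<oplus> d) = \<sigma> c \<oplus> \<sigma> d"
    proof (rule uniq)
      show "\<phi> (mscale (c \<oplus> d) v0) = mscale (\<sigma> c \<oplus> \<sigma> d) ?w"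
        using mscale_add[OF cd v0(1)] additive_commutingD(2)[OF \<phi>, of "mscale c v0" "mscale d v0"]
          \<sigma> cd v0(1) mscale_add[of "\<sigma> c" "\<sigma> d" ?w n 1] w by simp
    qed (use cd \<sigma> in auto)
    show "\<sigma> (c \<otimes> d) = \<sigma> c \<otimes> \<sigma> d"
    proof (rule uniq)
      have dv: "mscale d v0 \<in> kmat n 1" using cd v0 by simp
      show "\<phi> (mscale (c \<otimes> d) v0) = mscale (\<sigma> c \<otimes> \<sigma> d) ?w"
        using mscale_mscale[OF cd v0(1)] \<sigma>[OF cd(1)] \<sigma>[OF cd(2)] dv v0(1) mscale_mscale[of "\<sigma> c" "\<sigma> d" ?w n 1] w
        by metis
    qed (use cd \<sigma> in auto)
  qed
  moreover have "semilinear n \<sigma> \<phi>" using \<sigma> by (simp add: semilinear_def)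
  moreover have "\<sigma> gen = a" by (rule uniq) (use gen(1) a eig v0 in auto)
  ultimately show ?thesis using that by blast
qed

text \<open>The commutator of \<open>\<phi>\<close> with \<open>gen\<close> is nonzero since
  \<open>\<phi>\<close> is not linear, and its component at \<open>inv gen\<close> vanishes. If all
  other components vanished too, Fourier inversion would make it zero. A surviving component is
  semilinear with \<open>\<sigma> gen = inv \<alpha>\<close>, different from
  \<open>gen\<close>.\<close>

lemma semilinear_decomposition:
  assumes n: "n > 0" and B: "B \<subseteq> kmat n n" and \<phi>: "additive_commuting n B \<phi>"
    and nonlin: "\<not> semilinear n (\<lambda>c. c) \<phi>"
  obtains \<sigma> \<phi>' v where "field_endo \<sigma>" "\<sigma> gen \<noteq> gen" "additive_commuting n B \<phi>'" "semilinear n \<sigma> \<phi>'"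
    "v \<in> kmat n 1" "\<phi>' v \<noteq> mzero n 1"
proof -
  define \<psi> where "\<psi> v = \<phi> (mscale gen v) \<oplus>\<oplus> mneg (mscale gen (\<phi> v))" for v
  let ?N = "card K - 1"
  note \<phi>D = additive_commutingD[OF \<phi>]
  have g: "gen \<in> K" by (rule gen(1))
  have gv: "mscale gen v \<in> kmat n 1" if "v \<in> kmat n 1" for v using that g by simp
  have \<psi>: "additive_commuting n B \<psi>"
    unfolding additive_commuting_def
  proof (intro conjI ballI)
    fix v assume v: "v \<in> kmat n 1"
    show "\<psi> v \<in> kmat n 1" unfolding \<psi>_def using \<phi>D(1)[OF gv[OF v]] \<phi>D(1)[OF v] g by simp
    show "\<psi> (x \<odot>\<odot> v) = x \<odot>\<odot> \<psi> v" if x: "x \<in> B" for x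
    proof -
      have xk: "x \<in> kmat n n" using B x by blast
      have k: "mscale gen (\<phi> v) \<in> kmat n 1" using \<phi>D(1)[OF v] g by simp
      show ?thesis unfolding \<psi>_def
        using mmul_scale(1)[OF g xk v] \<phi>D(3)[OF x gv[OF v]] \<phi>D(3)[OF x v] mmul_scale(1)[OF g xk \<phi>D(1)[OF v]]
          mmul_distrib_left[OF xk \<phi>D(1)[OF gv[OF v]] mneg_closed[OF k]] mmul_neg(1)[OF xk k] by simp
    qed
    fix u assume u: "u \<in> kmat n 1"
    show "\<psi> (u \<oplus>\<oplus> v) = \<psi> u \<oplus>\<oplus> \<psi> v"
    proof -
      have k: "mscale gen (\<phi> u) \<in> kmat n 1" "mscale gen (\<phi> v) \<in> kmat n 1" using \<phi>D(1) u v g by auto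
      show ?thesis unfolding \<psi>_def
        using mscale_madd[OF g u v] \<phi>D(2)[OF gv[OF u] gv[OF v]] \<phi>D(2)[OF u v]
          mscale_madd[OF g \<phi>D(1)[OF u] \<phi>D(1)[OF v]] mneg_madd[OF k]
          madd_madd[OF \<phi>D(1)[OF gv[OF u]] \<phi>D(1)[OF gv[OF v]] mneg_closed[OF k(1)] mneg_closed[OF k(2)]] by simp
    qed
  qed
  have "\<exists>v0\<in>kmat n 1. \<psi> v0 \<noteq> mzero n 1"
  proof (rule ccontr)
    assume *: "\<not> ?thesis"
    have eig: "\<phi> (mscale gen v) = mscale gen (\<phi> v)" if v: "v \<in> kmat n 1" for v
      by (rule madd_neg_zeroD[OF \<phi>D(1)[OF gv[OF v]]]) (use * v \<phi>D(1)[OF v] g in \<open>auto simp: \<psi>_def\<close>)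
    have "\<phi> (mscale c v) = mscale c (\<phi> v)" if c: "c \<in> K" and v: "v \<in> kmat n 1" for c v
    proof (cases "c = \<zero>")
      case True
      then show ?thesis using mscale_zero[OF v] mscale_zero[OF \<phi>D(1)[OF v]] additive_zero[OF \<phi>] by simp
    next
      case False
      then obtain i :: nat where i: "c = gen [^] i" using gen_cases c by blast
      show ?thesis unfolding i using v
      proof (induction i arbitrary: v)
        case 0
        then show ?case using mscale_one[OF \<phi>D(1)[OF 0]] mscale_one[OF 0] by simp
      next
        case (Suc i)
        have "mscale (gen [^] Suc i) v = mscale (gen [^] i) (mscale gen v)"
          using mscale_mscale[of "gen [^] i" gen v n 1] g Suc.prems by simp
        then show ?case
          using Suc.IH[OF gv[OF Suc.prems]] eig[OF Suc.prems] mscale_mscale[of "gen [^] i" gen "\<phi> v" n 1] g \<phi>D(1)[OF Suc.prems]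
          by simp
      qed
    qed
    then show False using nonlin by (simp add: semilinear_def)
  qed
  then obtain v0 where v0: "v0 \<in> kmat n 1" "\<psi> v0 \<noteq> mzero n 1" by blast
  have "\<exists>\<alpha>\<in>K - {\<zero>}. \<exists>v\<in>kmat n 1. \<alpha> \<noteq> inv gen \<and> fourier n \<psi> \<alpha> ?N v \<noteq> mzero n 1"
  proof (rule ccontr)
    assume *: "\<not> ?thesis"
    have ig: "inv gen \<in> K" "inv gen \<noteq> \<zero>" "inv (inv gen) = gen"
      using g gen_nonzero field_Units by auto
    have z: "fourier n \<psi> \<alpha> ?N v0 = mzero n 1" if \<alpha>: "\<alpha> \<in> K - {\<zero>}" for \<alpha>
    proof (cases "\<alpha> = inv gen")
      case False
      then show ?thesis using * \<alpha> v0 by blast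
    next
      case True
      have "fourier n \<psi> \<alpha> ?N v0 = fourier n \<phi> \<alpha> ?N (mscale gen v0) \<oplus>\<oplus> mneg (mscale gen (fourier n \<phi> \<alpha> ?N v0))"
        unfolding \<psi>_def by (rule fourier_twist[OF \<phi> _ B v0(1)]) (use \<alpha> in auto)
      also have "fourier n \<phi> \<alpha> ?N (mscale gen v0) = mscale gen (fourier n \<phi> \<alpha> ?N v0)"
        using fourier_eigen[OF \<phi> _ B v0(1), of \<alpha>] \<alpha> True ig by simp
      finally show ?thesis using fourier_closed[OF \<phi> _ B v0(1), of \<alpha>] \<alpha> g by simp
    qed
    obtain r where r: "r < n" "\<psi> v0 $$ (r, 0) \<noteq> \<zero>"
      using kmat_nonzero_entry[OF additive_commutingD(1)[OF \<psi> v0(1)] v0(2)] .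
    \<comment> \<open>In a fixed row the transform is a polynomial in \<open>\<alpha>\<close> of
      degree below \<open>card K - 1\<close>. Vanishing at all units, it has only zero coefficients,
      and the constant one is the entry of \<open>\<psi> v0\<close>.\<close>
    have "\<psi> (mscale (gen [^] (0::nat)) v0) $$ (r, 0) = \<zero>"
    proof (rule poly_fun_zero[where c = "\<lambda>i. \<psi> (mscale (gen [^] i) v0) $$ (r, 0)" and S = "K - {\<zero>}" and m = ?N])
      show "\<psi> (mscale (gen [^] i) v0) $$ (r, 0) \<in> K" for i :: nat
        using kmat_entry[OF additive_commutingD(1)[OF \<psi>] r(1)] g v0 by simp
      show "card (K - {\<zero>}) \<ge> ?N" using finite_carrier by (simp add: card_Diff_singleton)
      show "0 < ?N" using subfield_card_ge_2[OF KF] by simp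
      show "(\<Oplus>i\<in>{..<?N}. \<psi> (mscale (gen [^] i) v0) $$ (r, 0) \<otimes> \<alpha> [^] i) = \<zero>" if "\<alpha> \<in> K - {\<zero>}" for \<alpha>
        using fourier_entry[OF \<psi> _ B v0(1) r(1), of \<alpha> ?N] z[OF that] that r(1) by (simp add: mzero_entry)
    qed auto
    then show False using r v0 by simp
  qed
  then obtain \<alpha> v where \<alpha>: "\<alpha> \<in> K" "\<alpha> \<noteq> \<zero>" "\<alpha> \<noteq> inv gen" and v: "v \<in> kmat n 1" "fourier n \<psi> \<alpha> ?N v \<noteq> mzero n 1"
    by blast
  have i: "inv \<alpha> \<in> K" "inv (inv \<alpha>) = \<alpha>" using \<alpha> field_Units by auto
  obtain \<sigma> where \<sigma>: "field_endo \<sigma>" "semilinear n \<sigma> (fourier n \<psi> \<alpha> ?N)" "\<sigma> gen = inv \<alpha>"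
    using semilinear_of_eigen[OF fourier_additive_commuting[OF \<psi> \<alpha>(1) B] i(1) fourier_eigen[OF \<psi> \<alpha>(1) B _ \<alpha>(2)] v]
    by blast
  have "\<sigma> gen \<noteq> gen" using \<sigma>(3) \<alpha>(3) i by metis
  then show ?thesis using that[OF \<sigma>(1) _ fourier_additive_commuting[OF \<psi> \<alpha>(1) B] \<sigma>(2) v] by blast
qed

section \<open>Endomorphisms of the field, their order and their norm\<close>

lemma field_endoD:
  assumes "field_endo \<sigma>"
  shows "a \<in> K \<Longrightarrow> \<sigma> a \<in> K" "a \<in> K \<Longrightarrow> b \<in> K \<Longrightarrow> \<sigma> (a \<oplus> b) = \<sigma> a \<oplus> \<sigma> b"
    "a \<in> K \<Longrightarrow> b \<in> K \<Longrightarrow> \<sigma> (a \<otimes> b) = \<sigma> a \<otimes> \<sigma> b" "\<sigma> \<one> = \<one>"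
  using assms by (auto simp: field_endo_def)

lemma field_endo_zero:
  assumes \<sigma>: "field_endo \<sigma>"
  shows "\<sigma> \<zero> = \<zero>"
proof -
  have "\<sigma> \<zero> \<oplus> \<sigma> \<zero> = \<sigma> \<zero>" using field_endoD(2)[OF \<sigma>, of \<zero> \<zero>] by simp
  then show ?thesis using field_endoD(1)[OF \<sigma> zero_closed] by (metis add.l_cancel_one')
qed

lemma field_endo_uminus:
  assumes \<sigma>: "field_endo \<sigma>" and a: "a \<in> K"
  shows "\<sigma> (\<ominus> a) = \<ominus> \<sigma> a"
proof -
  have "\<sigma> (\<ominus> a) \<oplus> \<sigma> a = \<zero>"
    using field_endoD(2)[OF \<sigma>, of "\<ominus> a" a] a field_endo_zero[OF \<sigma>] by (simp add: l_neg)
  then show ?thesis using minus_equality[of "\<sigma> (\<ominus> a)" "\<sigma> a"] field_endoD(1)[OF \<sigma>] a by simp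
qed

lemma field_endo_nonzero:
  assumes \<sigma>: "field_endo \<sigma>" and a: "a \<in> K" "a \<noteq> \<zero>"
  shows "\<sigma> a \<noteq> \<zero>"
proof
  assume "\<sigma> a = \<zero>"
  moreover have "a \<otimes> inv a = \<one>" "inv a \<in> K" using a field_Units by auto
  ultimately have "\<one> = \<zero>"
    using field_endoD(3)[OF \<sigma> a(1), of "inv a"] field_endoD(1,4)[OF \<sigma>] by simp
  then show False by simp
qed

lemma field_endo_inj:
  assumes \<sigma>: "field_endo \<sigma>" and ab: "a \<in> K" "b \<in> K" "\<sigma> a = \<sigma> b"
  shows "a = b"
proof -
  have "\<sigma> (a \<oplus> \<ominus> b) = \<zero>"
    using field_endoD(2)[OF \<sigma>, of a "\<ominus> b"] field_endo_uminus[OF \<sigma>] ab field_endoD(1)[OF \<sigma>]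
    by (simp add: r_neg)
  then have "a \<oplus> \<ominus> b = \<zero>" using field_endo_nonzero[OF \<sigma>, of "a \<oplus> \<ominus> b"] ab by auto
  then show ?thesis using ab by (metis a_inv_closed add.inv_equality minus_minus)
qed

lemma field_endo_pow:
  assumes \<sigma>: "field_endo \<sigma>" and a: "a \<in> K"
  shows "\<sigma> (a [^] (i::nat)) = \<sigma> a [^] i"
  by (induction i) (use field_endoD[OF \<sigma>] a in auto)

lemma field_endo_funpow:
  assumes \<sigma>: "field_endo \<sigma>"
  shows "field_endo (\<sigma> ^^ i)"
  by (induction i) (use field_endoD[OF \<sigma>] in \<open>auto simp: field_endo_def Pi_def\<close>)

lemma field_endo_gen_fixed:
  assumes \<sigma>: "field_endo \<sigma>" and g: "\<sigma> gen = gen" and a: "a \<in> K"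
  shows "\<sigma> a = a"
proof (cases "a = \<zero>")
  case False
  then obtain i :: nat where "a = gen [^] i" using gen_cases a by blast
  then show ?thesis using field_endo_pow[OF \<sigma> gen(1)] g by simp
qed (simp add: field_endo_zero[OF \<sigma>])

definition fixed_field :: "('a \<Rightarrow> 'a) \<Rightarrow> 'a set" where
  "fixed_field \<sigma> = {a \<in> K. \<sigma> a = a}"

lemma field_endo_inv:
  assumes \<sigma>: "field_endo \<sigma>" and a: "a \<in> K" "a \<noteq> \<zero>"
  shows "\<sigma> (inv a) = inv (\<sigma> a)"
proof -
  have i: "inv a \<in> K" "inv a \<otimes> a = \<one>" using a field_Units by auto
  have "\<sigma> (inv a) \<otimes> \<sigma> a = \<one>" using field_endoD(3)[OF \<sigma> i(1) a(1)] i field_endoD(4)[OF \<sigma>] by simp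
  moreover have "\<sigma> (inv a) \<in> K" "\<sigma> a \<in> K" using field_endoD(1)[OF \<sigma>] i a by auto
  ultimately show ?thesis by (metis comm_inv_char m_comm)
qed

lemma fixed_field_subfield:
  assumes \<sigma>: "field_endo \<sigma>"
  shows "subfield (fixed_field \<sigma>) R"
proof (rule subfieldI')
  show "subring (fixed_field \<sigma>) R"
    by (rule subringI)
      (use field_endoD[OF \<sigma>] field_endo_zero[OF \<sigma>] field_endo_uminus[OF \<sigma>] in \<open>auto simp: fixed_field_def\<close>)
  fix k assume k: "k \<in> fixed_field \<sigma> - {\<zero>}"
  then have "k \<in> K" "k \<noteq> \<zero>" "\<sigma> k = k" by (auto simp: fixed_field_def)
  then show "inv k \<in> fixed_field \<sigma>"
    using field_endo_inv[OF \<sigma>, of k] field_Units by (auto simp: fixed_field_def)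
qed

text \<open>The Vandermonde argument in the style of Artin's independence of characters: subtracting
  \<open>t m\<close> times one relation from the next removes the last term and leaves the
  coefficients \<open>\<alpha> i (t i - t m)\<close>.\<close>

lemma power_sums_zero:
  fixes m :: nat
  assumes "\<And>i. i < m \<Longrightarrow> t i \<in> K" "inj_on t {..<m}" "\<And>i. i < m \<Longrightarrow> \<alpha> i \<in> K"
    "\<And>j::nat. (\<Oplus>i\<in>{..<m}. \<alpha> i \<otimes> t i [^] j) = \<zero>"
  shows "i < m \<Longrightarrow> \<alpha> i = \<zero>"
  using assms
proof (induction m arbitrary: \<alpha> i)
  case (Suc m)
  have t: "t i \<in> K" if "i \<le> m" for i using Suc.prems(2) that by simp
  have \<alpha>: "\<alpha> i \<in> K" if "i \<le> m" for i using Suc.prems(4) that by simp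
  have S: "(\<Oplus>i\<in>{..<Suc m}. f i) = f m \<oplus> (\<Oplus>i\<in>{..<m}. f i)" if "\<And>i. i \<le> m \<Longrightarrow> f i \<in> K" for f
    using that by (simp add: lessThan_Suc Pi_def)
  have z: "\<alpha> m \<otimes> t m [^] j \<oplus> (\<Oplus>i\<in>{..<m}. \<alpha> i \<otimes> t i [^] j) = \<zero>" for j :: nat
    using Suc.prems(5)[of j] S[of "\<lambda>i. \<alpha> i \<otimes> t i [^] j"] t \<alpha> by simp
  have first: "\<alpha> i = \<zero>" if i: "i < m" for i
  proof -
    have "\<alpha> i \<otimes> (t i \<ominus> t m) = \<zero>"
    proof (rule Suc.IH[where \<alpha> = "\<lambda>i. \<alpha> i \<otimes> (t i \<ominus> t m)", OF i])
      show "inj_on t {..<m}" using Suc.prems(3) by (auto intro: inj_on_subset)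
      fix j :: nat
      have K: "\<alpha> i \<otimes> t i [^] j \<in> K" "\<alpha> i \<otimes> t i [^] Suc j \<in> K" if "i < m" for i using that t \<alpha> by auto
      have "(\<Oplus>i\<in>{..<m}. \<alpha> i \<otimes> (t i \<ominus> t m) \<otimes> t i [^] j)
          = (\<Oplus>i\<in>{..<m}. \<alpha> i \<otimes> t i [^] Suc j \<oplus> \<ominus> t m \<otimes> (\<alpha> i \<otimes> t i [^] j))"
      proof (rule finsum_cong')
        fix i assume "i \<in> {..<m}"
        then have k: "\<alpha> i \<in> K" "t i \<in> K" "t m \<in> K" "t i [^] j \<in> K" using t \<alpha> by auto
        have "\<alpha> i \<otimes> (t i \<ominus> t m) \<otimes> t i [^] j = \<alpha> i \<otimes> (t i [^] j \<otimes> t i) \<oplus> \<ominus> t m \<otimes> (\<alpha> i \<otimes> t i [^] j)"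
          using k by algebra
        then show "\<alpha> i \<otimes> (t i \<ominus> t m) \<otimes> t i [^] j = \<alpha> i \<otimes> t i [^] Suc j \<oplus> \<ominus> t m \<otimes> (\<alpha> i \<otimes> t i [^] j)" by simp
      qed (use K t in auto)
      also have "\<dots> = (\<Oplus>i\<in>{..<m}. \<alpha> i \<otimes> t i [^] Suc j) \<oplus> (\<Oplus>i\<in>{..<m}. \<ominus> t m \<otimes> (\<alpha> i \<otimes> t i [^] j))"
        by (rule finsum_addf) (use K t in auto)
      also have "(\<Oplus>i\<in>{..<m}. \<ominus> t m \<otimes> (\<alpha> i \<otimes> t i [^] j)) = \<ominus> t m \<otimes> (\<Oplus>i\<in>{..<m}. \<alpha> i \<otimes> t i [^] j)"
        by (rule finsum_rdistr[symmetric]) (use K t in auto)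
      finally have e: "(\<Oplus>i\<in>{..<m}. \<alpha> i \<otimes> (t i \<ominus> t m) \<otimes> t i [^] j)
          = (\<Oplus>i\<in>{..<m}. \<alpha> i \<otimes> t i [^] Suc j) \<oplus> \<ominus> t m \<otimes> (\<Oplus>i\<in>{..<m}. \<alpha> i \<otimes> t i [^] j)" .
      define A where "A = (\<Oplus>i\<in>{..<m}. \<alpha> i \<otimes> t i [^] j)"
      define A' where "A' = (\<Oplus>i\<in>{..<m}. \<alpha> i \<otimes> t i [^] Suc j)"
      have AK: "A \<in> K" "A' \<in> K" unfolding A_def A'_def using K by (auto intro!: finsum_closed)
      have k: "\<alpha> m \<in> K" "t m \<in> K" "t m [^] j \<in> K" using t \<alpha> by auto
      have z1: "\<alpha> m \<otimes> t m [^] j \<oplus> A = \<zero>" using z[of j] by (simp add: A_def)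
      have z2: "\<alpha> m \<otimes> (t m [^] j \<otimes> t m) \<oplus> A' = \<zero>" using z[of "Suc j"] by (simp add: A'_def)
      have "A' \<oplus> \<ominus> t m \<otimes> A = (\<alpha> m \<otimes> (t m [^] j \<otimes> t m) \<oplus> A') \<oplus> \<ominus> t m \<otimes> (\<alpha> m \<otimes> t m [^] j \<oplus> A)"
        using k AK by algebra
      also have "\<dots> = \<zero>" unfolding z1 z2 using k by simp
      finally show "(\<Oplus>i\<in>{..<m}. \<alpha> i \<otimes> (t i \<ominus> t m) \<otimes> t i [^] j) = \<zero>"
        unfolding e A_def A'_def .
    qed (use t \<alpha> in auto)
    moreover have "t i \<ominus> t m \<noteq> \<zero>"
    proof
      assume "t i \<ominus> t m = \<zero>"
      then have "t i = t m" using t[of i] t[of m] i by (simp add: r_right_minus_eq)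
      then show False using Suc.prems(3) i by (auto simp: inj_on_def)
    qed
    ultimately show ?thesis using integral[of "\<alpha> i" "t i \<ominus> t m"] \<alpha>[of i] t[of i] t[of m] i by auto
  qed
  show ?case
  proof (cases "i = m")
    case True
    have "(\<Oplus>i\<in>{..<m}. \<alpha> i \<otimes> t i [^] (0::nat)) = (\<Oplus>i\<in>{..<m}. \<zero>)"
      by (rule finsum_cong') (use first t in auto)
    then show ?thesis using z[of 0] t[of m] \<alpha>[of m] True by simp
  qed (use first Suc.prems(1) in simp)
qed simp

text \<open>An endomorphism fixing \<open>gen\<close> is the identity, since \<open>gen\<close>
  generates the unit group; so this is the order of \<open>\<sigma>\<close>, tested on one
  element.\<close>

definition endo_order :: "('a \<Rightarrow> 'a) \<Rightarrow> nat" where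
  "endo_order \<sigma> = (LEAST l. l > 0 \<and> (\<sigma> ^^ l) gen = gen)"

context
  fixes \<sigma>
  assumes \<sigma>: "field_endo \<sigma>"
begin

lemma funpow_cancel_gen:
  assumes "i < j" "(\<sigma> ^^ i) gen = (\<sigma> ^^ j) gen"
  shows "(\<sigma> ^^ (j - i)) gen = gen"
proof -
  have "(\<sigma> ^^ j) gen = (\<sigma> ^^ i) ((\<sigma> ^^ (j - i)) gen)"
    using assms(1) funpow_add[of i "j - i" \<sigma>] by simp
  then show ?thesis
    using field_endo_inj[OF field_endo_funpow[OF \<sigma>, of i], of "(\<sigma> ^^ (j - i)) gen" gen] assms(2)
      field_endoD(1)[OF field_endo_funpow[OF \<sigma>] gen(1)] gen(1) by simp
qed

lemma endo_order: "endo_order \<sigma> > 0" "(\<sigma> ^^ endo_order \<sigma>) gen = gen"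
  "\<And>l. 0 < l \<Longrightarrow> (\<sigma> ^^ l) gen = gen \<Longrightarrow> endo_order \<sigma> \<le> l"
proof -
  have "range (\<lambda>i. (\<sigma> ^^ i) gen) \<subseteq> K" using field_endoD(1)[OF field_endo_funpow[OF \<sigma>] gen(1)] by auto
  then have "\<not> inj (\<lambda>i. (\<sigma> ^^ i) gen)"
    using finite_carrier finite_subset range_inj_infinite by blast
  then obtain i j where "i \<noteq> j" "(\<sigma> ^^ i) gen = (\<sigma> ^^ j) gen" by (auto simp: inj_on_def)
  then have "\<exists>i j. i < j \<and> (\<sigma> ^^ i) gen = (\<sigma> ^^ j) gen" by (metis nat_neq_iff)
  then obtain l where "l > 0 \<and> (\<sigma> ^^ l) gen = gen" using funpow_cancel_gen by (metis zero_less_diff)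
  from LeastI[of "\<lambda>l. l > 0 \<and> (\<sigma> ^^ l) gen = gen", OF this]
  show "endo_order \<sigma> > 0" "(\<sigma> ^^ endo_order \<sigma>) gen = gen" by (simp_all add: endo_order_def)
  show "\<And>l. 0 < l \<Longrightarrow> (\<sigma> ^^ l) gen = gen \<Longrightarrow> endo_order \<sigma> \<le> l"
    unfolding endo_order_def by (rule Least_le) simp
qed

lemma endo_order_id: "a \<in> K \<Longrightarrow> (\<sigma> ^^ endo_order \<sigma>) a = a"
  by (rule field_endo_gen_fixed[OF field_endo_funpow[OF \<sigma>] endo_order(2)])

lemma conjugates_distinct: "inj_on (\<lambda>i. (\<sigma> ^^ i) gen) {..<endo_order \<sigma>}"
proof (rule inj_onI)
  have *: False if "i < j" "j < endo_order \<sigma>" "(\<sigma> ^^ i) gen = (\<sigma> ^^ j) gen" for i j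
    using endo_order(3)[of "j - i"] funpow_cancel_gen[OF that(1,3)] that by simp
  fix i j assume "i \<in> {..<endo_order \<sigma>}" "j \<in> {..<endo_order \<sigma>}" "(\<sigma> ^^ i) gen = (\<sigma> ^^ j) gen"
  then show "i = j" using *[of i j] *[of j i] by (cases i j rule: linorder_cases) auto
qed

primrec orbit_sum :: "nat \<Rightarrow> ('a mat \<Rightarrow> 'a mat) \<Rightarrow> nat \<Rightarrow> 'a mat \<Rightarrow> 'a mat" where
  "orbit_sum n \<psi> 0 v = mzero n 1"
| "orbit_sum n \<psi> (Suc k) v = orbit_sum n \<psi> k v \<oplus>\<oplus> (\<psi> ^^ k) v"

text \<open>
  The sum \<open>v + \<psi> v + \<dots>\<close> over the orbit is fixed by \<open>\<psi>\<close>. If it vanished on all multiples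
  \<open>\<theta>\<^sup>j v\<close> of a vector, the distinct conjugates of \<open>\<theta>\<close> would satisfy a linear relation.
\<close>

lemma semilinear_fixed_vector:
  assumes n: "n > 0" and \<psi>: "additive_commuting n B \<psi>" and sl: "semilinear n \<sigma> \<psi>"
    and ord: "\<And>v. v \<in> kmat n 1 \<Longrightarrow> (\<psi> ^^ endo_order \<sigma>) v = v"
  obtains w where "w \<in> kmat n 1" "w \<noteq> mzero n 1" "\<psi> w = w"
proof -
  let ?l = "endo_order \<sigma>"
  note \<psi>D = additive_commutingD[OF \<psi>]
  have pk: "(\<psi> ^^ k) v \<in> kmat n 1" if "v \<in> kmat n 1" for k v
    by (induction k) (use that \<psi>D(1) in auto)
  have psl: "(\<psi> ^^ k) (mscale c v) = mscale ((\<sigma> ^^ k) c) ((\<psi> ^^ k) v)" if "v \<in> kmat n 1" "c \<in> K" for k c v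
    by (induction k) (use that sl pk field_endoD(1)[OF field_endo_funpow[OF \<sigma>]] in \<open>auto simp: semilinear_def\<close>)
  have osk: "orbit_sum n \<psi> k v \<in> kmat n 1" if "v \<in> kmat n 1" for k v
    by (induction k) (use pk that in auto)
  have shift: "\<psi> (orbit_sum n \<psi> k v) \<oplus>\<oplus> v = orbit_sum n \<psi> (Suc k) v" if v: "v \<in> kmat n 1" for k v
  proof (induction k)
    case 0
    show ?case using additive_zero[OF \<psi>] v by simp
  next
    case (Suc k)
    have "\<psi> (orbit_sum n \<psi> (Suc k) v) \<oplus>\<oplus> v = \<psi> (orbit_sum n \<psi> k v) \<oplus>\<oplus> (\<psi> ^^ Suc k) v \<oplus>\<oplus> v"
      using \<psi>D(2)[OF osk[OF v] pk[OF v]] by simp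
    also have "\<dots> = \<psi> (orbit_sum n \<psi> k v) \<oplus>\<oplus> v \<oplus>\<oplus> (\<psi> ^^ Suc k) v"
      by (rule madd_swap[OF \<psi>D(1)[OF osk[OF v]] pk[OF v] v])
    also have "\<dots> = orbit_sum n \<psi> (Suc (Suc k)) v" using Suc by simp
    finally show ?case .
  qed
  have fixed: "\<psi> (orbit_sum n \<psi> ?l v) = orbit_sum n \<psi> ?l v" if v: "v \<in> kmat n 1" for v
  proof -
    have "\<psi> (orbit_sum n \<psi> ?l v) \<oplus>\<oplus> v = orbit_sum n \<psi> ?l v \<oplus>\<oplus> v"
      using shift[OF v, of ?l] ord[OF v] by simp
    from madd_cancel[OF \<psi>D(1)[OF osk[OF v]] v osk[OF v] v this]
    have "\<psi> (orbit_sum n \<psi> ?l v) \<oplus>\<oplus> mneg (orbit_sum n \<psi> ?l v) = mzero n 1" using v by simp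
    then show ?thesis by (rule madd_neg_zeroD[OF \<psi>D(1)[OF osk[OF v]] osk[OF v]])
  qed
  \<comment> \<open>A vector with entry 1 in row 0: the relation between the conjugates of
    \<open>gen\<close> then has coefficient 1 at index 0, which contradicts their
    independence.\<close>
  define v where "v = ecol n 0"
  have v: "v \<in> kmat n 1" using n by (simp add: v_def)
  have v0: "v $$ (0, 0) = \<one>" using n by (simp add: v_def ecol_def mcol_def mone_def)
  have gv: "mscale (gen [^] (j::nat)) v \<in> kmat n 1" for j using v gen(1) by simp
  have entry: "orbit_sum n \<psi> k (mscale (gen [^] (j::nat)) v) $$ (0, 0)
      = (\<Oplus>i\<in>{..<k}. (\<psi> ^^ i) v $$ (0, 0) \<otimes> ((\<sigma> ^^ i) gen) [^] j)" for k j
  proof (induction k)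
    case 0
    show ?case using n by (simp add: mzero_entry)
  next
    case (Suc k)
    have K: "(\<psi> ^^ i) v $$ (0, 0) \<in> K" "(\<sigma> ^^ i) gen \<in> K" for i
      using kmat_entry[OF pk[OF v] n] field_endoD(1)[OF field_endo_funpow[OF \<sigma>] gen(1)] by auto
    have "(\<psi> ^^ k) (mscale (gen [^] j) v) = mscale (((\<sigma> ^^ k) gen) [^] j) ((\<psi> ^^ k) v)"
      using psl[OF v] gen(1) field_endo_pow[OF field_endo_funpow[OF \<sigma>] gen(1)] by simp
    then have "(\<psi> ^^ k) (mscale (gen [^] j) v) $$ (0, 0) = (\<psi> ^^ k) v $$ (0, 0) \<otimes> ((\<sigma> ^^ k) gen) [^] j"
      using mscale_entry[OF pk[OF v] n, of 0] K by (simp add: m_comm)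
    then show ?case using Suc K madd_entry[OF osk[OF gv] n, of 0] by (simp add: lessThan_Suc a_comm)
  qed
  have "\<exists>j::nat. orbit_sum n \<psi> ?l (mscale (gen [^] j) v) \<noteq> mzero n 1"
  proof (rule ccontr)
    assume "\<not> ?thesis"
    then have z: "(\<Oplus>i\<in>{..<?l}. (\<psi> ^^ i) v $$ (0, 0) \<otimes> ((\<sigma> ^^ i) gen) [^] j) = \<zero>" for j :: nat
      using entry[of ?l j] n by (simp add: mzero_entry)
    have "(\<psi> ^^ 0) v $$ (0, 0) = \<zero>"
      by (rule power_sums_zero[OF _ conjugates_distinct _ z endo_order(1)])
        (use kmat_entry[OF pk[OF v] n] field_endoD(1)[OF field_endo_funpow[OF \<sigma>] gen(1)] in auto)
    then show False using v0 by simp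
  qed
  then show ?thesis using that osk[OF gv] fixed[OF gv] by blast
qed

text \<open>The product of the first \<open>k\<close> conjugates of \<open>a\<close>, arranged as
  the factor that the \<open>k\<close>-th iterate of \<open>v -> a \<sigma>(v)\<close>
  acquires.\<close>

primrec endo_norm :: "nat \<Rightarrow> 'a \<Rightarrow> 'a" where
  "endo_norm 0 a = \<one>"
| "endo_norm (Suc k) a = a \<otimes> \<sigma> (endo_norm k a)"

lemma endo_norm_closed: "a \<in> K \<Longrightarrow> endo_norm k a \<in> K"
  by (induction k) (use field_endoD(1)[OF \<sigma>] in auto)

lemma endo_norm_nonzero: "a \<in> K \<Longrightarrow> a \<noteq> \<zero> \<Longrightarrow> endo_norm k a \<noteq> \<zero>"
proof (induction k)
  case (Suc k)
  then have "\<sigma> (endo_norm k a) \<noteq> \<zero>" using field_endo_nonzero[OF \<sigma> endo_norm_closed] by simp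
  then show ?case using Suc integral[of a "\<sigma> (endo_norm k a)"] field_endoD(1)[OF \<sigma> endo_norm_closed] by auto
qed simp

lemma endo_norm_mult:
  "a \<in> K \<Longrightarrow> b \<in> K \<Longrightarrow> endo_norm k (a \<otimes> b) = endo_norm k a \<otimes> endo_norm k b"
proof (induction k)
  case (Suc k)
  then have k: "a \<in> K" "b \<in> K" "\<sigma> (endo_norm k a) \<in> K" "\<sigma> (endo_norm k b) \<in> K"
    using field_endoD(1)[OF \<sigma> endo_norm_closed] by auto
  have "endo_norm (Suc k) (a \<otimes> b) = a \<otimes> b \<otimes> (\<sigma> (endo_norm k a) \<otimes> \<sigma> (endo_norm k b))"
    using Suc field_endoD(3)[OF \<sigma> endo_norm_closed endo_norm_closed] by simp
  also have "\<dots> = (a \<otimes> \<sigma> (endo_norm k a)) \<otimes> (b \<otimes> \<sigma> (endo_norm k b))" using k by algebra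
  finally show ?case by simp
qed simp

lemma endo_norm_Suc': "a \<in> K \<Longrightarrow> endo_norm (Suc k) a = endo_norm k a \<otimes> (\<sigma> ^^ k) a"
proof (induction k)
  case 0
  then show ?case using field_endoD(4)[OF \<sigma>] by simp
next
  case (Suc k)
  have "endo_norm (Suc (Suc k)) a = a \<otimes> \<sigma> (endo_norm k a \<otimes> (\<sigma> ^^ k) a)" using Suc by simp
  also have "\<dots> = a \<otimes> (\<sigma> (endo_norm k a) \<otimes> (\<sigma> ^^ Suc k) a)"
    using field_endoD(3)[OF \<sigma> endo_norm_closed[OF Suc.prems] field_endoD(1)[OF field_endo_funpow[OF \<sigma>] Suc.prems]] by simp
  also have "\<dots> = endo_norm (Suc k) a \<otimes> (\<sigma> ^^ Suc k) a"
    using m_assoc[OF Suc.prems field_endoD(1)[OF \<sigma> endo_norm_closed[OF Suc.prems]]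
        field_endoD(1)[OF field_endo_funpow[OF \<sigma>, of "Suc k"] Suc.prems]] by simp
  finally show ?case .
qed

lemma endo_norm_fixed:
  assumes a: "a \<in> K" "a \<noteq> \<zero>"
  shows "\<sigma> (endo_norm (endo_order \<sigma>) a) = endo_norm (endo_order \<sigma>) a"
proof -
  let ?N = "endo_norm (endo_order \<sigma>) a"
  have k: "?N \<in> K" "\<sigma> ?N \<in> K" using endo_norm_closed[OF a(1)] field_endoD(1)[OF \<sigma>] by auto
  have "a \<otimes> \<sigma> ?N = ?N \<otimes> a" using endo_norm_Suc'[OF a(1), of "endo_order \<sigma>"] endo_order_id[OF a(1)] by simp
  then show ?thesis using a k m_lcancel[of a "\<sigma> ?N" ?N] by (simp add: m_comm)
qed

text \<open>On \<open>1 x 1\<close> matrices the map \<open>v -> a \<sigma>(v)\<close> is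
  semilinear, and its iterate of length \<open>endo_order \<sigma>\<close> is multiplication by the
  norm of \<open>a\<close>, hence the identity. A nonzero fixed vector of it is the required
  \<open>w\<close>.\<close>

lemma hilbert_90:
  assumes a: "a \<in> K" and N: "endo_norm (endo_order \<sigma>) a = \<one>"
  obtains w where "w \<in> K" "w \<noteq> \<zero>" "a \<otimes> \<sigma> w = w"
proof -
  define \<psi> where "\<psi> v = mscale (a \<otimes> \<sigma> (v $$ (0, 0))) (mone 1)" for v
  have e: "v $$ (0, 0) \<in> K" if "v \<in> kmat 1 1" for v using kmat_entry[OF that, of 0 0] by simp
  have \<psi>k: "\<psi> v \<in> kmat 1 1" if "v \<in> kmat 1 1" for v
    unfolding \<psi>_def using a field_endoD(1)[OF \<sigma> e[OF that]] by simp
  have \<psi>e: "\<psi> v $$ (0, 0) = a \<otimes> \<sigma> (v $$ (0, 0))" if "v \<in> kmat 1 1" for v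
    unfolding \<psi>_def using mscale_entry[OF mone_closed[of 1], of 0 0] a field_endoD(1)[OF \<sigma> e[OF that]]
    by (simp add: mone_entry)
  have eq: "u = v" if "u \<in> kmat 1 1" "v \<in> kmat 1 1" "u $$ (0, 0) = v $$ (0, 0)" for u v
    by (rule kmat_eqI[OF that(1,2)]) (use that in simp)
  have "additive_commuting 1 {} \<psi>"
    unfolding additive_commuting_def
  proof (intro conjI ballI)
    fix u v assume uv: "u \<in> kmat 1 1" "v \<in> kmat 1 1"
    show "\<psi> (u \<oplus>\<oplus> v) = \<psi> u \<oplus>\<oplus> \<psi> v"
    proof (rule eq)
      have "(u \<oplus>\<oplus> v) $$ (0, 0) = u $$ (0, 0) \<oplus> v $$ (0, 0)" by (rule madd_entry[OF uv(1)]) auto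
      moreover have "(\<psi> u \<oplus>\<oplus> \<psi> v) $$ (0, 0) = \<psi> u $$ (0, 0) \<oplus> \<psi> v $$ (0, 0)" by (rule madd_entry[OF \<psi>k[OF uv(1)]]) auto
      ultimately show "\<psi> (u \<oplus>\<oplus> v) $$ (0, 0) = (\<psi> u \<oplus>\<oplus> \<psi> v) $$ (0, 0)"
        using \<psi>e[OF madd_closed[OF uv]] \<psi>e[OF uv(1)] \<psi>e[OF uv(2)] field_endoD(2)[OF \<sigma> e[OF uv(1)] e[OF uv(2)]]
          a field_endoD(1)[OF \<sigma> e[OF uv(1)]] field_endoD(1)[OF \<sigma> e[OF uv(2)]] by (simp add: r_distr)
    qed (use \<psi>k uv in auto)
  qed (use \<psi>k in auto)
  moreover have "semilinear 1 \<sigma> \<psi>"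
    unfolding semilinear_def
  proof (intro ballI)
    fix c v assume c: "c \<in> K" and v: "v \<in> kmat 1 1"
    have cv: "mscale c v \<in> kmat 1 1" using c v by simp
    show "\<psi> (mscale c v) = mscale (\<sigma> c) (\<psi> v)"
    proof (rule eq)
      have "\<psi> (mscale c v) $$ (0, 0) = a \<otimes> \<sigma> (c \<otimes> v $$ (0, 0))"
        using \<psi>e[OF cv] mscale_entry[OF v, of 0 0 c] by simp
      also have "\<dots> = \<sigma> c \<otimes> (a \<otimes> \<sigma> (v $$ (0, 0)))"
        using field_endoD(3)[OF \<sigma> c e[OF v]] a field_endoD(1)[OF \<sigma> c] field_endoD(1)[OF \<sigma> e[OF v]] by (simp add: m_lcomm)
      also have "\<dots> = mscale (\<sigma> c) (\<psi> v) $$ (0, 0)" using \<psi>e[OF v] mscale_entry[OF \<psi>k[OF v], of 0 0 "\<sigma> c"] by simp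
      finally show "\<psi> (mscale c v) $$ (0, 0) = mscale (\<sigma> c) (\<psi> v) $$ (0, 0)" .
    qed (use \<psi>k cv v field_endoD(1)[OF \<sigma> c] in auto)
  qed
  moreover have "(\<psi> ^^ endo_order \<sigma>) v = v" if v: "v \<in> kmat 1 1" for v
  proof -
    have pk: "(\<psi> ^^ k) v \<in> kmat 1 1" for k by (induction k) (use v \<psi>k in auto)
    have "(\<psi> ^^ k) v $$ (0, 0) = endo_norm k a \<otimes> (\<sigma> ^^ k) (v $$ (0, 0))" for k
    proof (induction k)
      case 0
      show ?case using e[OF v] by simp
    next
      case (Suc k)
      have s: "(\<sigma> ^^ k) (v $$ (0, 0)) \<in> K" by (rule field_endoD(1)[OF field_endo_funpow[OF \<sigma>] e[OF v]])
      have "(\<psi> ^^ Suc k) v $$ (0, 0) = a \<otimes> \<sigma> (endo_norm k a \<otimes> (\<sigma> ^^ k) (v $$ (0, 0)))"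
        using \<psi>e[OF pk[of k]] Suc by simp
      also have "\<dots> = endo_norm (Suc k) a \<otimes> (\<sigma> ^^ Suc k) (v $$ (0, 0))"
        using field_endoD(3)[OF \<sigma> endo_norm_closed[OF a] s] a field_endoD(1)[OF \<sigma> endo_norm_closed[OF a]] field_endoD(1)[OF \<sigma> s]
        by (simp add: m_assoc)
      finally show ?case .
    qed
    from this[of "endo_order \<sigma>"] show ?thesis
      using endo_order_id[OF e[OF v]] N e[OF v] by (intro eq[OF pk v]) simp
  qed
  ultimately obtain w where w: "w \<in> kmat 1 1" "w \<noteq> mzero 1 1" "\<psi> w = w"
    using semilinear_fixed_vector[of 1 "{}" \<psi>] by auto
  have "w $$ (0, 0) \<noteq> \<zero>" using w(2) eq[OF w(1) mzero_closed] by (auto simp: mzero_entry)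
  then show ?thesis using that[of "w $$ (0, 0)"] e[OF w(1)] \<psi>e[OF w(1)] w(3) by simp
qed

text \<open>By counting. Hilbert 90 gives each \<open>a\<close> in the kernel \<open>A\<close> of
  the norm a unit \<open>w a\<close> with \<open>a \<sigma>(w a) = w a\<close>, and
  \<open>(a, f) -> w a f\<close> embeds the product of \<open>A\<close> and the units of the fixed
  field into the units of \<open>K\<close>. The fibres of the norm have at most
  \<open>card A\<close> elements, so its image is no smaller than the unit group of the fixed field,
  in which it lies.\<close>

lemma endo_norm_surj:
  assumes c: "c \<in> fixed_field \<sigma>" "c \<noteq> \<zero>"
  obtains a where "a \<in> K" "a \<noteq> \<zero>" "endo_norm (endo_order \<sigma>) a = c"
proof -
  let ?N = "endo_norm (endo_order \<sigma>)" and ?U = "K - {\<zero>}" and ?F = "fixed_field \<sigma> - {\<zero>}"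
  define A where "A = {a \<in> ?U. ?N a = \<one>}"
  have finU: "finite ?U" using finite_carrier by simp
  have U: "a \<in> ?U \<Longrightarrow> inv a \<in> ?U \<and> inv a \<otimes> a = \<one> \<and> a \<otimes> inv a = \<one>" for a using field_Units by auto
  have Um: "a \<in> ?U \<Longrightarrow> b \<in> ?U \<Longrightarrow> a \<otimes> b \<in> ?U" for a b using integral by auto
  have "\<exists>w. w \<in> ?U \<and> a \<otimes> \<sigma> w = w" if "a \<in> A" for a
    using hilbert_90[of a] that by (auto simp: A_def)
  then obtain w where w: "\<And>a. a \<in> A \<Longrightarrow> w a \<in> ?U \<and> a \<otimes> \<sigma> (w a) = w a" by metis
  have "card (A \<times> ?F) \<le> card ?U"
  proof (rule card_inj_on_le[where f = "\<lambda>(a, f). w a \<otimes> f"])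
    show "inj_on (\<lambda>(a, f). w a \<otimes> f) (A \<times> ?F)"
    proof (rule inj_onI)
      fix u v assume uv: "u \<in> A \<times> ?F" "v \<in> A \<times> ?F" "(\<lambda>(a, f). w a \<otimes> f) u = (\<lambda>(a, f). w a \<otimes> f) v"
      obtain a f b g where u: "u = (a, f)" "v = (b, g)" by (metis surj_pair)
      have ab: "a \<in> A" "b \<in> A" and f: "f \<in> fixed_field \<sigma>" "f \<noteq> \<zero>" and g: "g \<in> fixed_field \<sigma>" "g \<noteq> \<zero>"
        and eq: "w a \<otimes> f = w b \<otimes> g" using uv by (auto simp: u)
      have fg: "f \<in> ?U" "g \<in> ?U" "\<sigma> f = f" "\<sigma> g = g" using f g by (auto simp: fixed_field_def)
      have wab: "w a \<in> ?U" "w b \<in> ?U" using w ab by auto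
      have "a \<otimes> \<sigma> (w a \<otimes> f) = w a \<otimes> f"
        using w[OF ab(1)] fg field_endoD(3)[OF \<sigma>, of "w a" f] ab field_endoD(1)[OF \<sigma>, of "w a"]
        by (simp add: A_def m_assoc[symmetric])
      moreover have "b \<otimes> \<sigma> (w b \<otimes> g) = w b \<otimes> g"
        using w[OF ab(2)] fg field_endoD(3)[OF \<sigma>, of "w b" g] ab field_endoD(1)[OF \<sigma>, of "w b"]
        by (simp add: A_def m_assoc[symmetric])
      ultimately have "a \<otimes> \<sigma> (w a \<otimes> f) = b \<otimes> \<sigma> (w a \<otimes> f)" using eq by simp
      moreover have "\<sigma> (w a \<otimes> f) \<in> K" "\<sigma> (w a \<otimes> f) \<noteq> \<zero>"
        using Um[OF wab(1) fg(1)] field_endoD(1)[OF \<sigma>] field_endo_nonzero[OF \<sigma>] by auto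
      ultimately have "a = b" using ab m_rcancel[of "\<sigma> (w a \<otimes> f)" a b] by (auto simp: A_def)
      then show "u = v" using eq wab fg m_lcancel[of "w a" f g] by (auto simp: u)
    qed
    show "(\<lambda>(a, f). w a \<otimes> f) ` (A \<times> ?F) \<subseteq> ?U"
      using w Um by (auto simp: fixed_field_def)
  qed (rule finU)
  then have 1: "card A * card ?F \<le> card ?U" by (simp add: card_cartesian_product)
  define r where "r y = (SOME a. a \<in> ?U \<and> ?N a = y)" for y
  have r: "r (?N a) \<in> ?U \<and> ?N (r (?N a)) = ?N a" if "a \<in> ?U" for a
    unfolding r_def by (rule someI_ex) (use that in blast)
  have "card ?U \<le> card (?N ` ?U \<times> A)"
  proof (rule card_inj_on_le[where f = "\<lambda>a. (?N a, a \<otimes> inv (r (?N a)))"])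
    show "inj_on (\<lambda>a. (?N a, a \<otimes> inv (r (?N a)))) ?U"
    proof (rule inj_onI)
      fix a b assume ab: "a \<in> ?U" "b \<in> ?U" and eq: "(?N a, a \<otimes> inv (r (?N a))) = (?N b, b \<otimes> inv (r (?N b)))"
      then have "?N a = ?N b" "a \<otimes> inv (r (?N a)) = b \<otimes> inv (r (?N b))" by auto
      then have "a \<otimes> inv (r (?N a)) = b \<otimes> inv (r (?N a))" by metis
      moreover have "inv (r (?N a)) \<in> ?U" using r[OF ab(1)] U by blast
      ultimately show "a = b" using ab m_rcancel[of "inv (r (?N a))" a b] by auto
    qed
    show "(\<lambda>a. (?N a, a \<otimes> inv (r (?N a)))) ` ?U \<subseteq> ?N ` ?U \<times> A"
    proof (rule image_subsetI)
      fix a assume a: "a \<in> ?U"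
      let ?r = "r (?N a)"
      have i: "inv ?r \<in> ?U" "inv ?r \<otimes> ?r = \<one>" using r[OF a] U by blast+
      have Na: "?N a \<in> K" "?N (inv ?r) \<in> K" using endo_norm_closed a i by auto
      have one: "?N \<one> = \<one>"
      proof -
        have "endo_norm k \<one> = \<one>" for k by (induction k) (use field_endoD(4)[OF \<sigma>] in auto)
        then show ?thesis .
      qed
      have "?N (a \<otimes> inv ?r) = ?N a \<otimes> ?N (inv ?r)" using endo_norm_mult a i by auto
      also have "\<dots> = ?N (inv ?r) \<otimes> ?N ?r" using r[OF a] Na by (simp add: m_comm)
      also have "\<dots> = ?N (inv ?r \<otimes> ?r)" using endo_norm_mult[of "inv ?r" ?r] r[OF a] i by auto
      also have "\<dots> = \<one>" using i one by simp
      finally show "(?N a, a \<otimes> inv ?r) \<in> ?N ` ?U \<times> A" using Um[OF a i(1)] a by (simp add: A_def)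
    qed
    show "finite (?N ` ?U \<times> A)" using finU by (auto simp: A_def)
  qed
  then have 2: "card ?U \<le> card (?N ` ?U) * card A" by (simp add: card_cartesian_product)
  have "card A > 0"
  proof -
    have "endo_norm k \<one> = \<one>" for k by (induction k) (use field_endoD(4)[OF \<sigma>] in auto)
    then have "\<one> \<in> A" by (simp add: A_def)
    then show ?thesis using finU by (auto simp: A_def card_gt_0_iff)
  qed
  moreover have "card ?F * card A \<le> card (?N ` ?U) * card A"
    using 1 2 by (simp only: mult.commute[of "card A"] order.trans)
  ultimately have "card ?F \<le> card (?N ` ?U)" by (simp only: mult_le_cancel2)
  moreover have "?N ` ?U \<subseteq> ?F"
    using endo_norm_closed endo_norm_nonzero endo_norm_fixed by (auto simp: fixed_field_def)
  moreover have "finite ?F" using finite_carrier by (auto simp: fixed_field_def)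
  ultimately have "?N ` ?U = ?F" by (meson card_seteq)
  then have "c \<in> ?N ` ?U" using c by blast
  then show ?thesis using that by auto
qed

end

text \<open>Schur's lemma for semilinear maps: the kernel is a \<open>K\<close>-subspace stable
  under \<open>B\<close>, hence zero or everything.\<close>

lemma kernel_trivial:
  assumes irr: "irreducible_on n B" and B: "B \<subseteq> kmat n n" and \<phi>: "additive_commuting n B \<phi>" and sl: "semilinear n \<sigma> \<phi>"
    and \<sigma>: "\<And>c. c \<in> K \<Longrightarrow> \<sigma> c \<in> K"
    and v0: "v0 \<in> kmat n 1" "\<phi> v0 \<noteq> mzero n 1" and v: "v \<in> kmat n 1" "\<phi> v = mzero n 1"
  shows "v = mzero n 1"
proof -
  define U where "U = {v \<in> kmat n 1. \<phi> v = mzero n 1}"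
  note \<phi>D = additive_commutingD[OF \<phi>]
  have "subspace n U"
    unfolding subspace_def
  proof (intro conjI ballI)
    show "U \<subseteq> kmat n 1" by (auto simp: U_def)
    show "mzero n 1 \<in> U" using additive_zero[OF \<phi>] by (simp add: U_def)
    fix u assume u: "u \<in> U"
    show "mscale c u \<in> U" if "c \<in> K" for c using u that sl \<sigma> by (simp add: U_def semilinear_def)
    fix w assume "w \<in> U"
    then show "u \<oplus>\<oplus> w \<in> U" using u \<phi>D(2) by (simp add: U_def)
  qed
  moreover have "\<forall>x\<in>B. \<forall>u\<in>U. x \<odot>\<odot> u \<in> U"
  proof (intro ballI)
    fix x u assume x: "x \<in> B" and u: "u \<in> U"
    have xk: "x \<in> kmat n n" using B x by blast
    have "u \<in> kmat n 1" using u by (simp add: U_def)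
    then show "x \<odot>\<odot> u \<in> U"
      using u \<phi>D(3)[OF x] mmul_zero(1)[OF xk] mmul_closed[OF xk] by (simp add: U_def)
  qed
  ultimately have "U = {mzero n 1} \<or> U = kmat n 1" using irr unfolding irreducible_on_def by blast
  moreover have "U \<noteq> kmat n 1" using v0 by (auto simp: U_def)
  ultimately have "U = {mzero n 1}" by blast
  moreover have "v \<in> U" using v by (simp add: U_def)
  ultimately show ?thesis by blast
qed

lemma funpow_closed: "(\<And>v. v \<in> A \<Longrightarrow> f v \<in> A) \<Longrightarrow> v \<in> A \<Longrightarrow> (f ^^ k) v \<in> A"
  by (induction k) auto

lemma funpow_additive_commuting:
  assumes \<phi>: "additive_commuting n B \<phi>" and B: "B \<subseteq> kmat n n"
  shows "additive_commuting n B (\<phi> ^^ k)"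
proof (induction k)
  case 0
  show ?case by (simp add: additive_commuting_def)
next
  case (Suc k)
  note D = additive_commutingD[OF \<phi>] and E = additive_commutingD[OF Suc]
  have "x \<odot>\<odot> v \<in> kmat n 1" if "x \<in> B" "v \<in> kmat n 1" for x v using mmul_closed B that by blast
  then show ?case using D E by (simp add: additive_commuting_def)
qed

lemma funpow_semilinear:
  assumes \<phi>: "additive_commuting n B \<phi>" and sl: "semilinear n \<sigma> \<phi>" and \<sigma>: "field_endo \<sigma>"
  shows "semilinear n (\<sigma> ^^ k) (\<phi> ^^ k)"
proof (induction k)
  case (Suc k)
  have "(\<phi> ^^ k) v \<in> kmat n 1" if "v \<in> kmat n 1" for v
    by (rule funpow_closed[OF additive_commutingD(1)[OF \<phi>] that])
  then show ?case
    using Suc sl field_endoD(1)[OF field_endo_funpow[OF \<sigma>]] by (simp add: semilinear_def)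
qed (simp add: semilinear_def)

text \<open>In coordinates with respect to fixed vectors the map is \<open>\<sigma>\<close> applied
  to each entry.\<close>

lemma semilinear_mmul_fixed:
  assumes \<psi>: "additive_commuting n B \<psi>" and sl: "semilinear n \<sigma> \<psi>" and \<sigma>: "\<And>c. c \<in> K \<Longrightarrow> \<sigma> c \<in> K"
  shows "b \<in> kmat n d \<Longrightarrow> (\<And>j. j < d \<Longrightarrow> \<psi> (mcol b j) = mcol b j) \<Longrightarrow> a \<in> kmat d 1 \<Longrightarrow>
    \<psi> (b \<odot>\<odot> a) = b \<odot>\<odot> map_mat \<sigma> a"
proof (induction d arbitrary: b a)
  case 0
  then have "b \<odot>\<odot> a = mzero n 1" "b \<odot>\<odot> map_mat \<sigma> a = mzero n 1"
    by (auto intro!: eq_matI simp: mmul_def mzero_def kmat_dim)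
  then show ?case using additive_zero[OF \<psi>] by simp
next
  case (Suc d)
  obtain b' v where b: "b' \<in> kmat n d" "v \<in> kmat n 1" "b = hcat b' v" using kmat_split_last[OF Suc(2)] .
  obtain w c where a: "w \<in> kmat d 1" "c \<in> kmat 1 1" "a = vcat w c"
    by (rule vcat_cases[OF Suc(4)[unfolded Suc_eq_plus1 kmat_matsK]]) (rule that, simp_all add: kmat_matsK)
  have m: "map_mat \<sigma> x \<in> kmat r s" if "x \<in> kmat r s" for x r s
    using that \<sigma> by (auto intro!: kmatI simp: kmat_dim kmat_entry)
  have "mcol b' j = mcol b j" if "j < d" for j
    using b that by (intro eq_matI) (auto simp: mcol_def hcat_def kmat_dim)
  then have 1: "\<psi> (b' \<odot>\<odot> w) = b' \<odot>\<odot> map_mat \<sigma> w" using Suc.IH[OF b(1) _ a(1)] Suc(3) by simp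
  have "mcol b d = v" using b by (intro eq_matI) (auto simp: mcol_def hcat_def kmat_dim)
  then have v: "\<psi> v = v" using Suc(3)[of d] by simp
  have c0: "c $$ (0, 0) \<in> K" using kmat_entry[OF a(2), of 0 0] by simp
  have 2: "\<psi> (v \<odot>\<odot> c) = v \<odot>\<odot> map_mat \<sigma> c"
    using mmul_1_1[OF b(2) a(2)] mmul_1_1[OF b(2) m[OF a(2)]] sl b(2) c0 v a(2)
    by (simp add: semilinear_def kmat_dim)
  have "map_mat \<sigma> a = vcat (map_mat \<sigma> w) (map_mat \<sigma> c)"
    unfolding a(3) by (rule map_vcat) (use a in \<open>simp add: kmat_dim\<close>)
  then have "b \<odot>\<odot> map_mat \<sigma> a = b' \<odot>\<odot> map_mat \<sigma> w \<oplus>\<oplus> v \<odot>\<odot> map_mat \<sigma> c"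
    unfolding b(3) using mmul_hcat_vcat[OF b(1,2) m[OF a(1)] m[OF a(2)]] by simp
  then show ?case
    unfolding a(3) b(3) mmul_hcat_vcat[OF b(1,2) a(1,2)]
    using additive_commutingD(2)[OF \<psi> mmul_closed[OF b(1) a(1)] mmul_closed[OF b(2) a(2)]] 1 2
    by (simp add: a(3) b(3))
qed

text \<open>Take fixed vectors that are maximally independent over \<open>K\<close>. Elements of
  \<open>B\<close> send fixed vectors to fixed vectors, so the coordinates of the images are fixed
  by \<open>\<sigma>\<close>. The \<open>K\<close>-span of the fixed vectors is nonzero and stable
  under \<open>B\<close>, hence everything, and the chosen vectors form a basis in which
  \<open>B\<close> has entries in the fixed field.\<close>

lemma subfield_descent:
  assumes n: "n > 0" and B: "B \<subseteq> kmat n n" and irr: "irreducible_on n B"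
    and \<sigma>: "field_endo \<sigma>" and \<psi>: "additive_commuting n B \<psi>" and sl: "semilinear n \<sigma> \<psi>"
    and w: "w \<in> kmat n 1" "w \<noteq> mzero n 1" "\<psi> w = w"
  obtains S where "S \<in> GLs n" "\<And>x. x \<in> B \<Longrightarrow> mconj n S x \<in> mats (fixed_field \<sigma>) n n"
proof -
  define W where "W = {v \<in> kmat n 1. \<psi> v = v}"
  have "W \<subseteq> kmat n 1" by (auto simp: W_def)
  then obtain d b where b: "indep K n d b" "\<And>j. j < d \<Longrightarrow> mcol b j \<in> W" "W \<subseteq> col_span K d b"
    using maximal_indep[of W n] by metis
  have bk: "b \<in> kmat n d" using indepD[OF b(1)] by (simp add: kmat_matsK)
  have xW: "x \<odot>\<odot> v \<in> W" if "x \<in> B" "v \<in> W" for x v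
  proof -
    have "x \<in> kmat n n" "v \<in> kmat n 1" "\<psi> v = v" using that B by (auto simp: W_def)
    then show ?thesis using additive_commutingD(3)[OF \<psi> that(1)] mmul_closed[of x n n v 1] by (simp add: W_def)
  qed
  have "\<exists>P. P \<in> kmat d d \<and> x \<odot>\<odot> b = b \<odot>\<odot> P \<and> P \<in> mats (fixed_field \<sigma>) d d" if x: "x \<in> B" for x
  proof -
    have xk: "x \<in> kmat n n" using B x by blast
    have "\<exists>a. a \<in> kmat d 1 \<and> b \<odot>\<odot> a = mcol (x \<odot>\<odot> b) j \<and> a \<in> mats (fixed_field \<sigma>) d 1" if j: "j < d" for j
    proof -
      have xbW: "mcol (x \<odot>\<odot> b) j \<in> W" using xW[OF x b(2)[OF j]] mcol_mmul[OF xk bk j] by simp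
      then obtain a where a: "a \<in> kmat d 1" "b \<odot>\<odot> a = mcol (x \<odot>\<odot> b) j"
        using b(3) by (auto simp: col_span_def kmat_matsK)
      have m: "map_mat \<sigma> a \<in> kmat d 1"
        using a(1) field_endoD(1)[OF \<sigma>] by (auto intro!: kmatI simp: kmat_dim kmat_entry)
      have "b \<odot>\<odot> map_mat \<sigma> a = \<psi> (b \<odot>\<odot> a)"
        by (rule semilinear_mmul_fixed[OF \<psi> sl field_endoD(1)[OF \<sigma>] bk _ a(1), symmetric])
          (use b(2) in \<open>auto simp: W_def\<close>)
      also have "\<dots> = b \<odot>\<odot> a" using xbW a(2) by (simp add: W_def)
      finally have e: "b \<odot>\<odot> map_mat \<sigma> a = b \<odot>\<odot> a" .
      have ma: "map_mat \<sigma> a = a"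
        by (rule indep_cancel[OF KF b(1) m[unfolded kmat_matsK] a(1)[unfolded kmat_matsK] e])
      have "\<sigma> (a $$ (i, 0)) = a $$ (i, 0)" if "i < d" for i
      proof -
        have "\<sigma> (a $$ (i, 0)) = map_mat \<sigma> a $$ (i, 0)" using a(1) that by (simp add: kmat_dim)
        then show ?thesis by (simp only: ma)
      qed
      then have "a \<in> mats (fixed_field \<sigma>) d 1"
        using a(1) by (auto simp: mats_def fixed_field_def kmat_def)
      then show ?thesis using a by blast
    qed
    then obtain a where a: "\<And>j. j < d \<Longrightarrow> a j \<in> kmat d 1 \<and> b \<odot>\<odot> a j = mcol (x \<odot>\<odot> b) j \<and> a j \<in> mats (fixed_field \<sigma>) d 1"
      by metis
    define P where "P = mjoin d d a"
    have P: "P \<in> kmat d d" "P \<in> mats (fixed_field \<sigma>) d d" unfolding P_def using a by (auto simp: kmat_matsK)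
    have "x \<odot>\<odot> b = b \<odot>\<odot> P"
    proof (rule mats_eqI_mcol[of _ K n d])
      fix j assume j: "j < d"
      show "mcol (x \<odot>\<odot> b) j = mcol (b \<odot>\<odot> P) j"
        using mcol_mmul[OF bk P(1) j] mcol_mjoin[OF j, of a K d] a[OF j] by (simp add: P_def kmat_matsK)
    qed (use mmul_closed[OF xk bk] mmul_closed[OF bk P(1)] in \<open>simp_all add: kmat_matsK\<close>)
    then show ?thesis using P by blast
  qed
  then obtain P where P: "\<And>x. x \<in> B \<Longrightarrow> P x \<in> kmat d d \<and> x \<odot>\<odot> b = b \<odot>\<odot> P x \<and> P x \<in> mats (fixed_field \<sigma>) d d"
    by metis
  have "\<forall>x\<in>B. \<forall>u\<in>col_span K d b. x \<odot>\<odot> u \<in> col_span K d b"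
  proof (intro ballI)
    fix x u assume x: "x \<in> B" and "u \<in> col_span K d b"
    then obtain a where a: "a \<in> kmat d 1" "u = b \<odot>\<odot> a" by (auto simp: col_span_def kmat_matsK)
    have xk: "x \<in> kmat n n" using B x by blast
    have "x \<odot>\<odot> u = b \<odot>\<odot> (P x \<odot>\<odot> a)"
      using mmul_assoc[OF xk bk a(1)] mmul_assoc[OF bk _ a(1), of "P x"] P[OF x] a(2) by simp
    moreover have "P x \<odot>\<odot> a \<in> kmat d 1" using P[OF x] a(1) mmul_closed by blast
    ultimately show "x \<odot>\<odot> u \<in> col_span K d b" by (auto simp: col_span_def kmat_matsK)
  qed
  then have "col_span K d b = {mzero n 1} \<or> col_span K d b = kmat n 1"
    using irr subspace_col_span[OF bk] unfolding irreducible_on_def by blast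
  moreover have "w \<in> W" using w by (simp add: W_def)
  ultimately have full: "col_span K d b = kmat n 1" using b(3) w(2) by blast
  have "card K ^ d = card K ^ n"
    using card_col_span[OF KF b(1)] full by (simp add: card_kmat)
  then have dn: "d = n" using subfield_card_ge_2[OF KF] by simp
  have S: "b \<in> GLs n" using b(1) dn by (simp add: GLs_def)
  have "mconj n b x \<in> mats (fixed_field \<sigma>) n n" if x: "x \<in> B" for x
  proof -
    have "x \<in> kmat n n" using B x by blast
    then have "mconj n b x = P x" using mconj_unique[OF S] P[OF x] dn by simp
    then show ?thesis using P[OF x] dn by simp
  qed
  then show ?thesis using that[OF S] by blast
qed

text \<open>The iterate of \<open>\<phi>\<close> of length the order of \<open>\<sigma>\<close> is
  linear and commutes with \<open>B\<close>, so it is a scalar \<open>c\<close>. It commutes with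
  \<open>\<phi>\<close>, so \<open>\<sigma>\<close> fixes \<open>c\<close>, and \<open>inv c\<close>
  is the norm of some \<open>\<mu>\<close>. Then \<open>\<mu> \<phi>\<close> has trivial iterate and
  a nonzero fixed vector. The fixed field is proper because it misses \<open>gen\<close>.\<close>

lemma proper_subring_cases:
  assumes n: "n > 0" and Bs: "mat_subring n B" and irr: "irreducible_on n B" and proper: "B \<noteq> kmat n n"
    and scalar: "\<And>z. z \<in> kmat n n \<Longrightarrow> (\<And>x. x \<in> B \<Longrightarrow> z \<odot>\<odot> x = x \<odot>\<odot> z) \<Longrightarrow> \<exists>c\<in>K. z = mscale c (mone n)"
  obtains F S where "subfield F R" "F \<noteq> K" "S \<in> GLs n" "\<And>x. x \<in> B \<Longrightarrow> mconj n S x \<in> mats F n n"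
proof -
  have B: "B \<subseteq> kmat n n" using mat_subringD(1)[OF Bs] by blast
  have lin: "\<exists>c\<in>K. \<forall>v\<in>kmat n 1. \<phi> v = mscale c v"
    if \<phi>: "additive_commuting n B \<phi>" and sl: "semilinear n (\<lambda>c. c) \<phi>" for \<phi>
  proof -
    obtain z where z: "z \<in> kmat n n" "\<And>v. v \<in> kmat n 1 \<Longrightarrow> \<phi> v = z \<odot>\<odot> v" "\<And>x. x \<in> B \<Longrightarrow> z \<odot>\<odot> x = x \<odot>\<odot> z"
      by (rule linear_matrix[OF \<phi> sl B]) (rule that)
    obtain c where c: "c \<in> K" "z = mscale c (mone n)" using scalar[OF z(1,3)] by blast
    have "\<phi> v = mscale c v" if "v \<in> kmat n 1" for v
      using z(2)[OF that] c mmul_scale(2)[OF c(1) mone_closed that] that by simp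
    then show ?thesis using c by blast
  qed
  obtain \<phi>0 where \<phi>0: "additive_commuting n B \<phi>0" "\<not> (\<exists>c\<in>K. \<forall>v\<in>kmat n 1. \<phi>0 v = mscale c v)"
    by (rule nonscalar_commuting_map[OF n Bs irr proper]) (rule that)
  have "\<not> semilinear n (\<lambda>c. c) \<phi>0" using lin[OF \<phi>0(1)] \<phi>0(2) by blast
  from semilinear_decomposition[OF n B \<phi>0(1) this]
  obtain \<sigma> \<phi> v0 where \<sigma>: "field_endo \<sigma>" "\<sigma> gen \<noteq> gen" and \<phi>: "additive_commuting n B \<phi>" "semilinear n \<sigma> \<phi>"
    and v0: "v0 \<in> kmat n 1" "\<phi> v0 \<noteq> mzero n 1" by blast
  let ?l = "endo_order \<sigma>" and ?F = "fixed_field \<sigma>"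
  note \<sigma>K = field_endoD(1)[OF \<sigma>(1)] and \<phi>D = additive_commutingD[OF \<phi>(1)]
  have inj: "\<phi> v \<noteq> mzero n 1" if "v \<in> kmat n 1" "v \<noteq> mzero n 1" for v
    using kernel_trivial[OF irr B \<phi> \<sigma>K v0 that(1)] that(2) by blast
  have pk: "(\<phi> ^^ k) v \<in> kmat n 1" if "v \<in> kmat n 1" for k v by (rule funpow_closed[OF \<phi>D(1) that])
  have "semilinear n (\<lambda>c. c) (\<phi> ^^ ?l)"
    using funpow_semilinear[OF \<phi> \<sigma>(1), of ?l] endo_order_id[OF \<sigma>(1)] by (simp add: semilinear_def)
  from lin[OF funpow_additive_commuting[OF \<phi>(1) B] this]
  obtain c where c: "c \<in> K" "\<And>v. v \<in> kmat n 1 \<Longrightarrow> (\<phi> ^^ ?l) v = mscale c v" by blast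
  have v0n: "v0 \<noteq> mzero n 1" using v0 additive_zero[OF \<phi>(1)] by auto
  have "(\<phi> ^^ k) v0 \<noteq> mzero n 1" for k
    by (induction k) (use v0n inj[OF pk[OF v0(1)]] in auto)
  then have "mscale c v0 \<noteq> mzero n 1" using c(2)[OF v0(1)] by metis
  then have c0: "c \<noteq> \<zero>" using mscale_zero[OF v0(1)] by auto
  have "mscale (\<sigma> c) (\<phi> v0) = mscale c (\<phi> v0)"
  proof -
    have "\<phi> ((\<phi> ^^ ?l) v0) = (\<phi> ^^ ?l) (\<phi> v0)" by (simp add: funpow_swap1)
    then show ?thesis using c(2)[OF v0(1)] c(2)[OF \<phi>D(1)[OF v0(1)]] \<phi>(2) c(1) v0(1) by (simp add: semilinear_def)
  qed
  then have "\<sigma> c = c" using mscale_cancel[OF \<phi>D(1)[OF v0(1)] v0(2) \<sigma>K[OF c(1)] c(1)] by blast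
  then have cF: "c \<in> ?F" using c(1) by (simp add: fixed_field_def)
  have ic: "inv c \<in> ?F" "inv c \<noteq> \<zero>" "inv c \<otimes> c = \<one>"
    using subfield_m_inv[OF fixed_field_subfield[OF \<sigma>(1)], of c] cF c0 by auto
  obtain \<mu> where \<mu>: "\<mu> \<in> K" "\<mu> \<noteq> \<zero>" "endo_norm \<sigma> ?l \<mu> = inv c"
    using endo_norm_surj[OF \<sigma>(1) ic(1,2)] by blast
  define \<psi> where "\<psi> v = mscale \<mu> (\<phi> v)" for v
  have \<psi>: "additive_commuting n B \<psi>"
    unfolding additive_commuting_def
  proof (intro conjI ballI)
    fix v assume v: "v \<in> kmat n 1"
    show "\<psi> v \<in> kmat n 1" using \<phi>D(1)[OF v] \<mu> by (simp add: \<psi>_def)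
    show "\<psi> (x \<odot>\<odot> v) = x \<odot>\<odot> \<psi> v" if x: "x \<in> B" for x
    proof -
      have "x \<in> kmat n n" using B x by blast
      then show ?thesis using \<phi>D(3)[OF x v] mmul_scale(1)[OF \<mu>(1) _ \<phi>D(1)[OF v]] by (simp add: \<psi>_def)
    qed
    fix u assume u: "u \<in> kmat n 1"
    show "\<psi> (u \<oplus>\<oplus> v) = \<psi> u \<oplus>\<oplus> \<psi> v"
      using \<phi>D(2)[OF u v] mscale_madd[OF \<mu>(1) \<phi>D(1)[OF u] \<phi>D(1)[OF v]] by (simp add: \<psi>_def)
  qed
  have sl: "semilinear n \<sigma> \<psi>"
    unfolding semilinear_def
  proof (intro ballI)
    fix a v assume a: "a \<in> K" and v: "v \<in> kmat n 1"
    show "\<psi> (mscale a v) = mscale (\<sigma> a) (\<psi> v)"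
      using \<phi>(2) a v mscale_mscale[OF \<mu>(1) \<sigma>K[OF a] \<phi>D(1)[OF v]] mscale_mscale[OF \<sigma>K[OF a] \<mu>(1) \<phi>D(1)[OF v]]
        \<mu>(1) \<sigma>K[OF a] by (simp add: \<psi>_def semilinear_def m_comm)
  qed
  have "(\<psi> ^^ k) v = mscale (endo_norm \<sigma> k \<mu>) ((\<phi> ^^ k) v)" if v: "v \<in> kmat n 1" for k v
  proof (induction k)
    case 0
    show ?case using mscale_one[OF v] endo_norm.simps(1)[OF \<sigma>(1)] by simp
  next
    case (Suc k)
    have N: "endo_norm \<sigma> k \<mu> \<in> K" by (rule endo_norm_closed[OF \<sigma>(1) \<mu>(1)])
    have "(\<psi> ^^ Suc k) v = mscale \<mu> (mscale (\<sigma> (endo_norm \<sigma> k \<mu>)) ((\<phi> ^^ Suc k) v))"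
      using \<phi>(2) N pk[OF v] by (simp add: semilinear_def \<psi>_def[of "mscale (endo_norm \<sigma> k \<mu>) ((\<phi> ^^ k) v)"] Suc)
    then show ?case using mscale_mscale[OF \<mu>(1) \<sigma>K[OF N] pk[OF v, of "Suc k"]]
      endo_norm.simps(2)[OF \<sigma>(1), of k \<mu>] by simp
  qed
  then have ord: "(\<psi> ^^ ?l) v = v" if "v \<in> kmat n 1" for v
    using c(2)[OF that] \<mu>(3) mscale_mscale[of "inv c" c v n 1] ic c(1) mscale_one[OF that] that
    by (simp add: fixed_field_def)
  obtain w where w: "w \<in> kmat n 1" "w \<noteq> mzero n 1" "\<psi> w = w"
    using semilinear_fixed_vector[OF \<sigma>(1) n \<psi> sl ord] by blast
  obtain S where S: "S \<in> GLs n" "\<And>x. x \<in> B \<Longrightarrow> mconj n S x \<in> mats ?F n n"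
    by (rule subfield_descent[OF n B irr \<sigma>(1) \<psi> sl w]) (rule that)
  have "gen \<notin> ?F" using \<sigma>(2) by (simp add: fixed_field_def)
  then have "?F \<noteq> K" using gen(1) by blast
  then show ?thesis using that[OF fixed_field_subfield[OF \<sigma>(1)] _ S] by blast
qed

section \<open>Pairs commuting with a nonscalar matrix\<close>

definition centraliser :: "nat \<Rightarrow> 'a mat \<Rightarrow> 'a mat set" where
  "centraliser n z = {x \<in> kmat n n. x \<odot>\<odot> z = z \<odot>\<odot> x}"

lemma centraliserD:
  assumes "x \<in> centraliser n z"
  shows "x \<in> kmat n n" "x \<odot>\<odot> z = z \<odot>\<odot> x"
  using assms by (auto simp: centraliser_def)

lemma finite_centraliser: "finite (centraliser n z)"
  by (rule finite_subset[OF _ finite_kmat[of n n]]) (auto simp: centraliser_def)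

lemma mpow_commute:
  assumes z: "z \<in> kmat n n" and x: "x \<in> centraliser n z"
  shows "x \<odot>\<odot> mpow n z k = mpow n z k \<odot>\<odot> x"
proof (induction k)
  case 0
  show ?case using centraliserD(1)[OF x] by simp
next
  case (Suc k)
  note xk = centraliserD(1)[OF x] and m = mpow_closed[OF z, of k]
  have "x \<odot>\<odot> mpow n z (Suc k) = x \<odot>\<odot> mpow n z k \<odot>\<odot> z" by (simp add: mmul_assoc[OF xk m z])
  also have "\<dots> = mpow n z k \<odot>\<odot> (z \<odot>\<odot> x)"
    using centraliserD(2)[OF x] by (simp add: Suc mmul_assoc[OF m xk z])
  finally show ?case by (simp add: mmul_assoc[OF m z xk])
qed

lemma kry_mmul_commute:
  assumes z: "z \<in> kmat n n" and v: "v \<in> kmat n 1" and x: "x \<in> centraliser n z"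
  shows "kry n z (x \<odot>\<odot> v) l = x \<odot>\<odot> kry n z v l"
proof (rule mats_eqI_mcol[of _ K n l])
  note xk = centraliserD(1)[OF x]
  have xv: "x \<odot>\<odot> v \<in> kmat n 1" by (rule mmul_closed[OF xk v])
  show "kry n z (x \<odot>\<odot> v) l \<in> mats K n l" "x \<odot>\<odot> kry n z v l \<in> mats K n l"
    using kry_closed[OF z xv] mmul_closed[OF xk kry_closed[OF z v]] by (simp_all add: kmat_matsK)
  fix j assume j: "j < l"
  have "mcol (kry n z (x \<odot>\<odot> v) l) j = x \<odot>\<odot> (mpow n z j \<odot>\<odot> v)"
    using mcol_kry[OF z xv j] mmul_assoc[OF mpow_closed[OF z, of j] xk v] mmul_assoc[OF xk mpow_closed[OF z, of j] v]
      mpow_commute[OF z x, of j] by simp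
  then show "mcol (kry n z (x \<odot>\<odot> v) l) j = mcol (x \<odot>\<odot> kry n z v l) j"
    using mcol_mmul[OF xk kry_closed[OF z v] j] mcol_kry[OF z v j] by simp
qed

lemma kry_entry:
  assumes z: "z \<in> kmat n n" and v: "v \<in> kmat n 1" and ij: "i < n" "j < l"
  shows "kry n z v l $$ (i, j) = (mpow n z j \<odot>\<odot> v) $$ (i, 0)"
  using ij by (simp add: kry_def mjoin_def)

lemma kry_madd:
  assumes z: "z \<in> kmat n n" and u: "u \<in> kmat n 1" and v: "v \<in> kmat n 1"
  shows "kry n z (u \<oplus>\<oplus> v) l = kry n z u l \<oplus>\<oplus> kry n z v l"
proof (rule kmat_eqI[of _ n l])
  have uv: "u \<oplus>\<oplus> v \<in> kmat n 1" by (rule madd_closed[OF u v])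
  show "kry n z (u \<oplus>\<oplus> v) l \<in> kmat n l" "kry n z u l \<oplus>\<oplus> kry n z v l \<in> kmat n l"
    using kry_closed[OF z uv] madd_closed[OF kry_closed[OF z u] kry_closed[OF z v]] by simp_all
  fix i j assume ij: "i < n" "j < l"
  show "kry n z (u \<oplus>\<oplus> v) l $$ (i, j) = (kry n z u l \<oplus>\<oplus> kry n z v l) $$ (i, j)"
    using kry_entry[OF z uv ij] kry_entry[OF z u ij] kry_entry[OF z v ij]
      madd_entry[OF kry_closed[OF z u] ij] mmul_distrib_left[OF mpow_closed[OF z] u v]
      madd_entry[OF mpow_vec[OF z u], of i 0] ij by simp
qed

lemma kry_mscale:
  assumes z: "z \<in> kmat n n" and c: "c \<in> K" and v: "v \<in> kmat n 1"
  shows "kry n z (mscale c v) l = mscale c (kry n z v l)"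
proof (rule kmat_eqI[of _ n l])
  have cv: "mscale c v \<in> kmat n 1" by (rule mscale_closed[OF c v])
  show "kry n z (mscale c v) l \<in> kmat n l" "mscale c (kry n z v l) \<in> kmat n l"
    using kry_closed[OF z cv] mscale_closed[OF c kry_closed[OF z v]] by simp_all
  fix i j assume ij: "i < n" "j < l"
  show "kry n z (mscale c v) l $$ (i, j) = mscale c (kry n z v l) $$ (i, j)"
    using kry_entry[OF z cv ij] kry_entry[OF z v ij] mscale_entry[OF kry_closed[OF z v] ij]
      mmul_scale(1)[OF c mpow_closed[OF z] v] mscale_entry[OF mpow_vec[OF z v], of i 0] ij by simp
qed

text \<open>For fixed \<open>c\<close> the map is the action of a polynomial in \<open>z\<close>, so
  it commutes with whatever commutes with \<open>z\<close>.\<close>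

lemma kry_additive_commuting:
  assumes z: "z \<in> kmat n n" and c: "c \<in> kmat l 1"
  shows "additive_commuting n (centraliser n z) (\<lambda>v. kry n z v l \<odot>\<odot> c)"
  unfolding additive_commuting_def
proof (intro conjI ballI)
  fix v assume v: "v \<in> kmat n 1"
  show "kry n z v l \<odot>\<odot> c \<in> kmat n 1" by (rule mmul_closed[OF kry_closed[OF z v] c])
  show "kry n z (x \<odot>\<odot> v) l \<odot>\<odot> c = x \<odot>\<odot> (kry n z v l \<odot>\<odot> c)" if x: "x \<in> centraliser n z" for x
    using kry_mmul_commute[OF z v x] mmul_assoc[OF centraliserD(1)[OF x] kry_closed[OF z v] c] by simp
  fix u assume u: "u \<in> kmat n 1"
  show "kry n z (u \<oplus>\<oplus> v) l \<odot>\<odot> c = kry n z u l \<odot>\<odot> c \<oplus>\<oplus> kry n z v l \<odot>\<odot> c"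
    using kry_madd[OF z u v] mmul_distrib_right[OF kry_closed[OF z u] kry_closed[OF z v] c] by simp
qed

lemma kry_semilinear:
  assumes z: "z \<in> kmat n n" and c: "c \<in> kmat l 1"
  shows "semilinear n (\<lambda>c. c) (\<lambda>v. kry n z v l \<odot>\<odot> c)"
  unfolding semilinear_def
proof (intro ballI)
  fix a v assume a: "a \<in> K" and v: "v \<in> kmat n 1"
  show "kry n z (mscale a v) l \<odot>\<odot> c = mscale a (kry n z v l \<odot>\<odot> c)"
    using kry_mscale[OF z a v] mmul_scale(2)[OF a kry_closed[OF z v] c] by simp
qed

lemma additive_commuting_mono: "additive_commuting n C \<phi> \<Longrightarrow> B \<subseteq> C \<Longrightarrow> additive_commuting n B \<phi>"
  by (auto simp: additive_commuting_def)

text \<open>Schur's lemma for \<open>K[z]\<close>: an element that does not vanish on some vector is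
  injective.\<close>

lemma kry_kernel_trivial:
  assumes irr: "irreducible_on n B" and B: "B \<subseteq> centraliser n z" and z: "z \<in> kmat n n" and c: "c \<in> kmat l 1"
    and v0: "v0 \<in> kmat n 1" "kry n z v0 l \<odot>\<odot> c \<noteq> mzero n 1"
    and v: "v \<in> kmat n 1" "kry n z v l \<odot>\<odot> c = mzero n 1"
  shows "v = mzero n 1"
proof (rule kernel_trivial[OF irr])
  show "B \<subseteq> kmat n n" using B by (auto simp: centraliser_def)
  show "additive_commuting n B (\<lambda>v. kry n z v l \<odot>\<odot> c)"
    by (rule additive_commuting_mono[OF kry_additive_commuting[OF z c] B])
  show "semilinear n (\<lambda>c. c) (\<lambda>v. kry n z v l \<odot>\<odot> c)" by (rule kry_semilinear[OF z c])
qed (use v0 v in auto)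

text \<open>\<open>K[z]\<close> is a field with \<open>K\<close>-basis \<open>1, z, \<dots>, z\<^sup>l\<^sup>-\<^sup>1\<close>, and the standard basis vectors
  indexed by \<open>J\<close> span \<open>K\<^sup>n\<close> over it.\<close>

definition field_generator :: "nat \<Rightarrow> 'a mat \<Rightarrow> nat \<Rightarrow> 'a mat \<Rightarrow> nat set \<Rightarrow> bool" where
  "field_generator n z l a J \<longleftrightarrow> z \<in> kmat n n \<and> a \<in> kmat l 1 \<and> J \<subseteq> {..<n} \<and> l * card J = n \<and>
     (\<forall>v\<in>kmat n 1. mpow n z l \<odot>\<odot> v = kry n z v l \<odot>\<odot> a) \<and>
     (\<forall>W. subspace n W \<longrightarrow> (\<forall>i<l. \<forall>j\<in>J. mpow n z i \<odot>\<odot> ecol n j \<in> W) \<longrightarrow> W = kmat n 1) \<and>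
     (\<forall>c\<in>kmat l 1. c \<noteq> mzero l 1 \<longrightarrow> (\<forall>v\<in>kmat n 1. kry n z v l \<odot>\<odot> c = mzero n 1 \<longrightarrow> v = mzero n 1))"

lemma ecol_nonzero:
  assumes "j < n"
  shows "ecol n j \<noteq> mzero n 1"
proof
  assume "ecol n j = mzero n 1"
  then have "ecol n j $$ (j, 0) = mzero n 1 $$ (j, 0)" by simp
  then show False using assms by (simp add: ecol_def mzero_def mcol_def mone_def)
qed

lemma subspace_eq_UNIV:
  assumes U: "subspace n U" and e: "\<And>j. j < n \<Longrightarrow> ecol n j \<in> U"
  shows "U = kmat n 1"
proof
  show "U \<subseteq> kmat n 1" by (rule subspaceD(1)[OF U])
  show "kmat n 1 \<subseteq> U"
  proof
    fix v assume v: "v \<in> kmat n 1"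
    have "mcol (mone n) j \<in> U" if "j < n" for j
      using e[OF that] mmul_ecol[OF mone_closed that] e_closed(2)[OF that] by simp
    then show "v \<in> U" using subspace_mmul[OF U mone_closed _ v] v by simp
  qed
qed

context
  fixes n B z l a
  assumes n: "n > 0" and irr: "irreducible_on n B" and B: "B \<subseteq> centraliser n z" and z: "z \<in> kmat n n"
    and l: "l \<ge> 1" and a: "a \<in> kmat l 1"
    and ind: "indep K n l (kry n z (ecol n 0) l)"
    and rel: "mpow n z l \<odot>\<odot> ecol n 0 = kry n z (ecol n 0) l \<odot>\<odot> a"
begin

text \<open>The relation is known for one nonzero vector. The difference of its two sides is the
  action of an element of \<open>K[z]\<close>, encoded by the column \<open>c\<close> of length
  \<open>l + 1\<close>, and an element that kills a nonzero vector kills all of them.\<close>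

lemma kry_relation:
  assumes v: "v \<in> kmat n 1"
  shows "mpow n z l \<odot>\<odot> v = kry n z v l \<odot>\<odot> a"
proof -
  define c where "c = vcat (mneg a) (mone 1)"
  have c: "c \<in> kmat (Suc l) 1"
    unfolding c_def Suc_eq_plus1 using vcat_mats[of "mneg a" K l 1 "mone 1" 1] mneg_closed[OF a] mone_closed[of 1]
    by (simp add: kmat_matsK)
  have ev: "kry n z u (Suc l) \<odot>\<odot> c = mneg (kry n z u l \<odot>\<odot> a) \<oplus>\<oplus> mpow n z l \<odot>\<odot> u" if u: "u \<in> kmat n 1" for u
    unfolding kry_Suc[OF z u] c_def
      mmul_hcat_vcat[OF kry_closed[OF z u] mpow_vec[OF z u] mneg_closed[OF a] mone_closed]
    using mmul_one(2)[OF mpow_vec[OF z u]] mmul_neg[OF kry_closed[OF z u] a] by simp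
  have e: "ecol n 0 \<in> kmat n 1" using n by simp
  have "kry n z (ecol n 0) (Suc l) \<odot>\<odot> c = mzero n 1"
    unfolding ev[OF e] rel using madd_neg mmul_closed[OF kry_closed[OF z e] a] by blast
  then have "kry n z v (Suc l) \<odot>\<odot> c = mzero n 1"
    using kry_kernel_trivial[OF irr B z c v _ e] ecol_nonzero[OF n] by blast
  then have "mneg (kry n z v l \<odot>\<odot> a) \<oplus>\<oplus> mpow n z l \<odot>\<odot> v = mzero n 1" using ev[OF v] by simp
  then have "mpow n z l \<odot>\<odot> v \<oplus>\<oplus> mneg (kry n z v l \<odot>\<odot> a) = mzero n 1"
    using madd_comm[OF mneg_closed[OF mmul_closed[OF kry_closed[OF z v] a]] mpow_vec[OF z v], of l] by simp
  then show ?thesis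
    by (rule madd_neg_zeroD[OF mpow_vec[OF z v] mmul_closed[OF kry_closed[OF z v] a]])
qed

lemma kry_injective:
  assumes c: "c \<in> kmat l 1" "c \<noteq> mzero l 1" and v: "v \<in> kmat n 1" "kry n z v l \<odot>\<odot> c = mzero n 1"
  shows "v = mzero n 1"
proof -
  have "kry n z (ecol n 0) l \<odot>\<odot> c \<noteq> mzero n 1" using ind c by (auto simp: indep_def kmat_matsK)
  then show ?thesis by (rule kry_kernel_trivial[OF irr B z c(1) e_closed(2)[OF n] _ v])
qed

lemma kry_subspace_mem:
  assumes U: "subspace n U" "\<And>u. u \<in> U \<Longrightarrow> z \<odot>\<odot> u \<in> U" and u: "u \<in> U" and c: "c \<in> kmat l 1"
  shows "kry n z u l \<odot>\<odot> c \<in> U"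
proof -
  have uk: "u \<in> kmat n 1" using u subspaceD(1)[OF U(1)] by blast
  have "mpow n z i \<odot>\<odot> u \<in> U" for i
  proof (induction i)
    case 0
    then show ?case using u uk by simp
  next
    case (Suc i)
    then show ?case using U(2)[OF Suc] by (simp only: mpow_Suc_vec[OF z uk])
  qed
  then show ?thesis using subspace_mmul[OF U(1) kry_closed[OF z uk] _ c] mcol_kry[OF z uk] by simp
qed

text \<open>Takes the place of inverses in \<open>K[z]\<close>: a nonzero element is injective and
  maps the finite stable subspace \<open>U\<close> into itself, hence onto itself, so nothing
  outside \<open>U\<close> can be sent into \<open>U\<close>.\<close>

lemma kry_image_eq:
  assumes U: "subspace n U" "\<And>u. u \<in> U \<Longrightarrow> z \<odot>\<odot> u \<in> U" and c: "c \<in> kmat l 1" "c \<noteq> mzero l 1"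
    and v: "v \<in> kmat n 1" "kry n z v l \<odot>\<odot> c \<in> U"
  shows "v \<in> U"
proof -
  note D = additive_commutingD[OF kry_additive_commuting[OF z c(1)]]
  let ?\<phi> = "\<lambda>v. kry n z v l \<odot>\<odot> c"
  have Uk: "u \<in> kmat n 1" if "u \<in> U" for u using that subspaceD(1)[OF U(1)] by blast
  have inj: "u = w" if u: "u \<in> kmat n 1" and w: "w \<in> kmat n 1" and e: "?\<phi> u = ?\<phi> w" for u w
  proof (rule madd_neg_zeroD[OF u w])
    have m: "mneg w \<in> kmat n 1" by (rule mneg_closed[OF w])
    have "?\<phi> (u \<oplus>\<oplus> mneg w) = ?\<phi> (w \<oplus>\<oplus> mneg w)" using D(2)[OF u m] D(2)[OF w m] e by simp
    also have "\<dots> = mzero n 1"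
      using additive_zero[OF kry_additive_commuting[OF z c(1)]] madd_neg(1)[OF w] by simp
    finally show "u \<oplus>\<oplus> mneg w = mzero n 1" by (rule kry_injective[OF c madd_closed[OF u m]])
  qed
  have "finite U" using finite_subset[OF subspaceD(1)[OF U(1)] finite_kmat] .
  moreover have "?\<phi> ` U \<subseteq> U" using kry_subspace_mem[OF U _ c(1)] by blast
  moreover have "inj_on ?\<phi> U" using inj Uk by (intro inj_onI) blast
  ultimately have "?\<phi> ` U = U" by (rule endo_inj_surj)
  then have "?\<phi> v \<in> ?\<phi> ` U" using v(2) by simp
  then obtain u where u: "?\<phi> v = ?\<phi> u" "u \<in> U" by (rule imageE)
  have "v = u" by (rule inj[OF v(1) Uk[OF u(2)] u(1)])
  then show ?thesis using u(2) by simp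
qed

text \<open>Adjoins the line of \<open>e\<close> over \<open>K[z]\<close>. By
  \<open>kry_image_eq\<close> it meets \<open>U\<close> only in zero, whence the cardinality. The
  last clause expresses that \<open>V\<close> is spanned by \<open>U\<close> and the vectors
  \<open>z^i e\<close>.\<close>

lemma kry_extend:
  assumes U: "subspace n U" "\<And>u. u \<in> U \<Longrightarrow> z \<odot>\<odot> u \<in> U" and e: "e \<in> kmat n 1" "e \<notin> U"
  obtains V where "subspace n V" "\<forall>v\<in>V. z \<odot>\<odot> v \<in> V" "U \<subseteq> V" "e \<in> V" "card V = card U * card K ^ l"
    "\<forall>W. subspace n W \<longrightarrow> U \<subseteq> W \<longrightarrow> (\<forall>i<l. mpow n z i \<odot>\<odot> e \<in> W) \<longrightarrow> V \<subseteq> W"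
proof -
  note UD = subspaceD[OF U(1)]
  let ?k = "kry n z e l"
  define h where "h = (\<lambda>(u, c). u \<oplus>\<oplus> ?k \<odot>\<odot> c)"
  define V where "V = h ` (U \<times> kmat l 1)"
  have Uk: "u \<in> kmat n 1" if "u \<in> U" for u using that UD(1) by blast
  have kk: "?k \<in> kmat n l" by (rule kry_closed[OF z e(1)])
  have kc: "?k \<odot>\<odot> c \<in> kmat n 1" if "c \<in> kmat l 1" for c by (rule mmul_closed[OF kk that])
  have VI: "u \<oplus>\<oplus> ?k \<odot>\<odot> c \<in> V" if "u \<in> U" "c \<in> kmat l 1" for u c
    unfolding V_def h_def using that by (intro image_eqI[of _ _ "(u, c)"]) auto
  have VE: "\<exists>u c. u \<in> U \<and> c \<in> kmat l 1 \<and> v = u \<oplus>\<oplus> ?k \<odot>\<odot> c" if "v \<in> V" for v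
    using that unfolding V_def h_def by auto
  have VU: "U \<subseteq> V"
  proof
    fix u assume u: "u \<in> U"
    have "u \<oplus>\<oplus> ?k \<odot>\<odot> mzero l 1 = u" using mmul_zero(1)[OF kk, of 1] Uk[OF u] by simp
    then show "u \<in> V" using VI[OF u mzero_closed] by simp
  qed
  have V1: "subspace n V"
    unfolding subspace_def
  proof (intro conjI ballI)
    show "V \<subseteq> kmat n 1" using VE madd_closed[OF Uk kc] by blast
    show "mzero n 1 \<in> V" using VU UD(2) by blast
    fix v assume "v \<in> V"
    then obtain u c where u: "u \<in> U" "c \<in> kmat l 1" "v = u \<oplus>\<oplus> ?k \<odot>\<odot> c" using VE by blast
    show "mscale t v \<in> V" if t: "t \<in> K" for t
      using VI[OF UD(4)[OF t u(1)] mscale_closed[OF t u(2)]] mmul_scale(1)[OF t kk u(2)]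
        mscale_madd[OF t Uk[OF u(1)] kc[OF u(2)]] u(3) by simp
    fix v' assume "v' \<in> V"
    then obtain u' c' where u': "u' \<in> U" "c' \<in> kmat l 1" "v' = u' \<oplus>\<oplus> ?k \<odot>\<odot> c'" using VE by blast
    show "v \<oplus>\<oplus> v' \<in> V"
      using VI[OF UD(3)[OF u(1) u'(1)] madd_closed[OF u(2) u'(2)]] mmul_distrib_left[OF kk u(2) u'(2)]
        madd_madd[OF Uk[OF u(1)] kc[OF u(2)] Uk[OF u'(1)] kc[OF u'(2)]]
        madd_madd[OF Uk[OF u(1)] Uk[OF u'(1)] kc[OF u(2)] kc[OF u'(2)]] u(3) u'(3) by metis
  qed
  have V2: "\<forall>v\<in>V. z \<odot>\<odot> v \<in> V"
  proof
    fix v assume "v \<in> V"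
    obtain u c where u: "u \<in> U" "c \<in> kmat l 1" "v = u \<oplus>\<oplus> ?k \<odot>\<odot> c" using VE \<open>v \<in> V\<close> by blast
    let ?C = "companion l \<zero> \<one> (\<lambda>i. a $$ (i, 0))"
    have C: "?C \<in> kmat l l" using a by (auto simp: kmat_def companion_def)
    have "z \<odot>\<odot> v = z \<odot>\<odot> u \<oplus>\<oplus> ?k \<odot>\<odot> (?C \<odot>\<odot> c)"
      using mmul_distrib_left[OF z Uk[OF u(1)] kc[OF u(2)]] mmul_assoc[OF z kk u(2)] mmul_assoc[OF kk C u(2)]
        mmul_kry[OF z e(1) a kry_relation[OF e(1)]] u(3) by simp
    then show "z \<odot>\<odot> v \<in> V" using VI[OF U(2)[OF u(1)] mmul_closed[OF C u(2)]] by simp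
  qed
  have V3: "e \<in> V"
  proof -
    have el: "ecol l 0 \<in> kmat l 1" using l by simp
    have "mzero n 1 \<oplus>\<oplus> ?k \<odot>\<odot> ecol l 0 = e"
      using mmul_ecol[OF kk, of 0] mcol_kry[OF z e(1), of 0 l] l e(1) by simp
    then show ?thesis using VI[OF UD(2) el] by simp
  qed
  have "inj_on h (U \<times> kmat l 1)"
  proof (rule inj_onI)
    fix s t assume st: "s \<in> U \<times> kmat l 1" "t \<in> U \<times> kmat l 1" "h s = h t"
    obtain u c u' c' where eq: "s = (u, c)" "t = (u', c')" by (metis surj_pair)
    have u: "u \<in> U" "u' \<in> U" "c \<in> kmat l 1" "c' \<in> kmat l 1"
      and e1: "u \<oplus>\<oplus> ?k \<odot>\<odot> c = u' \<oplus>\<oplus> ?k \<odot>\<odot> c'" using st eq by (auto simp: h_def)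
    have mu: "mneg u' \<in> U"
    proof -
      have "mscale (\<ominus> \<one>) u' \<in> U" by (rule UD(4)[OF _ u(2)]) simp
      moreover have "mscale (\<ominus> \<one>) u' = mneg u'"
        by (rule kmat_eqI[of _ n 1]) (use Uk[OF u(2)] in \<open>auto simp: mscale_entry[of _ n 1] mneg_entry[of _ n 1] l_minus kmat_entry[of _ n 1]\<close>)
      ultimately show ?thesis by simp
    qed
    have "u \<oplus>\<oplus> mneg u' = ?k \<odot>\<odot> c' \<oplus>\<oplus> mneg (?k \<odot>\<odot> c)"
      by (rule madd_cancel[OF Uk[OF u(1)] kc[OF u(3)] Uk[OF u(2)] kc[OF u(4)] e1])
    also have "\<dots> = ?k \<odot>\<odot> (c' \<oplus>\<oplus> mneg c)"
      using mmul_distrib_left[OF kk u(4) mneg_closed[OF u(3)]] mmul_neg(1)[OF kk u(3)] by simp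
    finally have "?k \<odot>\<odot> (c' \<oplus>\<oplus> mneg c) \<in> U" using UD(3)[OF u(1) mu] by simp
    then have "c' \<oplus>\<oplus> mneg c = mzero l 1"
      using kry_image_eq[OF U madd_closed[OF u(4) mneg_closed[OF u(3)]] _ e(1)] e(2) by blast
    then have c: "c' = c" by (rule madd_neg_zeroD[OF u(4,3)])
    have "u \<oplus>\<oplus> mneg u' = mzero n 1"
      using \<open>u \<oplus>\<oplus> mneg u' = ?k \<odot>\<odot> c' \<oplus>\<oplus> mneg (?k \<odot>\<odot> c)\<close> c madd_neg(1)[OF kc[OF u(3)]] by simp
    then have "u = u'" by (rule madd_neg_zeroD[OF Uk[OF u(1)] Uk[OF u(2)]])
    then show "s = t" using c eq by simp
  qed
  then have V4: "card V = card U * card K ^ l"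
    by (simp add: V_def card_image card_cartesian_product card_kmat)
  have V5: "\<forall>W. subspace n W \<longrightarrow> U \<subseteq> W \<longrightarrow> (\<forall>i<l. mpow n z i \<odot>\<odot> e \<in> W) \<longrightarrow> V \<subseteq> W"
  proof (intro allI impI subsetI)
    fix W v assume W: "subspace n W" "U \<subseteq> W" "\<forall>i<l. mpow n z i \<odot>\<odot> e \<in> W"
    assume "v \<in> V"
    then obtain u c where u: "u \<in> U" "c \<in> kmat l 1" "v = u \<oplus>\<oplus> ?k \<odot>\<odot> c" using VE by blast
    have "?k \<odot>\<odot> c \<in> W" using subspace_mmul[OF W(1) kk _ u(2)] mcol_kry[OF z e(1)] W(3) by simp
    then show "v \<in> W" using subspaceD(3)[OF W(1)] u W(2) by blast
  qed
  show ?thesis by (rule that[OF V1 V2 VU V3 V4 V5])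
qed

text \<open>A greedy choice of a basis over \<open>K[z]\<close>; comparing cardinalities gives
  \<open>l\<close> times \<open>card J\<close> equal to \<open>n\<close>. Choosing among the unit
  vectors keeps the number of possible bases below a bound independent of the field, as the union
  bound requires.\<close>

lemma field_generator_exists: "\<exists>J. field_generator n z l a J"
proof -
  define P where "P = (\<lambda>(J, U). J \<subseteq> {..<n} \<and> subspace n U \<and> (\<forall>u\<in>U. z \<odot>\<odot> u \<in> U) \<and>
    card U = card K ^ (l * card J) \<and> (\<forall>j\<in>J. ecol n j \<in> U) \<and>
    (\<forall>W. subspace n W \<longrightarrow> (\<forall>i<l. \<forall>j\<in>J. mpow n z i \<odot>\<odot> ecol n j \<in> W) \<longrightarrow> U \<subseteq> W))"
  have "subspace n {mzero n 1}" by (auto simp: subspace_def)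
  then have "P ({}, {mzero n 1})"
    unfolding P_def using mmul_zero(1)[OF z, of 1] by (auto simp: subspace_def)
  moreover have "\<forall>y. P y \<longrightarrow> card (fst y) < Suc n"
    using card_mono[OF finite_lessThan, of _ n] by (fastforce simp: P_def)
  ultimately have "\<exists>x. P x \<and> (\<forall>y. P y \<longrightarrow> card (fst y) \<le> card (fst x))" by (rule ex_has_greatest_nat)
  then obtain J U where P: "P (J, U)" and max: "\<And>J' U'. P (J', U') \<Longrightarrow> card J' \<le> card J" by auto
  have J: "J \<subseteq> {..<n}" and U: "subspace n U" "\<And>u. u \<in> U \<Longrightarrow> z \<odot>\<odot> u \<in> U" and cU: "card U = card K ^ (l * card J)"
    and eU: "\<And>j. j \<in> J \<Longrightarrow> ecol n j \<in> U"
    and UW: "\<And>W. subspace n W \<Longrightarrow> (\<And>i j. i < l \<Longrightarrow> j \<in> J \<Longrightarrow> mpow n z i \<odot>\<odot> ecol n j \<in> W) \<Longrightarrow> U \<subseteq> W"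
    using P by (auto simp: P_def)
  have "U = kmat n 1"
  proof (rule subspace_eq_UNIV[OF U(1)], rule ccontr)
    fix j assume j: "j < n" "ecol n j \<notin> U"
    obtain V where V: "subspace n V" "\<forall>v\<in>V. z \<odot>\<odot> v \<in> V" "U \<subseteq> V" "ecol n j \<in> V"
      "card V = card U * card K ^ l"
      and VW: "\<forall>W. subspace n W \<longrightarrow> U \<subseteq> W \<longrightarrow> (\<forall>i<l. mpow n z i \<odot>\<odot> ecol n j \<in> W) \<longrightarrow> V \<subseteq> W"
      using kry_extend[OF U e_closed(2)[OF j(1)] j(2)] .
    have jJ: "j \<notin> J" using eU j(2) by blast
    have fJ: "finite J" using J finite_subset by blast
    have cV: "card V = card K ^ (l * card (insert j J))"
      using V(5) cU jJ fJ by (simp add: power_add)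
    have "V \<subseteq> W" if W: "subspace n W" "\<forall>i<l. \<forall>j'\<in>insert j J. mpow n z i \<odot>\<odot> ecol n j' \<in> W" for W
      using VW UW[OF W(1)] W by simp
    then have "P (insert j J, V)"
      unfolding P_def using J j(1) V cV eU by auto
    then have "card (insert j J) \<le> card J" by (rule max)
    then show False using jJ fJ by simp
  qed
  then have "card K ^ (l * card J) = card K ^ n" using cU by (simp add: card_kmat)
  then have lJ: "l * card J = n" using subfield_card_ge_2[OF KF] by simp
  have "W = kmat n 1" if W: "subspace n W" "\<forall>i<l. \<forall>j\<in>J. mpow n z i \<odot>\<odot> ecol n j \<in> W" for W
    using UW[OF W(1)] W(2) \<open>U = kmat n 1\<close> subspaceD(1)[OF W(1)] by blast
  then have "field_generator n z l a J"
    unfolding field_generator_def using z a J lJ kry_relation kry_injective by blast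
  then show ?thesis ..
qed

end

text \<open>A relation of length 1 would read \<open>z v = c v\<close> for all \<open>v\<close> with
  one and the same scalar \<open>c\<close>.\<close>

lemma nonscalar_field_generator:
  assumes n: "n > 0" and irr: "irreducible_on n B" and B: "B \<subseteq> centraliser n z" and z: "z \<in> kmat n n"
    and ns: "\<And>c. c \<in> K \<Longrightarrow> z \<noteq> mscale c (mone n)"
  obtains l a J where "l \<ge> 2" "field_generator n z l a J"
proof -
  have e: "ecol n 0 \<in> kmat n 1" using n by simp
  obtain l a where l: "l \<ge> 1" "indep K n l (kry n z (ecol n 0) l)" and a: "a \<in> kmat l 1"
    and rel: "mpow n z l \<odot>\<odot> ecol n 0 = kry n z (ecol n 0) l \<odot>\<odot> a"
    by (rule kry_stabilises[OF z e ecol_nonzero[OF n]])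
  obtain J where J: "field_generator n z l a J"
    using field_generator_exists[OF n irr B z l(1) a l(2) rel] by blast
  have "l \<noteq> 1"
  proof
    assume l1: "l = 1"
    let ?c = "a $$ (0, 0)"
    have c: "?c \<in> K" using kmat_entry[OF a, of 0 0] l1 by simp
    have s: "mscale ?c (mone n) \<in> kmat n n" by (rule mscale_closed[OF c mone_closed])
    have "z \<odot>\<odot> v = mscale ?c (mone n) \<odot>\<odot> v" if v: "v \<in> kmat n 1" for v
    proof -
      have "kry n z v 1 = v"
        by (rule kmat_eqI[of _ n 1]) (use kry_closed[OF z v] kry_entry[OF z v] v in auto)
      moreover have "mpow n z 1 \<odot>\<odot> v = kry n z v 1 \<odot>\<odot> a" using J v l1 by (auto simp: field_generator_def)
      ultimately have "z \<odot>\<odot> v = v \<odot>\<odot> a" using z by (simp add: One_nat_def)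
      also have "\<dots> = mscale ?c v" by (rule mmul_1_1[OF v]) (use a l1 in simp)
      finally show ?thesis using mmul_scale(2)[OF c mone_closed v] v by simp
    qed
    then have cols: "mcol z j = mcol (mscale ?c (mone n)) j" if "j < n" for j
      using mmul_ecol[OF z that] mmul_ecol[OF s that] e_closed(2)[OF that] by simp
    have "z = mscale ?c (mone n)"
      by (rule mats_eqI_mcol[OF z[unfolded kmat_matsK] s[unfolded kmat_matsK] cols])
    then show False using ns[OF c] by simp
  qed
  then show ?thesis using that[OF _ J] l(1) by simp
qed

text \<open>Coefficients run from the constant term upwards and the empty list stands for the
  leading coefficient 1, so a list of length \<open>k\<close> encodes a monic polynomial of degree
  \<open>k\<close>. The coefficients are matrices because division by \<open>x - y\<close> produces
  nonscalar ones.\<close>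

primrec horner :: "nat \<Rightarrow> 'a mat list \<Rightarrow> 'a mat \<Rightarrow> 'a mat" where
  "horner n [] x = mone n"
| "horner n (c # cs) x = x \<odot>\<odot> horner n cs x \<oplus>\<oplus> c"

lemma horner_closed: "x \<in> kmat n n \<Longrightarrow> set cs \<subseteq> kmat n n \<Longrightarrow> horner n cs x \<in> kmat n n"
  by (induction cs) (auto intro!: madd_closed mmul_closed[of x n n])

text \<open>Synthetic division by \<open>x - y\<close>: the coefficients of the quotient are Horner
  values at \<open>y\<close>. The matrix \<open>x\<close> has to commute with \<open>y\<close> so
  that it can be moved past the factor \<open>x - y\<close>.\<close>

lemma horner_divided_difference:
  assumes y: "y \<in> kmat n n"
  shows "set cs \<subseteq> kmat n n \<Longrightarrow> length cs = Suc k \<Longrightarrow> \<exists>ds. length ds = k \<and> set ds \<subseteq> kmat n n \<and>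
    (\<forall>x\<in>kmat n n. x \<odot>\<odot> y = y \<odot>\<odot> x \<longrightarrow> horner n cs x = (x \<oplus>\<oplus> mneg y) \<odot>\<odot> horner n ds x \<oplus>\<oplus> horner n cs y)"
proof (induction k arbitrary: cs)
  case 0
  then obtain c where c: "cs = [c]" "c \<in> kmat n n" by (auto simp: length_Suc_conv)
  have "horner n cs x = (x \<oplus>\<oplus> mneg y) \<odot>\<odot> horner n [] x \<oplus>\<oplus> horner n cs y" if x: "x \<in> kmat n n" for x
  proof -
    note m = mneg_closed[OF y]
    have "x \<oplus>\<oplus> mneg y \<oplus>\<oplus> (y \<oplus>\<oplus> c) = x \<oplus>\<oplus> (mneg y \<oplus>\<oplus> (y \<oplus>\<oplus> c))"
      by (rule madd_assoc[OF x m madd_closed[OF y c(2)]])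
    also have "mneg y \<oplus>\<oplus> (y \<oplus>\<oplus> c) = mneg y \<oplus>\<oplus> y \<oplus>\<oplus> c" by (rule madd_assoc[OF m y c(2), symmetric])
    also have "\<dots> = c" using madd_neg(2)[OF y] madd_zero[OF c(2)] by simp
    finally show ?thesis using c(1) mmul_one(2)[OF x] mmul_one(2)[OF y] mmul_one(2)[OF madd_closed[OF x m]] by simp
  qed
  then show ?case by (intro exI[of _ "[]"]) auto
next
  case (Suc k)
  then obtain c cs' where c: "cs = c # cs'" "c \<in> kmat n n" "set cs' \<subseteq> kmat n n" "length cs' = Suc k"
    by (auto simp: length_Suc_conv)
  from Suc.IH[OF c(3,4)] obtain ds where ds: "length ds = k" "set ds \<subseteq> kmat n n"
    and eq: "\<And>x. x \<in> kmat n n \<Longrightarrow> x \<odot>\<odot> y = y \<odot>\<odot> x \<Longrightarrow>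
      horner n cs' x = (x \<oplus>\<oplus> mneg y) \<odot>\<odot> horner n ds x \<oplus>\<oplus> horner n cs' y" by blast
  let ?h = "horner n cs' y"
  have h: "?h \<in> kmat n n" by (rule horner_closed[OF y c(3)])
  have "horner n cs x = (x \<oplus>\<oplus> mneg y) \<odot>\<odot> horner n (?h # ds) x \<oplus>\<oplus> horner n cs y"
    if x: "x \<in> kmat n n" and xy: "x \<odot>\<odot> y = y \<odot>\<odot> x" for x
  proof -
    note m = mneg_closed[OF y]
    let ?d = "x \<oplus>\<oplus> mneg y" and ?g = "horner n ds x"
    have d: "?d \<in> kmat n n" by (rule madd_closed[OF x m])
    have g: "?g \<in> kmat n n" by (rule horner_closed[OF x ds(2)])
    have dx: "?d \<odot>\<odot> x = x \<odot>\<odot> ?d"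
      using mmul_distrib_right[OF x m x] mmul_distrib_left[OF x x m] mmul_neg[OF x y] mmul_neg(2)[OF y x] xy by simp
    have xg: "x \<odot>\<odot> ?g \<in> kmat n n" by (rule mmul_closed[OF x g])
    have dy: "?d \<odot>\<odot> ?h \<oplus>\<oplus> y \<odot>\<odot> ?h = x \<odot>\<odot> ?h"
    proof -
      have "?d \<oplus>\<oplus> y = x" using madd_assoc[OF x m y] madd_neg(2)[OF y] madd_zero[OF x] by simp
      then show ?thesis using mmul_distrib_right[OF d y h] by simp
    qed
    have "?d \<odot>\<odot> (x \<odot>\<odot> ?g \<oplus>\<oplus> ?h) \<oplus>\<oplus> (y \<odot>\<odot> ?h \<oplus>\<oplus> c)
      = (?d \<odot>\<odot> (x \<odot>\<odot> ?g) \<oplus>\<oplus> ?d \<odot>\<odot> ?h) \<oplus>\<oplus> (y \<odot>\<odot> ?h \<oplus>\<oplus> c)"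
      by (simp only: mmul_distrib_left[OF d xg h])
    also have "\<dots> = ?d \<odot>\<odot> (x \<odot>\<odot> ?g) \<oplus>\<oplus> (?d \<odot>\<odot> ?h \<oplus>\<oplus> y \<odot>\<odot> ?h \<oplus>\<oplus> c)"
      using madd_assoc[OF mmul_closed[OF d xg] mmul_closed[OF d h] madd_closed[OF mmul_closed[OF y h] c(2)]]
        madd_assoc[OF mmul_closed[OF d h] mmul_closed[OF y h] c(2)] by simp
    also have "\<dots> = x \<odot>\<odot> (?d \<odot>\<odot> ?g) \<oplus>\<oplus> (x \<odot>\<odot> ?h \<oplus>\<oplus> c)"
      using mmul_assoc[OF d x g] mmul_assoc[OF x d g] dx by (simp only: dy)
    also have "\<dots> = x \<odot>\<odot> (?d \<odot>\<odot> ?g) \<oplus>\<oplus> x \<odot>\<odot> ?h \<oplus>\<oplus> c"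
      by (rule madd_assoc[OF mmul_closed[OF x mmul_closed[OF d g]] mmul_closed[OF x h] c(2), symmetric])
    also have "\<dots> = x \<odot>\<odot> horner n cs' x \<oplus>\<oplus> c"
      using mmul_distrib_left[OF x mmul_closed[OF d g] h] by (simp only: eq[OF x xy])
    finally show ?thesis by (simp add: c(1))
  qed
  then show ?case using ds h by (intro exI[of _ "?h # ds"]) auto
qed

lemma mone_neq_mzero:
  assumes "n > 0"
  shows "mone n \<noteq> mzero n n"
proof
  assume "mone n = mzero n n"
  then have "mone n $$ (0, 0) = mzero n n $$ (0, 0)" by simp
  then show False using assms by (simp add: mone_def mzero_def)
qed

text \<open>As over a field: divide by \<open>x - y\<close> for one zero \<open>y\<close>, and
  cancel this factor at the other zeros, which the hypothesis on differences permits. In degree 0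
  the polynomial is the identity matrix and has no zeros.\<close>

lemma card_horner_zeros:
  assumes n: "n > 0"
  shows "finite Y \<Longrightarrow> Y \<subseteq> kmat n n \<Longrightarrow> (\<And>x y. x \<in> Y \<Longrightarrow> y \<in> Y \<Longrightarrow> x \<odot>\<odot> y = y \<odot>\<odot> x) \<Longrightarrow>
    (\<And>x y m. x \<in> Y \<Longrightarrow> y \<in> Y \<Longrightarrow> x \<noteq> y \<Longrightarrow> m \<in> kmat n n \<Longrightarrow> (x \<oplus>\<oplus> mneg y) \<odot>\<odot> m = mzero n n \<Longrightarrow> m = mzero n n) \<Longrightarrow>
    set cs \<subseteq> kmat n n \<Longrightarrow> length cs = k \<Longrightarrow> (\<And>x. x \<in> Y \<Longrightarrow> horner n cs x = mzero n n) \<Longrightarrow> card Y \<le> k"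
proof (induction k arbitrary: cs Y)
  case 0
  then have "Y = {}" using mone_neq_mzero[OF n] by auto
  then show ?case by simp
next
  case (Suc k)
  show ?case
  proof (cases "Y = {}")
    case False
    then obtain y where y: "y \<in> Y" by blast
    have yk: "y \<in> kmat n n" using y Suc.prems(2) by blast
    obtain ds where ds: "length ds = k" "set ds \<subseteq> kmat n n"
      and eq: "\<And>x. x \<in> kmat n n \<Longrightarrow> x \<odot>\<odot> y = y \<odot>\<odot> x \<Longrightarrow>
        horner n cs x = (x \<oplus>\<oplus> mneg y) \<odot>\<odot> horner n ds x \<oplus>\<oplus> horner n cs y"
      using horner_divided_difference[OF yk Suc.prems(5,6)] by blast
    have "card (Y - {y}) \<le> k"
    proof (rule Suc.IH[OF _ _ _ _ ds(2,1)])
      fix x assume x: "x \<in> Y - {y}"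
      have xk: "x \<in> kmat n n" using x Suc.prems(2) by blast
      have h: "horner n ds x \<in> kmat n n" by (rule horner_closed[OF xk ds(2)])
      have dh: "(x \<oplus>\<oplus> mneg y) \<odot>\<odot> horner n ds x \<in> kmat n n"
        by (rule mmul_closed[OF madd_closed[OF xk mneg_closed[OF yk]] h])
      have "(x \<oplus>\<oplus> mneg y) \<odot>\<odot> horner n ds x = mzero n n"
        using eq[OF xk] Suc.prems(3)[of x y] Suc.prems(7)[of x] Suc.prems(7)[OF y] x y madd_zero[OF dh] by simp
      then show "horner n ds x = mzero n n" using Suc.prems(4)[of x y] x y h by simp
    next
      fix x y' m assume "x \<in> Y - {y}" "y' \<in> Y - {y}" "x \<noteq> y'" "m \<in> kmat n n"
        "(x \<oplus>\<oplus> mneg y') \<odot>\<odot> m = mzero n n"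
      then show "m = mzero n n" using Suc.prems(4)[of x y' m] by simp
    qed (use Suc.prems(1,2,3) in auto)
    then show ?thesis using y Suc.prems(1) by simp
  qed simp
qed

primrec poly_eval :: "nat \<Rightarrow> (nat \<Rightarrow> 'a) \<Rightarrow> 'a mat \<Rightarrow> nat \<Rightarrow> 'a mat" where
  "poly_eval n f x 0 = mscale (f 0) (mone n)"
| "poly_eval n f x (Suc k) = poly_eval n f x k \<oplus>\<oplus> mscale (f (Suc k)) (mpow n x (Suc k))"

context
  fixes n x
  assumes x: "x \<in> kmat n n"
begin

lemma poly_eval_closed: "(\<And>i. f i \<in> K) \<Longrightarrow> poly_eval n f x k \<in> kmat n n"
proof (induction k)
  case (Suc k)
  then show ?case using madd_closed[OF Suc.IH mscale_closed[OF _ mpow_closed[OF x]]] by (simp del: mpow.simps)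
qed simp

lemma poly_eval_entry:
  assumes f: "\<And>i. f i \<in> K" and ij: "i < n" "j < n"
  shows "poly_eval n f x k $$ (i, j) = (\<Oplus>t\<in>{..k}. f t \<otimes> mpow n x t $$ (i, j))"
proof -
  have m: "mpow n x t $$ (i, j) \<in> K" for t using kmat_entry[OF mpow_closed[OF x] ij] .
  show ?thesis
  proof (induction k)
    case 0
    show ?case using f m[of 0] mscale_entry[OF mone_closed ij] by simp
  next
    case (Suc k)
    have "(\<Oplus>t\<in>{..Suc k}. f t \<otimes> mpow n x t $$ (i, j)) =
      f (Suc k) \<otimes> mpow n x (Suc k) $$ (i, j) \<oplus> (\<Oplus>t\<in>{..k}. f t \<otimes> mpow n x t $$ (i, j))"
      by (rule finsum_Suc) (use f m in auto)
    moreover have "(\<Oplus>t\<in>{..k}. f t \<otimes> mpow n x t $$ (i, j)) \<in> K" by (rule finsum_closed) (use f m in auto)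
    moreover have "poly_eval n f x (Suc k) $$ (i, j) =
      (\<Oplus>t\<in>{..k}. f t \<otimes> mpow n x t $$ (i, j)) \<oplus> f (Suc k) \<otimes> mpow n x (Suc k) $$ (i, j)"
      unfolding poly_eval.simps(2) madd_entry[OF poly_eval_closed[OF f] ij]
        mscale_entry[OF mpow_closed[OF x] ij] Suc ..
    ultimately show ?case using a_comm[of "f (Suc k) \<otimes> mpow n x (Suc k) $$ (i, j)"] f m by (simp del: mpow.simps)
  qed
qed

lemma mmul_mscale_mpow: "c \<in> K \<Longrightarrow> x \<odot>\<odot> mscale c (mpow n x k) = mscale c (mpow n x (Suc k))"
  using mmul_scale(1)[OF _ x mpow_closed[OF x]] mpow_comm[OF x, of k] by simp

lemma poly_eval_front:
  assumes f: "\<And>i. f i \<in> K"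
  shows "poly_eval n f x (Suc k) = x \<odot>\<odot> poly_eval n (\<lambda>i. f (Suc i)) x k \<oplus>\<oplus> mscale (f 0) (mone n)"
proof (induction k)
  case 0
  have a: "mscale (f (Suc 0)) (mpow n x (Suc 0)) \<in> kmat n n" and b: "mscale (f 0) (mone n) \<in> kmat n n"
    using mscale_closed[OF f mpow_closed[OF x]] mscale_closed[OF f mone_closed] by blast+
  show ?case using madd_comm[OF b a] mmul_mscale_mpow[OF f, of _ 0] by simp
next
  case (Suc k)
  let ?g = "\<lambda>i. f (Suc i)" and ?m = "\<lambda>k. mscale (f k) (mpow n x k)" and ?c = "mscale (f 0) (mone n)"
  have p: "poly_eval n ?g x k \<in> kmat n n" by (rule poly_eval_closed) (rule f)
  have q: "mscale (?g (Suc k)) (mpow n x (Suc k)) \<in> kmat n n" and r: "?m (Suc (Suc k)) \<in> kmat n n"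
    using mscale_closed[OF f mpow_closed[OF x]] by blast+
  have c: "?c \<in> kmat n n" by (rule mscale_closed[OF f mone_closed])
  have "poly_eval n f x (Suc (Suc k)) = x \<odot>\<odot> poly_eval n ?g x k \<oplus>\<oplus> ?c \<oplus>\<oplus> ?m (Suc (Suc k))"
    by (simp only: poly_eval.simps(2)[of n f x "Suc k"] Suc)
  also have "\<dots> = x \<odot>\<odot> poly_eval n ?g x k \<oplus>\<oplus> ?m (Suc (Suc k)) \<oplus>\<oplus> ?c"
    by (rule madd_swap[OF mmul_closed[OF x p] c r])
  also have "?m (Suc (Suc k)) = x \<odot>\<odot> mscale (?g (Suc k)) (mpow n x (Suc k))"
    by (rule mmul_mscale_mpow[OF f, symmetric])
  finally show ?case by (simp only: poly_eval.simps(2) mmul_distrib_left[OF x p q])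
qed

lemma horner_poly_eval:
  "(\<And>i. f i \<in> K) \<Longrightarrow> f k = \<one> \<Longrightarrow> horner n (map (\<lambda>i. mscale (f i) (mone n)) [0..<k]) x = poly_eval n f x k"
proof (induction k arbitrary: f)
  case 0
  then show ?case using mscale_one[OF mone_closed[of n]] by simp
next
  case (Suc k)
  have "map (\<lambda>i. mscale (f i) (mone n)) [0..<Suc k]
    = mscale (f 0) (mone n) # map (\<lambda>i. mscale (f (Suc i)) (mone n)) [0..<k]"
    by (simp add: map_upt_Suc del: upt_Suc)
  then show ?case using Suc.IH[of "\<lambda>i. f (Suc i)"] poly_eval_front[of f k] Suc.prems by (simp only: horner.simps)
qed

end

lemma char_class_horner:
  assumes x: "x \<in> char_class n f"
  shows "horner n (map (\<lambda>i. mscale (f i) (mone n)) [0..<n]) x = mzero n n"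
proof -
  have xk: "x \<in> kmat n n" and cp: "cp n x = f" using x by (auto simp: char_class_def)
  have f: "f i \<in> K" for i using cp_closed[OF xk] by (auto simp: cp UP_def)
  have "horner n (map (\<lambda>i. mscale (f i) (mone n)) [0..<n]) x = poly_eval n f x n"
    by (rule horner_poly_eval[OF xk]) (use f cp_monic(1)[OF xk] cp in auto)
  also have "\<dots> = mzero n n"
    by (rule kmat_eqI[OF poly_eval_closed[OF xk f] mzero_closed])
      (simp only: poly_eval_entry[OF xk f] cayley_hamilton_kmat[OF xk, unfolded cp] mzero_entry)
  finally show ?thesis .
qed

section \<open>Counting generators, centralisers and commuting pairs\<close>

lemma kmat_eq_vecI:
  assumes "x \<in> kmat n n" "y \<in> kmat n n" "\<And>j. j < n \<Longrightarrow> x \<odot>\<odot> ecol n j = y \<odot>\<odot> ecol n j"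
  shows "x = y"
  by (rule mats_eqI_mcol[OF assms(1,2)[unfolded kmat_matsK]]) (use assms mmul_ecol[OF assms(1)] mmul_ecol[OF assms(2)] in simp)

lemma equaliser_subspace:
  assumes x: "x \<in> kmat n n" and y: "y \<in> kmat n n"
  shows "subspace n {v \<in> kmat n 1. x \<odot>\<odot> v = y \<odot>\<odot> v}" (is "subspace n ?W")
  unfolding subspace_def
proof (intro conjI ballI)
  show "?W \<subseteq> kmat n 1" by blast
  show "mzero n 1 \<in> ?W" using mmul_zero(1)[OF x] mmul_zero(1)[OF y] by simp
  fix u assume u: "u \<in> ?W"
  show "mscale c u \<in> ?W" if c: "c \<in> K" for c
    using u mmul_scale(1)[OF c x, of u 1] mmul_scale(1)[OF c y, of u 1] mscale_closed[OF c, of u n 1] by simp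
  fix v assume v: "v \<in> ?W"
  show "u \<oplus>\<oplus> v \<in> ?W"
    using u v mmul_distrib_left[OF x, of u 1 v] mmul_distrib_left[OF y, of u 1 v] madd_closed[of u n 1 v] by simp
qed

lemma field_generatorD:
  assumes "field_generator n z l a J"
  shows "z \<in> kmat n n" "a \<in> kmat l 1" "J \<subseteq> {..<n}" "l * card J = n" "finite J"
    "v \<in> kmat n 1 \<Longrightarrow> mpow n z l \<odot>\<odot> v = kry n z v l \<odot>\<odot> a"
    "subspace n W \<Longrightarrow> (\<And>i j. i < l \<Longrightarrow> j \<in> J \<Longrightarrow> mpow n z i \<odot>\<odot> ecol n j \<in> W) \<Longrightarrow> W = kmat n 1"
    "c \<in> kmat l 1 \<Longrightarrow> c \<noteq> mzero l 1 \<Longrightarrow> v \<in> kmat n 1 \<Longrightarrow> kry n z v l \<odot>\<odot> c = mzero n 1 \<Longrightarrow> v = mzero n 1"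
  using assms finite_subset[OF _ finite_lessThan, of J n] by (auto simp: field_generator_def)

lemma field_generator_eqI:
  assumes z: "field_generator n z l a J" and x: "x \<in> kmat n n" and y: "y \<in> kmat n n"
    and eq: "\<And>i j. i < l \<Longrightarrow> j \<in> J \<Longrightarrow> x \<odot>\<odot> (mpow n z i \<odot>\<odot> ecol n j) = y \<odot>\<odot> (mpow n z i \<odot>\<odot> ecol n j)"
  shows "x = y"
proof -
  note D = field_generatorD[OF z]
  let ?W = "{v \<in> kmat n 1. x \<odot>\<odot> v = y \<odot>\<odot> v}"
  have "?W = kmat n 1"
  proof (rule D(7)[OF equaliser_subspace[OF x y]])
    fix i j assume ij: "i < l" "j \<in> J"
    have "ecol n j \<in> kmat n 1" using ij D(3) by auto
    then show "mpow n z i \<odot>\<odot> ecol n j \<in> ?W" using mpow_vec[OF D(1)] eq[OF ij] by simp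
  qed
  then have "x \<odot>\<odot> ecol n j = y \<odot>\<odot> ecol n j" if "j < n" for j
    using e_closed(2)[OF that] by blast
  then show ?thesis by (rule kmat_eq_vecI[OF x y])
qed

text \<open>Once the relation \<open>a\<close> and the index set \<open>J\<close> are fixed,
  \<open>z\<close> is determined by the vectors \<open>z^i e\<close> with \<open>0 < i < l\<close>
  and \<open>e\<close> a basis vector indexed by \<open>J\<close>; the power \<open>l\<close>
  follows from \<open>a\<close>.\<close>

lemma card_field_generators_le:
  "card {z. field_generator n z l a J} \<le> card K ^ (n * ((l - 1) * card J))"
proof (cases "finite J")
  case True
  let ?I = "{..<l - 1} \<times> J"
  define \<Psi> where "\<Psi> z = restrict (\<lambda>(i, j). mpow n z (Suc i) \<odot>\<odot> ecol n j) ?I" for z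
  have e: "ecol n j \<in> kmat n 1" if "field_generator n z l a J" "j \<in> J" for z j
    using field_generatorD(3)[OF that(1)] that(2) by auto
  have "\<Psi> z \<in> ?I \<rightarrow>\<^sub>E kmat n 1" if z: "field_generator n z l a J" for z
    unfolding \<Psi>_def restrict_PiE_iff using mpow_vec[OF field_generatorD(1)[OF z] e[OF z]] by (auto simp del: mpow.simps)
  then have "\<Psi> ` {z. field_generator n z l a J} \<subseteq> ?I \<rightarrow>\<^sub>E kmat n 1" by blast
  moreover have "inj_on \<Psi> {z. field_generator n z l a J}"
  proof (rule inj_onI)
    fix z w assume "z \<in> {z. field_generator n z l a J}" "w \<in> {z. field_generator n z l a J}" and eq: "\<Psi> z = \<Psi> w"
    then have z: "field_generator n z l a J" and w: "field_generator n w l a J" by auto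
    note zk = field_generatorD(1)[OF z] and wk = field_generatorD(1)[OF w]
    have small: "mpow n z i \<odot>\<odot> ecol n j = mpow n w i \<odot>\<odot> ecol n j" if "i < l" "j \<in> J" for i j
    proof (cases i)
      case (Suc k)
      then have "(k, j) \<in> ?I" using that by auto
      then show ?thesis using fun_cong[OF eq, of "(k, j)"] Suc by (simp add: \<Psi>_def del: mpow.simps)
    qed simp
    show "z = w"
    proof (rule field_generator_eqI[OF z zk wk])
      fix i j assume ij: "i < l" "j \<in> J"
      note ej = e[OF z ij(2)]
      have "mpow n z (Suc i) \<odot>\<odot> ecol n j = mpow n w (Suc i) \<odot>\<odot> ecol n j"
      proof (cases "Suc i < l")
        case False
        then have "Suc i = l" using ij by simp
        moreover have "kry n z (ecol n j) l = kry n w (ecol n j) l"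
          unfolding kry_def mjoin_def by (rule cong_mat) (use small ij(2) in auto)
        ultimately show ?thesis using field_generatorD(6)[OF z ej] field_generatorD(6)[OF w ej] by simp
      qed (rule small[OF _ ij(2)])
      then show "z \<odot>\<odot> (mpow n z i \<odot>\<odot> ecol n j) = w \<odot>\<odot> (mpow n z i \<odot>\<odot> ecol n j)"
        using mpow_Suc_vec[OF zk ej, of i] mpow_Suc_vec[OF wk ej, of i] small[OF ij] by simp
    qed
  qed
  ultimately have "card {z. field_generator n z l a J} \<le> card (?I \<rightarrow>\<^sub>E kmat n 1)"
    by (intro card_inj_on_le) (auto intro!: finite_PiE finite_kmat True)
  also have "\<dots> = card K ^ (n * ((l - 1) * card J))"
    using True by (simp add: card_PiE card_kmat power_mult)
  finally show ?thesis .
next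
  case False
  then have "{z. field_generator n z l a J} = {}" using field_generatorD(5) by blast
  then show ?thesis by simp
qed

text \<open>Elements of the centraliser are linear over \<open>K[z]\<close>, so their values on the
  basis indexed by \<open>J\<close> suffice.\<close>

lemma card_centraliser_le:
  assumes z: "field_generator n z l a J"
  shows "card (centraliser n z) \<le> card K ^ (n * card J)"
proof -
  note D = field_generatorD[OF z]
  have e: "ecol n j \<in> kmat n 1" if "j \<in> J" for j using D(3) that by auto
  define \<Psi> where "\<Psi> x = restrict (\<lambda>j. x \<odot>\<odot> ecol n j) J" for x
  have "\<Psi> ` centraliser n z \<subseteq> J \<rightarrow>\<^sub>E kmat n 1"
  proof (rule image_subsetI)
    fix x assume "x \<in> centraliser n z"
    then show "\<Psi> x \<in> J \<rightarrow>\<^sub>E kmat n 1"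
      unfolding \<Psi>_def restrict_PiE_iff using mmul_closed[OF centraliserD(1) e] by blast
  qed
  moreover have "inj_on \<Psi> (centraliser n z)"
  proof (rule inj_onI)
    fix x y assume x: "x \<in> centraliser n z" and y: "y \<in> centraliser n z" and eq: "\<Psi> x = \<Psi> y"
    note xk = centraliserD(1)[OF x] and yk = centraliserD(1)[OF y]
    show "x = y"
    proof (rule field_generator_eqI[OF z xk yk])
      fix i j assume ij: "i < l" "j \<in> J"
      have c: "u \<odot>\<odot> (mpow n z i \<odot>\<odot> ecol n j) = mpow n z i \<odot>\<odot> (u \<odot>\<odot> ecol n j)" if u: "u \<in> centraliser n z" for u
        using mmul_assoc[OF centraliserD(1)[OF u] mpow_closed[OF D(1), of i] e[OF ij(2)]]
          mmul_assoc[OF mpow_closed[OF D(1), of i] centraliserD(1)[OF u] e[OF ij(2)]] mpow_commute[OF D(1) u, of i] by simp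
      have "x \<odot>\<odot> ecol n j = y \<odot>\<odot> ecol n j" using fun_cong[OF eq, of j] ij by (simp add: \<Psi>_def)
      then show "x \<odot>\<odot> (mpow n z i \<odot>\<odot> ecol n j) = y \<odot>\<odot> (mpow n z i \<odot>\<odot> ecol n j)" using c[OF x] c[OF y] by simp
    qed
  qed
  ultimately have "card (centraliser n z) \<le> card (J \<rightarrow>\<^sub>E kmat n 1)"
    by (intro card_inj_on_le) (auto intro!: finite_PiE finite_kmat D(5))
  also have "\<dots> = card K ^ (n * card J)"
    using D(5) by (simp add: card_PiE card_kmat power_mult)
  finally show ?thesis .
qed

text \<open>Every coset of the field \<open>K[z]\<close> in its centraliser meets the class in at most \<open>n\<close> points: they
  commute, their differences are invertible, and they are zeros of the same monic polynomial.\<close>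

lemma card_char_class_centraliser_le:
  assumes n: "n > 0" and z: "field_generator n z l a J"
  shows "card (char_class n f \<inter> centraliser n z) * card K ^ l \<le> n * card K ^ (n * card J)"
proof -
  note D = field_generatorD[OF z]
  let ?C = "centraliser n z" and ?A = "char_class n f"
  have zC: "z \<in> ?C" using D(1) by (simp add: centraliser_def)
  have "\<exists>P. P \<in> kmat n n \<and> (\<forall>v\<in>kmat n 1. kry n z v l \<odot>\<odot> c = P \<odot>\<odot> v) \<and> (\<forall>x\<in>?C. P \<odot>\<odot> x = x \<odot>\<odot> P)"
    if c: "c \<in> kmat l 1" for c
  proof -
    have "?C \<subseteq> kmat n n" by (auto simp: centraliser_def)
    then show ?thesis
      using linear_matrix[OF kry_additive_commuting[OF D(1) c] kry_semilinear[OF D(1) c]] by metis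
  qed
  then obtain P where P: "\<And>c. c \<in> kmat l 1 \<Longrightarrow> P c \<in> kmat n n"
    and Pv: "\<And>c v. c \<in> kmat l 1 \<Longrightarrow> v \<in> kmat n 1 \<Longrightarrow> kry n z v l \<odot>\<odot> c = P c \<odot>\<odot> v"
    and Pc: "\<And>c x. c \<in> kmat l 1 \<Longrightarrow> x \<in> ?C \<Longrightarrow> P c \<odot>\<odot> x = x \<odot>\<odot> P c" by metis
  have PC: "P c \<in> ?C" if "c \<in> kmat l 1" for c using P[OF that] Pc[OF that zC] by (simp add: centraliser_def)
  have cancel: "m = mzero n n" if c: "c \<in> kmat l 1" "c' \<in> kmat l 1" "c \<noteq> c'" and m: "m \<in> kmat n n"
    and 0: "(P c \<oplus>\<oplus> mneg (P c')) \<odot>\<odot> m = mzero n n" for c c' m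
  proof (rule kmat_eq_vecI[OF m mzero_closed])
    fix j assume j: "j < n"
    let ?v = "m \<odot>\<odot> ecol n j" and ?c = "c \<oplus>\<oplus> mneg c'"
    note e = e_closed(2)[OF j] and mc = mneg_closed[OF c(2)] and mP = mneg_closed[OF P[OF c(2)]]
    have v: "?v \<in> kmat n 1" by (rule mmul_closed[OF m e])
    note k = kry_closed[OF D(1) v]
    have "kry n z ?v l \<odot>\<odot> ?c = P c \<odot>\<odot> ?v \<oplus>\<oplus> mneg (P c' \<odot>\<odot> ?v)"
      using mmul_distrib_left[OF k c(1) mc] mmul_neg(1)[OF k c(2)] Pv[OF c(1) v] Pv[OF c(2) v] by simp
    also have "\<dots> = (P c \<oplus>\<oplus> mneg (P c')) \<odot>\<odot> ?v"
      using mmul_distrib_right[OF P[OF c(1)] mP v] mmul_neg(2)[OF P[OF c(2)] v] by simp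
    also have "\<dots> = mzero n n \<odot>\<odot> ecol n j"
      using mmul_assoc[OF madd_closed[OF P[OF c(1)] mP] m e] 0 by simp
    finally have "kry n z ?v l \<odot>\<odot> ?c = mzero n 1" using mmul_zero(2)[OF e] by simp
    moreover have "?c \<noteq> mzero l 1" using madd_neg_zeroD[OF c(1,2)] c(3) by blast
    ultimately have "?v = mzero n 1" using D(8)[OF madd_closed[OF c(1) mc] _ v] by blast
    then show "m \<odot>\<odot> ecol n j = mzero n n \<odot>\<odot> ecol n j" using mmul_zero(2)[OF e] by simp
  qed
  have Pinj: "c = c'" if c: "c \<in> kmat l 1" "c' \<in> kmat l 1" "P c = P c'" for c c'
  proof (rule ccontr)
    assume ne: "c \<noteq> c'"
    have "(P c \<oplus>\<oplus> mneg (P c')) \<odot>\<odot> mone n = mzero n n"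
      using madd_neg(1)[OF P[OF c(2)]] c(3) by simp
    then have "mone n = mzero n n" by (rule cancel[OF c(1,2) ne mone_closed])
    then show False using mone_neq_mzero[OF n] by simp
  qed
  \<comment> \<open>Parametrises the points of the coset \<open>x + K[z]\<close> that lie in the
    class.\<close>
  define Y where "Y x = {c \<in> kmat l 1. x \<oplus>\<oplus> P c \<in> ?A}" for x
  have fY: "finite (Y x)" for x using finite_kmat[of l 1] by (simp add: Y_def)
  have cY: "card (Y x) \<le> n" if x: "x \<in> ?C" for x
  proof -
    note xk = centraliserD(1)[OF x]
    let ?g = "\<lambda>c. x \<oplus>\<oplus> P c"
    have Yk: "c \<in> kmat l 1" if "c \<in> Y x" for c using that by (simp add: Y_def)
    have diff: "?g c \<oplus>\<oplus> mneg (?g c') = P c \<oplus>\<oplus> mneg (P c')" if c: "c \<in> Y x" "c' \<in> Y x" for c c'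
    proof -
      note p = P[OF Yk[OF c(1)]] and p' = P[OF Yk[OF c(2)]]
      have "x \<oplus>\<oplus> P c \<oplus>\<oplus> mneg (x \<oplus>\<oplus> P c') = P c \<oplus>\<oplus> x \<oplus>\<oplus> (mneg x \<oplus>\<oplus> mneg (P c'))"
        using madd_comm[OF xk p] mneg_madd[OF xk p'] by simp
      also have "\<dots> = P c \<oplus>\<oplus> (x \<oplus>\<oplus> (mneg x \<oplus>\<oplus> mneg (P c')))"
        by (rule madd_assoc[OF p xk madd_closed[OF mneg_closed[OF xk] mneg_closed[OF p']]])
      also have "x \<oplus>\<oplus> (mneg x \<oplus>\<oplus> mneg (P c')) = x \<oplus>\<oplus> mneg x \<oplus>\<oplus> mneg (P c')"
        by (rule madd_assoc[OF xk mneg_closed[OF xk] mneg_closed[OF p'], symmetric])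
      also have "\<dots> = mneg (P c')" using madd_neg(1)[OF xk] madd_zero[OF mneg_closed[OF p']] by simp
      finally show ?thesis .
    qed
    have inj: "inj_on ?g (Y x)"
    proof (rule inj_onI)
      fix c c' assume c: "c \<in> Y x" "c' \<in> Y x" "?g c = ?g c'"
      note p = P[OF Yk[OF c(1)]] and p' = P[OF Yk[OF c(2)]]
      have "P c \<oplus>\<oplus> mneg (P c') = mzero n n" using diff[OF c(1,2)] c(3) madd_neg(1)[OF madd_closed[OF xk p']] by simp
      from madd_neg_zeroD[OF p p' this] show "c = c'" by (rule Pinj[OF Yk[OF c(1)] Yk[OF c(2)]])
    qed
    have "card (?g ` Y x) \<le> n" if ne: "Y x \<noteq> {}"
    proof (rule card_horner_zeros[OF n])
      let ?cs = "map (\<lambda>i. mscale (f i) (mone n)) [0..<n]"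
      show "finite (?g ` Y x)" using fY by blast
      show "?g ` Y x \<subseteq> kmat n n" using madd_closed[OF xk P[OF Yk]] by blast
      show "length ?cs = n" by simp
      show "horner n ?cs y = mzero n n" if "y \<in> ?g ` Y x" for y
        using that char_class_horner by (auto simp: Y_def)
      show "y \<odot>\<odot> y' = y' \<odot>\<odot> y" if y: "y \<in> ?g ` Y x" "y' \<in> ?g ` Y x" for y y'
      proof -
        obtain c c' where c: "c \<in> Y x" "y = ?g c" "c' \<in> Y x" "y' = ?g c'" using y(1,2) by blast
        note p = P[OF Yk[OF c(1)]] and p' = P[OF Yk[OF c(3)]]
        show ?thesis
          unfolding c(2,4) mmul_distrib_left[OF madd_closed[OF xk p] xk p'] mmul_distrib_left[OF madd_closed[OF xk p'] xk p]
            mmul_distrib_right[OF xk p xk] mmul_distrib_right[OF xk p p'] mmul_distrib_right[OF xk p' xk]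
            mmul_distrib_right[OF xk p' p] Pc[OF Yk[OF c(1)] x] Pc[OF Yk[OF c(3)] x] Pc[OF Yk[OF c(1)] PC[OF Yk[OF c(3)]]]
          by (rule madd_madd[OF mmul_closed[OF xk xk] mmul_closed[OF xk p] mmul_closed[OF xk p'] mmul_closed[OF p' p]])
      qed
      show "m = mzero n n" if y: "y \<in> ?g ` Y x" "y' \<in> ?g ` Y x" "y \<noteq> y'" and m: "m \<in> kmat n n"
        "(y \<oplus>\<oplus> mneg y') \<odot>\<odot> m = mzero n n" for y y' m
      proof -
        obtain c c' where c: "c \<in> Y x" "y = ?g c" "c' \<in> Y x" "y' = ?g c'" using y(1,2) by blast
        show ?thesis
          by (rule cancel[OF Yk[OF c(1)] Yk[OF c(3)] _ m(1)]) (use c y(3) m(2) diff[OF c(1,3)] in auto)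
      qed
      show "set ?cs \<subseteq> kmat n n"
      proof -
        obtain c where "x \<oplus>\<oplus> P c \<in> ?A" using ne by (auto simp: Y_def)
        then have "f \<in> carrier (UP R)" using cp_closed by (auto simp: char_class_def)
        then have "f i \<in> K" for i by (auto simp: UP_def)
        then show ?thesis using mscale_closed[OF _ mone_closed] by auto
      qed
    qed
    then show ?thesis using card_image[OF inj] by (cases "Y x = {}") simp_all
  qed
  \<comment> \<open>Each class element in the centraliser is paired with every shift and recorded by
    the shifted base point. A base point accounts for at most \<open>n\<close> pairs, which gains
    the factor \<open>card K ^ l\<close> over the bound for the whole centraliser.\<close>
  define h where "h = (\<lambda>(x, c). (x \<oplus>\<oplus> mneg (P c), c))"
  have dec: "x \<oplus>\<oplus> mneg (P c) \<oplus>\<oplus> P c = x" if "x \<in> kmat n n" "c \<in> kmat l 1" for x c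
    using madd_assoc[OF that(1) mneg_closed[OF P[OF that(2)]] P[OF that(2)]] madd_neg(2)[OF P[OF that(2)]]
      madd_zero[OF that(1)] by simp
  have "h ` ((?A \<inter> ?C) \<times> kmat l 1) \<subseteq> Sigma ?C Y"
  proof (rule image_subsetI)
    fix s assume s: "s \<in> (?A \<inter> ?C) \<times> kmat l 1"
    obtain x c where eq: "s = (x, c)" by (metis surj_pair)
    then have x: "x \<in> ?A" "x \<in> ?C" and c: "c \<in> kmat l 1" using s by auto
    note xk = centraliserD(1)[OF x(2)] and m = mneg_closed[OF P[OF c]]
    have "x \<oplus>\<oplus> mneg (P c) \<in> ?C"
      using madd_closed[OF xk m] mmul_distrib_right[OF xk m D(1)] mmul_distrib_left[OF D(1) xk m]
        mmul_neg(2)[OF P[OF c] D(1)] mmul_neg(1)[OF D(1) P[OF c]] Pc[OF c zC] centraliserD(2)[OF x(2)]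
      by (simp add: centraliser_def)
    then show "h s \<in> Sigma ?C Y" using dec[OF xk c] x(1) c by (simp add: h_def eq Y_def)
  qed
  moreover have "inj_on h ((?A \<inter> ?C) \<times> kmat l 1)"
  proof (rule inj_onI)
    fix s t assume st: "s \<in> (?A \<inter> ?C) \<times> kmat l 1" "t \<in> (?A \<inter> ?C) \<times> kmat l 1" "h s = h t"
    obtain x c y d where eq: "s = (x, c)" "t = (y, d)" by (metis surj_pair)
    have xy: "x \<in> kmat n n" "y \<in> kmat n n" "c \<in> kmat l 1" "c = d" "x \<oplus>\<oplus> mneg (P c) = y \<oplus>\<oplus> mneg (P c)"
      using st eq by (auto simp: h_def centraliser_def)
    have "x = y \<oplus>\<oplus> mneg (P c) \<oplus>\<oplus> P c" by (simp only: dec[OF xy(1,3)] flip: xy(5))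
    then have "x = y" by (simp only: dec[OF xy(2,3)])
    then show "s = t" using xy(4) eq by simp
  qed
  ultimately have "card ((?A \<inter> ?C) \<times> kmat l 1) \<le> card (Sigma ?C Y)"
    by (intro card_inj_on_le) (auto intro!: finite_SigmaI finite_centraliser fY)
  also have "\<dots> = (\<Sum>x\<in>?C. card (Y x))" by (rule card_SigmaI) (auto intro: finite_centraliser fY)
  also have "\<dots> \<le> (\<Sum>x\<in>?C. n)" by (rule sum_mono) (rule cY)
  also have "\<dots> \<le> n * card K ^ (n * card J)" using card_centraliser_le[OF z] by simp
  finally show ?thesis by (simp add: card_cartesian_product card_kmat)
qed

definition nonscalar :: "nat \<Rightarrow> 'a mat \<Rightarrow> bool" where
  "nonscalar n z \<longleftrightarrow> z \<in> kmat n n \<and> (\<forall>c\<in>K. z \<noteq> mscale c (mone n))"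

lemma mscale_minus: "a \<in> K \<Longrightarrow> z \<in> kmat r c \<Longrightarrow> mscale (\<ominus> a) z = mneg (mscale a z)"
  by (rule kmat_eqI[of _ r c])
    (auto simp: mscale_entry[of _ r c] mneg_entry[of _ r c] l_minus kmat_entry[of _ r c])

lemma mscale_diff:
  assumes "a \<in> K" "b \<in> K" "z \<in> kmat r c"
  shows "mscale a z \<oplus>\<oplus> mneg (mscale b z) = mscale (a \<oplus> \<ominus> b) z"
  using mscale_add[OF assms(1) a_inv_closed[OF assms(2)] assms(3)] mscale_minus[OF assms(2,3)] by simp

lemma mscale_mone_cancel:
  assumes "n > 0" "a \<in> K" "b \<in> K" "mscale a (mone n) = mscale b (mone n)"
  shows "a = b"
proof -
  have "mscale c (mone n) $$ (0, 0) = c" if "c \<in> K" for c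
    using that assms(1) mscale_entry[OF mone_closed, of 0 n 0 c] mone_entry[of 0 n 0] by simp
  then show ?thesis using assms(2,3,4) by metis
qed

lemma nonscalar_affine_inj:
  assumes z: "nonscalar n z" and n: "n > 0" and K: "a \<in> K" "a' \<in> K" "c \<in> K" "c' \<in> K"
    and eq: "mscale a z \<oplus>\<oplus> mscale c (mone n) = mscale a' z \<oplus>\<oplus> mscale c' (mone n)"
  shows "a = a' \<and> c = c'"
proof -
  have zk: "z \<in> kmat n n" using z by (simp add: nonscalar_def)
  note s = mscale_closed[OF _ zk] and t = mscale_closed[OF _ mone_closed]
  let ?d = "a \<oplus> \<ominus> a'" and ?e = "c' \<oplus> \<ominus> c"
  have de: "?d \<in> K" "?e \<in> K" using K by auto
  have "mscale a z \<oplus>\<oplus> mneg (mscale a' z) = mscale c' (mone n) \<oplus>\<oplus> mneg (mscale c (mone n))"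
    by (rule madd_cancel[OF s[OF K(1)] t[OF K(3)] s[OF K(2)] t[OF K(4)] eq])
  then have e: "mscale ?d z = mscale ?e (mone n)"
    unfolding mscale_diff[OF K(1,2) zk] mscale_diff[OF K(4,3) mone_closed] .
  have "?d = \<zero>"
  proof (rule ccontr)
    assume nz: "?d \<noteq> \<zero>"
    have i: "inv ?d \<in> K" "inv ?d \<otimes> ?d = \<one>" using subfield_m_inv[OF KF, of ?d] de nz by auto
    have "mscale (inv ?d) (mscale ?d z) = mscale (inv ?d) (mscale ?e (mone n))" by (simp only: e)
    then have "z = mscale (inv ?d \<otimes> ?e) (mone n)"
      unfolding mscale_mscale[OF i(1) de(1) zk] mscale_mscale[OF i(1) de(2) mone_closed] i(2) mscale_one[OF zk] .
    then show False using z i(1) de(2) by (auto simp: nonscalar_def)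
  qed
  then have aa: "a = a'" using K by (metis minus_equality minus_minus a_comm a_inv_closed)
  have "mscale c' (mone n) \<oplus>\<oplus> mneg (mscale c (mone n)) = mzero n n"
    using e \<open>?d = \<zero>\<close> mscale_zero[OF zk] mscale_diff[OF K(4,3) mone_closed] by simp
  then have "mscale c' (mone n) = mscale c (mone n)" by (rule madd_neg_zeroD[OF t[OF K(4)] t[OF K(3)]])
  then show ?thesis using aa mscale_mone_cancel[OF n K(4,3)] by simp
qed

lemma affine_centraliser:
  assumes z: "z \<in> kmat n n" and x: "x \<in> centraliser n z" and K: "a \<in> K" "c \<in> K"
  shows "x \<in> centraliser n (mscale a z \<oplus>\<oplus> mscale c (mone n))"
proof -
  note xk = centraliserD(1)[OF x] and s = mscale_closed[OF K(1) z] and t = mscale_closed[OF K(2) mone_closed]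
  have "x \<odot>\<odot> (mscale a z \<oplus>\<oplus> mscale c (mone n)) = mscale a (x \<odot>\<odot> z) \<oplus>\<oplus> mscale c x"
    using mmul_distrib_left[OF xk s t] mmul_scale(1)[OF K(1) xk z] mmul_scale(1)[OF K(2) xk mone_closed]
      mmul_one(2)[OF xk] by simp
  moreover have "(mscale a z \<oplus>\<oplus> mscale c (mone n)) \<odot>\<odot> x = mscale a (z \<odot>\<odot> x) \<oplus>\<oplus> mscale c x"
    using mmul_distrib_right[OF s t xk] mmul_scale(2)[OF K(1) z xk] mmul_scale(2)[OF K(2) mone_closed xk]
      mmul_one(1)[OF xk] by simp
  ultimately show ?thesis using xk centraliserD(2)[OF x] by (simp add: centraliser_def)
qed

text \<open>All \<open>a z + c\<close> with \<open>a\<close> nonzero are again nonscalar and commute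
  with the pair. Dividing by this multiplicity saves a factor of order \<open>Q^2\<close>, without
  which the count for \<open>n = 2\<close> would show no gain.\<close>

lemma card_nonscalar_affine_ge:
  assumes z: "nonscalar n z" and n: "n > 0" and x: "x \<in> centraliser n z" and y: "y \<in> centraliser n z"
  shows "card K * (card K - 1) \<le> card {w. nonscalar n w \<and> x \<in> centraliser n w \<and> y \<in> centraliser n w}" (is "_ \<le> card ?W")
proof -
  have zk: "z \<in> kmat n n" using z by (simp add: nonscalar_def)
  define h where "h = (\<lambda>(c, a). mscale a z \<oplus>\<oplus> mscale c (mone n))"
  have "inj_on h (K \<times> (K - {\<zero>}))"
  proof (rule inj_onI)
    fix s t assume st: "s \<in> K \<times> (K - {\<zero>})" "t \<in> K \<times> (K - {\<zero>})" "h s = h t"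
    obtain c a c' a' where eq: "s = (c, a)" "t = (c', a')" by (metis surj_pair)
    then show "s = t" using nonscalar_affine_inj[OF z n, of a a' c c'] st by (simp add: h_def)
  qed
  moreover have "h ` (K \<times> (K - {\<zero>})) \<subseteq> ?W"
  proof (rule image_subsetI)
    fix s assume s: "s \<in> K \<times> (K - {\<zero>})"
    obtain c a where eq: "s = (c, a)" by (metis surj_pair)
    have ca: "c \<in> K" "a \<in> K" "a \<noteq> \<zero>" using s eq by auto
    have hs: "h s = mscale a z \<oplus>\<oplus> mscale c (mone n)" by (simp add: h_def eq)
    have k: "h s \<in> kmat n n" unfolding hs by (rule madd_closed[OF mscale_closed[OF ca(2) zk] mscale_closed[OF ca(1) mone_closed]])
    have "nonscalar n (h s)"
      unfolding nonscalar_def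
    proof (intro conjI ballI notI k)
      fix d assume d: "d \<in> K" "h s = mscale d (mone n)"
      have "mscale a z \<oplus>\<oplus> mscale c (mone n) = mscale \<zero> z \<oplus>\<oplus> mscale d (mone n)"
        using d(2) hs mscale_zero[OF zk] madd_zero[OF mscale_closed[OF d(1) mone_closed]] by simp
      then show False using nonscalar_affine_inj[OF z n ca(2) _ ca(1) d(1)] ca(3) by blast
    qed
    then show "h s \<in> ?W" using affine_centraliser[OF zk x ca(2,1)] affine_centraliser[OF zk y ca(2,1)] hs by simp
  qed
  moreover have "finite ?W" by (rule finite_subset[OF _ finite_kmat[of n n]]) (auto simp: nonscalar_def)
  ultimately have "card (K \<times> (K - {\<zero>})) \<le> card ?W" by (rule card_inj_on_le)
  then show ?thesis by (simp add: card_cartesian_product card_Diff_singleton)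
qed

definition nonscalar_pairs :: "nat \<Rightarrow> (nat \<Rightarrow> 'a) \<Rightarrow> ('a mat \<times> 'a mat) set" where
  "nonscalar_pairs n f = {(x, y). x \<in> char_class n f \<and> y \<in> char_class n f \<and> irreducible_on n {x, y} \<and>
     (\<exists>z. nonscalar n z \<and> x \<in> centraliser n z \<and> y \<in> centraliser n z)}"

text \<open>Double counting of triples formed by a pair and a nonscalar matrix commuting with it:
  from below by the affine family of each such matrix, from above by summing over \<open>l\<close>,
  \<open>J\<close>, the relation \<open>a\<close> and the generator.\<close>

lemma card_nonscalar_pairs:
  assumes n1: "n > 1"
  shows "card (nonscalar_pairs n f) * card K ^ 4 \<le> 2 * n ^ 3 * 2 ^ n * card K ^ (n\<^sup>2 + n * (n div 2))"
proof -
  have n: "n > 0" using n1 by simp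
  let ?Q = "card K" and ?A = "char_class n f"
  have Q2: "?Q \<ge> 2" using subfield_card_ge_2[OF KF] .
  define X where "X z = ?A \<inter> centraliser n z" for z
  have fX: "finite (X z)" for z by (simp add: X_def finite_char_class)
  define G where "G = {z. nonscalar n z \<and> (\<exists>B. irreducible_on n B \<and> B \<subseteq> centraliser n z)}"
  define FG where "FG l a J = {z. field_generator n z l a J}" for l a J
  have fFG: "finite (FG l a J)" for l a J
    by (rule finite_subset[OF _ finite_kmat[of n n]]) (auto simp: FG_def field_generator_def)
  define I where "I = Sigma {2..n} (\<lambda>l. {J. J \<subseteq> {..<n} \<and> l * card J = n})"
  have fI: "finite I" unfolding I_def by (intro finite_SigmaI) auto
  have cI: "card I \<le> n * 2 ^ n"
  proof -
    have "I \<subseteq> {2..n} \<times> Pow {..<n}" by (auto simp: I_def)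
    then have "card I \<le> card ({2..n} \<times> Pow {..<n})" by (intro card_mono) auto
    also have "\<dots> \<le> n * 2 ^ n" by (simp add: card_cartesian_product card_Pow)
    finally show ?thesis .
  qed
  let ?S = "\<lambda>M. Sigma M (\<lambda>z. X z \<times> X z)"
  let ?U = "\<lambda>(l, J). \<Union>a\<in>kmat l 1. ?S (FG l a J)"
  have cover: "?S G \<subseteq> (\<Union>i\<in>I. ?U i)"
  proof
    fix t assume "t \<in> ?S G"
    then obtain z p where t: "t = (z, p)" "z \<in> G" "p \<in> X z \<times> X z" by auto
    then obtain B where z: "nonscalar n z" and B: "irreducible_on n B" "B \<subseteq> centraliser n z" by (auto simp: G_def)
    then obtain l a J where l: "l \<ge> 2" and fg: "field_generator n z l a J"
      using nonscalar_field_generator[OF n B] by (metis nonscalar_def)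
    have lJ: "l * card J = n" and a: "a \<in> kmat l 1" and J: "J \<subseteq> {..<n}" using field_generatorD[OF fg] by auto
    have "l \<le> n" using lJ n by (cases "card J") auto
    then have "(l, J) \<in> I" using l lJ J by (simp add: I_def)
    moreover have "t \<in> ?U (l, J)" using t a fg by (auto simp: FG_def)
    ultimately show "t \<in> (\<Union>i\<in>I. ?U i)" by blast
  qed
  \<comment> \<open>The relation, the generator and the pair contribute
    \<open>l + (n^2 - n r) + 2 (n r - l) = n^2 + n r - l\<close> with \<open>r = card J\<close>.
    Since \<open>l >= 2\<close>, also \<open>r <= n div 2\<close>; the same inequality gives the
    \<open>- 2\<close>.\<close>
  let ?e = "n\<^sup>2 + n * (n div 2) - 2"
  have bound: "card (?U i) \<le> n\<^sup>2 * ?Q ^ ?e" if "i \<in> I" for i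
  proof -
    obtain l J where i: "i = (l, J)" by (metis surj_pair)
    have l: "2 \<le> l" "l \<le> n" and lJ: "l * card J = n" using that by (auto simp: i I_def)
    let ?r = "card J"
    have r0: "?r > 0" using lJ n by (cases ?r) auto
    have r: "?r \<le> n div 2" using lJ l(1) by (metis div_le_mono2 nonzero_mult_div_cancel_left not_numeral_le_zero zero_less_numeral)
    have lnr: "l \<le> n * ?r" using l(2) r0 by (metis le_trans mult.right_neutral mult_le_mono2 Suc_leI One_nat_def)
    have cX: "card (X z) \<le> n * ?Q ^ (n * ?r - l)" if "z \<in> FG l a J" for z a
    proof -
      have "card (X z) * ?Q ^ l \<le> n * ?Q ^ (n * ?r)"
        using card_char_class_centraliser_le[OF n, of z l a J f] that by (simp add: X_def FG_def)
      also have "\<dots> = n * ?Q ^ (n * ?r - l) * ?Q ^ l" using lnr by (simp flip: power_add)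
      finally show ?thesis using Q2 by simp
    qed
    have "card (?S (FG l a J)) \<le> ?Q ^ (n * ((l - 1) * ?r)) * (n * ?Q ^ (n * ?r - l))\<^sup>2" for a
    proof -
      have "card (?S (FG l a J)) = (\<Sum>z\<in>FG l a J. card (X z \<times> X z))"
        by (rule card_SigmaI) (auto intro: fFG fX)
      also have "\<dots> \<le> (\<Sum>z\<in>FG l a J. (n * ?Q ^ (n * ?r - l))\<^sup>2)"
        by (rule sum_mono) (simp add: card_cartesian_product power2_eq_square mult_le_mono cX)
      also have "\<dots> = card (FG l a J) * (n * ?Q ^ (n * ?r - l))\<^sup>2" by simp
      also have "\<dots> \<le> ?Q ^ (n * ((l - 1) * ?r)) * (n * ?Q ^ (n * ?r - l))\<^sup>2"
        using card_field_generators_le[of n l a J] by (intro mult_le_mono1) (simp add: FG_def)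
      finally show ?thesis .
    qed
    then have "(\<Sum>a\<in>kmat l 1. card (?S (FG l a J))) \<le> (\<Sum>a\<in>kmat l 1. ?Q ^ (n * ((l - 1) * ?r)) * (n * ?Q ^ (n * ?r - l))\<^sup>2)"
      by (intro sum_mono)
    also have "\<dots> = ?Q ^ l * (?Q ^ (n * ((l - 1) * ?r)) * (n * ?Q ^ (n * ?r - l))\<^sup>2)" by (simp add: card_kmat)
    also have "\<dots> = n\<^sup>2 * ?Q ^ (l + n * ((l - 1) * ?r) + 2 * (n * ?r - l))"
      by (simp add: power_mult_distrib power_add power_mult power2_eq_square mult_ac)
    also have "\<dots> \<le> n\<^sup>2 * ?Q ^ ?e"
    proof (intro mult_le_mono2 power_increasing)
      have "(l - 1) * ?r = n - ?r" using lJ by (simp add: diff_mult_distrib)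
      then have 1: "n * ((l - 1) * ?r) = n\<^sup>2 - n * ?r" by (simp add: diff_mult_distrib2 power2_eq_square)
      have "n * ?r \<le> n * n" using r by (intro mult_le_mono2) auto
      then have 2: "n * ?r \<le> n\<^sup>2" by (simp add: power2_eq_square)
      have 3: "n * ?r \<le> n * (n div 2)" using r by (rule mult_le_mono2)
      show "l + n * ((l - 1) * ?r) + 2 * (n * ?r - l) \<le> ?e" unfolding 1 using 2 3 l(1) lnr by linarith
    qed (use Q2 in simp)
    finally have s: "(\<Sum>a\<in>kmat l 1. card (?S (FG l a J))) \<le> n\<^sup>2 * ?Q ^ ?e" .
    have "card (?U i) \<le> (\<Sum>a\<in>kmat l 1. card (?S (FG l a J)))"
      unfolding i prod.case by (rule card_UN_le[OF finite_kmat])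
    then show ?thesis using s by (rule le_trans)
  qed
  have fS: "finite (?S (FG l a J))" for l a J
    by (intro finite_SigmaI finite_cartesian_product fFG fX)
  have fU: "finite (?U i)" for i
    using fS finite_kmat by (cases i) auto
  have "card (?S G) \<le> card (\<Union>i\<in>I. ?U i)"
    by (rule card_mono[OF finite_UN_I[OF fI fU] cover])
  also have "\<dots> \<le> (\<Sum>i\<in>I. card (?U i))" by (rule card_UN_le[OF fI])
  also have "\<dots> \<le> (\<Sum>i\<in>I. n\<^sup>2 * ?Q ^ ?e)" by (rule sum_mono) (rule bound)
  also have "\<dots> = card I * (n\<^sup>2 * ?Q ^ ?e)" by simp
  also have "\<dots> \<le> n * 2 ^ n * (n\<^sup>2 * ?Q ^ ?e)" by (rule mult_le_mono1[OF cI])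
  finally have SG: "card (?S G) \<le> n ^ 3 * 2 ^ n * ?Q ^ ?e"
    by (simp add: power2_eq_square power3_eq_cube mult_ac)
  let ?N = "nonscalar_pairs n f"
  let ?Z = "\<lambda>(x, y). {z. nonscalar n z \<and> x \<in> centraliser n z \<and> y \<in> centraliser n z}"
  have fN: "finite ?N"
    by (rule finite_subset[of _ "?A \<times> ?A"]) (auto simp: nonscalar_pairs_def finite_char_class)
  have fZ: "finite {z. nonscalar n z \<and> x \<in> centraliser n z \<and> y \<in> centraliser n z}" for x y
    by (rule finite_subset[OF _ finite_kmat[of n n]]) (auto simp: nonscalar_def)
  have "card ?N * (?Q * (?Q - 1)) = (\<Sum>p\<in>?N. ?Q * (?Q - 1))" by simp
  also have "\<dots> \<le> (\<Sum>p\<in>?N. card (?Z p))"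
  proof (rule sum_mono)
    fix p assume "p \<in> ?N"
    moreover obtain x y where "p = (x, y)" by (metis surj_pair)
    ultimately show "?Q * (?Q - 1) \<le> card (?Z p)"
      using card_nonscalar_affine_ge[OF _ n, of _ x y] by (auto simp: nonscalar_pairs_def)
  qed
  also have "\<dots> = card (Sigma ?N ?Z)" by (rule card_SigmaI[symmetric]) (use fN fZ in auto)
  also have "\<dots> \<le> card (?S G)"
  proof (rule card_inj_on_le)
    show "inj_on prod.swap (Sigma ?N ?Z)" by simp
    show "prod.swap ` Sigma ?N ?Z \<subseteq> ?S G"
    proof (rule image_subsetI)
      fix t assume t: "t \<in> Sigma ?N ?Z"
      obtain x y z where eq: "t = ((x, y), z)" by (metis surj_pair)
      have xy: "irreducible_on n {x, y}" "x \<in> ?A" "y \<in> ?A" "nonscalar n z" "x \<in> centraliser n z" "y \<in> centraliser n z"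
        using t eq by (auto simp: nonscalar_pairs_def)
      have "z \<in> G" unfolding G_def using xy by (intro CollectI conjI exI[of _ "{x, y}"]) auto
      then show "prod.swap t \<in> ?S G" using xy eq by (auto simp: X_def)
    qed
    have "finite G" by (rule finite_subset[OF _ finite_kmat[of n n]]) (auto simp: G_def nonscalar_def)
    then show "finite (?S G)" using fX by (intro finite_SigmaI) auto
  qed
  finally have NG: "card ?N * (?Q * (?Q - 1)) \<le> n ^ 3 * 2 ^ n * ?Q ^ ?e" using SG by (rule le_trans)
  have "?Q * ?Q \<le> 2 * (?Q * (?Q - 1))"
  proof -
    have "?Q \<le> 2 * (?Q - 1)" using Q2 by simp
    then have "?Q * ?Q \<le> ?Q * (2 * (?Q - 1))" by (rule mult_le_mono2)
    then show ?thesis by simp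
  qed
  then have "card ?N * ?Q ^ 2 \<le> 2 * (card ?N * (?Q * (?Q - 1)))"
    using mult_le_mono2[of "?Q * ?Q" "2 * (?Q * (?Q - 1))" "card ?N"] by (simp add: power2_eq_square mult_ac)
  also have "\<dots> \<le> 2 * (n ^ 3 * 2 ^ n * ?Q ^ ?e)" using NG by (rule mult_le_mono2)
  finally have "card ?N * ?Q ^ 2 * ?Q ^ 2 \<le> 2 * (n ^ 3 * 2 ^ n * ?Q ^ ?e) * ?Q ^ 2" by (rule mult_le_mono1)
  moreover have "?Q ^ ?e * ?Q ^ 2 = ?Q ^ (n\<^sup>2 + n * (n div 2))"
  proof -
    have "n\<^sup>2 \<ge> 2\<^sup>2" using n1 by (intro power_mono) auto
    then have "?e + 2 = n\<^sup>2 + n * (n div 2)" by simp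
    then show ?thesis by (simp flip: power_add)
  qed
  moreover have "2 * (n ^ 3 * 2 ^ n * ?Q ^ ?e) * ?Q ^ 2 = 2 * n ^ 3 * 2 ^ n * (?Q ^ ?e * ?Q ^ 2)" by simp
  moreover have "card ?N * ?Q ^ 2 * ?Q ^ 2 = card ?N * ?Q ^ 4" by (simp add: mult.assoc flip: power_add)
  ultimately show ?thesis by metis
qed

section \<open>Pairs conjugate into a subfield\<close>

lemma subfield_closed:
  assumes F: "subfield F R"
  shows "x \<in> F \<Longrightarrow> x \<in> K" "x \<in> F \<Longrightarrow> y \<in> F \<Longrightarrow> x \<oplus> y \<in> F" "x \<in> F \<Longrightarrow> y \<in> F \<Longrightarrow> x \<otimes> y \<in> F"
    "x \<in> F \<Longrightarrow> \<ominus> x \<in> F" "\<zero> \<in> F" "\<one> \<in> F" "x \<in> F \<Longrightarrow> x \<noteq> \<zero> \<Longrightarrow> inv x \<in> F"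
  using subfieldE(3)[OF F] subringE[OF subfieldE(1)[OF F]] subfield_m_inv(1)[OF F, of x] by auto

lemma minus_zeroD: "a \<in> K \<Longrightarrow> b \<in> K \<Longrightarrow> a \<oplus> \<ominus> b = \<zero> \<Longrightarrow> a = b"
  by (metis a_inv_closed minus_equality minus_minus)

text \<open>An element \<open>t\<close> outside \<open>F\<close> is independent of 1 over
  \<open>F\<close>, so \<open>a + b t\<close> takes \<open>(card F)^2\<close> different
  values.\<close>

lemma proper_subfield_card:
  assumes F: "subfield F R" "F \<noteq> K"
  shows "(card F)\<^sup>2 \<le> card K"
proof -
  note c = subfield_closed[OF F(1)]
  obtain t where t: "t \<in> K" "t \<notin> F" using F c(1) by blast
  define h where "h = (\<lambda>(a, b). a \<oplus> b \<otimes> t)"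
  have "inj_on h (F \<times> F)"
  proof (rule inj_onI)
    fix s s' assume s: "s \<in> F \<times> F" "s' \<in> F \<times> F" "h s = h s'"
    obtain a b a' b' where eq: "s = (a, b)" "s' = (a', b')" by (metis surj_pair)
    have ab: "a \<in> F" "b \<in> F" "a' \<in> F" "b' \<in> F" and e: "a \<oplus> b \<otimes> t = a' \<oplus> b' \<otimes> t"
      using s eq by (auto simp: h_def)
    have k: "a \<in> K" "b \<in> K" "a' \<in> K" "b' \<in> K" using ab c(1) by auto
    have e2: "(b \<oplus> \<ominus> b') \<otimes> t = a' \<oplus> \<ominus> a"
    proof -
      have "b \<otimes> t = a' \<oplus> b' \<otimes> t \<oplus> \<ominus> a" using e k t(1) by (metis a_assoc a_comm a_inv_closed m_closed r_neg2 add.m_closed)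
      then have "b \<otimes> t \<oplus> \<ominus> (b' \<otimes> t) = a' \<oplus> \<ominus> a" using k t(1) by (simp add: a_ac r_neg2 r_neg1 r_neg)
      then show ?thesis using k t(1) by (simp add: l_distr l_minus)
    qed
    have "b \<oplus> \<ominus> b' = \<zero>"
    proof (rule ccontr)
      assume nz: "b \<oplus> \<ominus> b' \<noteq> \<zero>"
      have d: "b \<oplus> \<ominus> b' \<in> F" using c(2,4) ab by blast
      have i: "inv (b \<oplus> \<ominus> b') \<in> F" "inv (b \<oplus> \<ominus> b') \<otimes> (b \<oplus> \<ominus> b') = \<one>"
        using subfield_m_inv[OF F(1), of "b \<oplus> \<ominus> b'"] d nz by auto
      have "t = inv (b \<oplus> \<ominus> b') \<otimes> ((b \<oplus> \<ominus> b') \<otimes> t)"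
        using i(2) t(1) m_assoc[OF c(1)[OF i(1)] c(1)[OF d] t(1)] by simp
      also have "\<dots> \<in> F" unfolding e2 by (intro c(2,3,4) i ab)
      finally show False using t(2) by simp
    qed
    moreover from this have "a' \<oplus> \<ominus> a = \<zero>" using e2 t(1) by simp
    ultimately have "a = a'" "b = b'" using minus_zeroD k by blast+
    then show "s = s'" using eq by simp
  qed
  moreover have "h ` (F \<times> F) \<subseteq> K" using c(1) t(1) by (auto simp: h_def)
  ultimately have "card (F \<times> F) \<le> card K" by (rule card_inj_on_le) (rule finite_carrier)
  then show ?thesis by (simp add: card_cartesian_product power2_eq_square)
qed

lemma subfield_power_card:
  assumes F: "subfield F R" and x: "x \<in> F"
  shows "x [^] card F = x"
proof (cases "x = \<zero>")
  case True
  moreover have "card F = Suc (card F - 1)" using subfield_card_ge_2[OF F] by simp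
  ultimately show ?thesis by (metis nat_pow_Suc nat_pow_closed r_null zero_closed)
next
  case False
  have ff: "finite_field (R\<lparr>carrier := F\<rparr>)"
    unfolding finite_field_def finite_field_axioms_def
    using subfield_iff(2)[OF F] subfield_finite[OF F] by simp
  have "x [^]\<^bsub>R\<lparr>carrier := F\<rparr>\<^esub> (card F - 1) = \<one>"
    using finite_field.unit_power_card[OF ff, of x] x False by simp
  then have "x [^] (card F - 1) = \<one>" by (simp flip: nat_pow_consistent)
  moreover have "x \<in> K" using subfield_closed(1)[OF F x] .
  moreover have "card F = Suc (card F - 1)" using subfield_card_ge_2[OF F] by simp
  ultimately show ?thesis by (metis nat_pow_Suc l_one)
qed

text \<open>Two subfields of order \<open>s\<close> both consist of roots of \<open>X^s - X\<close>;
  if they differed, their union would contain more than \<open>s\<close> roots.\<close>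

lemma subfield_card_inj: "inj_on card {F. subfield F R}"
proof (rule inj_onI)
  fix F G assume "F \<in> {F. subfield F R}" "G \<in> {F. subfield F R}" and eq: "card F = card G"
  then have F: "subfield F R" and G: "subfield G R" by auto
  let ?s = "card F"
  have s: "?s \<ge> 2" by (rule subfield_card_ge_2[OF F])
  note fin = subfield_finite[OF F] subfield_finite[OF G]
  have "F \<union> G = F"
  proof (rule ccontr)
    assume "F \<union> G \<noteq> F"
    then have "F \<subset> F \<union> G" by blast
    then have c: "card (F \<union> G) \<ge> Suc ?s" using psubset_card_mono[of "F \<union> G" F] fin by simp
    define c where "c i = (if i = ?s then \<one> else if i = 1 then \<ominus> \<one> else \<zero>)" for i
    have sub: "F \<union> G \<subseteq> K" using subfield_closed(1)[OF F] subfield_closed(1)[OF G] by blast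
    have "c ?s = \<zero>"
    proof (rule poly_fun_zero[OF _ sub c])
      fix a assume a: "a \<in> F \<union> G"
      have aK: "a \<in> K" using a sub by blast
      have pw: "a [^] ?s = a" using a subfield_power_card[OF F, of a] subfield_power_card[OF G, of a] eq by auto
      have "(\<Oplus>i\<in>{..<Suc ?s}. c i \<otimes> a [^] i) = (\<Oplus>i\<in>{1, ?s}. c i \<otimes> a [^] i)"
        by (rule add.finprod_mono_neutral_cong_right) (use s aK in \<open>auto simp: c_def\<close>)
      also have "\<dots> = c 1 \<otimes> a [^] (1::nat) \<oplus> c ?s \<otimes> a [^] ?s"
        using s aK by (simp add: c_def)
      also have "\<dots> = \<zero>" using s aK pw by (simp add: c_def l_minus l_neg)
      finally show "(\<Oplus>i\<in>{..<Suc ?s}. c i \<otimes> a [^] i) = \<zero>" .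
    qed (auto simp: c_def)
    then show False by (simp add: c_def)
  qed
  then have "G \<subseteq> F" by blast
  then show "F = G" using card_subset_eq[OF fin(1)] eq by auto
qed

text \<open>The order of a subfield is a power of \<open>p\<close> by Lagrange's theorem in the
  additive group, and it determines the subfield. So the union over subfields costs only a factor
  logarithmic in the order of \<open>K\<close>.\<close>

lemma card_subfields_le:
  assumes p: "prime p" and K: "card K = p ^ N"
  shows "card {F. subfield F R} \<le> N + 1"
proof -
  have "card ` {F. subfield F R} \<subseteq> (\<lambda>i. p ^ i) ` {..N}"
  proof (rule image_subsetI)
    fix F assume "F \<in> {F. subfield F R}"
    then have "subgroup F (add_monoid R)" using subring.axioms(1)[OF subfieldE(1)] by blast
    from group.lagrange[OF a_group this]
    have "card F dvd p ^ N" using K by (metis (no_types, lifting) dvd_triv_right Coset.order_def partial_object.select_convs(1))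
    then show "card F \<in> (\<lambda>i. p ^ i) ` {..N}" using divides_primepow_nat[OF p] by auto
  qed
  then have "card (card ` {F. subfield F R}) \<le> card ((\<lambda>i. p ^ i) ` {..N})" by (intro card_mono) auto
  also have "\<dots> \<le> N + 1" using card_image_le[of "{..N}" "\<lambda>i. p ^ i"] by simp
  finally show ?thesis by (simp add: card_image subfield_card_inj)
qed

text \<open>Scalars act trivially by conjugation, so GL(n, F) may be enlarged by the units of
  \<open>K\<close>. This gains about \<open>card K / card F\<close> in the order of the conjugating
  group, which is decisive for \<open>n = 2\<close>. The constant 8 is 4 from the order of GL times
  2 from comparing \<open>card K\<close> with \<open>card K - 1\<close>.\<close>

lemma scalar_GL_card:
  assumes F: "subfield F R" and n: "n > 0"
  defines "H \<equiv> (\<lambda>(c, g). mscale c g) ` ((K - {\<zero>}) \<times> {g. indep F n n g})"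
  shows "card K * card F ^ n\<^sup>2 \<le> 8 * card H * card F"
proof -
  let ?G = "{g. indep F n n g}"
  note cF = subfield_closed[OF F]
  have gF: "g \<in> mats F n n" if "g \<in> ?G" for g using that by (simp add: indepD)
  have fG: "finite ?G" by (rule finite_subset[OF _ finite_mats[OF subfield_finite[OF F], of n n]]) (auto simp: indepD)
  have gk: "g \<in> kmat n n" if "g \<in> ?G" for g using mats_kmat[OF F gF[OF that]] .
  have fH: "finite H" unfolding H_def by (intro finite_imageI finite_cartesian_product fG) (simp add: finite_carrier)
  \<comment> \<open>Two representations of the same matrix differ by a scalar of \<open>F\<close>:
    compare them at a nonzero entry of \<open>g\<close>, where both entries lie in
    \<open>F\<close>.\<close>
  have ratio: "c \<otimes> inv c' \<in> F" if c: "c \<in> K" "c \<noteq> \<zero>" "c' \<in> K" "c' \<noteq> \<zero>" and g: "g \<in> ?G" "g' \<in> ?G"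
    and eq: "mscale c g = mscale c' g'" for c c' g g'
  proof -
    have "g \<noteq> mzero n n"
    proof
      assume z: "g = mzero n n"
      have "mone n = mzero n n"
      proof -
        obtain T where T: "T \<in> mats F n n" "T \<odot>\<odot> g = mone n" using indep_inverse[OF F] g(1) by blast
        then show ?thesis using z mmul_zero(1)[OF mats_kmat[OF F T(1)], of n] by simp
      qed
      then show False using mone_neq_mzero[OF n] by simp
    qed
    then obtain i j where ij: "i < n" "j < n" "g $$ (i, j) \<noteq> \<zero>"
      using kmat_eqI[OF gk[OF g(1)] mzero_closed, of ] by (auto simp: mzero_entry)
    have a: "g $$ (i, j) \<in> F" "g' $$ (i, j) \<in> F" using gF[OF g(1)] gF[OF g(2)] ij by (auto simp: mats_def)
    have e: "c \<otimes> g $$ (i, j) = c' \<otimes> g' $$ (i, j)"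
      using mscale_entry[OF gk[OF g(1)] ij(1,2), of c] mscale_entry[OF gk[OF g(2)] ij(1,2), of c'] eq by simp
    let ?i = "inv (g $$ (i, j))"
    have i: "?i \<in> F" "g $$ (i, j) \<otimes> ?i = \<one>" using subfield_m_inv[OF F, of "g $$ (i, j)"] a(1) ij(3) by auto
    have ci: "inv c' \<in> K" "c' \<otimes> inv c' = \<one>" using subfield_m_inv[OF KF, of c'] c by auto
    note K = cF(1)[OF a(1)] cF(1)[OF a(2)] cF(1)[OF i(1)] ci(1) c(1,3)
    have "c = c \<otimes> g $$ (i, j) \<otimes> ?i" using i(2) K by (simp add: m_assoc)
    then have "c \<otimes> inv c' = c' \<otimes> g' $$ (i, j) \<otimes> ?i \<otimes> inv c'" unfolding e by simp
    also have "\<dots> = (c' \<otimes> inv c') \<otimes> (g' $$ (i, j) \<otimes> ?i)" using K by (simp add: m_ac)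
    also have "\<dots> = g' $$ (i, j) \<otimes> ?i" using ci(2) K by simp
    finally show ?thesis using cF(3)[OF a(2) i(1)] by simp
  qed
  have "\<exists>c. c \<in> K - {\<zero>} \<and> (\<exists>g\<in>?G. h = mscale c g)" if "h \<in> H" for h
    using that unfolding H_def by auto
  then obtain \<kappa> where \<kappa>: "\<And>h. h \<in> H \<Longrightarrow> \<kappa> h \<in> K - {\<zero>} \<and> (\<exists>g\<in>?G. h = mscale (\<kappa> h) g)" by metis
  \<comment> \<open>\<open>\<kappa>\<close> selects one scalar for each element of \<open>H\<close>;
    any other representation is recovered from its ratio to it, an element of
    \<open>F\<close>.\<close>
  define \<Phi> where "\<Phi> = (\<lambda>(c, g). (mscale c g, c \<otimes> inv (\<kappa> (mscale c g))))"
  have \<Phi>H: "\<Phi> ` ((K - {\<zero>}) \<times> ?G) \<subseteq> H \<times> F"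
  proof (rule image_subsetI)
    fix s assume s: "s \<in> (K - {\<zero>}) \<times> ?G"
    obtain c g where eq: "s = (c, g)" by (metis surj_pair)
    have cg: "c \<in> K" "c \<noteq> \<zero>" "g \<in> ?G" using s eq by auto
    have h: "mscale c g \<in> H" unfolding H_def using cg by (intro image_eqI[of _ _ "(c, g)"]) auto
    obtain g' where g': "g' \<in> ?G" "mscale c g = mscale (\<kappa> (mscale c g)) g'" using \<kappa>[OF h] by blast
    have "c \<otimes> inv (\<kappa> (mscale c g)) \<in> F"
      by (rule ratio[OF cg(1,2) _ _ cg(3) g'(1) g'(2)]) (use \<kappa>[OF h] in auto)
    then show "\<Phi> s \<in> H \<times> F" using h eq by (simp add: \<Phi>_def)
  qed
  have "inj_on \<Phi> ((K - {\<zero>}) \<times> ?G)"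
  proof (rule inj_onI)
    fix s t assume st: "s \<in> (K - {\<zero>}) \<times> ?G" "t \<in> (K - {\<zero>}) \<times> ?G" "\<Phi> s = \<Phi> t"
    obtain c g d g' where eq: "s = (c, g)" "t = (d, g')" by (metis surj_pair)
    have c: "c \<in> K" "c \<noteq> \<zero>" "d \<in> K" and g: "g \<in> ?G" "g' \<in> ?G" using st eq by auto
    let ?h = "mscale c g"
    have h: "?h \<in> H" unfolding H_def using st(1) eq by (intro image_eqI[of _ _ "(c, g)"]) auto
    have e: "mscale c g = mscale d g'" "c \<otimes> inv (\<kappa> ?h) = d \<otimes> inv (\<kappa> ?h)" using st(3) eq by (auto simp: \<Phi>_def)
    have k: "\<kappa> ?h \<in> K" "inv (\<kappa> ?h) \<in> K" "inv (\<kappa> ?h) \<otimes> \<kappa> ?h = \<one>"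
      using \<kappa>[OF h] subfield_m_inv[OF KF, of "\<kappa> ?h"] by auto
    have "c = c \<otimes> inv (\<kappa> ?h) \<otimes> \<kappa> ?h" using k c by (simp add: m_assoc)
    also have "\<dots> = d" unfolding e(2) using k c by (simp add: m_assoc)
    finally have cd: "c = d" .
    have ic: "inv c \<in> K" "inv c \<otimes> c = \<one>" using subfield_m_inv[OF KF, of c] c by auto
    have "mscale (inv c) (mscale c g) = mscale (inv c) (mscale c g')" using e(1) cd by simp
    then have "g = g'"
      unfolding mscale_mscale[OF ic(1) c(1) gk[OF g(1)]] mscale_mscale[OF ic(1) c(1) gk[OF g(2)]] ic(2)
        mscale_one[OF gk[OF g(1)]] mscale_one[OF gk[OF g(2)]] .
    then show "s = t" using cd eq by simp
  qed
  from card_inj_on_le[OF this \<Phi>H]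
  have "(card K - 1) * card ?G \<le> card H * card F"
    using fH subfield_finite[OF F] by (simp add: card_cartesian_product card_Diff_singleton)
  moreover have "card K \<le> 2 * (card K - 1)" using subfield_card_ge_2[OF KF] by simp
  ultimately have "card K * card F ^ n\<^sup>2 \<le> 2 * (card K - 1) * (4 * card ?G)"
    using card_GL_ge[OF F, of n] by (intro mult_le_mono)
  also have "\<dots> = 8 * ((card K - 1) * card ?G)" by simp
  also have "\<dots> \<le> 8 * (card H * card F)" using \<open>(card K - 1) * card ?G \<le> card H * card F\<close> by (rule mult_le_mono2)
  finally show ?thesis by (simp add: mult_ac)
qed

lemma card_subfield_pairs:
  assumes F: "subfield F R" and n: "n > 0"
    and B: "\<And>x y. (x, y) \<in> B \<Longrightarrow> x \<in> char_class n f \<and> y \<in> char_class n f \<and>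
      (\<exists>S\<in>GLs n. mconj n S x \<in> mats F n n \<and> mconj n S y \<in> mats F n n)"
  shows "card B * card K \<le> 8 * n\<^sup>2 * card K ^ n\<^sup>2 * card F ^ (n - 1)\<^sup>2"
proof -
  define H where "H = (\<lambda>(c, g). mscale c g) ` ((K - {\<zero>}) \<times> {g. indep F n n g})"
  define X where "X = char_class n f \<inter> mats F n n"
  have "card B * card H \<le> card K ^ n\<^sup>2 * (card X)\<^sup>2"
  proof (rule simultaneous_conjugation_count)
    show "X \<subseteq> kmat n n" by (auto simp: X_def char_class_def)
    have inv: "h \<in> GLs n \<and> (\<forall>x\<in>X. mconj n h x \<in> X)" if "h \<in> H" for h
    proof -
      obtain c g where c: "c \<in> K" "c \<noteq> \<zero>" and g: "indep F n n g" and h: "h = mscale c g"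
        using \<open>h \<in> H\<close> unfolding H_def by auto
      obtain T where T: "T \<in> mats F n n" "T \<odot>\<odot> g = mone n" using indep_inverse[OF F g] by blast
      have gF: "g \<in> mats F n n" by (rule indepD[OF g])
      note gk = mats_kmat[OF F gF] and Tk = mats_kmat[OF F T(1)]
      have ic: "inv c \<in> K" "inv c \<otimes> c = \<one>" using subfield_m_inv[OF KF, of c] c by auto
      have g1: "g \<in> GLs n" by (rule GLsI[OF gk Tk T(2)])
      have hk: "h \<in> kmat n n" unfolding h by (rule mscale_closed[OF c(1) gk])
      have "mscale (inv c) T \<odot>\<odot> h = mone n"
        unfolding h mmul_scale(1)[OF c(1) mscale_closed[OF ic(1) Tk] gk] mmul_scale(2)[OF ic(1) Tk gk] T(2)
          mscale_mscale[OF c(1) ic(1) mone_closed] using ic c(1) m_comm[of c "inv c"] mscale_one[OF mone_closed] by simp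
      then have h1: "h \<in> GLs n" by (rule GLsI[OF hk mscale_closed[OF ic(1) Tk]])
      have "mconj n h x \<in> X" if x: "x \<in> X" for x
      proof -
        have xF: "x \<in> mats F n n" and xk: "x \<in> kmat n n" using x by (auto simp: X_def char_class_def)
        have y: "mconj n g x \<in> kmat n n" by (rule mconj_closed[OF g1 xk])
        have "x \<odot>\<odot> h = h \<odot>\<odot> mconj n g x"
          unfolding h using mmul_scale(1)[OF c(1) xk gk] mmul_scale(2)[OF c(1) gk y] mmul_mconj[OF g1 xk] by simp
        then have e: "mconj n h x = mconj n g x" by (rule mconj_unique[OF h1 xk y])
        have "minv n g = T" by (rule minv_unique[OF gk Tk T(2)])
        then have "mconj n g x \<in> mats F n n"
          unfolding mconj_def using mats_closed[OF F] T(1) xF gF by metis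
        then show ?thesis using e cp_mconj[OF h1 xk] x mconj_closed[OF h1 xk] by (simp add: X_def char_class_def)
      qed
      then show ?thesis using h1 by blast
    qed
    show "H \<subseteq> GLs n" using inv by blast
    show "mconj n p x \<in> X" if "p \<in> H" "x \<in> X" for p x using inv that by blast
    show "x \<in> kmat n n \<and> y \<in> kmat n n \<and> (\<exists>S\<in>GLs n. mconj n S x \<in> X \<and> mconj n S y \<in> X)" if xy: "(x, y) \<in> B" for x y
    proof -
      obtain S where S: "S \<in> GLs n" "mconj n S x \<in> mats F n n" "mconj n S y \<in> mats F n n"
        and A: "x \<in> char_class n f" "y \<in> char_class n f" using B[OF xy] by blast
      have k: "x \<in> kmat n n" "y \<in> kmat n n" using A by (auto simp: char_class_def)
      have "mconj n S x \<in> X" "mconj n S y \<in> X"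
        using S A cp_mconj[OF S(1) k(1)] cp_mconj[OF S(1) k(2)] mconj_closed[OF S(1) k(1)] mconj_closed[OF S(1) k(2)]
        by (simp_all add: X_def char_class_def)
      then show ?thesis using S(1) k by blast
    qed
  qed
  also have "\<dots> \<le> card K ^ n\<^sup>2 * (n * card F ^ (n\<^sup>2 - n))\<^sup>2"
    using card_char_class_mats_le[OF F n, of f] by (intro mult_le_mono2 power_mono) (auto simp: X_def)
  finally have BH: "card B * card H \<le> card K ^ n\<^sup>2 * (n * card F ^ (n\<^sup>2 - n))\<^sup>2" .
  have "card B * card K * card F ^ n\<^sup>2 = card B * (card K * card F ^ n\<^sup>2)" by simp
  also have "\<dots> \<le> card B * (8 * card H * card F)"
    using scalar_GL_card[OF F n] unfolding H_def by (rule mult_le_mono2)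
  also have "\<dots> = 8 * card F * (card B * card H)" by simp
  also have "\<dots> \<le> 8 * card F * (card K ^ n\<^sup>2 * (n * card F ^ (n\<^sup>2 - n))\<^sup>2)" using BH by (rule mult_le_mono2)
  also have "\<dots> = 8 * n\<^sup>2 * card K ^ n\<^sup>2 * card F ^ (1 + 2 * (n\<^sup>2 - n))"
    by (simp add: power_mult_distrib power_add power_mult[symmetric] mult_ac)
  \<comment> \<open>The summand \<open>n^2\<close> cancels against the order of GL(n, F) and leaves
    the exponent \<open>(n - 1)^2\<close>.\<close>
  also have "1 + 2 * (n\<^sup>2 - n) = (n - 1)\<^sup>2 + n\<^sup>2"
  proof -
    obtain m where "n = Suc m" using n by (cases n) auto
    then show ?thesis by (simp add: power2_eq_square)
  qed
  also have "8 * n\<^sup>2 * card K ^ n\<^sup>2 * card F ^ ((n - 1)\<^sup>2 + n\<^sup>2)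
    = 8 * n\<^sup>2 * card K ^ n\<^sup>2 * card F ^ (n - 1)\<^sup>2 * card F ^ n\<^sup>2" by (simp add: power_add)
  finally show ?thesis using subfield_card_ge_2[OF F] by simp
qed

end

section \<open>The error bound\<close>

lemma parabolic_bound:
  fixes q b :: real
  assumes q: "q \<ge> 2" and d: "0 < d" "d < n" and small: "real n ^ 2 \<le> sqrt q ^ n"
    and b: "b * q ^ (d * (n - d)) \<le> 16 * real n ^ (2 * min d (n - d) + 4) * W" and b0: "b \<ge> 0" and W: "W \<ge> 0"
  shows "16 * b \<le> 256 * real n ^ 6 / sqrt q ^ n * W"
proof -
  define s where "s = sqrt q"
  define \<mu> where "\<mu> = min d (n - d)"
  define t where "t = real n ^ 2 / s ^ n"
  have s: "s \<ge> 1" "s\<^sup>2 = q" using q by (auto simp: s_def)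
  have sn: "s ^ n > 0" using s(1) by (intro zero_less_power) linarith
  have t: "0 \<le> t" "t \<le> 1" using small sn by (auto simp: t_def s_def)
  have "n * \<mu> \<le> 2 * (d * (n - d))"
  proof (cases "d \<le> n - d")
    case True
    then have "n * d \<le> 2 * (n - d) * d" using d by (intro mult_le_mono1) linarith
    then show ?thesis using True by (simp add: \<mu>_def mult_ac)
  next
    case False
    then have "n * (n - d) \<le> 2 * d * (n - d)" using d by (intro mult_le_mono1) linarith
    then show ?thesis using False by (simp add: \<mu>_def mult_ac)
  qed
  then have "s ^ (n * \<mu>) \<le> s ^ (2 * (d * (n - d)))" using s(1) by (rule power_increasing)
  also have "\<dots> = q ^ (d * (n - d))" by (simp add: power_mult s(2))
  finally have "b * (s ^ n) ^ \<mu> \<le> b * q ^ (d * (n - d))" using b0 by (simp add: power_mult mult_left_mono)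
  also have "\<dots> \<le> 16 * real n ^ 4 * (real n ^ 2) ^ \<mu> * W"
    using b by (simp add: \<mu>_def power_add power_mult mult_ac)
  finally have "b \<le> 16 * real n ^ 4 * t ^ \<mu> * W"
    using sn by (simp add: t_def power_divide field_simps)
  also have "\<dots> \<le> 16 * real n ^ 4 * t * W"
    using power_decreasing[of 1 \<mu> t] t d W by (intro mult_right_mono mult_left_mono) (auto simp: \<mu>_def)
  finally have "16 * b \<le> 16 * (16 * real n ^ 4 * t * W)" by (rule mult_left_mono) simp
  also have "\<dots> = 256 * real n ^ 6 / s ^ n * W" by (simp add: t_def flip: power_add)
  finally show ?thesis by (simp add: s_def)
qed

text \<open>The factor \<open>2^n\<close> from the choice of \<open>J\<close> is at most 64 for
  \<open>n <= 6\<close>; from \<open>n = 7\<close> on it is bounded by \<open>q^n\<close>, for which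
  the quadratic exponents leave room because \<open>7 n <= n^2\<close>. The constant 2048 is 16
  times 2 times 64.\<close>

lemma nonscalar_bound:
  fixes q b :: real
  assumes q: "q \<ge> 2" and n: "n \<ge> 2" and b: "b * q ^ 4 \<le> 2 * real n ^ 3 * 2 ^ n * q ^ (n\<^sup>2 + n * (n div 2))"
  shows "16 * b \<le> 2048 * real n ^ 3 / sqrt q ^ n * q ^ (2 * (n\<^sup>2 - n))"
proof -
  define s where "s = sqrt q"
  have s: "s \<ge> 1" "s\<^sup>2 = q" using q by (auto simp: s_def)
  have qs: "q ^ k = s ^ (2 * k)" for k by (simp add: power_mult s(2))
  have sn: "s ^ k > 0" for k using s(1) by (intro zero_less_power) linarith
  have h: "2 * (n * (n div 2)) \<le> n * n" by (metis div_times_less_eq_dividend mult.assoc mult.commute mult_le_mono2)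
  have key: "2 ^ n * s ^ (2 * (n\<^sup>2 + n * (n div 2)) + n) \<le> 64 * s ^ (8 + 2 * (2 * (n\<^sup>2 - n)))"
  proof (cases "n \<ge> 7")
    case False
    then have "n \<le> 6" by simp
    then have "(2::real) ^ n \<le> 2 ^ 6" by (intro power_increasing) auto
    moreover have "2 * (n\<^sup>2 + n * (n div 2)) + n \<le> 8 + 2 * (2 * (n\<^sup>2 - n))"
    proof -
      have "n \<in> {2..6}" using n \<open>n \<le> 6\<close> by simp
      then have "n \<in> {2, 3, 4, 5, 6}" by auto
      then show ?thesis by (elim insertE) (simp_all add: power2_eq_square)
    qed
    then have "s ^ (2 * (n\<^sup>2 + n * (n div 2)) + n) \<le> s ^ (8 + 2 * (2 * (n\<^sup>2 - n)))" using s(1) by (rule power_increasing)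
    ultimately show ?thesis using sn by (intro mult_mono) (auto simp: less_imp_le)
  next
    case True
    have "(2::real) ^ n \<le> q ^ n" using q by (intro power_mono) auto
    then have "2 ^ n * s ^ (2 * (n\<^sup>2 + n * (n div 2)) + n) \<le> s ^ (2 * n) * s ^ (2 * (n\<^sup>2 + n * (n div 2)) + n)"
      unfolding qs using sn by (intro mult_right_mono) (auto simp: less_imp_le)
    also have "\<dots> = s ^ (2 * n + (2 * (n\<^sup>2 + n * (n div 2)) + n))" by (rule power_add[symmetric])
    also have "\<dots> \<le> s ^ (8 + 2 * (2 * (n\<^sup>2 - n)))"
    proof (rule power_increasing[OF _ s(1)])
      have "7 * n \<le> n * n" using True by (rule mult_le_mono1)
      moreover have "2 * n + (2 * (a + c) + n) \<le> 8 + 2 * (2 * (a - n))" if "7 * n \<le> a" "2 * c \<le> a" for a c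
      proof -
        obtain e where "a = n + e" using \<open>7 * n \<le> a\<close> le_Suc_ex[of n a] by auto
        then show ?thesis using that by simp
      qed
      ultimately show "2 * n + (2 * (n\<^sup>2 + n * (n div 2)) + n) \<le> 8 + 2 * (2 * (n\<^sup>2 - n))"
        using h by (simp only: power2_eq_square)
    qed
    also have "\<dots> \<le> 64 * s ^ (8 + 2 * (2 * (n\<^sup>2 - n)))" using sn[of "8 + 2 * (2 * (n\<^sup>2 - n))"] by simp
    finally show ?thesis .
  qed
  have "b * s ^ 8 \<le> 2 * real n ^ 3 * (2 ^ n * s ^ (2 * (n\<^sup>2 + n * (n div 2))))" using b by (simp add: qs mult_ac)
  then have "b * s ^ 8 * s ^ n \<le> 2 * real n ^ 3 * (2 ^ n * s ^ (2 * (n\<^sup>2 + n * (n div 2)))) * s ^ n"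
    using sn by (intro mult_right_mono) (auto simp: less_imp_le)
  also have "\<dots> = 2 * real n ^ 3 * (2 ^ n * s ^ (2 * (n\<^sup>2 + n * (n div 2)) + n))" by (simp add: power_add)
  also have "\<dots> \<le> 2 * real n ^ 3 * (64 * s ^ (8 + 2 * (2 * (n\<^sup>2 - n))))" using key by (intro mult_left_mono) auto
  finally have "(b * s ^ n) * s ^ 8 \<le> (128 * real n ^ 3 * s ^ (2 * (2 * (n\<^sup>2 - n)))) * s ^ 8" by (simp add: power_add mult_ac)
  then have "b * s ^ n \<le> 128 * real n ^ 3 * s ^ (2 * (2 * (n\<^sup>2 - n)))" using sn[of 8] by (rule mult_right_le_imp_le)
  then have "b \<le> 128 * real n ^ 3 * s ^ (2 * (2 * (n\<^sup>2 - n))) / s ^ n" using sn[of n] by (simp add: pos_le_divide_eq)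
  then show ?thesis by (simp add: s_def[symmetric] qs)
qed

text \<open>In terms of the fourth root \<open>r\<close> of \<open>q\<close> the exponents compare
  as \<open>4 n^2 + 2 (n - 1)^2 + n <= 4 + 4 (2 (n^2 - n))\<close>, that is,
  \<open>0 <= (2 n - 1) (n - 2)\<close>. Equality at \<open>n = 2\<close> explains why this error
  decays only with the fourth root.\<close>

lemma subfield_bound:
  fixes q b c :: real
  assumes q: "q \<ge> 2" and n: "n \<ge> 2" and c: "0 \<le> c" "c \<le> sqrt q"
    and b: "b * q \<le> 8 * real n ^ 2 * q ^ n\<^sup>2 * c ^ (n - 1)\<^sup>2"
  shows "16 * b \<le> 128 * real n ^ 2 / sqrt (sqrt q) ^ n * q ^ (2 * (n\<^sup>2 - n))"
proof -
  define r where "r = sqrt (sqrt q)"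
  have r: "r \<ge> 1" "r\<^sup>2 = sqrt q" using q by (auto simp: r_def)
  have "q = (r\<^sup>2)\<^sup>2" using q r(2) by simp
  then have qr: "q = r ^ 4" by (simp flip: power_mult)
  have qk: "q ^ k = r ^ (4 * k)" for k unfolding qr by (simp add: power_mult)
  have rk: "r ^ k > 0" for k using r(1) by (intro zero_less_power) linarith
  obtain m where m: "n = m + 2" using n by (metis add.commute le_Suc_ex)
  have "c ^ (n - 1)\<^sup>2 \<le> (r\<^sup>2) ^ (n - 1)\<^sup>2" using c r(2) by (intro power_mono) auto
  then have "b * q \<le> 8 * real n ^ 2 * q ^ n\<^sup>2 * (r\<^sup>2) ^ (n - 1)\<^sup>2"
    using b q mult_left_mono[of "c ^ (n - 1)\<^sup>2" "(r\<^sup>2) ^ (n - 1)\<^sup>2" "8 * real n ^ 2 * q ^ n\<^sup>2"] by simp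
  then have "b * r ^ 4 * r ^ n \<le> 8 * real n ^ 2 * q ^ n\<^sup>2 * (r\<^sup>2) ^ (n - 1)\<^sup>2 * r ^ n"
    unfolding qr using rk by (intro mult_right_mono) (auto simp: less_imp_le)
  also have "\<dots> = 8 * real n ^ 2 * r ^ (4 * n\<^sup>2 + 2 * (n - 1)\<^sup>2 + n)"
    unfolding qk by (simp add: power_add power_mult)
  also have "\<dots> \<le> 8 * real n ^ 2 * r ^ (4 + 4 * (2 * (n\<^sup>2 - n)))"
    using r(1) by (intro mult_left_mono power_increasing) (auto simp: m power2_eq_square algebra_simps)
  finally have "b * r ^ n * r ^ 4 \<le> 8 * real n ^ 2 * r ^ (4 * (2 * (n\<^sup>2 - n))) * r ^ 4" by (simp add: power_add mult_ac)
  then have "b * r ^ n \<le> 8 * real n ^ 2 * r ^ (4 * (2 * (n\<^sup>2 - n)))" using rk[of 4] by (rule mult_right_le_imp_le)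
  then have "b \<le> 8 * real n ^ 2 * r ^ (4 * (2 * (n\<^sup>2 - n))) / r ^ n" using rk[of n] by (simp add: pos_le_divide_eq)
  then show ?thesis by (simp add: r_def[symmetric] qk)
qed

text \<open>The argument stands for \<open>Q^n\<close>. The summands belong to invariant subspaces,
  commuting nonscalar matrices and subfields. The logarithm replaces both \<open>n\<close> and the
  degree of \<open>K\<close> over its prime field; the seventh power is a sixth power times the
  number of dimensions \<open>d\<close>, and \<open>log 2 X + 1\<close> bounds the number of
  subfields.\<close>

definition error_bound :: "real \<Rightarrow> real" where
  "error_bound X = 256 * log 2 X ^ 7 / sqrt X + 2048 * log 2 X ^ 3 / sqrt X + 128 * log 2 X ^ 2 * (log 2 X + 1) / sqrt (sqrt X)"

lemma error_bound_tendsto: "(error_bound \<longlongrightarrow> 0) at_top"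
  unfolding error_bound_def by real_asymp

section \<open>The union bound over the three kinds of pairs\<close>

context finite_field
begin

lemma irreducible_on_mono: "irreducible_on n A \<Longrightarrow> A \<subseteq> B \<Longrightarrow> irreducible_on n B"
  unfolding irreducible_on_def by blast

definition parabolic_pairs :: "nat \<Rightarrow> (nat \<Rightarrow> 'a) \<Rightarrow> nat \<Rightarrow> ('a mat \<times> 'a mat) set" where
  "parabolic_pairs n f d = {(x, y). x \<in> char_class n f \<and> y \<in> char_class n f \<and>
     (\<exists>S\<in>GLs n. mconj n S x \<in> parabolics n d \<and> mconj n S y \<in> parabolics n d)}"

definition subfield_pairs :: "nat \<Rightarrow> (nat \<Rightarrow> 'a) \<Rightarrow> 'a set \<Rightarrow> ('a mat \<times> 'a mat) set" where
  "subfield_pairs n f F = {(x, y). x \<in> char_class n f \<and> y \<in> char_class n f \<and>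
     (\<exists>S\<in>GLs n. mconj n S x \<in> mats F n n \<and> mconj n S y \<in> mats F n n)}"

text \<open>Irreducibility is decided for the pair and not for \<open>B\<close>: the count of pairs
  with a commuting nonscalar matrix needs it for the pair itself, and it passes upwards to
  \<open>B\<close>, where the subfield case uses it.\<close>

lemma proper_subring_pairs:
  assumes n: "n > 0" and x: "x \<in> char_class n f" and y: "y \<in> char_class n f"
    and B: "mat_subring n B" "{x, y} \<subseteq> B" "B \<noteq> kmat n n"
  shows "(\<exists>d\<in>{1..<n}. (x, y) \<in> parabolic_pairs n f d) \<or> (x, y) \<in> nonscalar_pairs n f \<or>
    (\<exists>F\<in>{F. subfield F R} - {K}. (x, y) \<in> subfield_pairs n f F)"
proof (cases "irreducible_on n {x, y}")
  case False
  then obtain U where U: "subspace n U" "\<forall>z\<in>{x, y}. \<forall>u\<in>U. z \<odot>\<odot> u \<in> U" "U \<noteq> {mzero n 1}" "U \<noteq> kmat n 1"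
    unfolding irreducible_on_def by blast
  have "\<exists>d S. 0 < d \<and> d < n \<and> S \<in> GLs n \<and> (\<forall>x. x \<in> kmat n n \<longrightarrow> (\<forall>u\<in>U. x \<odot>\<odot> u \<in> U) \<longrightarrow> mconj n S x \<in> parabolics n d)"
    using subspace_parabolic[OF U(1,3,4)] by metis
  then obtain d S where d: "0 < d" "d < n" "S \<in> GLs n"
    and S: "\<And>x. x \<in> kmat n n \<Longrightarrow> (\<forall>u\<in>U. x \<odot>\<odot> u \<in> U) \<Longrightarrow> mconj n S x \<in> parabolics n d" by blast
  have "(x, y) \<in> parabolic_pairs n f d"
    unfolding parabolic_pairs_def using x y d(3) S[OF char_class_kmat[OF x]] S[OF char_class_kmat[OF y]] U(2) by blast
  then show ?thesis using d by (intro disjI1 bexI[of _ d]) auto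
next
  case True
  note irr = irreducible_on_mono[OF True B(2)]
  show ?thesis
  proof (cases "\<exists>z. nonscalar n z \<and> B \<subseteq> centraliser n z")
    case True
    then show ?thesis using \<open>irreducible_on n {x, y}\<close> x y B(2) unfolding nonscalar_pairs_def by blast
  next
    case False
    have scalar: "\<exists>c\<in>K. z = mscale c (mone n)"
      if "z \<in> kmat n n" "\<And>x. x \<in> B \<Longrightarrow> z \<odot>\<odot> x = x \<odot>\<odot> z" for z
    proof (rule ccontr)
      assume "\<not> ?thesis"
      then have "nonscalar n z" using that(1) by (auto simp: nonscalar_def)
      moreover have "B \<subseteq> centraliser n z" using that(2) mat_subringD(1)[OF B(1)] by (auto simp: centraliser_def)
      ultimately show False using False by blast
    qed
    have "\<exists>F S. subfield F R \<and> F \<noteq> K \<and> S \<in> GLs n \<and> (\<forall>x\<in>B. mconj n S x \<in> mats F n n)"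
      using proper_subring_cases[OF n B(1) irr B(3) scalar] by metis
    then show ?thesis using x y B(2) unfolding subfield_pairs_def by blast
  qed
qed

lemma nonscalar_pairs_bound:
  assumes "n \<ge> 2"
  shows "16 * real (card (nonscalar_pairs n f)) \<le> 2048 * real n ^ 3 / sqrt (card K) ^ n * real (card K) ^ (2 * (n\<^sup>2 - n))"
proof (rule nonscalar_bound)
  have "real (card (nonscalar_pairs n f) * card K ^ 4) \<le> real (2 * n ^ 3 * 2 ^ n * card K ^ (n\<^sup>2 + n * (n div 2)))"
    using card_nonscalar_pairs[of n f] assms by (subst of_nat_le_iff) simp
  then show "real (card (nonscalar_pairs n f)) * real (card K) ^ 4 \<le> 2 * real n ^ 3 * 2 ^ n * real (card K) ^ (n\<^sup>2 + n * (n div 2))"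
    by simp
qed (use assms subfield_card_ge_2[OF KF] in auto)

lemma parabolic_pairs_bound:
  assumes d: "d \<in> {1..<n}" and f: "monic n f" and small: "real n ^ 2 \<le> sqrt (card K) ^ n"
  shows "16 * real (card (parabolic_pairs n f d)) \<le> 256 * real n ^ 6 / sqrt (card K) ^ n * real (card K) ^ (2 * (n\<^sup>2 - n))"
proof (rule parabolic_bound)
  have "card (parabolic_pairs n f d) * card K ^ (d * (n - d)) \<le> 16 * n ^ (2 * min d (n - d) + 4) * card K ^ (2 * (n\<^sup>2 - n))"
    by (rule card_parabolic_pairs[OF _ _ f]) (use d in \<open>auto simp: parabolic_pairs_def\<close>)
  then have "real (card (parabolic_pairs n f d) * card K ^ (d * (n - d))) \<le> real (16 * n ^ (2 * min d (n - d) + 4) * card K ^ (2 * (n\<^sup>2 - n)))"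
    by (subst of_nat_le_iff)
  then show "real (card (parabolic_pairs n f d)) * real (card K) ^ (d * (n - d)) \<le> 16 * real n ^ (2 * min d (n - d) + 4) * real (card K) ^ (2 * (n\<^sup>2 - n))"
    by simp
qed (use d small subfield_card_ge_2[OF KF] in auto)

lemma subfield_pairs_bound:
  assumes n: "n \<ge> 2" and F: "subfield F R" "F \<noteq> K"
  shows "16 * real (card (subfield_pairs n f F)) \<le> 128 * real n ^ 2 / sqrt (sqrt (card K)) ^ n * real (card K) ^ (2 * (n\<^sup>2 - n))"
proof (rule subfield_bound)
  have "card (subfield_pairs n f F) * card K \<le> 8 * n\<^sup>2 * card K ^ n\<^sup>2 * card F ^ (n - 1)\<^sup>2"
    by (rule card_subfield_pairs[OF F(1)]) (use n in \<open>auto simp: subfield_pairs_def\<close>)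
  then have "real (card (subfield_pairs n f F) * card K) \<le> real (8 * n\<^sup>2 * card K ^ n\<^sup>2 * card F ^ (n - 1)\<^sup>2)"
    by (subst of_nat_le_iff)
  then show "real (card (subfield_pairs n f F)) * real (card K) \<le> 8 * real n ^ 2 * real (card K) ^ n\<^sup>2 * real (card F) ^ (n - 1)\<^sup>2"
    by simp
  have "real ((card F)\<^sup>2) \<le> real (card K)" using proper_subfield_card[OF F] by (subst of_nat_le_iff)
  then show "real (card F) \<le> sqrt (real (card K))" by (simp add: real_le_rsqrt)
qed (use n subfield_card_ge_2[OF KF] in auto)

definition proper_pairs :: "nat \<Rightarrow> (nat \<Rightarrow> 'a) \<Rightarrow> ('a mat \<times> 'a mat) set" where
  "proper_pairs n f = {(x, y). x \<in> char_class n f \<and> y \<in> char_class n f \<and>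
     (\<exists>B. mat_subring n B \<and> {x, y} \<subseteq> B \<and> B \<noteq> kmat n n)}"

lemma proper_pairs_bound:
  assumes n: "n \<ge> 2" and f: "monic n f" and p: "prime p" "card K = p ^ N"
    and small: "error_bound (real (card K) ^ n) < 1"
  shows "16 * real (card (proper_pairs n f)) \<le> error_bound (real (card K) ^ n) * real (card K) ^ (2 * (n\<^sup>2 - n))"
proof -
  let ?q = "real (card K)" and ?S = "{F. subfield F R} - {K}"
  define X where "X = ?q ^ n"
  define L where "L = log 2 X"
  define W where "W = ?q ^ (2 * (n\<^sup>2 - n))"
  have q: "?q \<ge> 2" using subfield_card_ge_2[OF KF] by simp
  have W0: "W \<ge> 0" by (simp add: W_def)
  have X2: "2 ^ n \<le> X" unfolding X_def using q by (intro power_mono) auto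
  have X0: "X > 0" using X2 by (rule less_le_trans[rotated]) simp
  have nL: "real n \<le> L" unfolding L_def using X2 X0 by (simp add: le_log_iff powr_realpow)
  have NL: "real N \<le> L"
  proof -
    have "(2::real) ^ N \<le> real p ^ N" using prime_ge_2_nat[OF p(1)] by (intro power_mono) auto
    also have "\<dots> = ?q" using p(2) by simp
    also have "\<dots> \<le> X" unfolding X_def using q n self_le_power[of ?q n] by simp
    finally show ?thesis unfolding L_def using X0 by (simp add: le_log_iff powr_realpow)
  qed
  have s: "sqrt ?q ^ n = sqrt X" "sqrt (sqrt ?q) ^ n = sqrt (sqrt X)" by (simp_all add: X_def real_sqrt_power)
  have sX: "sqrt X > 0" "sqrt (sqrt X) > 0" using X0 by auto
  have L0: "L \<ge> 2" using nL n by linarith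
  \<comment> \<open>If \<open>n^2\<close> exceeded the square root of \<open>X\<close>, the first
    summand of the error would already be larger than 1, against \<open>small\<close>.\<close>
  have sm: "real n ^ 2 \<le> sqrt ?q ^ n"
  proof (rule ccontr)
    assume "\<not> ?thesis"
    then have "sqrt X < real n ^ 2" by (simp add: s)
    also have "\<dots> \<le> L ^ 2" using nL by (intro power_mono) auto
    also have "\<dots> \<le> L ^ 7" using L0 by (intro power_increasing) auto
    also have "\<dots> \<le> 256 * L ^ 7" using L0 by simp
    finally have "256 * L ^ 7 / sqrt X > 1" using sX by (simp add: less_divide_eq)
    moreover have "2048 * L ^ 3 / sqrt X \<ge> 0" "128 * L ^ 2 * (L + 1) / sqrt (sqrt X) \<ge> 0" using L0 sX by auto
    ultimately have "error_bound X > 1" by (simp add: error_bound_def L_def)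
    then show False using small by (simp add: X_def)
  qed
  have fin: "finite ?S"
    by (rule finite_subset[of _ "Pow K"]) (auto dest: subfieldE(3) simp: finite_carrier)
  have finA: "finite (char_class n f \<times> char_class n f)" by (simp add: finite_char_class)
  have fp: "finite (parabolic_pairs n f d)" "finite (nonscalar_pairs n f)" "finite (subfield_pairs n f F)" for d F
    by (rule finite_subset[OF _ finA], auto simp: parabolic_pairs_def nonscalar_pairs_def subfield_pairs_def)+
  have "proper_pairs n f \<subseteq> (\<Union>d\<in>{1..<n}. parabolic_pairs n f d) \<union> nonscalar_pairs n f \<union> (\<Union>F\<in>?S. subfield_pairs n f F)"
  proof
    fix t assume t: "t \<in> proper_pairs n f"
    obtain x y where xy: "t = (x, y)" by (metis surj_pair)
    obtain B where B: "x \<in> char_class n f" "y \<in> char_class n f" "mat_subring n B" "{x, y} \<subseteq> B" "B \<noteq> kmat n n"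
      using t unfolding xy proper_pairs_def by blast
    have "n > 0" using n by simp
    from proper_subring_pairs[OF this B]
    show "t \<in> (\<Union>d\<in>{1..<n}. parabolic_pairs n f d) \<union> nonscalar_pairs n f \<union> (\<Union>F\<in>?S. subfield_pairs n f F)"
      unfolding xy by blast
  qed
  then have "card (proper_pairs n f) \<le> card ((\<Union>d\<in>{1..<n}. parabolic_pairs n f d) \<union> nonscalar_pairs n f \<union> (\<Union>F\<in>?S. subfield_pairs n f F))"
    using fin fp by (intro card_mono) auto
  also have "\<dots> \<le> card (\<Union>d\<in>{1..<n}. parabolic_pairs n f d) + card (nonscalar_pairs n f) + card (\<Union>F\<in>?S. subfield_pairs n f F)"
    by (meson card_Un_le le_trans add_le_mono1)
  also have "\<dots> \<le> (\<Sum>d\<in>{1..<n}. card (parabolic_pairs n f d)) + card (nonscalar_pairs n f) + (\<Sum>F\<in>?S. card (subfield_pairs n f F))"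
    using card_UN_le[OF fin, of "subfield_pairs n f"] card_UN_le[of "{1..<n}" "parabolic_pairs n f"] by simp
  finally have "real (card (proper_pairs n f)) \<le> real ((\<Sum>d\<in>{1..<n}. card (parabolic_pairs n f d)) + card (nonscalar_pairs n f) + (\<Sum>F\<in>?S. card (subfield_pairs n f F)))"
    by (subst of_nat_le_iff)
  then have "16 * real (card (proper_pairs n f)) \<le> (\<Sum>d\<in>{1..<n}. 16 * real (card (parabolic_pairs n f d)))
      + 16 * real (card (nonscalar_pairs n f)) + (\<Sum>F\<in>?S. 16 * real (card (subfield_pairs n f F)))"
    by (simp add: sum_distrib_left[symmetric])
  also have "(\<Sum>d\<in>{1..<n}. 16 * real (card (parabolic_pairs n f d))) \<le> 256 * L ^ 7 / sqrt X * W"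
  proof -
    have "(\<Sum>d\<in>{1..<n}. 16 * real (card (parabolic_pairs n f d))) \<le> (\<Sum>d\<in>{1..<n}. 256 * real n ^ 6 / sqrt X * W)"
      using parabolic_pairs_bound[OF _ f sm] by (intro sum_mono) (simp add: s W_def)
    also have "\<dots> = real (n - 1) * (256 * real n ^ 6 / sqrt X * W)" by simp
    also have "\<dots> \<le> L * (256 * L ^ 6 / sqrt X * W)"
      using nL sX W0 n L0 by (intro mult_mono mult_right_mono divide_right_mono mult_left_mono power_mono) auto
    also have "\<dots> = 256 * (L * L ^ 6) / sqrt X * W" by simp
    also have "L * L ^ 6 = L ^ 7" by (simp flip: power_Suc)
    finally show ?thesis .
  qed
  also have "16 * real (card (nonscalar_pairs n f)) \<le> 2048 * L ^ 3 / sqrt X * W"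
  proof -
    have "16 * real (card (nonscalar_pairs n f)) \<le> 2048 * real n ^ 3 / sqrt X * W"
      using nonscalar_pairs_bound[OF n, of f] by (simp add: s W_def)
    also have "\<dots> \<le> 2048 * L ^ 3 / sqrt X * W"
      using nL sX W0 by (intro mult_right_mono divide_right_mono mult_left_mono power_mono) auto
    finally show ?thesis .
  qed
  also have "(\<Sum>F\<in>?S. 16 * real (card (subfield_pairs n f F))) \<le> 128 * L ^ 2 * (L + 1) / sqrt (sqrt X) * W"
  proof -
    have "(\<Sum>F\<in>?S. 16 * real (card (subfield_pairs n f F))) \<le> (\<Sum>F\<in>?S. 128 * real n ^ 2 / sqrt (sqrt X) * W)"
      using subfield_pairs_bound[OF n] by (intro sum_mono) (simp add: s W_def)
    also have "\<dots> = real (card ?S) * (128 * real n ^ 2 / sqrt (sqrt X) * W)" by simp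
    also have "\<dots> \<le> (L + 1) * (128 * L ^ 2 / sqrt (sqrt X) * W)"
    proof (intro mult_mono mult_right_mono divide_right_mono mult_left_mono power_mono)
      have "finite {F. subfield F R}"
        by (rule finite_subset[of _ "Pow K"]) (auto dest: subfieldE(3) simp: finite_carrier)
      then have "card ?S \<le> N + 1" using card_subfields_le[OF p] card_mono[of "{F. subfield F R}" ?S] by fastforce
      then show "real (card ?S) \<le> L + 1" using NL by linarith
    qed (use nL sX W0 L0 in auto)
    finally show ?thesis by (simp add: mult_ac)
  qed
  finally show ?thesis unfolding error_bound_def X_def[symmetric] L_def[symmetric] W_def[symmetric] by (simp only: distrib_right)
qed

section \<open>From generated subalgebras to proper subrings\<close>

lemma matrix_algebra_sel:
  "carrier (matrix_algebra R n) = kmat n n"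
  "\<one>\<^bsub>matrix_algebra R n\<^esub> = mone n" "\<zero>\<^bsub>matrix_algebra R n\<^esub> = mzero n n"
  "x \<in> kmat n n \<Longrightarrow> y \<in> kmat n n \<Longrightarrow> x \<otimes>\<^bsub>matrix_algebra R n\<^esub> y = x \<odot>\<odot> y"
  "x \<in> kmat n n \<Longrightarrow> y \<in> kmat n n \<Longrightarrow> x \<oplus>\<^bsub>matrix_algebra R n\<^esub> y = x \<oplus>\<oplus> y"
  "x \<in> kmat n n \<Longrightarrow> c \<odot>\<^bsub>matrix_algebra R n\<^esub> x = mscale c x"
  by (auto simp: matrix_algebra_def kmat_def mone_def mzero_def mmul_def madd_def mscale_def)

lemma abelian_group_matrix_algebra: "abelian_group (matrix_algebra R n)"
proof (rule abelian_groupI)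
  fix x y z assume "x \<in> carrier (matrix_algebra R n)" "y \<in> carrier (matrix_algebra R n)" "z \<in> carrier (matrix_algebra R n)"
  then have x: "x \<in> kmat n n" and y: "y \<in> kmat n n" and z: "z \<in> kmat n n" by (simp_all add: matrix_algebra_sel(1))
  show "x \<oplus>\<^bsub>matrix_algebra R n\<^esub> y \<oplus>\<^bsub>matrix_algebra R n\<^esub> z = x \<oplus>\<^bsub>matrix_algebra R n\<^esub> (y \<oplus>\<^bsub>matrix_algebra R n\<^esub> z)"
    using madd_assoc[OF x y z] madd_closed[OF x y] madd_closed[OF y z] x y z by (simp add: matrix_algebra_sel)
next
  fix x y assume "x \<in> carrier (matrix_algebra R n)" "y \<in> carrier (matrix_algebra R n)"
  then have x: "x \<in> kmat n n" and y: "y \<in> kmat n n" by (simp_all add: matrix_algebra_sel(1))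
  show "x \<oplus>\<^bsub>matrix_algebra R n\<^esub> y \<in> carrier (matrix_algebra R n)"
    using madd_closed[OF x y] x y by (simp add: matrix_algebra_sel)
  show "x \<oplus>\<^bsub>matrix_algebra R n\<^esub> y = y \<oplus>\<^bsub>matrix_algebra R n\<^esub> x"
    using madd_comm[OF x y] x y by (simp add: matrix_algebra_sel)
next
  fix x assume "x \<in> carrier (matrix_algebra R n)"
  then have x: "x \<in> kmat n n" by (simp_all add: matrix_algebra_sel(1))
  show "\<zero>\<^bsub>matrix_algebra R n\<^esub> \<oplus>\<^bsub>matrix_algebra R n\<^esub> x = x"
    using x madd_zero[OF x] mzero_closed[of n n] by (simp add: matrix_algebra_sel)
  have "mneg x \<oplus>\<^bsub>matrix_algebra R n\<^esub> x = mzero n n"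
    using matrix_algebra_sel(5)[OF mneg_closed[OF x] x] madd_neg(2)[OF x] by simp
  then show "\<exists>y\<in>carrier (matrix_algebra R n). y \<oplus>\<^bsub>matrix_algebra R n\<^esub> x = \<zero>\<^bsub>matrix_algebra R n\<^esub>"
    using mneg_closed[OF x] by (auto simp: matrix_algebra_sel)
qed (simp add: matrix_algebra_sel)

lemma unital_subalgebra_carrier:
  assumes k: "subfield k R"
  shows "unital_subalgebra k (kmat n n) (matrix_algebra R n)"
  unfolding unital_subalgebra_def
proof (intro conjI ballI subring.intro)
  have "carrier (add_monoid (matrix_algebra R n)) = kmat n n" by (simp add: matrix_algebra_sel)
  then show "subgroup (kmat n n) (add_monoid (matrix_algebra R n))"
    using group.subgroup_self[OF abelian_group.a_group[OF abelian_group_matrix_algebra, of n]] by simp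
  show "submonoid (kmat n n) (matrix_algebra R n)"
  proof
    show "kmat n n \<subseteq> carrier (matrix_algebra R n)" by (simp add: matrix_algebra_sel)
    show "\<one>\<^bsub>matrix_algebra R n\<^esub> \<in> kmat n n" using mone_closed by (simp add: matrix_algebra_sel)
    show "x \<otimes>\<^bsub>matrix_algebra R n\<^esub> y \<in> kmat n n" if "x \<in> kmat n n" "y \<in> kmat n n" for x y
      using mmul_closed[OF that] that by (simp add: matrix_algebra_sel)
  qed
  fix c x assume "c \<in> k" and x: "x \<in> kmat n n"
  then have "c \<in> K" using subfield_closed(1)[OF k] by blast
  then show "c \<odot>\<^bsub>matrix_algebra R n\<^esub> x \<in> kmat n n"
    using mscale_closed[OF _ x] x by (simp add: matrix_algebra_sel)
qed

text \<open>Reduces proper subalgebras to the proper subrings counted above; negatives arise from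
  the scalar \<open>-1\<close> of \<open>k\<close>.\<close>

lemma unital_subalgebra_mat_subring:
  assumes k: "subfield k R" and B: "unital_subalgebra k B (matrix_algebra R n)"
  shows "mat_subring n B"
proof -
  have sub: "subring B (matrix_algebra R n)" using B by (simp add: unital_subalgebra_def)
  note g = subring.axioms(1)[OF sub] and m = subring.axioms(2)[OF sub]
  have Bk: "x \<in> kmat n n" if "x \<in> B" for x
    using submonoid.subset[OF m] that by (auto simp: matrix_algebra_sel)
  show ?thesis
    unfolding mat_subring_def
  proof (intro conjI ballI subsetI)
    show "mone n \<in> B" using submonoid.one_closed[OF m] by (simp add: matrix_algebra_sel)
    fix x assume x: "x \<in> B"
    show "x \<in> kmat n n" by (rule Bk[OF x])
    have "\<ominus> \<one> \<odot>\<^bsub>matrix_algebra R n\<^esub> x \<in> B"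
      using B x subfield_closed(4)[OF k subfield_closed(6)[OF k]] by (simp add: unital_subalgebra_def)
    then show "mneg x \<in> B"
      using mscale_minus[OF one_closed Bk[OF x]] mscale_one[OF Bk[OF x]] by (simp add: matrix_algebra_sel Bk[OF x])
    fix y assume y: "y \<in> B"
    show "x \<oplus>\<oplus> y \<in> B"
      using subgroup.m_closed[OF g x y] matrix_algebra_sel(5)[OF Bk[OF x] Bk[OF y]] by simp
    show "x \<odot>\<odot> y \<in> B"
      using submonoid.m_closed[OF m x y] matrix_algebra_sel(4)[OF Bk[OF x] Bk[OF y]] by simp
  qed
qed

text \<open>A pair that fails to generate lies in a proper subring. Squaring the lower bound
  \<open>Q^(n^2 - n) / 4\<close> for the class turns the number of such pairs into a proportion,
  which is the origin of the factor 16 carried through all estimates.\<close>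

lemma generation_probability_ge:
  assumes n: "n \<ge> 2" and f: "monic n f" and p: "prime p" "card K = p ^ N" and k: "subfield k R"
    and small: "error_bound (real (card K) ^ n) < 1"
  shows "generation_probability k R n f \<ge> 1 - error_bound (real (card K) ^ n)"
proof -
  let ?q = "real (card K)" and ?g = "error_bound (real (card K) ^ n)"
  define A where "A = char_class n f"
  define G where "G = {(x, y). x \<in> A \<and> y \<in> A \<and> generated_subalgebra k (matrix_algebra R n) {x, y} = kmat n n}"
  have A: "matrices_with_char_poly R n f = A"
    by (auto simp: matrices_with_char_poly_def A_def char_class_def matrix_algebra_sel cp_def)
  have fA: "finite A" by (simp add: A_def finite_char_class)
  have fi: "f i \<in> K" and fn: "f n = \<one>" and f0: "i > n \<Longrightarrow> f i = \<zero>" for i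
  proof -
    interpret UP: UP_domain R "UP R" by unfold_locales
    have c: "f \<in> carrier (UP R)" "deg R f = n" "up_ring.coeff (UP R) f n = \<one>" using f by (auto simp: monic_def)
    have co: "up_ring.coeff (UP R) f i = f i" for i using c(1) by (simp add: UP_def)
    show "f i \<in> K" using c(1) by (auto simp: UP_def)
    show "f n = \<one>" using c(3) co by simp
    show "f i = \<zero>" if "i > n" using UP.deg_aboveD[OF _ c(1), of i] c(2) that co by simp
  qed
  have "card K ^ n\<^sup>2 \<le> 4 * card A * card K ^ n"
    unfolding A_def by (rule card_char_class_ge) (use n fi fn f0 in auto)
  moreover have "n\<^sup>2 = (n\<^sup>2 - n) + n" by (simp add: power2_eq_square)
  ultimately have "card K ^ (n\<^sup>2 - n) * card K ^ n \<le> 4 * card A * card K ^ n" by (metis power_add)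
  then have "card K ^ (n\<^sup>2 - n) \<le> 4 * card A" using subfield_card_ge_2[OF KF] by simp
  then have "real (card K ^ (n\<^sup>2 - n)) \<le> real (4 * card A)" by (subst of_nat_le_iff)
  then have qA: "?q ^ (n\<^sup>2 - n) \<le> 4 * real (card A)" by simp
  have W: "?q ^ (2 * (n\<^sup>2 - n)) \<le> 16 * (real (card A))\<^sup>2"
    using power_mono[OF qA, of 2] by (simp add: power_mult_distrib mult.commute flip: power_mult)
  have "?q ^ (n\<^sup>2 - n) > 0" using subfield_card_ge_2[OF KF] by simp
  then have A0: "real (card A) > 0" using qA by linarith
  have bad: "A \<times> A - G \<subseteq> proper_pairs n f"
  proof
    fix t assume t: "t \<in> A \<times> A - G"
    obtain x y where xy: "t = (x, y)" by (metis surj_pair)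
    have x: "x \<in> char_class n f" and y: "y \<in> char_class n f"
      and ne: "generated_subalgebra k (matrix_algebra R n) {x, y} \<noteq> kmat n n" using t xy by (auto simp: G_def A_def)
    have "\<exists>B. unital_subalgebra k B (matrix_algebra R n) \<and> {x, y} \<subseteq> B \<and> B \<noteq> kmat n n"
    proof (rule ccontr)
      assume "\<not> ?thesis"
      then have "{B. unital_subalgebra k B (matrix_algebra R n) \<and> {x, y} \<subseteq> B} = {kmat n n}"
        using unital_subalgebra_carrier[OF k, of n] char_class_kmat[OF x] char_class_kmat[OF y] by blast
      then show False using ne by (simp add: generated_subalgebra_def)
    qed
    then show "t \<in> proper_pairs n f"
      unfolding xy proper_pairs_def using x y unital_subalgebra_mat_subring[OF k] by blast
  qed
  have GA: "G \<subseteq> A \<times> A" by (auto simp: G_def)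
  have fp: "finite (proper_pairs n f)"
    by (rule finite_subset[of _ "A \<times> A"]) (auto simp: proper_pairs_def A_def finite_char_class)
  have "real (card (A \<times> A)) - real (card G) = real (card (A \<times> A - G))"
    using card_Diff_subset[OF finite_subset[OF GA] GA] card_mono[OF _ GA] fA by (simp add: of_nat_diff)
  also have "\<dots> \<le> real (card (proper_pairs n f))" using card_mono[OF fp bad] by simp
  finally have "16 * ((real (card A))\<^sup>2 - real (card G)) \<le> 16 * real (card (proper_pairs n f))"
    by (simp add: card_cartesian_product power2_eq_square)
  also have "\<dots> \<le> ?g * ?q ^ (2 * (n\<^sup>2 - n))" by (rule proper_pairs_bound[OF n f p small])
  also have "\<dots> \<le> ?g * (16 * (real (card A))\<^sup>2)"
  proof (rule mult_left_mono[OF W])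
    have "(1::real) \<le> ?q ^ n" using subfield_card_ge_2[OF KF] by simp
    then have "0 \<le> log 2 (?q ^ n)" by (rule zero_le_log_cancel_iff[THEN iffD2, rotated -1]) (use subfield_card_ge_2[OF KF] in auto)
    then show "0 \<le> ?g" by (auto simp: error_bound_def intro!: add_nonneg_nonneg divide_nonneg_nonneg mult_nonneg_nonneg zero_le_power)
  qed
  finally have "(1 - ?g) * (real (card A))\<^sup>2 \<le> real (card G)" by (simp add: algebra_simps)
  then show ?thesis
    unfolding generation_probability_def A matrix_algebra_sel(1) G_def[symmetric] using A0 by (simp add: pos_le_divide_eq)
qed

end

theorem theorem1p7:
  fixes \<delta> :: real
  assumes "\<delta> > 0"
  shows "\<exists>N :: nat. \<forall>(q :: nat) (m :: nat) (n :: nat) (K :: 'a ring) (k :: 'a set) (f :: nat \<Rightarrow> 'a).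
           primepow q \<longrightarrow> m \<ge> 1 \<longrightarrow> n > 1 \<longrightarrow>
           field K \<longrightarrow> card (carrier K) = q ^ m \<longrightarrow>
           subfield k K \<longrightarrow> card k = q \<longrightarrow>
           q ^ (m * n\<^sup>2) \<ge> N \<longrightarrow>
           monic_of_degree K n f \<longrightarrow>
           generation_probability k K n f > 1 - \<delta>"
proof -
  have "eventually (\<lambda>X. error_bound X < min \<delta> 1) at_top"
    by (rule order_tendstoD(2)[OF error_bound_tendsto]) (use assms in simp)
  then obtain X0 where X0: "\<And>X. X \<ge> X0 \<Longrightarrow> error_bound X < min \<delta> 1" by (auto simp: eventually_at_top_linorder)
  define M where "M = nat \<lceil>X0\<rceil> + 1"
  show ?thesis
  proof (intro exI[of _ "M ^ M + 1"] allI impI)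
    fix q m n :: nat and K :: "'a ring" and k and f :: "nat \<Rightarrow> 'a"
    assume q: "primepow q" and m: "m \<ge> 1" and n: "n > 1" and K: "field K" "card (carrier K) = q ^ m"
      and k: "subfield k K" "card k = q" and N: "q ^ (m * n\<^sup>2) \<ge> M ^ M + 1" and f: "monic_of_degree K n f"
    have q2: "q \<ge> 2" using primepow_gt_Suc_0[OF q] by simp
    have "card (carrier K) > 0" using K(2) q2 by simp
    then have "finite (carrier K)" by (rule card_ge_0_finite)
    then interpret finite_field K using K(1) by (simp add: finite_field_def finite_field_axioms_def)
    obtain p j where p: "prime p" "q = p ^ j" using q by (auto simp: primepow_def)
    define X where "X = card (carrier K) ^ n"
    \<comment> \<open>If \<open>X < M\<close>, then \<open>n < X < M\<close>, so the cardinality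
      \<open>X^n\<close> of the algebra is at most \<open>M^M\<close>, which the threshold
      \<open>M^M + 1\<close> excludes.\<close>
    have "M \<le> X"
    proof (rule ccontr)
      assume "\<not> M \<le> X"
      then have XM: "X < M" by simp
      have "2 ^ n \<le> X" unfolding X_def using subfield_card_ge_2[OF KF] by (rule power_mono) simp
      then have nX: "n < X" using less_exp[of n] by linarith
      have "q ^ (m * n\<^sup>2) = X ^ n" by (simp add: X_def K(2) power2_eq_square power_mult)
      also have "\<dots> \<le> M ^ n" using XM by (intro power_mono) auto
      also have "\<dots> \<le> M ^ M" using nX XM by (intro power_increasing) auto
      finally show False using N by simp
    qed
    then have "real X \<ge> X0" unfolding M_def by linarith
    from X0[OF this] have e: "error_bound (real (card (carrier K)) ^ n) < min \<delta> 1" by (simp add: X_def)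
    have "1 - error_bound (real (card (carrier K)) ^ n) \<le> generation_probability k K n f"
    proof (rule generation_probability_ge[OF _ _ p(1) _ k(1)])
      show "2 \<le> n" using n by simp
      show "monic n f" using f by (simp add: monic_def monic_of_degree_def)
      show "card (carrier K) = p ^ (j * m)" using K(2) p(2) by (simp add: power_mult)
      show "error_bound (real (card (carrier K)) ^ n) < 1" using e by simp
    qed
    then show "1 - \<delta> < generation_probability k K n f" using e by linarith
  qed
qed

end
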